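(* Let $1<r\le n$ be integers and let $\mathcal{A}=\mathcal{A}(\tilde B)$ be the cluster algebra with coefficients associated with an initial integer $n\times r$-matrix $\tilde B$ of maximal rank $r$ (with antisymmetric principal part). Suppose that $\mathcal{A}(\tilde B)$ admits a Frobenius $2$-Calabi-Yau realization $\mathcal{E}$ with cluster-tilting object $T$. Then: (a) The cluster monomials of $\mathcal{A}$ are linearly independent over $\mathbb{Z}$ (equivalently over $\mathbb{Q}$). (b) 1) Different cluster monomials have different $\mathbf{g}$-vectors with respect to a given initial seed. 2) The $\mathbf{g}$-vectors of the cluster variables in any given cluster form a $\mathbb{Z}$-basis of the lattice $\mathbb{Z}^r$. (c) If $(g_1,\dots,g_r)$ and $(g'_1,\dots,g'_r)$ are the $\mathbf{g}$-vectors of one and the same cluster variable with respect to two clusters $t$ and $t'$ related by the mutation at $l$, then $$g'_j=\begin{cases}-g_l&\text{if }j=l,\\ g_j+[b_{jl}]_+g_l-b_{jl}\min(g_l,0)&\text{if }j\ne l,\end{cases}$$ where the $b_{ij}$ are the entries of the $r\times r$-matrix $B$ (principal part) associated with $t$ and $[x]_+=\max(x,0)$.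
   Context: Cluster algebras. Let $\mathcal{F}=\mathbb{Q}(x_1,\dots,x_n)$. A seed is a pair $(\tilde B,\mathbf{x})$ with $\tilde B=(b_{ij})$ an integer $n\times r$-matrix whose principal part (first $r$ rows) is antisymmetric and $\mathbf{x}=\{x_1,\dots,x_r\}$ a free generating set of $\mathcal{F}$ over $\mathbb{Q}(x_{r+1},\dots,x_n)$ (frozen variables $x_{r+1},\dots,x_n$ fixed). Mutation $\mu_s$, $1\le s\le r$: $b'_{ij}=-b_{ij}$ if $i=s$ or $j=s$, and $b'_{ij}=b_{ij}+\mathrm{sgn}(b_{is})[b_{is}b_{sj}]_+$ otherwise ($\mathrm{sgn}(x)\in\{-1,0,1\}$ the usual sign); $x'_j=x_j$ for $j\ne s$, $x'_sx_s=\prod_{i=1}^nx_i^{[b_{is}]_+}+\prod_{i=1}^nx_i^{[-b_{is}]_+}$. The cluster pattern assigns to each vertex $t$ of the $r$-regular tree a seed $(\tilde B_t,\mathbf{x}_t)$, with initial seed $(\tilde B,\{x_1,\dots,x_r\})$ at $t_0$ and seeds joined by an edge labelled $s$ related by $\mu_s$. Clusters are the $\mathbf{x}_t$, cluster variables their elements; $\mathcal{A}(\tilde B)$ is the $\mathbb{Z}[x_{r+1}^{\pm1},\dots,x_n^{\pm1}]$-subalgebra of $\mathcal{F}$ generated by the cluster variables. A cluster monomial is a monomial (with non-negative exponents) in the cluster variables of a single cluster. $\mathbf{g}$-vectors. With respect to a seed $(\tilde B_t,\{x_1,\dots,x_r\})$ with $\tilde B_t=(b_{ij})$ of rank $r$,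 let $\hat y_j=\prod_{i=1}^nx_i^{b_{ij}}$, $1\le j\le r$. If $z=R(\hat y_1,\dots,\hat y_r)\prod_{i=1}^nx_i^{g_i}$ with $R$ a primitive rational function (quotient of two polynomials not divisible by any of the variables), the $\mathbf{g}$-vector of $z$ with respect to this seed is $(g_1,\dots,g_r)$; it is well defined. Frobenius $2$-Calabi-Yau categories. $k$ is an algebraically closed field; $\mathcal{E}$ is a $k$-linear $\mathrm{Hom}$-finite Frobenius category (exact category with enough projectives and injectives, projectives $=$ injectives) with split idempotents, whose stable category $\mathcal{C}=\underline{\mathcal{E}}$ (quotient by morphisms factoring through projectives; triangulated with suspension $\Sigma$) is $2$-Calabi-Yau: there are linear forms $t_X:\mathcal{C}(X,\Sigma^2X)\to k$ such that the forms $\langle f,g\rangle=t_X(f\circ g)$ on $\mathcal{C}(Y,\Sigma^2X)\times\mathcal{C}(X,Y)$ are non-degenerate and $\langle\Sigma^pf,g\rangle=(-1)^{pq}\langle\Sigma^qg,f\rangle$ for $f\in\mathcal{C}(Y,\Sigma^qX)$, $g\in\mathcal{C}(X,\Sigma^pY)$, $p+q=2$. Conflation means admissible short exact sequence. A cluster-tilting subcategory of $\mathcal{E}$ is a full additive subcategory $\mathcal{T}$, closed under direct factors, such that for each $X$ the functors $\mathcal{E}(X,?)|_{\mathcal{T}}$ and $\mathcal{E}(?,X)|_{\mathcal{T}}$ are finitely generated, and $X\in\mathcal{T}$ iff $\mathrm{Ext}^1_{\mathcal{E}}(T',X)=0$ for all $T'\in\mathcal{T}$. A cluster-tilting object is a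 basic object $T$ (indecomposable summands of multiplicity one) with $\mathrm{add}(T)$ cluster-tilting. The quiver $Q(\mathcal{T})$ has as vertices the isoclasses of indecomposables of $\mathcal{T}$ and $\dim\mathrm{rad}(T_1,T_2)/\mathrm{rad}^2(T_1,T_2)$ arrows from $T_1$ to $T_2$ ($\mathrm{rad}$ the radical of $\mathcal{T}$). The antisymmetric matrix of a quiver has entries $b_{ij}=\#\{i\to j\}-\#\{j\to i\}$; mutation of quivers is defined via matrix mutation. Cluster structure on $\mathcal{E}$: (0) a cluster-tilting subcategory exists; (1) for each cluster-tilting $\mathcal{T}'$ and each non-projective indecomposable $M\in\mathcal{T}'$ there is a unique (up to isomorphism) non-projective indecomposable $M^*\not\cong M$ such that the subcategory $\mathcal{T}''=\mu_M(\mathcal{T}')$ with indecomposables $\mathrm{indec}(\mathcal{T}')\setminus\{M\}\cup\{M^*\}$ is cluster-tilting; (2) there are then conflations $0\to M^*\xrightarrow{f}E\xrightarrow{g}M\to0$ and $0\to M\xrightarrow{s}E'\xrightarrow{t}M^*\to0$ with $g,t$ minimal right and $f,s$ minimal left $\mathcal{T}'\cap\mathcal{T}''$-approximations; (3) no $Q(\mathcal{T}')$ has loops or $2$-cycles; (4) $Q^\circ(\mu_M(\mathcal{T}'))=\mu_M(Q^\circ(\mathcal{T}'))$, where $Q^\circ$ is $Q$ with arrows between projective vertices removed. A Frobenius $2$-Calabi-Yau realization of $\mathcal{A}(\tilde B)$ is such an $\mathcal{E}$ having a cluster structure, with a cluster-tilting object $T$ having exactly $n$ pairwise non-isomorphic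 indecomposable summands $T_1,\dots,T_n$, of which precisely $T_{r+1},\dots,T_n$ are projective, such that $\tilde B$ is formed by the first $r$ columns of the antisymmetric matrix of the quiver of $\mathrm{End}_{\mathcal{E}}(T)$ (i.e. of $Q(\mathrm{add}\,T)$). *)

theory Defs
  imports
    "HOL-Library.Poly_Mapping"
    "HOL-Computational_Algebra.Fraction_Field"
    "HOL-Computational_Algebra.Polynomial"
    "Jordan_Normal_Form.DL_Rank"
begin

section \<open>Cluster algebras\<close>

subsection \<open>Rational functions\<close>

text \<open>
  Indices are 1-based, as in the mathematical notation.  The ambient field of rational functions
  in \<open>x\<^sub>1, \<dots>, x\<^sub>n\<close> over the rationals is regarded as a subfield of the field of rational functions
  in the countably many indeterminates \<open>xvar 0, xvar 1, \<dots>\<close>; only those with index in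
  \<open>{1..n}\<close> ever occur in the clusters.
\<close>

type_synonym mpoly = "(nat \<Rightarrow>\<^sub>0 nat) \<Rightarrow>\<^sub>0 rat"
type_synonym ratfun = "mpoly fract"

definition pvar :: "nat \<Rightarrow> mpoly" where
  "pvar i = Poly_Mapping.single (Poly_Mapping.single i 1) 1"

definition xvar :: "nat \<Rightarrow> ratfun" where
  "xvar i = Fract (pvar i) 1"

definition rconst :: "rat \<Rightarrow> ratfun" where
  "rconst c = Fract (Poly_Mapping.single 0 c) 1"

definition poly_in :: "nat set \<Rightarrow> mpoly \<Rightarrow> bool" where
  "poly_in V P \<longleftrightarrow> (\<forall>m \<in> Poly_Mapping.keys P. Poly_Mapping.keys m \<subseteq> V)"

definition peval :: "(nat \<Rightarrow> ratfun) \<Rightarrow> mpoly \<Rightarrow> ratfun" where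
  "peval v P = (\<Sum>m \<in> Poly_Mapping.keys P. rconst (Poly_Mapping.lookup P m)
     * (\<Prod>i \<in> Poly_Mapping.keys m. v i ^ Poly_Mapping.lookup m i))"

subsection \<open>Seeds and the cluster pattern\<close>

definition pos_part :: "int \<Rightarrow> int" where
  "pos_part x = max x 0"

definition mutate_matrix :: "'i \<Rightarrow> ('i \<Rightarrow> 'i \<Rightarrow> int) \<Rightarrow> 'i \<Rightarrow> 'i \<Rightarrow> int" where
  "mutate_matrix s b i j =
     (if i = s \<or> j = s then - b i j else b i j + sgn (b i s) * pos_part (b i s * b s j))"

text \<open>
  In a seed \<open>(b, x)\<close> only the entries \<open>b i j\<close> with \<open>i \<in> {1..n}\<close>, \<open>j \<in> {1..r}\<close> are meaningful,
  and \<open>x\<close> lists the cluster \<open>x 1, \<dots>, x r\<close> followed by the frozen variables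
  \<open>x (r+1), \<dots>, x n\<close>.
\<close>

type_synonym seed = "(nat \<Rightarrow> nat \<Rightarrow> int) \<times> (nat \<Rightarrow> ratfun)"

definition mutate_seed :: "nat \<Rightarrow> nat \<Rightarrow> seed \<Rightarrow> seed" where
  "mutate_seed n s \<Sigma> = (case \<Sigma> of (b, x) \<Rightarrow>
     (mutate_matrix s b,
      x(s := ((\<Prod>i = 1..n. x i ^ nat (pos_part (b i s)))
              + (\<Prod>i = 1..n. x i ^ nat (pos_part (- b i s)))) / x s)))"

text \<open>
  A vertex of the \<open>r\<close>-regular tree is encoded by the sequence of edge labels on the shortest path
  leading to it from the root \<open>t\<^sub>0\<close>, i.e. by a word in \<open>{1..r}\<close> without equal adjacent letters.
\<close>

definition tree_vertex :: "nat \<Rightarrow> nat list \<Rightarrow> bool" where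
  "tree_vertex r t \<longleftrightarrow> set t \<subseteq> {1..r} \<and> distinct_adj t"

definition tree_edge :: "nat \<Rightarrow> nat \<Rightarrow> nat list \<Rightarrow> nat list \<Rightarrow> bool" where
  "tree_edge r l t t' \<longleftrightarrow> tree_vertex r t \<and> tree_vertex r t' \<and> (t' = t @ [l] \<or> t = t' @ [l])"

text \<open>Seed mutation being an involution, it suffices to mutate in the direction away from the root.\<close>

definition seed_at :: "nat \<Rightarrow> (nat \<Rightarrow> nat \<Rightarrow> int) \<Rightarrow> nat list \<Rightarrow> seed" where
  "seed_at n B t = foldl (\<lambda>\<Sigma> s. mutate_seed n s \<Sigma>) (B, xvar) t"

definition cluster :: "nat \<Rightarrow> nat \<Rightarrow> (nat \<Rightarrow> nat \<Rightarrow> int) \<Rightarrow> nat list \<Rightarrow> ratfun set" where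
  "cluster n r B t = snd (seed_at n B t) ` {1..r}"

definition cluster_variables :: "nat \<Rightarrow> nat \<Rightarrow> (nat \<Rightarrow> nat \<Rightarrow> int) \<Rightarrow> ratfun set" where
  "cluster_variables n r B = (\<Union>t \<in> {t. tree_vertex r t}. cluster n r B t)"

definition cluster_monomials :: "nat \<Rightarrow> nat \<Rightarrow> (nat \<Rightarrow> nat \<Rightarrow> int) \<Rightarrow> ratfun set" where
  "cluster_monomials n r B =
     {\<Prod>j = 1..r. snd (seed_at n B t) j ^ a j | t (a :: nat \<Rightarrow> nat). tree_vertex r t}"

definition matrix_rank :: "nat \<Rightarrow> nat \<Rightarrow> (nat \<Rightarrow> nat \<Rightarrow> int) \<Rightarrow> nat" where
  "matrix_rank n r B =
     vec_space.rank n (mat n r (\<lambda>(i, j). rat_of_int (B (Suc i) (Suc j))))"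

subsection \<open>g-vectors\<close>

text \<open>
  The lattice of integer vectors of length \<open>r\<close> consists of the finitely supported functions
  vanishing outside \<open>{1..r}\<close>; its scalar multiplication is the library's \<open>frag_cmul\<close>.
\<close>

definition int_lattice :: "nat \<Rightarrow> (nat \<Rightarrow>\<^sub>0 int) set" where
  "int_lattice r = {v. Poly_Mapping.keys v \<subseteq> {1..r}}"

definition int_basis :: "nat \<Rightarrow> (nat \<Rightarrow>\<^sub>0 int) set \<Rightarrow> bool" where
  "int_basis r S \<longleftrightarrow> \<not> Modules.module.dependent frag_cmul S
     \<and> Modules.module.span frag_cmul S = int_lattice r"

definition yhat :: "nat \<Rightarrow> seed \<Rightarrow> nat \<Rightarrow> ratfun" where
  "yhat n \<Sigma> j = (case \<Sigma> of (b, x) \<Rightarrow> \<Prod>i = 1..n. x i powi b i j)"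

text \<open>
  The primitive rational function is \<open>P/Q\<close>.  The exponents \<open>h i\<close> of the frozen variables are
  unconstrained and do not enter the g-vector.
\<close>

definition is_g_vector :: "nat \<Rightarrow> nat \<Rightarrow> seed \<Rightarrow> ratfun \<Rightarrow> (nat \<Rightarrow>\<^sub>0 int) \<Rightarrow> bool" where
  "is_g_vector n r \<Sigma> z g \<longleftrightarrow> g \<in> int_lattice r \<and>
     (\<exists>P Q (h :: nat \<Rightarrow> int).
        poly_in {1..r} P \<and> poly_in {1..r} Q
        \<and> (\<forall>j \<in> {1..r}. \<not> pvar j dvd P \<and> \<not> pvar j dvd Q)
        \<and> peval (yhat n \<Sigma>) Q \<noteq> 0
        \<and> (\<forall>i \<in> {1..r}. h i = Poly_Mapping.lookup g i)
        \<and> z = peval (yhat n \<Sigma>) P / peval (yhat n \<Sigma>) Q * (\<Prod>i = 1..n. snd \<Sigma> i powi h i))"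

definition g_vector :: "nat \<Rightarrow> nat \<Rightarrow> seed \<Rightarrow> ratfun \<Rightarrow> (nat \<Rightarrow>\<^sub>0 int)" where
  "g_vector n r \<Sigma> z = (THE g. is_g_vector n r \<Sigma> z g)"


section \<open>Frobenius 2-Calabi-Yau categories\<close>

subsection \<open>Linear and additive categories\<close>

text \<open>
  All morphism spaces of a linear category are subspaces of one vector space \<open>'m\<close> (for instance
  of their direct sum).  Hence the zero morphisms coincide and a morphism does not determine its
  source and target, which are therefore always mentioned explicitly.  \<open>cmp E g f\<close> is
  the composite of \<open>f\<close> followed by \<open>g\<close>.
\<close>

record ('o, 'm, 'k) lin_cat =
  Ob :: "'o set"
  Hom :: "'o \<Rightarrow> 'o \<Rightarrow> 'm set"
  idm :: "'o \<Rightarrow> 'm"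
  cmp :: "'m \<Rightarrow> 'm \<Rightarrow> 'm"
  scl :: "'k \<Rightarrow> 'm \<Rightarrow> 'm"

locale linear_category =
  fixes E :: "('o, 'm::ab_group_add, 'k::field, 'x) lin_cat_scheme" (structure)
  assumes vector_space_scl: "Vector_Spaces.vector_space (scl E)"
    and Hom_subspace: "\<lbrakk>X \<in> Ob E; Y \<in> Ob E\<rbrakk> \<Longrightarrow> Modules.module.subspace (scl E) (Hom E X Y)"
    and idm_in_Hom: "X \<in> Ob E \<Longrightarrow> idm E X \<in> Hom E X X"
    and cmp_in_Hom: "\<lbrakk>X \<in> Ob E; Y \<in> Ob E; Z \<in> Ob E; f \<in> Hom E X Y; g \<in> Hom E Y Z\<rbrakk>
      \<Longrightarrow> cmp E g f \<in> Hom E X Z"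
    and cmp_idm: "\<lbrakk>X \<in> Ob E; Y \<in> Ob E; f \<in> Hom E X Y\<rbrakk> \<Longrightarrow> cmp E f (idm E X) = f"
    and idm_cmp: "\<lbrakk>X \<in> Ob E; Y \<in> Ob E; f \<in> Hom E X Y\<rbrakk> \<Longrightarrow> cmp E (idm E Y) f = f"
    and cmp_assoc: "\<lbrakk>W \<in> Ob E; X \<in> Ob E; Y \<in> Ob E; Z \<in> Ob E;
        f \<in> Hom E W X; g \<in> Hom E X Y; h \<in> Hom E Y Z\<rbrakk>
      \<Longrightarrow> cmp E h (cmp E g f) = cmp E (cmp E h g) f"
    and cmp_add_left: "\<lbrakk>X \<in> Ob E; Y \<in> Ob E; Z \<in> Ob E; f \<in> Hom E X Y; g \<in> Hom E Y Z; g' \<in> Hom E Y Z\<rbrakk>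
      \<Longrightarrow> cmp E (g + g') f = cmp E g f + cmp E g' f"
    and cmp_add_right: "\<lbrakk>X \<in> Ob E; Y \<in> Ob E; Z \<in> Ob E; f \<in> Hom E X Y; f' \<in> Hom E X Y; g \<in> Hom E Y Z\<rbrakk>
      \<Longrightarrow> cmp E g (f + f') = cmp E g f + cmp E g f'"
    and cmp_scl_left: "\<lbrakk>X \<in> Ob E; Y \<in> Ob E; Z \<in> Ob E; f \<in> Hom E X Y; g \<in> Hom E Y Z\<rbrakk>
      \<Longrightarrow> cmp E (scl E c g) f = scl E c (cmp E g f)"
    and cmp_scl_right: "\<lbrakk>X \<in> Ob E; Y \<in> Ob E; Z \<in> Ob E; f \<in> Hom E X Y; g \<in> Hom E Y Z\<rbrakk>
      \<Longrightarrow> cmp E g (scl E c f) = scl E c (cmp E g f)"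

definition iso_mor :: "('o, 'm, 'k, 'x) lin_cat_scheme \<Rightarrow> 'o \<Rightarrow> 'o \<Rightarrow> 'm \<Rightarrow> bool" where
  "iso_mor E X Y f \<longleftrightarrow> f \<in> Hom E X Y \<and>
     (\<exists>g \<in> Hom E Y X. cmp E g f = idm E X \<and> cmp E f g = idm E Y)"

definition isomorphic :: "('o, 'm, 'k, 'x) lin_cat_scheme \<Rightarrow> 'o \<Rightarrow> 'o \<Rightarrow> bool" where
  "isomorphic E X Y \<longleftrightarrow> X \<in> Ob E \<and> Y \<in> Ob E \<and> (\<exists>f. iso_mor E X Y f)"

definition zero_object :: "('o, 'm::zero, 'k, 'x) lin_cat_scheme \<Rightarrow> 'o \<Rightarrow> bool" where
  "zero_object E Z \<longleftrightarrow> Z \<in> Ob E \<and> idm E Z = 0"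

text \<open>\<open>X\<close> is a direct sum of the objects \<open>A 1, \<dots>, A m\<close>; for \<open>m = 0\<close>, a zero object.\<close>

definition direct_sum ::
    "('o, 'm::comm_monoid_add, 'k, 'x) lin_cat_scheme \<Rightarrow> 'o \<Rightarrow> nat \<Rightarrow> (nat \<Rightarrow> 'o) \<Rightarrow> bool" where
  "direct_sum E X m A \<longleftrightarrow> X \<in> Ob E \<and> (\<forall>i \<in> {1..m}. A i \<in> Ob E) \<and>
     (\<exists>\<iota> \<pi>. (\<forall>i \<in> {1..m}. \<iota> i \<in> Hom E (A i) X \<and> \<pi> i \<in> Hom E X (A i))
        \<and> (\<forall>i \<in> {1..m}. \<forall>j \<in> {1..m}. cmp E (\<pi> i) (\<iota> j) = (if i = j then idm E (A i) else 0))
        \<and> (\<Sum>i = 1..m. cmp E (\<iota> i) (\<pi> i)) = idm E X)"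

definition direct_factor :: "('o, 'm::comm_monoid_add, 'k, 'x) lin_cat_scheme \<Rightarrow> 'o \<Rightarrow> 'o \<Rightarrow> bool" where
  "direct_factor E Y X \<longleftrightarrow> (\<exists>A. A 1 = Y \<and> direct_sum E X 2 A)"

definition indecomposable :: "('o, 'm::comm_monoid_add, 'k, 'x) lin_cat_scheme \<Rightarrow> 'o \<Rightarrow> bool" where
  "indecomposable E X \<longleftrightarrow> X \<in> Ob E \<and> \<not> zero_object E X \<and>
     (\<forall>A. direct_sum E X 2 A \<longrightarrow> zero_object E (A 1) \<or> zero_object E (A 2))"

definition indec :: "('o, 'm::comm_monoid_add, 'k, 'x) lin_cat_scheme \<Rightarrow> 'o set \<Rightarrow> 'o set" where
  "indec E T = {X \<in> T. indecomposable E X}"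

locale additive_category = linear_category +
  assumes direct_sum_exists: "(\<And>i. i \<in> {1..m} \<Longrightarrow> A i \<in> Ob E) \<Longrightarrow> \<exists>X. direct_sum E X m A"

subsection \<open>Exact categories\<close>

text \<open>\<open>Conf E X f M g Y\<close> says that \<open>X \<rightarrow> M \<rightarrow> Y\<close>, with morphisms \<open>f\<close> and \<open>g\<close>, is a conflation.\<close>

record ('o, 'm, 'k) exact_cat = "('o, 'm, 'k) lin_cat" +
  Conf :: "'o \<Rightarrow> 'm \<Rightarrow> 'o \<Rightarrow> 'm \<Rightarrow> 'o \<Rightarrow> bool"

definition is_kernel ::
    "('o, 'm::zero, 'k, 'x) lin_cat_scheme \<Rightarrow> 'o \<Rightarrow> 'm \<Rightarrow> 'o \<Rightarrow> 'm \<Rightarrow> 'o \<Rightarrow> bool" where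
  "is_kernel E X f M g Y \<longleftrightarrow> f \<in> Hom E X M \<and> g \<in> Hom E M Y \<and> cmp E g f = 0 \<and>
     (\<forall>W \<in> Ob E. \<forall>h \<in> Hom E W M. cmp E g h = 0 \<longrightarrow> (\<exists>!u. u \<in> Hom E W X \<and> cmp E f u = h))"

definition is_cokernel ::
    "('o, 'm::zero, 'k, 'x) lin_cat_scheme \<Rightarrow> 'o \<Rightarrow> 'm \<Rightarrow> 'o \<Rightarrow> 'm \<Rightarrow> 'o \<Rightarrow> bool" where
  "is_cokernel E X f M g Y \<longleftrightarrow> f \<in> Hom E X M \<and> g \<in> Hom E M Y \<and> cmp E g f = 0 \<and>
     (\<forall>W \<in> Ob E. \<forall>h \<in> Hom E M W. cmp E h f = 0 \<longrightarrow> (\<exists>!u. u \<in> Hom E Y W \<and> cmp E u g = h))"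

text \<open>The squares below have \<open>X\<close> in the upper left corner, \<open>M\<close> in the upper right one,
  \<open>X'\<close> in the lower left and \<open>M'\<close> in the lower right one.\<close>

definition pushout_square :: "('o, 'm, 'k, 'x) lin_cat_scheme \<Rightarrow>
    'o \<Rightarrow> 'o \<Rightarrow> 'o \<Rightarrow> 'o \<Rightarrow> 'm \<Rightarrow> 'm \<Rightarrow> 'm \<Rightarrow> 'm \<Rightarrow> bool" where
  "pushout_square E X M X' M' f a f' b \<longleftrightarrow>
     f \<in> Hom E X M \<and> a \<in> Hom E X X' \<and> f' \<in> Hom E X' M' \<and> b \<in> Hom E M M'
     \<and> cmp E b f = cmp E f' a
     \<and> (\<forall>W \<in> Ob E. \<forall>u \<in> Hom E X' W. \<forall>v \<in> Hom E M W. cmp E u a = cmp E v f \<longrightarrow>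
          (\<exists>!w. w \<in> Hom E M' W \<and> cmp E w f' = u \<and> cmp E w b = v))"

definition pullback_square :: "('o, 'm, 'k, 'x) lin_cat_scheme \<Rightarrow>
    'o \<Rightarrow> 'o \<Rightarrow> 'o \<Rightarrow> 'o \<Rightarrow> 'm \<Rightarrow> 'm \<Rightarrow> 'm \<Rightarrow> 'm \<Rightarrow> bool" where
  "pullback_square E X M X' M' f a f' b \<longleftrightarrow>
     f \<in> Hom E X M \<and> a \<in> Hom E X X' \<and> f' \<in> Hom E X' M' \<and> b \<in> Hom E M M'
     \<and> cmp E b f = cmp E f' a
     \<and> (\<forall>W \<in> Ob E. \<forall>u \<in> Hom E W X'. \<forall>v \<in> Hom E W M. cmp E f' u = cmp E b v \<longrightarrow>
          (\<exists>!w. w \<in> Hom E W X \<and> cmp E a w = u \<and> cmp E f w = v))"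

definition inflation :: "('o, 'm, 'k, 'x) exact_cat_scheme \<Rightarrow> 'o \<Rightarrow> 'o \<Rightarrow> 'm \<Rightarrow> bool" where
  "inflation E X M f \<longleftrightarrow> (\<exists>g Y. Conf E X f M g Y)"

definition deflation :: "('o, 'm, 'k, 'x) exact_cat_scheme \<Rightarrow> 'o \<Rightarrow> 'o \<Rightarrow> 'm \<Rightarrow> bool" where
  "deflation E M Y g \<longleftrightarrow> (\<exists>X f. Conf E X f M g Y)"

locale exact_category = additive_category E
  for E :: "('o, 'm::ab_group_add, 'k::field, 'x) exact_cat_scheme" (structure) +
  assumes Conf_Ob: "Conf E X f M g Y \<Longrightarrow> X \<in> Ob E \<and> M \<in> Ob E \<and> Y \<in> Ob E"
    and Conf_kernel: "Conf E X f M g Y \<Longrightarrow> is_kernel E X f M g Y"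
    and Conf_cokernel: "Conf E X f M g Y \<Longrightarrow> is_cokernel E X f M g Y"
    and Conf_iso: "\<lbrakk>Conf E X f M g Y; X' \<in> Ob E; M' \<in> Ob E; Y' \<in> Ob E;
        f' \<in> Hom E X' M'; g' \<in> Hom E M' Y'; iso_mor E X X' a; iso_mor E M M' b; iso_mor E Y Y' c;
        cmp E b f = cmp E f' a; cmp E c g = cmp E g' b\<rbrakk> \<Longrightarrow> Conf E X' f' M' g' Y'"
    and inflation_idm: "X \<in> Ob E \<Longrightarrow> inflation E X X (idm E X)"
    and deflation_idm: "X \<in> Ob E \<Longrightarrow> deflation E X X (idm E X)"
    and inflation_cmp: "\<lbrakk>inflation E X Y f; inflation E Y Z g\<rbrakk> \<Longrightarrow> inflation E X Z (cmp E g f)"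
    and deflation_cmp: "\<lbrakk>deflation E X Y f; deflation E Y Z g\<rbrakk> \<Longrightarrow> deflation E X Z (cmp E g f)"
    and inflation_pushout: "\<lbrakk>inflation E X M f; X' \<in> Ob E; a \<in> Hom E X X'\<rbrakk>
      \<Longrightarrow> \<exists>M' \<in> Ob E. \<exists>f' b. pushout_square E X M X' M' f a f' b \<and> inflation E X' M' f'"
    and deflation_pullback: "\<lbrakk>deflation E X' M' f'; M \<in> Ob E; b \<in> Hom E M M'\<rbrakk>
      \<Longrightarrow> \<exists>X \<in> Ob E. \<exists>f a. pullback_square E X M X' M' f a f' b \<and> deflation E X M f"

definition projective :: "('o, 'm, 'k, 'x) exact_cat_scheme \<Rightarrow> 'o \<Rightarrow> bool" where
  "projective E P \<longleftrightarrow> P \<in> Ob E \<and>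
     (\<forall>M Y g. deflation E M Y g \<longrightarrow> (\<forall>h \<in> Hom E P Y. \<exists>h' \<in> Hom E P M. cmp E g h' = h))"

definition injective :: "('o, 'm, 'k, 'x) exact_cat_scheme \<Rightarrow> 'o \<Rightarrow> bool" where
  "injective E I \<longleftrightarrow> I \<in> Ob E \<and>
     (\<forall>X M f. inflation E X M f \<longrightarrow> (\<forall>h \<in> Hom E X I. \<exists>h' \<in> Hom E M I. cmp E h' f = h))"

text \<open>Yoneda extensions of \<open>A\<close> by \<open>B\<close>: conflations \<open>B \<rightarrow> M \<rightarrow> A\<close> modulo equivalence.\<close>

definition extensions :: "('o, 'm, 'k, 'x) exact_cat_scheme \<Rightarrow> 'o \<Rightarrow> 'o \<Rightarrow> ('o \<times> 'm \<times> 'm) set" where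
  "extensions E A B = {(M, f, g). Conf E B f M g A}"

definition ext_equiv :: "('o, 'm, 'k, 'x) exact_cat_scheme \<Rightarrow> 'o \<Rightarrow> 'o \<Rightarrow>
    (('o \<times> 'm \<times> 'm) \<times> ('o \<times> 'm \<times> 'm)) set" where
  "ext_equiv E A B = {((M, f, g), (M', f', g')).
     (M, f, g) \<in> extensions E A B \<and> (M', f', g') \<in> extensions E A B
     \<and> (\<exists>\<phi>. iso_mor E M M' \<phi> \<and> cmp E \<phi> f = f' \<and> cmp E g' \<phi> = g)}"

definition Ext1 :: "('o, 'm, 'k, 'x) exact_cat_scheme \<Rightarrow> 'o \<Rightarrow> 'o \<Rightarrow> ('o \<times> 'm \<times> 'm) set set" where
  "Ext1 E A B = extensions E A B // ext_equiv E A B"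

text \<open>The zero element of \<open>Ext1 E A B\<close> is the class consisting of the split extensions.\<close>

definition Ext1_zero :: "('o, 'm, 'k, 'x) exact_cat_scheme \<Rightarrow> 'o \<Rightarrow> 'o \<Rightarrow> ('o \<times> 'm \<times> 'm) set" where
  "Ext1_zero E A B = {(M, f, g) \<in> extensions E A B. \<exists>s \<in> Hom E A M. cmp E g s = idm E A}"

subsection \<open>The stable category and the 2-Calabi-Yau property\<close>

definition proj_factoring :: "('o, 'm, 'k, 'x) exact_cat_scheme \<Rightarrow> 'o \<Rightarrow> 'o \<Rightarrow> 'm set" where
  "proj_factoring E X Y = {cmp E v u | P u v. projective E P \<and> u \<in> Hom E X P \<and> v \<in> Hom E P Y}"

text \<open>Stable morphisms are cosets modulo \<open>proj_factoring E X Y\<close>, which is also the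
  zero stable morphism.\<close>

definition stable_class ::
    "('o, 'm::plus, 'k, 'x) exact_cat_scheme \<Rightarrow> 'o \<Rightarrow> 'o \<Rightarrow> 'm \<Rightarrow> 'm set" where
  "stable_class E X Y f = {f + p | p. p \<in> proj_factoring E X Y}"

definition stable_Hom :: "('o, 'm::plus, 'k, 'x) exact_cat_scheme \<Rightarrow> 'o \<Rightarrow> 'o \<Rightarrow> 'm set set" where
  "stable_Hom E X Y = stable_class E X Y ` Hom E X Y"

definition stable_cmp ::
    "('o, 'm::plus, 'k, 'x) exact_cat_scheme \<Rightarrow> 'o \<Rightarrow> 'o \<Rightarrow> 'm set \<Rightarrow> 'm set \<Rightarrow> 'm set" where
  "stable_cmp E X Z d c = (\<Union>g \<in> d. \<Union>f \<in> c. stable_class E X Z (cmp E g f))"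

text \<open>
  The suspension of the stable category depends on the choice, for each object \<open>X\<close>, of a
  conflation \<open>X \<rightarrow> I X \<rightarrow> S X\<close> with \<open>I X\<close> injective and morphisms \<open>\<iota> X\<close>, \<open>\<pi> X\<close>.
  Different choices yield canonically isomorphic functors.
\<close>

record ('o, 'm) susp_data =
  susp_inj :: "'o \<Rightarrow> 'o"
  susp :: "'o \<Rightarrow> 'o"
  susp_in :: "'o \<Rightarrow> 'm"
  susp_out :: "'o \<Rightarrow> 'm"

definition is_susp_data ::
    "('o, 'm, 'k, 'x) exact_cat_scheme \<Rightarrow> ('o, 'm) susp_data \<Rightarrow> bool" where
  "is_susp_data E D \<longleftrightarrow> (\<forall>X \<in> Ob E. injective E (susp_inj D X) \<and>
     Conf E X (susp_in D X) (susp_inj D X) (susp_out D X) (susp D X))"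

text \<open>
  The suspension of a stable morphism \<open>c\<close> from \<open>X\<close> to \<open>Y\<close>: all \<open>f'\<close> which, together with some
  \<open>f \<in> c\<close> and some \<open>h\<close>, form a morphism between the chosen conflations.  In a Frobenius category
  this set is a single coset.
\<close>

definition susp_map :: "('o, 'm, 'k, 'x) exact_cat_scheme \<Rightarrow> ('o, 'm) susp_data \<Rightarrow>
    'o \<Rightarrow> 'o \<Rightarrow> 'm set \<Rightarrow> 'm set" where
  "susp_map E D X Y c = {f' \<in> Hom E (susp D X) (susp D Y).
     \<exists>f \<in> c. \<exists>h \<in> Hom E (susp_inj D X) (susp_inj D Y).
       cmp E h (susp_in D X) = cmp E (susp_in D Y) f \<and>
       cmp E f' (susp_out D X) = cmp E (susp_out D Y) h}"

primrec susp_map_pow :: "nat \<Rightarrow> ('o, 'm, 'k, 'x) exact_cat_scheme \<Rightarrow> ('o, 'm) susp_data \<Rightarrow>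
    'o \<Rightarrow> 'o \<Rightarrow> 'm set \<Rightarrow> 'm set" where
  "susp_map_pow 0 E D X Y c = c"
| "susp_map_pow (Suc p) E D X Y c =
     susp_map E D ((susp D ^^ p) X) ((susp D ^^ p) Y) (susp_map_pow p E D X Y c)"

definition cy_pairing :: "('o, 'm::plus, 'k, 'x) exact_cat_scheme \<Rightarrow> ('o, 'm) susp_data \<Rightarrow>
    ('o \<Rightarrow> 'm set \<Rightarrow> 'k) \<Rightarrow> 'o \<Rightarrow> 'm set \<Rightarrow> 'm set \<Rightarrow> 'k" where
  "cy_pairing E D t X d c = t X (stable_cmp E X ((susp D ^^ 2) X) d c)"

definition stably_2_calabi_yau :: "('o, 'm::ab_group_add, 'k::field, 'x) exact_cat_scheme \<Rightarrow> bool" where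
  "stably_2_calabi_yau E \<longleftrightarrow> (\<exists>(D :: ('o, 'm) susp_data) (t :: 'o \<Rightarrow> 'm set \<Rightarrow> 'k).
     is_susp_data E D
     \<and> (\<forall>X \<in> Ob E. \<forall>f \<in> Hom E X ((susp D ^^ 2) X). \<forall>g \<in> Hom E X ((susp D ^^ 2) X). \<forall>a b.
          t X (stable_class E X ((susp D ^^ 2) X) (scl E a f + scl E b g))
          = a * t X (stable_class E X ((susp D ^^ 2) X) f)
            + b * t X (stable_class E X ((susp D ^^ 2) X) g))
     \<and> (\<forall>X \<in> Ob E. \<forall>Y \<in> Ob E. \<forall>d \<in> stable_Hom E Y ((susp D ^^ 2) X).
          (\<forall>c \<in> stable_Hom E X Y. cy_pairing E D t X d c = 0)
          \<longrightarrow> d = proj_factoring E Y ((susp D ^^ 2) X))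
     \<and> (\<forall>X \<in> Ob E. \<forall>Y \<in> Ob E. \<forall>c \<in> stable_Hom E X Y.
          (\<forall>d \<in> stable_Hom E Y ((susp D ^^ 2) X). cy_pairing E D t X d c = 0)
          \<longrightarrow> c = proj_factoring E X Y)
     \<and> (\<forall>p q. p + q = 2 \<longrightarrow> (\<forall>X \<in> Ob E. \<forall>Y \<in> Ob E.
          \<forall>d \<in> stable_Hom E Y ((susp D ^^ q) X). \<forall>c \<in> stable_Hom E X ((susp D ^^ p) Y).
            cy_pairing E D t X (susp_map_pow p E D Y ((susp D ^^ q) X) d) c
            = (- 1) ^ (p * q) * cy_pairing E D t Y (susp_map_pow q E D X ((susp D ^^ p) Y) c) d)))"

locale frobenius_2cy_category = exact_category E
  for E :: "('o, 'm::ab_group_add, 'k::alg_closed_field, 'x) exact_cat_scheme" (structure) +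
  assumes Hom_finite: "\<lbrakk>X \<in> Ob E; Y \<in> Ob E\<rbrakk>
      \<Longrightarrow> \<exists>S. finite S \<and> Modules.module.span (scl E) S = Hom E X Y"
    and enough_projectives: "X \<in> Ob E \<Longrightarrow> \<exists>P g. projective E P \<and> deflation E P X g"
    and enough_injectives: "X \<in> Ob E \<Longrightarrow> \<exists>I f. injective E I \<and> inflation E X I f"
    and projective_iff_injective: "projective E P \<longleftrightarrow> injective E P"
    and split_idempotents: "\<lbrakk>X \<in> Ob E; e \<in> Hom E X X; cmp E e e = e\<rbrakk>
      \<Longrightarrow> \<exists>Y \<in> Ob E. \<exists>p \<in> Hom E X Y. \<exists>i \<in> Hom E Y X. cmp E i p = e \<and> cmp E p i = idm E Y"
    and stably_2cy: "stably_2_calabi_yau E"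

subsection \<open>Cluster-tilting subcategories and their quivers\<close>

text \<open>
  A full subcategory is given by its set of objects.  A functor \<open>E(X,?)\<close> on \<open>T\<close> is finitely
  generated iff there are finitely many elements \<open>w i \<in> E(X, U i)\<close>, with \<open>U i\<close> in \<open>T\<close>, such that
  every element \<open>f \<in> E(X, T')\<close> is a sum of images \<open>v i w i\<close> of these; dually for \<open>E(?,X)\<close>.
\<close>

definition fin_gen_covariant ::
    "('o, 'm::comm_monoid_add, 'k, 'x) lin_cat_scheme \<Rightarrow> 'o set \<Rightarrow> 'o \<Rightarrow> bool" where
  "fin_gen_covariant E T X \<longleftrightarrow> (\<exists>m (U :: nat \<Rightarrow> 'o) w.
     (\<forall>i \<in> {1..m}. U i \<in> T \<and> w i \<in> Hom E X (U i))
     \<and> (\<forall>T' \<in> T. \<forall>f \<in> Hom E X T'. \<exists>v. (\<forall>i \<in> {1..m}. v i \<in> Hom E (U i) T')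
          \<and> f = (\<Sum>i = 1..m. cmp E (v i) (w i))))"

definition fin_gen_contravariant ::
    "('o, 'm::comm_monoid_add, 'k, 'x) lin_cat_scheme \<Rightarrow> 'o set \<Rightarrow> 'o \<Rightarrow> bool" where
  "fin_gen_contravariant E T X \<longleftrightarrow> (\<exists>m (U :: nat \<Rightarrow> 'o) w.
     (\<forall>i \<in> {1..m}. U i \<in> T \<and> w i \<in> Hom E (U i) X)
     \<and> (\<forall>T' \<in> T. \<forall>f \<in> Hom E T' X. \<exists>v. (\<forall>i \<in> {1..m}. v i \<in> Hom E T' (U i))
          \<and> f = (\<Sum>i = 1..m. cmp E (w i) (v i))))"

definition cluster_tilting_subcat ::
    "('o, 'm::comm_monoid_add, 'k, 'x) exact_cat_scheme \<Rightarrow> 'o set \<Rightarrow> bool" where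
  "cluster_tilting_subcat E T \<longleftrightarrow> T \<subseteq> Ob E
     \<and> (\<forall>X m A. (\<forall>i \<in> {1..m}. A i \<in> T) \<and> direct_sum E X m A \<longrightarrow> X \<in> T)
     \<and> (\<forall>X \<in> T. \<forall>Y. direct_factor E Y X \<longrightarrow> Y \<in> T)
     \<and> (\<forall>X \<in> Ob E. fin_gen_covariant E T X \<and> fin_gen_contravariant E T X)
     \<and> (\<forall>X \<in> Ob E. X \<in> T \<longleftrightarrow> (\<forall>T' \<in> T. Ext1 E T' X = {Ext1_zero E T' X}))"

definition add_closure ::
    "('o, 'm::comm_monoid_add, 'k, 'x) lin_cat_scheme \<Rightarrow> 'o set \<Rightarrow> 'o set" where
  "add_closure E S = {X. \<exists>Y m A. (\<forall>i \<in> {1..m}. A i \<in> S) \<and> direct_sum E Y m A \<and> direct_factor E X Y}"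

definition basic_object :: "('o, 'm::comm_monoid_add, 'k, 'x) lin_cat_scheme \<Rightarrow> 'o \<Rightarrow> bool" where
  "basic_object E X \<longleftrightarrow> (\<exists>m A. direct_sum E X m A \<and> (\<forall>i \<in> {1..m}. indecomposable E (A i))
     \<and> (\<forall>i \<in> {1..m}. \<forall>j \<in> {1..m}. i \<noteq> j \<longrightarrow> \<not> isomorphic E (A i) (A j)))"

definition cluster_tilting_object ::
    "('o, 'm::comm_monoid_add, 'k, 'x) exact_cat_scheme \<Rightarrow> 'o \<Rightarrow> bool" where
  "cluster_tilting_object E T \<longleftrightarrow> basic_object E T \<and> cluster_tilting_subcat E (add_closure E {T})"

text \<open>\<open>radical E X Y\<close> only depends on the full subcategory on \<open>X\<close> and \<open>Y\<close>, so it is also the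
  radical of any full subcategory \<open>T\<close> containing them.  Its square, in contrast, depends on \<open>T\<close>.\<close>

definition radical :: "('o, 'm::minus, 'k, 'x) lin_cat_scheme \<Rightarrow> 'o \<Rightarrow> 'o \<Rightarrow> 'm set" where
  "radical E X Y = {f \<in> Hom E X Y. \<forall>g \<in> Hom E Y X. iso_mor E X X (idm E X - cmp E g f)}"

definition radical_sq ::
    "('o, 'm::ab_group_add, 'k::field, 'x) lin_cat_scheme \<Rightarrow> 'o set \<Rightarrow> 'o \<Rightarrow> 'o \<Rightarrow> 'm set" where
  "radical_sq E T X Y = Modules.module.span (scl E)
     {cmp E g f | Z f g. Z \<in> T \<and> f \<in> radical E X Z \<and> g \<in> radical E Z Y}"

text \<open>The number of arrows from \<open>X\<close> to \<open>Y\<close> in the quiver of \<open>T\<close>: the dimension of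
  \<open>radical E X Y\<close> modulo its subspace \<open>radical_sq E T X Y\<close> (all spaces are finite-dimensional).\<close>

definition arrows ::
    "('o, 'm::ab_group_add, 'k::field, 'x) lin_cat_scheme \<Rightarrow> 'o set \<Rightarrow> 'o \<Rightarrow> 'o \<Rightarrow> nat" where
  "arrows E T X Y = Vector_Spaces.vector_space.dim (scl E) (radical E X Y)
     - Vector_Spaces.vector_space.dim (scl E) (radical_sq E T X Y)"

text \<open>A quiver is given by its numbers of arrows.\<close>

definition quiver_matrix :: "('v \<Rightarrow> 'v \<Rightarrow> nat) \<Rightarrow> 'v \<Rightarrow> 'v \<Rightarrow> int" where
  "quiver_matrix q i j = int (q i j) - int (q j i)"

definition mutate_quiver :: "'v \<Rightarrow> ('v \<Rightarrow> 'v \<Rightarrow> nat) \<Rightarrow> 'v \<Rightarrow> 'v \<Rightarrow> nat" where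
  "mutate_quiver s q i j = nat (mutate_matrix s (quiver_matrix q) i j)"

definition remove_arrows :: "('v \<Rightarrow> bool) \<Rightarrow> ('v \<Rightarrow> 'v \<Rightarrow> nat) \<Rightarrow> 'v \<Rightarrow> 'v \<Rightarrow> nat" where
  "remove_arrows F q i j = (if F i \<and> F j then 0 else q i j)"

subsection \<open>Cluster structures and realizations\<close>

definition mutate_subcat ::
    "('o, 'm::comm_monoid_add, 'k, 'x) lin_cat_scheme \<Rightarrow> 'o set \<Rightarrow> 'o \<Rightarrow> 'o \<Rightarrow> 'o set" where
  "mutate_subcat E T M N = add_closure E ({X \<in> indec E T. \<not> isomorphic E X M} \<union> {N})"

definition exchange_partner ::
    "('o, 'm::comm_monoid_add, 'k, 'x) exact_cat_scheme \<Rightarrow> 'o set \<Rightarrow> 'o \<Rightarrow> 'o \<Rightarrow> bool" where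
  "exchange_partner E T M N \<longleftrightarrow> indecomposable E N \<and> \<not> projective E N \<and> \<not> isomorphic E N M
     \<and> cluster_tilting_subcat E (mutate_subcat E T M N)"

definition min_right_approx ::
    "('o, 'm, 'k, 'x) lin_cat_scheme \<Rightarrow> 'o set \<Rightarrow> 'o \<Rightarrow> 'o \<Rightarrow> 'm \<Rightarrow> bool" where
  "min_right_approx E S F M g \<longleftrightarrow> F \<in> S \<and> g \<in> Hom E F M
     \<and> (\<forall>U \<in> S. \<forall>h \<in> Hom E U M. \<exists>u \<in> Hom E U F. cmp E g u = h)
     \<and> (\<forall>\<phi> \<in> Hom E F F. cmp E g \<phi> = g \<longrightarrow> iso_mor E F F \<phi>)"

definition min_left_approx ::
    "('o, 'm, 'k, 'x) lin_cat_scheme \<Rightarrow> 'o set \<Rightarrow> 'o \<Rightarrow> 'o \<Rightarrow> 'm \<Rightarrow> bool" where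
  "min_left_approx E S M F f \<longleftrightarrow> F \<in> S \<and> f \<in> Hom E M F
     \<and> (\<forall>U \<in> S. \<forall>h \<in> Hom E M U. \<exists>u \<in> Hom E F U. cmp E u f = h)
     \<and> (\<forall>\<phi> \<in> Hom E F F. cmp E \<phi> f = f \<longrightarrow> iso_mor E F F \<phi>)"

definition exchange_conflations ::
    "('o, 'm, 'k, 'x) exact_cat_scheme \<Rightarrow> 'o set \<Rightarrow> 'o \<Rightarrow> 'o \<Rightarrow> bool" where
  "exchange_conflations E S M N \<longleftrightarrow> (\<exists>F f g F' s t.
     Conf E N f F g M \<and> min_right_approx E S F M g \<and> min_left_approx E S N F f
     \<and> Conf E M s F' t N \<and> min_right_approx E S F' N t \<and> min_left_approx E S M F' s)"

text \<open>
  Compatibility of quivers with mutation: \<open>\<sigma>\<close> identifies the vertices of the quiver of \<open>T\<close> with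
  those of the quiver of the mutated subcategory.  To have \<open>M\<close> as the only representative of its
  isomorphism class, the other indecomposables isomorphic to it are discarded.  Arrows between
  projective vertices are disregarded on both sides, in particular those which
  mutation at \<open>M\<close> would create.
\<close>

definition quiver_mutation_compatible ::
    "('o, 'm::ab_group_add, 'k::field, 'x) exact_cat_scheme \<Rightarrow> 'o set \<Rightarrow> 'o \<Rightarrow> 'o \<Rightarrow> bool" where
  "quiver_mutation_compatible E T M N \<longleftrightarrow>
     (let V = {X \<in> indec E T. X = M \<or> \<not> isomorphic E X M};
          \<sigma> = (\<lambda>X. if X = M then N else X);
          Q = remove_arrows (projective E) (arrows E T);
          Q' = remove_arrows (projective E) (arrows E (mutate_subcat E T M N))
      in \<forall>X \<in> V. \<forall>Y \<in> V. Q' (\<sigma> X) (\<sigma> Y) = remove_arrows (projective E) (mutate_quiver M Q) X Y)"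

definition cluster_structure ::
    "('o, 'm::ab_group_add, 'k::field, 'x) exact_cat_scheme \<Rightarrow> bool" where
  "cluster_structure E \<longleftrightarrow>
     (\<exists>T. cluster_tilting_subcat E T)
     \<and> (\<forall>T. cluster_tilting_subcat E T \<longrightarrow>
          (\<forall>M \<in> indec E T. \<not> projective E M \<longrightarrow>
             (\<exists>N. exchange_partner E T M N)
             \<and> (\<forall>N N'. exchange_partner E T M N \<and> exchange_partner E T M N' \<longrightarrow> isomorphic E N N')
             \<and> (\<forall>N. exchange_partner E T M N \<longrightarrow>
                  exchange_conflations E (T \<inter> mutate_subcat E T M N) M N
                  \<and> quiver_mutation_compatible E T M N))
          \<and> (\<forall>X \<in> indec E T. arrows E T X X = 0)
          \<and> (\<forall>X \<in> indec E T. \<forall>Y \<in> indec E T. arrows E T X Y = 0 \<or> arrows E T Y X = 0))"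

definition frobenius_2cy_realization ::
    "('o, 'm::ab_group_add, 'k::alg_closed_field, 'x) exact_cat_scheme \<Rightarrow> 'o \<Rightarrow>
     nat \<Rightarrow> nat \<Rightarrow> (nat \<Rightarrow> nat \<Rightarrow> int) \<Rightarrow> bool" where
  "frobenius_2cy_realization E T n r B \<longleftrightarrow>
     frobenius_2cy_category E \<and> cluster_structure E \<and> cluster_tilting_object E T
     \<and> (\<exists>Ts. direct_sum E T n Ts \<and> (\<forall>i \<in> {1..n}. indecomposable E (Ts i))
          \<and> (\<forall>i \<in> {1..n}. \<forall>j \<in> {1..n}. i \<noteq> j \<longrightarrow> \<not> isomorphic E (Ts i) (Ts j))
          \<and> (\<forall>i \<in> {1..n}. projective E (Ts i) \<longleftrightarrow> r < i)
          \<and> (\<forall>i \<in> {1..n}. \<forall>j \<in> {1..r}.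
               B i j = quiver_matrix (arrows E (add_closure E {T})) (Ts i) (Ts j)))"

end

theory Submission
  imports Defs
begin

text \<open>
  For a conflation \<open>0 \<rightarrow> N \<rightarrow> F \<rightarrow> M \<rightarrow> 0\<close> exchanging two summands of a cluster-tilting object, the dimensions
  of the morphism spaces into (or out of) a rigid object satisfy a tropical exchange relation, because
  2-Calabi-Yau duality prevents both exchange conflations from failing to be exact after applying
  \<open>Hom(X, -)\<close>.  The same argument for pairs of objects without extensions makes the defects (c-vectors and
  rows of g-vectors) sign-coherent.

  Sign-coherence of the c-vectors lets one factor a monomial out of every exchange binomial, so that each
  cluster variable is the monomial given by its g-vector times a quotient of two polynomials with constant
  term \<open>1\<close> in the \<open>y\<close>-hats.  If two cluster monomials have equal g-vectors, these are equal with respect to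
  all seeds, by sign-coherence of the rows; then by the Laurent phenomenon their quotient and its inverse
  are Laurent polynomials, each in one of the two clusters, and comparing valuations shows that the quotient
  is \<open>1\<close>.  Finally, in a linear relation between cluster monomials the exponent that is minimal in the
  dominance order occurs only once.
\<close>

section \<open>Hom-finite exact categories\<close>

text \<open>The category enters through integers only: once the dimensions \<open>d v i w k\<close>
  satisfy the locale \<open>hom_dimensions\<close>, objects and morphisms play no further part and
  no cluster character has to be constructed. Pairing these dimensions with the columns of the
  exchange matrix at \<open>w\<close> gives c-vectors, with those at \<open>v\<close> it gives
  g-vectors, and both kinds of sign-coherence come from one statement and its dual. For that reason
  the Calabi-Yau property is condensed into the self-dual condition \<open>ext_duality\<close>, and
  the other categorical arguments live in a class of categories closed under \<open>opp\<close>. Two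
  difficulties shape the second half. And valuations propagate through mutations only for
  expressions free of subtraction, whereas Laurent expansions are not known to be positive; hence
  subtraction-free fractions and Laurent polynomials are kept side by side and compared.\<close>

definition opp :: "('o, 'm, 'k) exact_cat \<Rightarrow> ('o, 'm, 'k) exact_cat" where
  "opp E = \<lparr>Ob = Ob E, Hom = (\<lambda>X Y. Hom E Y X), idm = idm E, cmp = (\<lambda>g f. cmp E f g),
     scl = scl E, Conf = (\<lambda>X f M g Y. Conf E Y g M f X)\<rparr>"

lemma opp_simps [simp]:
  "Ob (opp E) = Ob E" "Hom (opp E) X Y = Hom E Y X" "idm (opp E) = idm E"
  "cmp (opp E) g f = cmp E f g" "scl (opp E) = scl E" "Conf (opp E) X f M g Y = Conf E Y g M f X"
  by (simp_all add: opp_def)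

lemma opp_opp [simp]: "opp (opp E) = E"
  by (simp add: opp_def)

text \<open>Neither enough projectives nor any duality is assumed, so the axioms are self-dual and
  \<open>opp\<close> stays inside the locale. The record type has no extension slot because
  \<open>opp\<close> builds a new record.\<close>

locale finite_exact_category = exact_category E
  for E :: "('o, 'm::ab_group_add, 'k::alg_closed_field) exact_cat" (structure) +
  assumes Hom_finite: "\<lbrakk>X \<in> Ob E; Y \<in> Ob E\<rbrakk>
      \<Longrightarrow> \<exists>S. finite S \<and> Modules.module.span (scl E) S = Hom E X Y"
    and split_idempotents: "\<lbrakk>X \<in> Ob E; e \<in> Hom E X X; cmp E e e = e\<rbrakk>
      \<Longrightarrow> \<exists>Y \<in> Ob E. \<exists>p \<in> Hom E X Y. \<exists>i \<in> Hom E Y X. cmp E i p = e \<and> cmp E p i = idm E Y"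
begin

sublocale vs: Vector_Spaces.vector_space "scl E"
  by (rule vector_space_scl)

abbreviation comp (infixl "\<cdot>" 70) where "g \<cdot> f \<equiv> cmp E g f"

text \<open>\<open>Hom E X Y\<close> is unconstrained when \<open>X\<close> or \<open>Y\<close> is
  not an object. Making it empty there lets membership carry the typing of source and target, so
  that the laws below need no separate object hypotheses.\<close>

definition hom :: "'o \<Rightarrow> 'o \<Rightarrow> 'm set" where
  "hom X Y = (if X \<in> Ob E \<and> Y \<in> Ob E then Hom E X Y else {})"

lemma hom_eq: "X \<in> Ob E \<Longrightarrow> Y \<in> Ob E \<Longrightarrow> hom X Y = Hom E X Y"
  by (simp add: hom_def)

lemma homD: "f \<in> hom X Y \<Longrightarrow> X \<in> Ob E \<and> Y \<in> Ob E \<and> f \<in> Hom E X Y"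
  by (auto simp: hom_def split: if_splits)

lemma homI: "f \<in> Hom E X Y \<Longrightarrow> X \<in> Ob E \<Longrightarrow> Y \<in> Ob E \<Longrightarrow> f \<in> hom X Y"
  by (auto simp: hom_def split: if_splits)

lemma hom_dom: "f \<in> hom X Y \<Longrightarrow> X \<in> Ob E" and hom_cod: "f \<in> hom X Y \<Longrightarrow> Y \<in> Ob E"
  by (auto dest: homD)

lemma comp_in [intro]: "f \<in> hom X Y \<Longrightarrow> g \<in> hom Y Z \<Longrightarrow> g \<cdot> f \<in> hom X Z"
  using cmp_in_Hom by (auto simp: hom_def split: if_splits)

lemma id_in [intro, simp]: "X \<in> Ob E \<Longrightarrow> idm E X \<in> hom X X"
  using idm_in_Hom by (auto simp: hom_def)

lemma comp_id: "f \<in> hom X Y \<Longrightarrow> f \<cdot> idm E X = f"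
  using cmp_idm by (auto dest!: homD)

lemma id_comp: "f \<in> hom X Y \<Longrightarrow> idm E Y \<cdot> f = f"
  using idm_cmp by (auto dest!: homD)

lemma assoc: "f \<in> hom W X \<Longrightarrow> g \<in> hom X Y \<Longrightarrow> h \<in> hom Y Z \<Longrightarrow> h \<cdot> (g \<cdot> f) = h \<cdot> g \<cdot> f"
  using cmp_assoc by (auto dest!: homD)

lemma assoc4:
  assumes "f \<in> hom V W" "g \<in> hom W X" "h \<in> hom X Y" "k \<in> hom Y Z"
  shows "(k \<cdot> h) \<cdot> (g \<cdot> f) = k \<cdot> ((h \<cdot> g) \<cdot> f)"
  using assms assoc[OF assms(1,2) comp_in[OF assms(3,4)]] assoc[OF assms(2-4)]
    assoc[OF assms(1) comp_in[OF assms(2,3)] assms(4)] by simp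

lemma comp_add_left: "f \<in> hom X Y \<Longrightarrow> g \<in> hom Y Z \<Longrightarrow> g' \<in> hom Y Z \<Longrightarrow> (g + g') \<cdot> f = g \<cdot> f + g' \<cdot> f"
  using cmp_add_left by (auto dest!: homD)

lemma comp_add_right: "f \<in> hom X Y \<Longrightarrow> f' \<in> hom X Y \<Longrightarrow> g \<in> hom Y Z \<Longrightarrow> g \<cdot> (f + f') = g \<cdot> f + g \<cdot> f'"
  using cmp_add_right by (auto dest!: homD)

lemma comp_scl_left: "f \<in> hom X Y \<Longrightarrow> g \<in> hom Y Z \<Longrightarrow> scl E c g \<cdot> f = scl E c (g \<cdot> f)"
  using cmp_scl_left by (auto dest!: homD)

lemma comp_scl_right: "f \<in> hom X Y \<Longrightarrow> g \<in> hom Y Z \<Longrightarrow> g \<cdot> scl E c f = scl E c (g \<cdot> f)"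
  using cmp_scl_right by (auto dest!: homD)

lemma subspace_hom: "X \<in> Ob E \<Longrightarrow> Y \<in> Ob E \<Longrightarrow> vs.subspace (hom X Y)"
  using Hom_subspace by (simp add: hom_def)

lemma add_in [intro]: "f \<in> hom X Y \<Longrightarrow> g \<in> hom X Y \<Longrightarrow> f + g \<in> hom X Y"
  using subspace_hom vs.subspace_add hom_dom hom_cod by metis

lemma minus_in [intro]: "f \<in> hom X Y \<Longrightarrow> g \<in> hom X Y \<Longrightarrow> f - g \<in> hom X Y"
  using subspace_hom vs.subspace_diff hom_dom hom_cod by metis

lemma uminus_in [intro]: "f \<in> hom X Y \<Longrightarrow> - f \<in> hom X Y"
  using subspace_hom vs.subspace_neg hom_dom hom_cod by metis

lemma zero_in [intro, simp]: "X \<in> Ob E \<Longrightarrow> Y \<in> Ob E \<Longrightarrow> 0 \<in> hom X Y"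
  using subspace_hom vs.subspace_0 by metis

lemma scl_in [intro]: "f \<in> hom X Y \<Longrightarrow> scl E c f \<in> hom X Y"
  using subspace_hom vs.subspace_scale hom_dom hom_cod by metis

lemma sum_in: "X \<in> Ob E \<Longrightarrow> Y \<in> Ob E \<Longrightarrow> (\<And>i. i \<in> I \<Longrightarrow> f i \<in> hom X Y) \<Longrightarrow> (\<Sum>i\<in>I. f i) \<in> hom X Y"
  using subspace_hom vs.subspace_sum by metis

lemma comp_zero_right [simp]: "g \<in> hom Y Z \<Longrightarrow> g \<cdot> 0 = 0"
proof -
  assume g: "g \<in> hom Y Z"
  then have z: "(0::'m) \<in> hom Y Y" using hom_dom by auto
  show ?thesis using comp_add_right[OF z z g] by simp
qed

lemma comp_zero_left [simp]: "f \<in> hom X Y \<Longrightarrow> 0 \<cdot> f = 0"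
proof -
  assume f: "f \<in> hom X Y"
  then have z: "(0::'m) \<in> hom Y Y" using hom_cod by auto
  show ?thesis using comp_add_left[OF f z z] by simp
qed

lemma comp_minus_left: "f \<in> hom X Y \<Longrightarrow> g \<in> hom Y Z \<Longrightarrow> g' \<in> hom Y Z \<Longrightarrow> (g - g') \<cdot> f = g \<cdot> f - g' \<cdot> f"
  using comp_add_left[of f X Y "g - g'" Z g'] minus_in by (simp add: algebra_simps)

lemma comp_minus_right: "f \<in> hom X Y \<Longrightarrow> f' \<in> hom X Y \<Longrightarrow> g \<in> hom Y Z \<Longrightarrow> g \<cdot> (f - f') = g \<cdot> f - g \<cdot> f'"
  using comp_add_right[of "f - f'" X Y f' g Z] minus_in by (simp add: algebra_simps)

lemma comp_uminus_left: "f \<in> hom X Y \<Longrightarrow> g \<in> hom Y Z \<Longrightarrow> (- g) \<cdot> f = - (g \<cdot> f)"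
  using comp_minus_left[of f X Y 0 Z g] by (auto simp: hom_dom hom_cod)

lemma comp_sum_left: "f \<in> hom X Y \<Longrightarrow> Z \<in> Ob E \<Longrightarrow> (\<And>i. i \<in> I \<Longrightarrow> g i \<in> hom Y Z) \<Longrightarrow> (\<Sum>i\<in>I. g i) \<cdot> f = (\<Sum>i\<in>I. g i \<cdot> f)"
proof (induction I rule: infinite_finite_induct)
  case (insert x F)
  have "(\<Sum>i\<in>F. g i) \<in> hom Y Z" using insert hom_cod by (auto intro!: sum_in)
  then show ?case using insert comp_add_left[of f X Y "g x" Z "sum g F"] by simp
qed auto

lemma comp_sum_right: "g \<in> hom Y Z \<Longrightarrow> X \<in> Ob E \<Longrightarrow> (\<And>i. i \<in> I \<Longrightarrow> f i \<in> hom X Y) \<Longrightarrow> g \<cdot> (\<Sum>i\<in>I. f i) = (\<Sum>i\<in>I. g \<cdot> f i)"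
proof (induction I rule: infinite_finite_induct)
  case (insert x F)
  have "(\<Sum>i\<in>F. f i) \<in> hom X Y" using insert hom_dom by (auto intro!: sum_in)
  then show ?case using insert comp_add_right[of "f x" X Y "sum f F" g Z] by simp
qed auto

definition iso :: "'o \<Rightarrow> 'o \<Rightarrow> 'm \<Rightarrow> bool" where
  "iso X Y f \<longleftrightarrow> f \<in> hom X Y \<and> (\<exists>g \<in> hom Y X. g \<cdot> f = idm E X \<and> f \<cdot> g = idm E Y)"

lemma iso_in: "iso X Y f \<Longrightarrow> f \<in> hom X Y"
  by (simp add: iso_def)

lemma iso_mor_eq: "X \<in> Ob E \<Longrightarrow> Y \<in> Ob E \<Longrightarrow> iso_mor E X Y f \<longleftrightarrow> iso X Y f"
  by (simp add: iso_mor_def iso_def hom_def)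

lemma isomorphic_eq: "isomorphic E X Y \<longleftrightarrow> (\<exists>f. iso X Y f)"
  unfolding isomorphic_def using iso_mor_eq[of X Y] homD[OF iso_in] by blast

lemma iso_inv: "iso X Y f \<Longrightarrow> \<exists>g. iso Y X g \<and> g \<cdot> f = idm E X \<and> f \<cdot> g = idm E Y"
  by (auto simp: iso_def)

lemma iso_id [simp]: "X \<in> Ob E \<Longrightarrow> iso X X (idm E X)"
  unfolding iso_def using comp_id id_in by blast

lemma iso_comp: assumes "iso X Y f" "iso Y Z g" shows "iso X Z (g \<cdot> f)"
proof -
  obtain f' where f: "f \<in> hom X Y" "f' \<in> hom Y X" "f' \<cdot> f = idm E X" "f \<cdot> f' = idm E Y"
    using assms(1) by (auto simp: iso_def)
  obtain g' where g: "g \<in> hom Y Z" "g' \<in> hom Z Y" "g' \<cdot> g = idm E Y" "g \<cdot> g' = idm E Z"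
    using assms(2) by (auto simp: iso_def)
  have "(f' \<cdot> g') \<cdot> (g \<cdot> f) = idm E X"
    using assoc4[OF f(1) g(1) g(2) f(2)] f g id_comp[OF f(1)] by simp
  moreover have "(g \<cdot> f) \<cdot> (f' \<cdot> g') = idm E Z"
    using assoc4[OF g(2) f(2) f(1) g(1)] f g id_comp[OF g(2)] by simp
  ultimately show ?thesis using f g unfolding iso_def by blast
qed

lemma isomorphic_refl: "X \<in> Ob E \<Longrightarrow> isomorphic E X X"
  using iso_id isomorphic_eq by blast
lemma isomorphic_sym: "isomorphic E X Y \<Longrightarrow> isomorphic E Y X"
  using iso_inv isomorphic_eq by blast
lemma isomorphic_trans: "isomorphic E X Y \<Longrightarrow> isomorphic E Y Z \<Longrightarrow> isomorphic E X Z"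
  unfolding isomorphic_eq using iso_comp by metis

lemma iso_left_right:
  assumes "f \<in> hom X Y" "g \<in> hom Y X" "h \<in> hom Y X" "g \<cdot> f = idm E X" "f \<cdot> h = idm E Y"
  shows "iso X Y f"
proof -
  have "g = g \<cdot> (f \<cdot> h)" using assms comp_id by metis
  also have "\<dots> = h" using assms assoc id_comp by metis
  finally show ?thesis using assms by (auto simp: iso_def)
qed

text \<open>If \<open>u\<close> inverts 1 - gf, then 1 + fug inverts 1 - fg. Applied to the
  definition of the radical, this gives its left-right symmetry, which is needed for passing to
  \<open>opp\<close>.\<close>

lemma iso_one_minus:
  assumes f: "f \<in> hom X Y" and g: "g \<in> hom Y X" and i: "iso X X (idm E X - g \<cdot> f)"
  shows "iso Y Y (idm E Y - f \<cdot> g)"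
proof -
  have X: "X \<in> Ob E" "Y \<in> Ob E" using f hom_dom hom_cod by auto
  obtain u where u: "u \<in> hom X X" "u \<cdot> (idm E X - g \<cdot> f) = idm E X" "(idm E X - g \<cdot> f) \<cdot> u = idm E X"
    using i by (auto simp: iso_def)
  have gf: "g \<cdot> f \<in> hom X X" "f \<cdot> g \<in> hom Y Y" using f g by auto
  have u1: "u - u \<cdot> (g \<cdot> f) = idm E X"
    using u gf X comp_minus_right[of "idm E X" X X "g \<cdot> f" u X] comp_id[OF u(1)] by auto
  have u2: "u - g \<cdot> f \<cdot> u = idm E X"
    using u gf X comp_minus_left[of u X X "idm E X" X "g \<cdot> f"] id_comp[OF u(1)] by auto
  define w where "w = f \<cdot> (u \<cdot> g)"
  have w: "w \<in> hom Y Y" "u \<cdot> g \<in> hom Y X" unfolding w_def using f g u by auto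
  have a: "(f \<cdot> g) \<cdot> w = f \<cdot> ((g \<cdot> f \<cdot> u) \<cdot> g)"
    unfolding w_def using assoc4[OF w(2) f g f] assoc[OF w(2) f g] assoc[OF g u(1) gf(1)] by simp
  have b: "w \<cdot> (f \<cdot> g) = f \<cdot> ((u \<cdot> (g \<cdot> f)) \<cdot> g)"
    unfolding w_def using assoc4[OF g f w(2) f] assoc4[OF g f g u(1)] assoc[OF g gf(1) u(1)]
      assoc[OF comp_in[OF g f] w(2) f] assoc[OF g f w(2)] assoc[OF f g u(1)] by simp
  have c: "f \<cdot> ((u - idm E X) \<cdot> g) = w - f \<cdot> g"
    unfolding w_def using f g u w(2) X comp_minus_left[of g Y X u X "idm E X"] id_comp[OF g] comp_minus_right[of "u \<cdot> g" Y X g f Y] by auto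
  have d: "g \<cdot> f \<cdot> u = u - idm E X" "u \<cdot> (g \<cdot> f) = u - idm E X" using u1 u2 by (auto simp: algebra_simps)
  have e: "(f \<cdot> g) \<cdot> w = w - f \<cdot> g" "w \<cdot> (f \<cdot> g) = w - f \<cdot> g" using a b c d by auto
  define v where "v = idm E Y + w"
  have v: "v \<in> hom Y Y" unfolding v_def using w X by auto
  have "(idm E Y - f \<cdot> g) \<cdot> v = v - (f \<cdot> g) \<cdot> v"
    using comp_minus_left[of v Y Y "idm E Y" Y "f \<cdot> g"] v X gf id_comp[OF v] by auto
  also have "(f \<cdot> g) \<cdot> v = f \<cdot> g + (f \<cdot> g) \<cdot> w" unfolding v_def
    using comp_add_right[of "idm E Y" Y Y w "f \<cdot> g" Y] w X gf comp_id[OF gf(2)] by auto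
  finally have 1: "(idm E Y - f \<cdot> g) \<cdot> v = idm E Y" using e by (simp add: v_def)
  have "v \<cdot> (idm E Y - f \<cdot> g) = v - v \<cdot> (f \<cdot> g)"
    using comp_minus_right[of "idm E Y" Y Y "f \<cdot> g" v Y] v X gf comp_id[OF v] by auto
  also have "v \<cdot> (f \<cdot> g) = f \<cdot> g + w \<cdot> (f \<cdot> g)" unfolding v_def
    using comp_add_left[of "f \<cdot> g" Y Y "idm E Y" Y w] w X gf id_comp[OF gf(2)] by auto
  finally have 2: "v \<cdot> (idm E Y - f \<cdot> g) = idm E Y" using e by (simp add: v_def)
  show ?thesis using 1 2 v X gf by (auto simp: iso_def)
qed

end

section \<open>Linear algebra in finite-dimensional subspaces\<close>

context Vector_Spaces.vector_space
begin

lemma finite_dim_basis: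
  assumes "subspace V" "finite S" "V \<subseteq> span S" "K \<subseteq> V" "independent K"
  obtains B where "K \<subseteq> B" "B \<subseteq> V" "independent B" "span B = V" "finite B" "card B = dim V"
proof -
  obtain B where B: "K \<subseteq> B" "B \<subseteq> V" "independent B" "V \<subseteq> span B"
    using maximal_independent_subset_extend[OF assms(4,5)] by metis
  have f: "finite B" using independent_span_bound[OF assms(2) B(3)] B(2) assms(3) by auto
  have s: "span B = V" using B assms(1) by (metis span_minimal subset_antisym)
  have "card B = dim V" using B by (metis basis_card_eq_dim)
  then show thesis using that B f s by metis
qed

lemma dim_mono_finite:
  assumes "subspace V" "finite S" "V \<subseteq> span S" "subspace K" "K \<subseteq> V"
  shows "dim K \<le> dim V" and "dim K = dim V \<Longrightarrow> K = V"
proof -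
  obtain A where A: "A \<subseteq> K" "independent A" "span A = K" "finite A" "card A = dim K"
    using finite_dim_basis[OF assms(4,2) order_trans[OF assms(5,3)], of "{}"] independent_empty by auto
  obtain B where B: "A \<subseteq> B" "B \<subseteq> V" "independent B" "span B = V" "finite B" "card B = dim V"
    using finite_dim_basis[OF assms(1-3), of A] A assms(5) by blast
  show "dim K \<le> dim V" using A B by (metis card_mono)
  assume "dim K = dim V"
  then have "A = B" using A B by (metis card_subset_eq)
  then show "K = V" using A B by simp
qed

lemma dim_zero_space [simp]: "dim {0} = 0"
  by (rule dim_unique[of "{}"]) (auto simp: independent_empty)

text \<open>Rank-nullity with linearity demanded only on \<open>V\<close>: composition with a fixed
  morphism is known to be linear on morphism spaces, not on the whole ambient vector space.\<close>

lemma dim_kernel_image: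
  assumes V: "subspace V" "finite S" "V \<subseteq> span S"
    and add: "\<And>x y. x \<in> V \<Longrightarrow> y \<in> V \<Longrightarrow> f (x + y) = f x + f y"
    and scl: "\<And>c x. x \<in> V \<Longrightarrow> f (scale c x) = scale c (f x)"
  shows "dim V = dim {v \<in> V. f v = 0} + dim (f ` V)"
proof -
  have sm: "f (\<Sum>b\<in>A. scale (c b) b) = (\<Sum>b\<in>A. scale (c b) (f b))" if "A \<subseteq> V" "finite A" for A c
    using that(2,1)
  proof (induction A rule: finite_induct)
    case empty
    show ?case using scl[of 0 0] subspace_0[OF V(1)] by simp
  next
    case (insert x F)
    have "(\<Sum>b\<in>F. scale (c b) b) \<in> V" using insert by (intro subspace_sum V subspace_scale) auto
    then show ?case using insert add scl subspace_scale[OF V(1)] by simp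
  qed
  define K where "K = {v \<in> V. f v = 0}"
  have K: "subspace K"
    unfolding K_def subspace_def using V(1) add scl subspace_add subspace_scale subspace_0 scl[of 0 0] by auto
  obtain A where A: "A \<subseteq> K" "independent A" "span A = K" "finite A" "card A = dim K"
    using finite_dim_basis[OF K V(2), of "{}"] V(3) K_def independent_empty by auto
  obtain B where B: "A \<subseteq> B" "B \<subseteq> V" "independent B" "span B = V" "finite B" "card B = dim V"
    using finite_dim_basis[OF V, of A] A K_def by blast
  define C where "C = B - A"
  have C: "finite C" "C \<subseteq> V" using B C_def by auto
  \<comment> \<open>A relation among the images of \<open>C\<close> puts a combination of
    \<open>C\<close> into the kernel, hence into the span of \<open>A\<close>, and independence of
    \<open>B\<close> kills it. The coefficients are indexed by \<open>C\<close> rather than by its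
    image, so that injectivity of \<open>f\<close> on \<open>C\<close> follows as well.\<close>
  have key: "\<forall>v\<in>C. c v = 0" if "(\<Sum>v\<in>C. scale (c v) (f v)) = 0" for c :: "'b \<Rightarrow> 'a"
  proof -
    have "f (\<Sum>v\<in>C. scale (c v) v) = 0" using sm[OF C(2,1)] that by simp
    moreover have "(\<Sum>v\<in>C. scale (c v) v) \<in> V" using C by (intro subspace_sum V subspace_scale) auto
    ultimately have "(\<Sum>v\<in>C. scale (c v) v) \<in> span A" using A K_def by simp
    then obtain d where d: "(\<Sum>v\<in>C. scale (c v) v) = (\<Sum>v\<in>A. scale (d v) v)"
      using A(4) by (auto simp: span_finite)
    define e where "e v = (if v \<in> A then - d v else c v)" for v
    have "(\<Sum>v\<in>B. scale (e v) v) = (\<Sum>v\<in>A. scale (e v) v) + (\<Sum>v\<in>C. scale (e v) v)"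
      unfolding C_def using B(1,5) by (metis add.commute sum.subset_diff)
    also have "(\<Sum>v\<in>A. scale (e v) v) = - (\<Sum>v\<in>A. scale (d v) v)"
      unfolding sum_negf[symmetric] by (intro sum.cong) (auto simp: e_def)
    also have "(\<Sum>v\<in>C. scale (e v) v) = (\<Sum>v\<in>C. scale (c v) v)"
      by (intro sum.cong) (auto simp: e_def C_def)
    finally have "(\<Sum>v\<in>B. scale (e v) v) = 0" using d by simp
    then have "\<forall>v\<in>B. e v = 0" using B(3,5) by (metis independentD order_refl)
    then show ?thesis using C_def by (auto simp: e_def)
  qed
  have inj: "inj_on f C"
  proof (rule inj_onI, rule ccontr)
    fix x y assume xy: "x \<in> C" "y \<in> C" "f x = f y" "x \<noteq> y"
    define c :: "'b \<Rightarrow> 'a" where "c v = (if v = x then 1 else if v = y then - 1 else 0)" for v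
    have "(\<Sum>v\<in>C. scale (c v) (f v)) = (\<Sum>v\<in>{x,y}. scale (c v) (f v))"
      using xy C by (intro sum.mono_neutral_right) (auto simp: c_def)
    also have "\<dots> = 0" using xy by (simp add: c_def)
    finally show False using key[of c] xy by (auto simp: c_def)
  qed
  have ind: "independent (f ` C)"
  proof (rule independent_if_scalars_zero)
    show "finite (f ` C)" using C by simp
    fix g w assume "(\<Sum>x\<in>f ` C. scale (g x) x) = 0" "w \<in> f ` C"
    then show "g w = 0" using key[of "\<lambda>v. g (f v)"] by (auto simp: sum.reindex[OF inj])
  qed
  have fV: "f ` V \<subseteq> span (f ` C)"
  proof
    fix w assume "w \<in> f ` V"
    then obtain v where v: "v \<in> V" "w = f v" by auto
    then obtain d where d: "v = (\<Sum>b\<in>B. scale (d b) b)"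
      using B(4,5) by (auto simp: span_finite)
    have "w = (\<Sum>b\<in>B. scale (d b) (f b))" using v d sm B by simp
    also have "\<dots> = (\<Sum>b\<in>C. scale (d b) (f b))"
      using A(1) B(5) by (intro sum.mono_neutral_right) (auto simp: C_def K_def)
    finally show "w \<in> span (f ` C)" by (auto intro: span_sum span_scale span_base)
  qed
  have "dim (f ` V) = card (f ` C)"
    using C(2) by (intro dim_unique[OF _ fV ind]) auto
  also have "\<dots> = card B - card A" using inj B A by (simp add: card_image C_def card_Diff_subset)
  finally show ?thesis using A B card_mono[OF B(5,1)] unfolding K_def by simp
qed

end

section \<open>Annihilating polynomials, Fitting's lemma and eigenvalues\<close>

context finite_exact_category
begin

definition pw :: "'m \<Rightarrow> 'o \<Rightarrow> nat \<Rightarrow> 'm" where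
  "pw f X n = ((\<lambda>g. f \<cdot> g) ^^ n) (idm E X)"

lemma pw_0 [simp]: "pw f X 0 = idm E X" and pw_Suc: "pw f X (Suc n) = f \<cdot> pw f X n"
  by (simp_all add: pw_def)

lemma pw_in: "f \<in> hom X X \<Longrightarrow> pw f X n \<in> hom X X"
  by (induction n) (auto simp: pw_Suc hom_dom)

lemma pw_add: "f \<in> hom X X \<Longrightarrow> pw f X (m + n) = pw f X m \<cdot> pw f X n"
proof (induction m)
  case 0
  then show ?case using id_comp[OF pw_in] by simp
next
  case (Suc m)
  then show ?case using assoc[OF pw_in[OF Suc.prems] pw_in[OF Suc.prems] Suc.prems, of m n] by (simp add: pw_Suc)
qed

lemma pw_1: "f \<in> hom X X \<Longrightarrow> pw f X 1 = f"
  using comp_id by (simp add: pw_Suc)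

lemma pw_Suc2: "f \<in> hom X X \<Longrightarrow> pw f X (Suc n) = pw f X n \<cdot> f"
  using pw_add[of f X n 1] pw_1 by simp

lemma pw_comm:
  assumes "f \<in> hom X X" "g \<in> hom X X" "f \<cdot> g = g \<cdot> f"
  shows "f \<cdot> pw g X n = pw g X n \<cdot> f"
proof (induction n)
  case 0
  then show ?case using assms comp_id id_comp by simp
next
  case (Suc n)
  have "f \<cdot> pw g X (Suc n) = (f \<cdot> g) \<cdot> pw g X n"
    using assoc[OF pw_in[OF assms(2)] assms(2,1)] by (simp add: pw_Suc)
  also have "\<dots> = g \<cdot> (f \<cdot> pw g X n)"
    using assoc[OF pw_in[OF assms(2)] assms(1,2)] assms(3) by simp
  also have "\<dots> = pw g X (Suc n) \<cdot> f"
    using Suc assoc[OF assms(1) pw_in[OF assms(2)] assms(2)] by (simp add: pw_Suc)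
  finally show ?case .
qed

text \<open>Horner's scheme for the value of a polynomial at an endomorphism; the endomorphisms of
  \<open>X\<close> are only a subset of the type of morphisms, with \<open>idm E X\<close> as
  unit.\<close>

definition pe :: "'m \<Rightarrow> 'o \<Rightarrow> 'k poly \<Rightarrow> 'm" where
  "pe f X p = fold_coeffs (\<lambda>a g. scl E a (idm E X) + f \<cdot> g) p 0"

lemma pe_0 [simp]: "pe f X 0 = 0"
  by (simp add: pe_def)

lemma pe_pCons: "f \<in> hom X X \<Longrightarrow> pe f X (pCons a p) = scl E a (idm E X) + f \<cdot> pe f X p"
  by (cases "p = 0 \<and> a = 0") (auto simp: pe_def)

lemma pe_in: "f \<in> hom X X \<Longrightarrow> pe f X p \<in> hom X X"
  by (induction p) (auto simp: pe_pCons hom_dom intro!: add_in scl_in)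

lemma pe_add: "f \<in> hom X X \<Longrightarrow> pe f X (p + q) = pe f X p + pe f X q"
proof (induction p q rule: poly_induct2)
  case (pCons a p b q)
  then show ?case using comp_add_right[OF pe_in[OF pCons.prems] pe_in[OF pCons.prems] pCons.prems, of p q]
    by (simp add: pe_pCons vs.scale_left_distrib)
qed simp

lemma pe_smult: "f \<in> hom X X \<Longrightarrow> pe f X (Polynomial.smult c p) = scl E c (pe f X p)"
proof (induction p)
  case (pCons a p)
  then show ?case using comp_scl_right[OF pe_in[OF pCons.prems] pCons.prems, of c p]
    by (simp add: pe_pCons vs.scale_right_distrib)
qed simp

lemma pe_linear_factor:
  assumes f: "f \<in> hom X X"
  shows "pe f X ([:- c, 1:] * p) = (f - scl E c (idm E X)) \<cdot> pe f X p"
proof -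
  have X: "X \<in> Ob E" using f hom_dom by auto
  have "pe f X ([:- c, 1:] * p) = scl E (- c) (pe f X p) + f \<cdot> pe f X p"
    unfolding mult_pCons_left pe_add[OF f] pe_smult[OF f] pe_pCons[OF f] using comp_zero_right[OF f] by (simp add: pe_pCons[OF f] comp_zero_right[OF f])
  also have "\<dots> = (f - scl E c (idm E X)) \<cdot> pe f X p"
    using comp_minus_left[OF pe_in[OF f] f scl_in[OF id_in[OF X]]] comp_scl_left[OF pe_in[OF f] id_in[OF X]]
      id_comp[OF pe_in[OF f]] by simp
  finally show ?thesis .
qed

lemma pe_comm: "f \<in> hom X X \<Longrightarrow> f \<cdot> pe f X p = pe f X p \<cdot> f"
proof (induction p)
  case (pCons a p)
  note f = pCons.prems
  have X: "X \<in> Ob E" using f hom_dom by auto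
  have "f \<cdot> pe f X (pCons a p) = scl E a f + f \<cdot> (f \<cdot> pe f X p)"
    using comp_add_right[OF scl_in[OF id_in[OF X]] comp_in[OF pe_in[OF f] f] f]
      comp_scl_right[OF id_in[OF X] f] comp_id[OF f] by (simp add: pe_pCons[OF f])
  moreover have "pe f X (pCons a p) \<cdot> f = scl E a f + f \<cdot> pe f X p \<cdot> f"
    using comp_add_left[OF f scl_in[OF id_in[OF X]] comp_in[OF pe_in[OF f] f]]
      comp_scl_left[OF f id_in[OF X]] id_comp[OF f] by (simp add: pe_pCons[OF f])
  ultimately show ?case using pCons assoc[OF f pe_in[OF f] f] by simp
qed (auto simp: hom_dom)

lemma hom_finite_span: "X \<in> Ob E \<Longrightarrow> Y \<in> Ob E \<Longrightarrow> \<exists>S. finite S \<and> hom X Y \<subseteq> vs.span S"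
  using Hom_finite[of X Y] unfolding hom_eq by (metis order_refl)

text \<open>Infinitely many powers lie in a finite-dimensional space: either two of them coincide or
  they are linearly dependent, and both cases give a polynomial.\<close>

lemma pe_annihilator:
  assumes f: "f \<in> hom X X" shows "\<exists>p. p \<noteq> 0 \<and> pe f X p = 0"
proof -
  have mono: "pe f X (monom c i) = scl E c (pw f X i)" for c i
  proof (induction i)
    case 0
    then show ?case using f by (simp add: monom_0 pe_pCons)
  next
    case (Suc i)
    then show ?case using f comp_scl_right[OF pw_in[OF f] f] by (simp add: monom_Suc pe_pCons pw_Suc)
  qed
  show ?thesis
  proof (cases "inj (pw f X)")
    case False
    then obtain i j where ij: "i \<noteq> j" "pw f X i = pw f X j" by (auto simp: inj_def)
    have "pe f X (monom 1 i + Polynomial.smult (- 1) (monom 1 j)) = 0"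
      unfolding pe_add[OF f] pe_smult[OF f] mono using ij by simp
    moreover have "monom (1::'k) i + Polynomial.smult (- 1) (monom 1 j) \<noteq> 0"
    proof
      assume "monom (1::'k) i + Polynomial.smult (- 1) (monom 1 j) = 0"
      then have "coeff (monom (1::'k) i + Polynomial.smult (- 1) (monom 1 j)) i = coeff 0 i" by simp
      then show False using ij(1) by simp
    qed
    ultimately show ?thesis by blast
  next
    case True
    obtain S where S: "finite S" "hom X X \<subseteq> vs.span S" using hom_finite_span f hom_dom by metis
    have "infinite (range (pw f X))" using True by (simp add: finite_image_iff)
    moreover have "range (pw f X) \<subseteq> vs.span S" using S pw_in[OF f] by auto
    ultimately have "vs.dependent (range (pw f X))" using vs.independent_span_bound[OF S(1)] by blast
    then obtain t u v where t: "finite t" "t \<subseteq> range (pw f X)" "(\<Sum>v\<in>t. scl E (u v) v) = 0" "v \<in> t" "u v \<noteq> 0"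
      unfolding vs.dependent_explicit by blast
    then obtain I where I: "t = pw f X ` I" by (metis subset_imageE)
    have inj: "inj_on (pw f X) I" using True inj_on_subset by blast
    then have fI: "finite I" using t I by (metis finite_image_iff)
    define p where "p = (\<Sum>i\<in>I. monom (u (pw f X i)) i)"
    have "pe f X (\<Sum>i\<in>J. monom (u (pw f X i)) i) = (\<Sum>i\<in>J. scl E (u (pw f X i)) (pw f X i))" if "finite J" for J
      using that by (induction J rule: finite_induct) (simp_all add: pe_add[OF f] mono)
    then have "pe f X p = 0" using t(3) fI unfolding I by (simp add: p_def sum.reindex[OF inj])
    moreover obtain i where i: "i \<in> I" "v = pw f X i" using t(4) I by auto
    then have "coeff p i = u v" using fI by (simp add: p_def coeff_sum)
    ultimately show ?thesis using t(5) by (metis coeff_0)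
  qed
qed

text \<open>Factors of the indeterminate are moved from the polynomial into the power of
  \<open>f\<close> until the constant coefficient \<open>a\<close> is nonzero. Dividing by it writes
  the \<open>m\<close>-th power of \<open>f\<close> as the next power times a polynomial in
  \<open>f\<close>, which commutes with \<open>f\<close>.\<close>

lemma fitting_aux:
  assumes f: "f \<in> hom X X"
  shows "p \<noteq> 0 \<Longrightarrow> pw f X m \<cdot> pe f X p = 0 \<Longrightarrow>
    \<exists>n w. w \<in> hom X X \<and> f \<cdot> w = w \<cdot> f \<and> pw f X n = pw f X (Suc n) \<cdot> w"
proof (induction p arbitrary: m)
  case (pCons a p)
  have X: "X \<in> Ob E" using f hom_dom by auto
  have 1: "pw f X m \<cdot> (f \<cdot> pe f X p) = pw f X (Suc m) \<cdot> pe f X p"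
    using assoc[OF pe_in[OF f] f pw_in[OF f]] by (simp add: pw_Suc2[OF f])
  show ?case
  proof (cases "a = 0")
    case True
    have "pw f X (Suc m) \<cdot> pe f X p = 0" using pCons.prems 1 True by (simp add: pe_pCons[OF f])
    moreover have "p \<noteq> 0" using pCons True by auto
    ultimately show ?thesis using pCons by blast
  next
    case False
    have "pw f X m \<cdot> (scl E a (idm E X) + f \<cdot> pe f X p) = scl E a (pw f X m) + pw f X (Suc m) \<cdot> pe f X p"
      using comp_add_right[OF scl_in[OF id_in[OF X]] comp_in[OF pe_in[OF f] f] pw_in[OF f]]
        comp_scl_right[OF id_in[OF X] pw_in[OF f]] comp_id[OF pw_in[OF f]] 1 by simp
    then have "scl E a (pw f X m) = - (pw f X (Suc m) \<cdot> pe f X p)"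
      using pCons.prems by (simp add: pe_pCons[OF f] eq_neg_iff_add_eq_0)
    then have "scl E (inverse a) (scl E a (pw f X m)) = scl E (inverse a) (- (pw f X (Suc m) \<cdot> pe f X p))"
      by simp
    moreover define c where "c = - inverse a"
    ultimately have "pw f X m = scl E c (pw f X (Suc m) \<cdot> pe f X p)" using False by simp
    then have "pw f X m = pw f X (Suc m) \<cdot> scl E c (pe f X p)"
      using comp_scl_right[OF pe_in[OF f] pw_in[OF f]] by simp
    moreover have "f \<cdot> scl E c (pe f X p) = scl E c (pe f X p) \<cdot> f"
      using comp_scl_right[OF pe_in[OF f] f] comp_scl_left[OF f pe_in[OF f]] pe_comm[OF f] by simp
    ultimately show ?thesis using pe_in[OF f] by blast
  qed
qed simp

lemma fitting:
  assumes f: "f \<in> hom X X"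
  obtains n w where "w \<in> hom X X" "f \<cdot> w = w \<cdot> f" "pw f X n = pw f X (Suc n) \<cdot> w"
proof -
  obtain p where p: "p \<noteq> 0" "pe f X p = 0" using pe_annihilator[OF f] by auto
  then have "pw f X 0 \<cdot> pe f X p = 0" using comp_zero_right[OF id_in] f hom_dom by auto
  then show thesis using fitting_aux[OF f p(1)] that by blast
qed

text \<open>A morphism all of whose translates by scalars are invertible would have no annihilating polynomial.\<close>

lemma eigenvalue:
  assumes f: "f \<in> hom X X" and X: "\<not> zero_object E X"
  obtains c where "\<not> iso X X (f - scl E c (idm E X))"
proof -
  have XO: "X \<in> Ob E" using f hom_dom by auto
  have id0: "idm E X \<noteq> 0" using X XO by (auto simp: zero_object_def)
  have "\<exists>c. \<not> iso X X (f - scl E c (idm E X))" if "p \<noteq> 0" "pe f X p = 0" for p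
    using that
  proof (induction "degree p" arbitrary: p rule: less_induct)
    case less
    show ?case
    proof (cases "degree p = 0")
      case True
      then obtain a where "p = [:a:]" by (rule degree_eq_zeroE)
      then show ?thesis using less.prems id0 pe_pCons[OF f, of a 0] f by simp
    next
      case False
      then obtain c where "poly p c = 0" using alg_closed_imp_poly_has_root by blast
      then obtain q where q: "p = [:- c, 1:] * q" by (metis dvdE poly_eq_0_iff_dvd)
      then have q0: "q \<noteq> 0" using less.prems by auto
      have "degree q < degree p" unfolding q using q0 by (subst degree_mult_eq) auto
      moreover have "(f - scl E c (idm E X)) \<cdot> pe f X q = 0" using less.prems q pe_linear_factor[OF f] by simp
      moreover have "pe f X q = 0" if "iso X X (f - scl E c (idm E X))" "(f - scl E c (idm E X)) \<cdot> pe f X q = 0"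
        using that assoc[OF pe_in[OF f]] id_comp[OF pe_in[OF f]] unfolding iso_def by (metis comp_zero_right)
      ultimately show ?thesis using less.hyps q0 by blast
    qed
  qed
  then show thesis using pe_annihilator[OF f] that by blast
qed

end

section \<open>Direct sums and radicals\<close>

declare One_nat_def [simp del]

context finite_exact_category
begin

lemma direct_sum_2_iff:
  "direct_sum E Y 2 A \<longleftrightarrow> Y \<in> Ob E \<and> A 1 \<in> Ob E \<and> A 2 \<in> Ob E \<and>
    (\<exists>i1 \<in> hom (A 1) Y. \<exists>i2 \<in> hom (A 2) Y. \<exists>p1 \<in> hom Y (A 1). \<exists>p2 \<in> hom Y (A 2).
      p1 \<cdot> i1 = idm E (A 1) \<and> p2 \<cdot> i2 = idm E (A 2) \<and> p1 \<cdot> i2 = 0 \<and> p2 \<cdot> i1 = 0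
      \<and> i1 \<cdot> p1 + i2 \<cdot> p2 = idm E Y)" (is "?L \<longleftrightarrow> ?R")
proof
  have two: "{1..2::nat} = {1,2}" by auto
  {
    assume ?L
    then obtain i p where ip: "Y \<in> Ob E" "\<forall>n\<in>{1,2}. A n \<in> Ob E"
      "\<forall>n\<in>{1,2}. i n \<in> Hom E (A n) Y \<and> p n \<in> Hom E Y (A n)"
      "\<forall>n\<in>{1,2}. \<forall>m\<in>{1,2}. p n \<cdot> i m = (if n = m then idm E (A n) else 0)"
      "(\<Sum>n\<in>{1,2}. i n \<cdot> p n) = idm E Y"
      unfolding direct_sum_def two by blast
    have h: "i 1 \<in> hom (A 1) Y" "i 2 \<in> hom (A 2) Y" "p 1 \<in> hom Y (A 1)" "p 2 \<in> hom Y (A 2)"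
      using ip(1-3) by (auto intro!: homI)
    show ?R
      by (intro conjI bexI[OF _ h(1)] bexI[OF _ h(2)] bexI[OF _ h(3)] bexI[OF _ h(4)])
        (use ip in auto)
  }
  assume ?R
  then obtain i1 i2 p1 p2 where ip: "Y \<in> Ob E" "A 1 \<in> Ob E" "A 2 \<in> Ob E"
      "i1 \<in> hom (A 1) Y" "i2 \<in> hom (A 2) Y" "p1 \<in> hom Y (A 1)" "p2 \<in> hom Y (A 2)"
      "p1 \<cdot> i1 = idm E (A 1)" "p2 \<cdot> i2 = idm E (A 2)" "p1 \<cdot> i2 = 0" "p2 \<cdot> i1 = 0"
      "i1 \<cdot> p1 + i2 \<cdot> p2 = idm E Y" by auto
  define i where "i n = (if n = (1::nat) then i1 else i2)" for n
  define p where "p n = (if n = (1::nat) then p1 else p2)" for n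
  show ?L unfolding direct_sum_def two
    using ip homD[OF ip(4)] homD[OF ip(5)] homD[OF ip(6)] homD[OF ip(7)]
    by (intro conjI exI[of _ i] exI[of _ p]) (auto simp: i_def p_def)
qed

text \<open>The complement comes from splitting the idempotent 1 - ip. The last clause records that
  a vanishing complement makes \<open>i\<close> and \<open>p\<close> mutually inverse.\<close>

lemma retract_direct_factor:
  assumes i: "i \<in> hom X Y" and p: "p \<in> hom Y X" and pi: "p \<cdot> i = idm E X"
  obtains A where "A 1 = X" "direct_sum E Y 2 A" "zero_object E (A 2) \<Longrightarrow> i \<cdot> p = idm E Y"
proof -
  have Ob: "X \<in> Ob E" "Y \<in> Ob E" using i hom_dom hom_cod by auto
  define e where "e = idm E Y - i \<cdot> p"
  have ip: "i \<cdot> p \<in> hom Y Y" using i p by auto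
  have e: "e \<in> hom Y Y" unfolding e_def using ip Ob by auto
  have ei: "e \<cdot> i = 0" unfolding e_def
    using comp_minus_left[OF i id_in[OF Ob(2)] ip] id_comp[OF i] assoc[OF i p i] pi comp_id[OF i] by simp
  have pe: "p \<cdot> e = 0" unfolding e_def
    using comp_minus_right[OF id_in[OF Ob(2)] ip p] comp_id[OF p] assoc[OF p i p] pi id_comp[OF p] by simp
  have ee: "e \<cdot> e = e"
    using comp_minus_right[OF id_in[OF Ob(2)] ip e] comp_id[OF e] assoc[OF p i e] ei comp_zero_left[OF p]
    by (simp add: e_def[symmetric])
  obtain Z q j where Z: "Z \<in> Ob E" "q \<in> hom Y Z" "j \<in> hom Z Y" "j \<cdot> q = e" "q \<cdot> j = idm E Z"
    using split_idempotents[of Y e] Ob e ee by (metis homI hom_eq)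
  have pj: "p \<cdot> j = 0"
  proof -
    have "p \<cdot> j = p \<cdot> (j \<cdot> (q \<cdot> j))" using Z comp_id by simp
    also have "\<dots> = (p \<cdot> e) \<cdot> j" using assoc[OF Z(3,2,3)] assoc[OF Z(3) e p] Z(4) by simp
    finally show ?thesis using pe Z by simp
  qed
  have qi: "q \<cdot> i = 0"
  proof -
    have "q \<cdot> i = (q \<cdot> j \<cdot> q) \<cdot> i" using Z id_comp by simp
    also have "\<dots> = q \<cdot> (e \<cdot> i)" using assoc[OF Z(2,3,2)] assoc[OF i e Z(2)] Z(4) by simp
    finally show ?thesis using ei Z by simp
  qed
  define A where "A n = (if n = (1::nat) then X else Z)" for n
  have s: "i \<cdot> p + j \<cdot> q = idm E Y" using Z by (simp add: e_def)
  have "direct_sum E Y 2 A" unfolding direct_sum_2_iff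
    using Ob Z i p pi pj qi s
    by (intro conjI bexI[of _ i] bexI[of _ j] bexI[of _ p] bexI[of _ q]) (simp_all add: A_def)
  moreover have "i \<cdot> p = idm E Y" if "zero_object E Z"
    using s that Z comp_zero_left[OF Z(2)] comp_id[OF Z(3)] by (auto simp: zero_object_def)
  ultimately show thesis using that[of A] by (auto simp: A_def)
qed

lemma indecomposable_Ob: "indecomposable E X \<Longrightarrow> X \<in> Ob E"
  by (simp add: indecomposable_def)

lemma indecomposable_nonzero: "indecomposable E X \<Longrightarrow> idm E X \<noteq> 0"
  by (simp add: indecomposable_def zero_object_def)

lemma retract_of_indecomposable:
  assumes Y: "indecomposable E Y" and i: "i \<in> hom X Y" and p: "p \<in> hom Y X"
    and pi: "p \<cdot> i = idm E X" and X: "idm E X \<noteq> 0"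
  shows "i \<cdot> p = idm E Y"
proof -
  obtain A where "A 1 = X" "direct_sum E Y 2 A" "zero_object E (A 2) \<Longrightarrow> i \<cdot> p = idm E Y"
    using retract_direct_factor[OF i p pi] by metis
  then show ?thesis using Y X unfolding indecomposable_def zero_object_def by metis
qed

lemma indecomposable_idempotent:
  assumes X: "indecomposable E X" and e: "e \<in> hom X X" "e \<cdot> e = e"
  shows "e = 0 \<or> e = idm E X"
proof -
  obtain Y p i where Y: "Y \<in> Ob E" "p \<in> hom X Y" "i \<in> hom Y X" "i \<cdot> p = e" "p \<cdot> i = idm E Y"
    using split_idempotents[of X e] e indecomposable_Ob[OF X] by (metis homI hom_eq)
  show ?thesis
  proof (cases "idm E Y = 0")
    case True
    then have "i = 0" using comp_id[OF Y(3)] comp_zero_right[OF Y(3)] by simp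
    then show ?thesis using Y by auto
  next
    case False
    then show ?thesis using retract_of_indecomposable[OF X Y(3,2,5)] Y by simp
  qed
qed

lemma indecomposable_split_iso:
  assumes X: "idm E X \<noteq> 0" and Y: "indecomposable E Y"
    and f: "f \<in> hom X Y" and g: "g \<in> hom Y X" and i: "iso X X (g \<cdot> f)"
  shows "iso X Y f" "iso Y X g"
proof -
  obtain u where u: "u \<in> hom X X" "u \<cdot> (g \<cdot> f) = idm E X" "(g \<cdot> f) \<cdot> u = idm E X"
    using i by (auto simp: iso_def)
  have ug: "u \<cdot> g \<in> hom Y X" "(u \<cdot> g) \<cdot> f = idm E X" using u f g assoc[OF f g u(1)] by auto
  have fu: "f \<cdot> u \<in> hom X Y" "g \<cdot> (f \<cdot> u) = idm E X" using u f g assoc[OF u(1) f g] by auto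
  show "iso X Y f" using retract_of_indecomposable[OF Y f ug X] f ug by (auto simp: iso_def)
  show "iso Y X g" using retract_of_indecomposable[OF Y fu(1) g fu(2) X] g fu by (auto simp: iso_def)
qed

text \<open>Put g for a high power of \<open>f\<close> and v for a power of \<open>w\<close>. The
  relation g = g g v makes gv an idempotent: if it is 0, then g vanishes, and if it is the identity,
  then \<open>f\<close> has inverses on both sides.\<close>

lemma unit_or_nilpotent:
  assumes X: "indecomposable E X" and f: "f \<in> hom X X"
  shows "iso X X f \<or> (\<exists>n. pw f X n = 0)"
proof -
  have XO: "X \<in> Ob E" using f hom_dom by auto
  obtain n w where w: "w \<in> hom X X" "f \<cdot> w = w \<cdot> f" "pw f X n = pw f X (Suc n) \<cdot> w"
    using fitting[OF f] .
  have step: "pw f X m = pw f X (Suc m) \<cdot> w" if "n \<le> m" for m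
    using that
  proof (induction m rule: dec_induct)
    case (step m)
    then show ?case using assoc[OF w(1) pw_in[OF f] f, of "Suc m"] by (simp add: pw_Suc)
  qed (rule w(3))
  \<comment> \<open>Iterating the Fitting relation pulls arbitrarily high powers of \<open>f\<close>
    out of the power with exponent \<open>Suc n\<close>; the case \<open>j = Suc n\<close> is the
    one used.\<close>
  have it: "pw f X (Suc n) = pw f X (Suc n + j) \<cdot> pw w X j" for j
  proof (induction j)
    case 0
    then show ?case using comp_id[OF pw_in[OF f]] by simp
  next
    case (Suc j)
    have "pw f X (Suc n + j) = pw f X (Suc n + Suc j) \<cdot> w" using step[of "Suc n + j"] by simp
    moreover have "pw f X (Suc n + Suc j) \<cdot> pw w X (Suc j) = pw f X (Suc n + Suc j) \<cdot> w \<cdot> pw w X j"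
      unfolding pw_Suc[of w] by (rule assoc[OF pw_in[OF w(1)] w(1) pw_in[OF f]])
    ultimately show ?case using Suc by metis
  qed
  define g where "g = pw f X (Suc n)"
  define v where "v = pw w X (Suc n)"
  have g: "g \<in> hom X X" "v \<in> hom X X" unfolding g_def v_def using pw_in f w by auto
  have ggv: "g = g \<cdot> g \<cdot> v" using it[of "Suc n"] pw_add[OF f, of "Suc n" "Suc n"] by (simp add: g_def v_def)
  have "f \<cdot> v = v \<cdot> f" unfolding v_def using pw_comm[OF f w(1,2)] .
  then have gv: "g \<cdot> v = v \<cdot> g" unfolding g_def using pw_comm[OF g(2) f, of "Suc n"] by simp
  have gvin: "g \<cdot> v \<in> hom X X" using g by auto
  have "(g \<cdot> v) \<cdot> (g \<cdot> v) = g \<cdot> ((v \<cdot> g) \<cdot> v)" using assoc4[OF g(2,1,2,1)] .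
  also have "\<dots> = (g \<cdot> g \<cdot> v) \<cdot> v"
    using gv assoc[OF g(2) gvin g(1)] assoc[OF g(2,1,1)] by simp
  finally have idem: "(g \<cdot> v) \<cdot> (g \<cdot> v) = g \<cdot> v" using ggv by simp
  consider "g \<cdot> v = 0" | "g \<cdot> v = idm E X" using indecomposable_idempotent[OF X gvin idem] by auto
  then show ?thesis
  proof cases
    case 1
    then have "g = 0" using ggv assoc[OF g(2,1,1)] comp_zero_right[OF g(1)] by simp
    then show ?thesis unfolding g_def by blast
  next
    case 2
    have "f \<cdot> (pw f X n \<cdot> v) = idm E X"
      using assoc[OF g(2) pw_in[OF f] f, of n] 2 by (simp add: g_def pw_Suc)
    moreover have "(v \<cdot> pw f X n) \<cdot> f = idm E X"
      using assoc[OF f pw_in[OF f] g(2), of n] 2 gv pw_Suc2[OF f, of n] by (simp add: g_def)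
    ultimately show ?thesis using iso_left_right[OF f] pw_in[OF f] g by blast
  qed
qed

lemma one_minus_nilpotent:
  assumes f: "f \<in> hom X X" and n: "pw f X n = 0"
  shows "iso X X (idm E X - f)"
proof -
  have XO: "X \<in> Ob E" using f hom_dom by auto
  define s where "s m = (\<Sum>i<m. pw f X i)" for m
  have s: "s m \<in> hom X X" for m unfolding s_def using XO pw_in[OF f] by (auto intro!: sum_in)
  have f1: "idm E X - f \<in> hom X X" using f XO by auto
  have "(idm E X - f) \<cdot> s m = idm E X - pw f X m \<and> s m \<cdot> (idm E X - f) = idm E X - pw f X m" for m
  proof (induction m)
    case 0
    then show ?case using comp_zero_left[OF f1] comp_zero_right[OF f1] by (simp add: s_def)
  next
    case (Suc m)
    have "s (Suc m) = s m + pw f X m" by (simp add: s_def)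
    moreover have "(idm E X - f) \<cdot> pw f X m = pw f X m - pw f X (Suc m)"
      using comp_minus_left[OF pw_in[OF f] id_in[OF XO] f] id_comp[OF pw_in[OF f]] by (simp add: pw_Suc)
    moreover have "pw f X m \<cdot> (idm E X - f) = pw f X m - pw f X (Suc m)"
      using comp_minus_right[OF id_in[OF XO] f pw_in[OF f]] comp_id[OF pw_in[OF f]] by (simp add: pw_Suc2[OF f])
    ultimately show ?case using Suc comp_add_right[OF s pw_in[OF f] f1] comp_add_left[OF f1 s pw_in[OF f]]
      by simp
  qed
  from this[of n] show ?thesis using n s f1 unfolding iso_def by auto
qed

lemma indecomposable_local:
  assumes X: "indecomposable E X" and f: "f \<in> hom X X" "\<not> iso X X f"
  shows "iso X X (idm E X - f)"
  using unit_or_nilpotent[OF X f(1)] f one_minus_nilpotent by blast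

lemma iso_add_cases:
  assumes X: "indecomposable E X" and f: "f \<in> hom X X" and g: "g \<in> hom X X" and i: "iso X X (f + g)"
  shows "iso X X f \<or> iso X X g"
proof (rule ccontr)
  assume n: "\<not> ?thesis"
  have XO: "X \<in> Ob E" using f hom_dom by auto
  obtain u where u: "u \<in> hom X X" "u \<cdot> (f + g) = idm E X" "(f + g) \<cdot> u = idm E X"
    using i by (auto simp: iso_def)
  have fu: "f \<cdot> u + g \<cdot> u = idm E X" using u comp_add_left[OF u(1) f g] by simp
  have iu: "iso X X u" using u f g by (auto simp: iso_def intro!: bexI[of _ "f + g"])
  have key: "iso X X h" if "h \<in> hom X X" "iso X X (h \<cdot> u)" for h
  proof -
    have "iso X X ((h \<cdot> u) \<cdot> (f + g))" using iso_comp[OF i that(2)] .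
    then show ?thesis using assoc[OF add_in[OF f g] u(1) that(1)] u comp_id[OF that(1)] by simp
  qed
  have "\<not> iso X X (f \<cdot> u)" using n key f by blast
  then have "iso X X (idm E X - f \<cdot> u)" using indecomposable_local[OF X] f u by blast
  then have "iso X X (g \<cdot> u)" using fu by (metis add_diff_cancel_left')
  then show False using n key g by blast
qed

lemma iso_sum_cases:
  assumes X: "indecomposable E X" and "finite I" "\<And>i. i \<in> I \<Longrightarrow> f i \<in> hom X X"
    and "iso X X (\<Sum>i\<in>I. f i)"
  shows "\<exists>i\<in>I. iso X X (f i)"
  using assms(2-4)
proof (induction I rule: finite_induct)
  case empty
  then obtain g where "g \<in> hom X X" "g \<cdot> 0 = idm E X" by (auto simp: iso_def)
  then have "idm E X = 0" using comp_zero_right by metis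
  then show ?case using indecomposable_nonzero[OF X] by simp
next
  case (insert x F)
  have "(\<Sum>i\<in>F. f i) \<in> hom X X" using insert indecomposable_Ob[OF X] by (intro sum_in) auto
  then show ?case using iso_add_cases[OF X, of "f x" "\<Sum>i\<in>F. f i"] insert by auto
qed

lemma scalar_plus_nonunit:
  assumes X: "indecomposable E X" and f: "f \<in> hom X X"
  obtains c where "\<not> iso X X (f - scl E c (idm E X))"
  using eigenvalue[OF f] X by (auto simp: indecomposable_def)

lemma not_iso_zero: "indecomposable E X \<Longrightarrow> \<not> iso X Y 0"
  using indecomposable_nonzero comp_zero_right unfolding iso_def by metis

lemma radical_in: "X \<in> Ob E \<Longrightarrow> Y \<in> Ob E \<Longrightarrow> f \<in> radical E X Y \<Longrightarrow> f \<in> hom X Y"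
  by (simp add: radical_def hom_eq)

text \<open>The condition on 1 - gf becomes one on gf itself, because an endomorphism of
  \<open>X\<close> or its complement is invertible. Only the source is indecomposable, so the target
  may be the middle term of a conflation.\<close>

lemma radical_iff:
  assumes X: "indecomposable E X" and Y: "Y \<in> Ob E"
  shows "f \<in> radical E X Y \<longleftrightarrow> f \<in> hom X Y \<and> (\<forall>g \<in> hom Y X. \<not> iso X X (g \<cdot> f))"
proof -
  have XO: "X \<in> Ob E" using indecomposable_Ob[OF X] .
  have "iso X X (idm E X - g \<cdot> f)" if "f \<in> hom X Y" "g \<in> hom Y X" "\<not> iso X X (g \<cdot> f)" for g
    using indecomposable_local[OF X] that by blast
  moreover have "\<exists>h \<in> hom Y X. \<not> iso X X (idm E X - h \<cdot> f)" if f: "f \<in> hom X Y" and g: "g \<in> hom Y X" "iso X X (g \<cdot> f)" for g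
  proof -
    obtain u where u: "u \<in> hom X X" "u \<cdot> (g \<cdot> f) = idm E X" using g by (auto simp: iso_def)
    then have "idm E X - (u \<cdot> g) \<cdot> f = 0" using assoc[OF f g(1) u(1)] by simp
    then show ?thesis using not_iso_zero[OF X] u g by (intro bexI[of _ "u \<cdot> g"]) auto
  qed
  ultimately show ?thesis unfolding radical_def using XO Y by (auto simp: hom_eq iso_mor_eq)
qed

lemma radical_iff_not_iso:
  assumes X: "indecomposable E X" and Y: "indecomposable E Y"
  shows "f \<in> radical E X Y \<longleftrightarrow> f \<in> hom X Y \<and> \<not> iso X Y f"
proof -
  have "\<exists>g \<in> hom Y X. iso X X (g \<cdot> f)" if "iso X Y f"
    using that indecomposable_Ob[OF X] by (metis iso_def iso_id)
  then show ?thesis unfolding radical_iff[OF X indecomposable_Ob[OF Y]]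
    using indecomposable_split_iso(1)[OF indecomposable_nonzero[OF X] Y] by blast
qed

end

section \<open>Decompositions and dimensions of morphism spaces\<close>

context finite_exact_category
begin

lemma direct_sum_2E:
  assumes "direct_sum E Y 2 A"
  obtains i1 i2 p1 p2 where "Y \<in> Ob E" "A 1 \<in> Ob E" "A 2 \<in> Ob E"
    "i1 \<in> hom (A 1) Y" "i2 \<in> hom (A 2) Y" "p1 \<in> hom Y (A 1)" "p2 \<in> hom Y (A 2)"
    "p1 \<cdot> i1 = idm E (A 1)" "p2 \<cdot> i2 = idm E (A 2)" "p1 \<cdot> i2 = 0" "p2 \<cdot> i1 = 0"
    "i1 \<cdot> p1 + i2 \<cdot> p2 = idm E Y"
  using assms unfolding direct_sum_2_iff by blast

lemma direct_sum_swap: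
  assumes "direct_sum E Y 2 A" shows "direct_sum E Y 2 (\<lambda>n. if n = 1 then A 2 else A 1)"
proof (rule direct_sum_2E[OF assms])
  fix i1 i2 p1 p2
  assume h: "Y \<in> Ob E" "A 1 \<in> Ob E" "A 2 \<in> Ob E"
    "i1 \<in> hom (A 1) Y" "i2 \<in> hom (A 2) Y" "p1 \<in> hom Y (A 1)" "p2 \<in> hom Y (A 2)"
    "p1 \<cdot> i1 = idm E (A 1)" "p2 \<cdot> i2 = idm E (A 2)" "p1 \<cdot> i2 = 0" "p2 \<cdot> i1 = 0"
    "i1 \<cdot> p1 + i2 \<cdot> p2 = idm E Y"
  then show ?thesis unfolding direct_sum_2_iff
    by (intro conjI bexI[of _ i2] bexI[of _ i1] bexI[of _ p2] bexI[of _ p1]) (simp_all add: add.commute)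
qed

definition closed_factors :: "'o set \<Rightarrow> bool" where
  "closed_factors T \<longleftrightarrow> T \<subseteq> Ob E \<and> (\<forall>X \<in> T. \<forall>Y. direct_factor E Y X \<longrightarrow> Y \<in> T)"

lemma direct_sum_factors:
  assumes "direct_sum E Y 2 A" "closed_factors T" "Y \<in> T" shows "A 1 \<in> T" "A 2 \<in> T"
  using assms direct_sum_swap[OF assms(1)] unfolding closed_factors_def direct_factor_def by fastforce+

text \<open>A decomposition as an inductive predicate with binary sums, so that additive functions
  of objects are handled by rule induction.\<close>

inductive built :: "'o set \<Rightarrow> 'o \<Rightarrow> bool" for S where
  built_zero: "zero_object E Y \<Longrightarrow> built S Y"
| built_one: "Y \<in> S \<Longrightarrow> built S Y"
| built_sum: "direct_sum E Y 2 A \<Longrightarrow> built S (A 1) \<Longrightarrow> built S (A 2) \<Longrightarrow> built S Y"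

text \<open>Sending \<open>u\<close> to i1 u p1 embeds the endomorphisms of \<open>A 1\<close> into
  those of \<open>Y\<close> and misses the identity, which would force p2 = 0. So the dimension of
  the endomorphism space is a termination measure for decomposing objects.\<close>

lemma dim_hom_less:
  assumes ds: "direct_sum E Y 2 A" and nz: "\<not> zero_object E (A 2)"
  shows "vs.dim (hom (A 1) (A 1)) < vs.dim (hom Y Y)"
proof (rule direct_sum_2E[OF ds])
  fix i1 i2 p1 p2
  assume h: "Y \<in> Ob E" "A 1 \<in> Ob E" "A 2 \<in> Ob E"
    "i1 \<in> hom (A 1) Y" "i2 \<in> hom (A 2) Y" "p1 \<in> hom Y (A 1)" "p2 \<in> hom Y (A 2)"
    "p1 \<cdot> i1 = idm E (A 1)" "p2 \<cdot> i2 = idm E (A 2)" "p1 \<cdot> i2 = 0" "p2 \<cdot> i1 = 0"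
    "i1 \<cdot> p1 + i2 \<cdot> p2 = idm E Y"
  define f where "f u = i1 \<cdot> (u \<cdot> p1)" for u
  let ?V = "hom (A 1) (A 1)"
  obtain S where S: "finite S" "?V \<subseteq> vs.span S" using hom_finite_span h by metis
  obtain S' where S': "finite S'" "hom Y Y \<subseteq> vs.span S'" using hom_finite_span h by metis
  have V: "vs.subspace ?V" "vs.subspace (hom Y Y)" using subspace_hom h by auto
  have add: "f (x + y) = f x + f y" if "x \<in> ?V" "y \<in> ?V" for x y
    using that h comp_add_left[of p1 Y "A 1" x "A 1" y] comp_add_right[of "x \<cdot> p1" Y "A 1" "y \<cdot> p1" i1 Y]
    by (auto simp: f_def)
  have scl: "f (scl E c x) = scl E c (f x)" if "x \<in> ?V" for c x
    using that h comp_scl_left[of p1 Y "A 1" x "A 1" c] comp_scl_right[of "x \<cdot> p1" Y "A 1" i1 Y c]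
    by (auto simp: f_def)
  have inv: "p1 \<cdot> f x \<cdot> i1 = x" if x: "x \<in> ?V" for x
  proof -
    have "p1 \<cdot> f x = x \<cdot> p1" unfolding f_def
      using assoc[of "x \<cdot> p1" Y "A 1" i1 Y p1 "A 1"] x h id_comp[of "x \<cdot> p1"] by auto
    then show ?thesis using assoc[of i1 "A 1" Y p1 "A 1" x "A 1"] x h comp_id[OF x] by simp
  qed
  have "{v \<in> ?V. f v = 0} = {0}"
  proof -
    have "v = 0" if "v \<in> ?V" "f v = 0" for v using inv[OF that(1)] that(2) h by simp
    moreover have "f 0 = 0" using comp_zero_left[OF h(6)] comp_zero_right[OF h(4)] by (simp add: f_def)
    ultimately show ?thesis using h by auto
  qed
  then have d: "vs.dim ?V = vs.dim (f ` ?V)" using vs.dim_kernel_image[OF V(1) S add scl] by simp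
  have sub: "vs.subspace (f ` ?V)"
  proof (rule vs.subspaceI)
    show "0 \<in> f ` ?V" using comp_zero_left[OF h(6)] comp_zero_right[OF h(4)] h by (auto simp: f_def intro!: image_eqI[of _ _ 0])
  qed (use add scl in \<open>auto 0 3 simp flip: add scl intro: imageI\<close>)
  have fY: "f ` ?V \<subseteq> hom Y Y" using h by (auto simp: f_def)
  have "idm E Y \<notin> f ` ?V"
  proof
    assume "idm E Y \<in> f ` ?V"
    then obtain x where x: "x \<in> ?V" "idm E Y = i1 \<cdot> (x \<cdot> p1)" by (auto simp: f_def)
    have "p2 = (p2 \<cdot> i1) \<cdot> (x \<cdot> p1)"
      using comp_id[OF h(7)] x(2) assoc[OF comp_in[OF h(6) x(1)] h(4,7)] by simp
    then have "p2 = 0" using comp_zero_left[OF comp_in[OF h(6) x(1)]] h(11) by simp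
    then have "idm E (A 2) = 0" using h(9) comp_zero_left[OF h(5)] by simp
    then show False using nz h by (simp add: zero_object_def)
  qed
  then have "f ` ?V \<noteq> hom Y Y" using h by auto
  then show ?thesis using vs.dim_mono_finite[OF V(2) S' sub fY] d by force
qed

lemma built_indec:
  assumes T: "closed_factors T"
  shows "Y \<in> T \<Longrightarrow> built (indec E T) Y"
proof (induction "vs.dim (hom Y Y)" arbitrary: Y rule: less_induct)
  case less
  have YO: "Y \<in> Ob E" using less T by (auto simp: closed_factors_def)
  show ?case
  proof (cases "zero_object E Y \<or> indecomposable E Y")
    case True
    then show ?thesis using less by (auto intro: built.intros simp: indec_def)
  next
    case False
    then obtain A where A: "direct_sum E Y 2 A" "\<not> zero_object E (A 1)" "\<not> zero_object E (A 2)"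
      using YO by (auto simp: indecomposable_def)
    have "vs.dim (hom (A 2) (A 2)) < vs.dim (hom Y Y)"
      using dim_hom_less[OF direct_sum_swap[OF A(1)]] A(2) by simp
    then show ?thesis using dim_hom_less[OF A(1,3)] less direct_sum_factors[OF A(1) T] A(1)
      by (intro built_sum[OF A(1)]) auto
  qed
qed

text \<open>Stated for subspaces compatible with inclusions and projections, in order to cover both
  the full morphism space and the radical.\<close>

lemma dim_sum_2:
  assumes ds: "direct_sum E Y 2 A" and X: "X \<in> Ob E"
    and p: "i1 \<in> hom (A 1) Y" "i2 \<in> hom (A 2) Y" "p1 \<in> hom Y (A 1)" "p2 \<in> hom Y (A 2)"
    "p1 \<cdot> i1 = idm E (A 1)" "p2 \<cdot> i2 = idm E (A 2)" "p1 \<cdot> i2 = 0" "p2 \<cdot> i1 = 0"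
    "i1 \<cdot> p1 + i2 \<cdot> p2 = idm E Y"
    and V: "vs.subspace V" "V \<subseteq> hom X Y" and V1: "V1 \<subseteq> hom X (A 1)" and V2: "V2 \<subseteq> hom X (A 2)"
    and c: "\<And>v. v \<in> V \<Longrightarrow> p1 \<cdot> v \<in> V1" "\<And>v. v \<in> V \<Longrightarrow> p2 \<cdot> v \<in> V2"
      "\<And>v. v \<in> V1 \<Longrightarrow> i1 \<cdot> v \<in> V" "\<And>v. v \<in> V2 \<Longrightarrow> i2 \<cdot> v \<in> V"
  shows "vs.dim V = vs.dim V1 + vs.dim V2"
proof -
  have Y: "Y \<in> Ob E" using p(1) hom_cod by auto
  obtain S where S: "finite S" "V \<subseteq> vs.span S" using hom_finite_span[OF X Y] V(2) by (meson subset_trans)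
  define K where "K = {v \<in> V. p1 \<cdot> v = 0}"
  have l1: "p1 \<cdot> (x + y) = p1 \<cdot> x + p1 \<cdot> y" "p1 \<cdot> scl E k x = scl E k (p1 \<cdot> x)"
    and l2: "p2 \<cdot> (x + y) = p2 \<cdot> x + p2 \<cdot> y" "p2 \<cdot> scl E k x = scl E k (p2 \<cdot> x)"
    if "x \<in> V" "y \<in> V" for x y k
    using comp_add_right[of x X Y y] comp_scl_right[of x X Y] p(3,4) V(2) that by blast+
  have subK: "vs.subspace K" unfolding vs.subspace_def K_def
    using V(1) l1 comp_zero_right[OF p(3)] by (auto simp: vs.subspace_def)
  have im1: "(\<lambda>v. p1 \<cdot> v) ` V = V1"
  proof
    show "V1 \<subseteq> (\<lambda>v. p1 \<cdot> v) ` V"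
    proof
      fix w assume w: "w \<in> V1"
      then have "p1 \<cdot> (i1 \<cdot> w) = w" using assoc[of w X "A 1" i1 Y p1 "A 1"] V1 p id_comp[of w] by auto
      then show "w \<in> (\<lambda>v. p1 \<cdot> v) ` V" using c(3)[OF w] by (metis imageI)
    qed
  qed (use c in auto)
  have im2: "(\<lambda>v. p2 \<cdot> v) ` K = V2"
  proof
    show "V2 \<subseteq> (\<lambda>v. p2 \<cdot> v) ` K"
    proof
      fix w assume w: "w \<in> V2"
      then have "p2 \<cdot> (i2 \<cdot> w) = w" using assoc[of w X "A 2" i2 Y p2 "A 2"] V2 p id_comp[of w] by auto
      moreover have "p1 \<cdot> (i2 \<cdot> w) = 0"
        using assoc[of w X "A 2" i2 Y p1 "A 1"] V2 w p comp_zero_left[of w] by auto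
      ultimately show "w \<in> (\<lambda>v. p2 \<cdot> v) ` K" using c(4)[OF w] unfolding K_def
        by (metis (mono_tags, lifting) imageI mem_Collect_eq)
    qed
  qed (use c K_def in auto)
  have "v = 0" if "v \<in> K" "p2 \<cdot> v = 0" for v
  proof -
    have v: "v \<in> hom X Y" "p1 \<cdot> v = 0" using that V K_def by auto
    have "v = (i1 \<cdot> p1) \<cdot> v + (i2 \<cdot> p2) \<cdot> v"
      using id_comp[OF v(1)] comp_add_left[OF v(1), of "i1 \<cdot> p1" Y "i2 \<cdot> p2"] p by auto
    then show "v = 0" using assoc[OF v(1) p(3,1)] assoc[OF v(1) p(4,2)] v that(2)
      comp_zero_right[OF p(1)] comp_zero_right[OF p(2)] by simp
  qed
  then have ker2: "{v \<in> K. p2 \<cdot> v = 0} = {0}"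
    using vs.subspace_0[OF subK] comp_zero_right[OF p(4)] by auto
  have "vs.dim V = vs.dim K + vs.dim V1"
    unfolding K_def im1[symmetric]
    by (rule vs.dim_kernel_image[OF V(1) S]) (use l1 in auto)
  moreover have "vs.dim K = vs.dim {v \<in> K. p2 \<cdot> v = 0} + vs.dim V2"
    unfolding im2[symmetric]
    by (rule vs.dim_kernel_image[OF subK S(1)])
      (use S l2 K_def in auto)
  ultimately show ?thesis unfolding ker2 by simp
qed

lemma dim_hom_sum:
  assumes ds: "direct_sum E Y 2 A" and X: "X \<in> Ob E"
  shows "vs.dim (hom X Y) = vs.dim (hom X (A 1)) + vs.dim (hom X (A 2))"
proof (rule direct_sum_2E[OF ds])
  fix i1 i2 p1 p2
  assume h: "Y \<in> Ob E" "A 1 \<in> Ob E" "A 2 \<in> Ob E"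
    and p: "i1 \<in> hom (A 1) Y" "i2 \<in> hom (A 2) Y" "p1 \<in> hom Y (A 1)" "p2 \<in> hom Y (A 2)"
    "p1 \<cdot> i1 = idm E (A 1)" "p2 \<cdot> i2 = idm E (A 2)" "p1 \<cdot> i2 = 0" "p2 \<cdot> i1 = 0"
    "i1 \<cdot> p1 + i2 \<cdot> p2 = idm E Y"
  show ?thesis by (rule dim_sum_2[OF ds X p]) (use h X subspace_hom p in auto)
qed

lemma radical_subspace:
  assumes X: "indecomposable E X" and Y: "Y \<in> Ob E"
  shows "vs.subspace (radical E X Y)"
proof (rule vs.subspaceI)
  have XO: "X \<in> Ob E" using indecomposable_Ob[OF X] .
  show "0 \<in> radical E X Y" unfolding radical_iff[OF X Y] using XO Y not_iso_zero[OF X] by auto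
  fix f f' assume f: "f \<in> radical E X Y" "f' \<in> radical E X Y"
  have "\<not> iso X X (g \<cdot> (f + f'))" if g: "g \<in> hom Y X" for g
    using f g comp_add_right[of f X Y f' g X] iso_add_cases[OF X, of "g \<cdot> f" "g \<cdot> f'"]
    unfolding radical_iff[OF X Y] by auto
  then show "f + f' \<in> radical E X Y" using f unfolding radical_iff[OF X Y] by auto
next
  fix c f assume f: "f \<in> radical E X Y"
  have "\<not> iso X X (g \<cdot> scl E c f)" if g: "g \<in> hom Y X" for g
    using f g scl_in[OF g, of c] comp_scl_right[of f X Y g X c] comp_scl_left[of f X Y g X c]
    unfolding radical_iff[OF X Y] by force
  then show "scl E c f \<in> radical E X Y" using f unfolding radical_iff[OF X Y] by auto
qed

lemma radical_comp_left:
  assumes X: "indecomposable E X" and f: "f \<in> radical E X Y" and Y: "Y \<in> Ob E" and u: "u \<in> hom Y Z"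
  shows "u \<cdot> f \<in> radical E X Z"
proof -
  have Z: "Z \<in> Ob E" using u hom_cod by auto
  have f': "f \<in> hom X Y" using f radical_iff[OF X Y] by auto
  have "\<not> iso X X (g \<cdot> (u \<cdot> f))" if "g \<in> hom Z X" for g
    using f u that assoc[OF f' u that] unfolding radical_iff[OF X Y] by auto
  then show ?thesis unfolding radical_iff[OF X Z] using f' u by auto
qed

text \<open>If g f h were invertible, \<open>h\<close> would split into an indecomposable and hence
  be invertible, and so would h g f, against the choice of \<open>f\<close>.\<close>

lemma radical_comp_right:
  assumes X: "indecomposable E X" and W: "indecomposable E W" and f: "f \<in> radical E X Y" and Y: "Y \<in> Ob E"
    and h: "h \<in> hom W X"
  shows "f \<cdot> h \<in> radical E W Y"
proof -
  have f': "f \<in> hom X Y" using f radical_iff[OF X Y] by auto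
  have "\<not> iso W W (g \<cdot> (f \<cdot> h))" if g: "g \<in> hom Y W" for g
  proof
    assume "iso W W (g \<cdot> (f \<cdot> h))"
    then have "iso W W ((g \<cdot> f) \<cdot> h)" using assoc[OF h f' g] by simp
    then have "iso W X h" "iso X W (g \<cdot> f)"
      using indecomposable_split_iso[OF indecomposable_nonzero[OF W] X h] f' g by auto
    then have "iso X X (h \<cdot> (g \<cdot> f))" using iso_comp by auto
    then have "iso X X ((h \<cdot> g) \<cdot> f)" using assoc[OF f' g h] by simp
    then show False using f g h unfolding radical_iff[OF X Y] by auto
  qed
  then show ?thesis unfolding radical_iff[OF W Y] using f' h by auto
qed

lemma dim_radical_sum:
  assumes ds: "direct_sum E Y 2 A" and X: "indecomposable E X"
  shows "vs.dim (radical E X Y) = vs.dim (radical E X (A 1)) + vs.dim (radical E X (A 2))"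
proof (rule direct_sum_2E[OF ds])
  fix i1 i2 p1 p2
  assume h: "Y \<in> Ob E" "A 1 \<in> Ob E" "A 2 \<in> Ob E"
    and p: "i1 \<in> hom (A 1) Y" "i2 \<in> hom (A 2) Y" "p1 \<in> hom Y (A 1)" "p2 \<in> hom Y (A 2)"
    "p1 \<cdot> i1 = idm E (A 1)" "p2 \<cdot> i2 = idm E (A 2)" "p1 \<cdot> i2 = 0" "p2 \<cdot> i1 = 0"
    "i1 \<cdot> p1 + i2 \<cdot> p2 = idm E Y"
  note XO = indecomposable_Ob[OF X]
  show ?thesis
    by (rule dim_sum_2[OF ds XO p radical_subspace[OF X h(1)]])
      (use radical_in[OF XO] h p radical_comp_left[OF X] in auto)
qed

text \<open>Over an algebraically closed field the endomorphism ring modulo its radical is the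
  field: subtracting an eigenvalue of \<theta>' f leaves a radical morphism, so one generator
  \<theta> beyond the radical spans everything.\<close>

lemma dim_radical_indec:
  assumes X: "indecomposable E X" and Y: "indecomposable E Y"
  shows "vs.dim (hom X Y) = vs.dim (radical E X Y) + (if isomorphic E X Y then 1 else 0)"
proof (cases "isomorphic E X Y")
  case False
  then have "radical E X Y = hom X Y" using radical_iff_not_iso[OF X Y] isomorphic_eq by blast
  then show ?thesis using False by simp
next
  case True
  then obtain \<theta> where \<theta>: "iso X Y \<theta>" using isomorphic_eq by auto
  obtain \<theta>' where \<theta>': "iso Y X \<theta>'" "\<theta>' \<cdot> \<theta> = idm E X" "\<theta> \<cdot> \<theta>' = idm E Y" using iso_inv[OF \<theta>] by auto
  note in1 = iso_in[OF \<theta>] iso_in[OF \<theta>'(1)]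
  note XO = indecomposable_Ob[OF X] and YO = indecomposable_Ob[OF Y]
  have rad: "vs.subspace (radical E X Y)" "radical E X Y \<subseteq> hom X Y"
    using radical_subspace[OF X YO] radical_in[OF XO YO] by auto
  obtain S where S: "finite S" "hom X Y \<subseteq> vs.span S" using hom_finite_span[OF XO YO] by auto
  have ne: "radical E X Y \<noteq> hom X Y" using \<theta> in1 radical_iff_not_iso[OF X Y] by auto
  have lt: "vs.dim (radical E X Y) < vs.dim (hom X Y)"
    using vs.dim_mono_finite[OF subspace_hom[OF XO YO] S rad] ne by force
  obtain B where B: "vs.span B = radical E X Y" "finite B" "card B = vs.dim (radical E X Y)"
    using vs.finite_dim_basis[OF rad(1) S(1) order_trans[OF rad(2) S(2)] empty_subsetI vs.independent_empty] .
  have "hom X Y \<subseteq> vs.span (insert \<theta> B)"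
  proof
    fix f assume f: "f \<in> hom X Y"
    obtain c where c: "\<not> iso X X (\<theta>' \<cdot> f - scl E c (idm E X))"
      using scalar_plus_nonunit[OF X, of "\<theta>' \<cdot> f"] f in1 by auto
    define r where "r = f - scl E c \<theta>"
    have r: "r \<in> hom X Y" unfolding r_def using f in1 by auto
    have "\<theta>' \<cdot> r = \<theta>' \<cdot> f - scl E c (idm E X)"
      using comp_minus_right[OF f scl_in[OF in1(1)] in1(2)] comp_scl_right[OF in1] \<theta>' by (simp add: r_def)
    then have "\<not> iso X Y r" using c iso_comp[OF _ \<theta>'(1), of X r] by auto
    then have "r \<in> vs.span B" using B radical_iff_not_iso[OF X Y] r by auto
    moreover have "f = r + scl E c \<theta>" by (simp add: r_def)
    ultimately show "f \<in> vs.span (insert \<theta> B)"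
      using vs.span_mono[OF subset_insertI[of B \<theta>]] vs.span_add[OF _ vs.span_scale[OF vs.span_base]] by blast
  qed
  then have "vs.dim (hom X Y) \<le> card (insert \<theta> B)" using vs.dim_le_card B(2) by auto
  also have "\<dots> \<le> Suc (card B)" using B(2) by (simp add: card_insert_if)
  finally show ?thesis using lt B(3) True by auto
qed

end

context finite_exact_category
begin

lemma dim_hom_zero: "zero_object E Y \<Longrightarrow> X \<in> Ob E \<Longrightarrow> vs.dim (hom X Y) = 0"
proof -
  assume Y: "zero_object E Y" and X: "X \<in> Ob E"
  have "f = 0" if "f \<in> hom X Y" for f using id_comp[OF that] comp_zero_left[OF that] Y by (auto simp: zero_object_def)
  then have "hom X Y = {0}" using X Y by (auto simp: zero_object_def)
  then show ?thesis by simp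
qed

lemma dim_hom_iso:
  assumes i: "isomorphic E Y Z" and X: "X \<in> Ob E" shows "vs.dim (hom X Y) = vs.dim (hom X Z)"
proof -
  obtain f g where f: "iso Y Z f" "iso Z Y g" "g \<cdot> f = idm E Y" "f \<cdot> g = idm E Z"
    using i iso_inv unfolding isomorphic_eq by blast
  note h = iso_in[OF f(1)] iso_in[OF f(2)]
  obtain S where S: "finite S" "hom X Y \<subseteq> vs.span S" using hom_finite_span[OF X hom_dom[OF h(1)]] by auto
  have gf: "g \<cdot> (f \<cdot> v) = v" if "v \<in> hom X Y" for v using assoc[OF that h] f id_comp[OF that] by simp
  have fg: "f \<cdot> (g \<cdot> v) = v" if "v \<in> hom X Z" for v using assoc[OF that h(2,1)] f id_comp[OF that] by simp
  have "{v \<in> hom X Y. f \<cdot> v = 0} = {0}"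
  proof -
    have "v = 0" if "v \<in> hom X Y" "f \<cdot> v = 0" for v using gf[OF that(1)] that(2) comp_zero_right[OF h(2)] by simp
    then show ?thesis using X hom_dom[OF h(1)] comp_zero_right[OF h(1)] by auto
  qed
  moreover have "(\<lambda>v. f \<cdot> v) ` hom X Y = hom X Z"
  proof
    show "hom X Z \<subseteq> (\<lambda>v. f \<cdot> v) ` hom X Y" using fg h by (metis comp_in image_eqI subsetI)
  qed (use h in auto)
  moreover have "vs.dim (hom X Y) = vs.dim {v \<in> hom X Y. f \<cdot> v = 0} + vs.dim ((\<lambda>v. f \<cdot> v) ` hom X Y)"
    by (rule vs.dim_kernel_image[OF subspace_hom[OF X hom_dom[OF h(1)]] S])
      (use comp_add_right[OF _ _ h(1)] comp_scl_right[OF _ h(1)] in auto)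
  ultimately show ?thesis by simp
qed

text \<open>The same multiplicities describe the covariant and the contravariant dimensions, hence the joint statement.\<close>

definition multiplicities :: "nat set \<Rightarrow> (nat \<Rightarrow> 'o) \<Rightarrow> (nat \<Rightarrow> nat) \<Rightarrow> 'o \<Rightarrow> bool" where
  "multiplicities J T \<mu> Y \<longleftrightarrow> Y \<in> Ob E
     \<and> (\<forall>X \<in> Ob E. vs.dim (hom X Y) = (\<Sum>i\<in>J. \<mu> i * vs.dim (hom X (T i))))
     \<and> (\<forall>X \<in> Ob E. vs.dim (hom Y X) = (\<Sum>i\<in>J. \<mu> i * vs.dim (hom (T i) X)))
     \<and> (\<forall>i\<in>J. vs.dim (hom (T i) Y) = vs.dim (radical E (T i) Y) + \<mu> i)"

lemma inv_square:
  assumes a: "iso X' X a" "a' \<in> hom X X'" "a' \<cdot> a = idm E X'" "a \<cdot> a' = idm E X"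
    and b: "iso M' M b" "b' \<in> hom M M'" "b' \<cdot> b = idm E M'" "b \<cdot> b' = idm E M"
    and f: "f \<in> hom X M" "f' \<in> hom X' M'" and c: "b \<cdot> f' = f \<cdot> a"
  shows "b' \<cdot> f = f' \<cdot> a'"
proof -
  note ai = iso_in[OF a(1)] and bi = iso_in[OF b(1)]
  have "b' \<cdot> f = b' \<cdot> (f \<cdot> a \<cdot> a')" using assoc[OF a(2) ai f(1)] a(4) comp_id[OF f(1)] by simp
  also have "\<dots> = b' \<cdot> (b \<cdot> (f' \<cdot> a'))" using c assoc[OF a(2) f(2) bi] by simp
  also have "\<dots> = f' \<cdot> a'" using assoc[OF comp_in[OF a(2) f(2)] bi b(2)] b(3) id_comp[OF comp_in[OF a(2) f(2)]] by simp
  finally show ?thesis .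
qed

text \<open>Closure of conflations under isomorphisms pointing the other way, which is what the
  axiom turns into when arrows are reversed.\<close>

lemma Conf_iso_back:
  assumes "Conf E X f M g Y" and a: "iso X' X a" and b: "iso M' M b" and c: "iso Y' Y c"
    and f': "f' \<in> hom X' M'" and g': "g' \<in> hom M' Y'" and 1: "b \<cdot> f' = f \<cdot> a" and 2: "c \<cdot> g' = g \<cdot> b"
  shows "Conf E X' f' M' g' Y'"
proof -
  obtain a' where a': "iso X X' a'" "a' \<cdot> a = idm E X'" "a \<cdot> a' = idm E X" using iso_inv[OF a] by auto
  obtain b' where b': "iso M M' b'" "b' \<cdot> b = idm E M'" "b \<cdot> b' = idm E M" using iso_inv[OF b] by auto
  obtain c' where c': "iso Y Y' c'" "c' \<cdot> c = idm E Y'" "c \<cdot> c' = idm E Y" using iso_inv[OF c] by auto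
  have O: "X \<in> Ob E" "M \<in> Ob E" "Y \<in> Ob E" using Conf_Ob[OF assms(1)] by auto
  have O': "X' \<in> Ob E" "M' \<in> Ob E" "Y' \<in> Ob E" using a b c hom_dom iso_in by blast+
  have fg: "f \<in> hom X M" "g \<in> hom M Y"
    using Conf_kernel[OF assms(1)] O by (auto simp: is_kernel_def hom_eq)
  have sq: "b' \<cdot> f = f' \<cdot> a'" "c' \<cdot> g = g' \<cdot> b'"
    using inv_square[OF a iso_in[OF a'(1)] a'(2,3) b iso_in[OF b'(1)] b'(2,3) fg(1) f' 1]
      inv_square[OF b iso_in[OF b'(1)] b'(2,3) c iso_in[OF c'(1)] c'(2,3) fg(2) g' 2] by auto
  have m: "iso_mor E X X' a'" "iso_mor E M M' b'" "iso_mor E Y Y' c'"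
    unfolding iso_mor_eq[OF O(1) O'(1)] iso_mor_eq[OF O(2) O'(2)] iso_mor_eq[OF O(3) O'(3)]
    using a'(1) b'(1) c'(1) by blast+
  have h: "f' \<in> Hom E X' M'" "g' \<in> Hom E M' Y'" using f' g' homD by blast+
  show ?thesis by (rule Conf_iso[OF assms(1) O' h m sq])
qed

end

section \<open>Passage to the opposite category\<close>

lemma linear_category_opp: "linear_category E \<Longrightarrow> linear_category (opp E)"
  unfolding linear_category_def by auto

lemma direct_sum_opp: "direct_sum (opp E) X m A \<longleftrightarrow> direct_sum E X m A"
proof -
  have key: "direct_sum (opp E) X m A" if "direct_sum E X m A"
    for E :: "('a, 'b::comm_monoid_add, 'c) exact_cat" and X m A
  proof -
    have ex: "\<exists>i p. (\<forall>n\<in>{1..m}. i n \<in> Hom E (A n) X \<and> p n \<in> Hom E X (A n))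
        \<and> (\<forall>n\<in>{1..m}. \<forall>k\<in>{1..m}. cmp E (p n) (i k) = (if n = k then idm E (A n) else 0))
        \<and> (\<Sum>n = 1..m. cmp E (i n) (p n)) = idm E X"
      and O: "X \<in> Ob E" "\<forall>n\<in>{1..m}. A n \<in> Ob E"
      using that by (simp_all add: direct_sum_def)
    obtain i p where ip: "\<forall>n\<in>{1..m}. i n \<in> Hom E (A n) X \<and> p n \<in> Hom E X (A n)"
      "\<forall>n\<in>{1..m}. \<forall>k\<in>{1..m}. cmp E (p n) (i k) = (if n = k then idm E (A n) else 0)"
      "(\<Sum>n = 1..m. cmp E (i n) (p n)) = idm E X" using ex by (elim exE conjE)
    have sw: "\<forall>n\<in>{1..m}. \<forall>k\<in>{1..m}. cmp E (p k) (i n) = (if n = k then idm E (A n) else 0)"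
      using ip(2) by simp
    have sw2: "\<forall>n\<in>{1..m}. p n \<in> Hom E X (A n) \<and> i n \<in> Hom E (A n) X" using ip(1) by blast
    show ?thesis unfolding direct_sum_def opp_simps
      by (intro conjI exI[of _ p] exI[of _ i]) (fact O ip sw sw2)+
  qed
  from key[of E X m A] key[of "opp E" X m A] show ?thesis by auto
qed

lemma iso_mor_opp: "iso_mor (opp E) X Y f \<longleftrightarrow> iso_mor E Y X f"
  unfolding iso_mor_def opp_simps by (auto intro: bexI)

lemma isomorphic_opp: "isomorphic (opp E) X Y \<longleftrightarrow> isomorphic E Y X"
  unfolding isomorphic_def iso_mor_opp by auto

lemma zero_object_opp: "zero_object (opp E) X \<longleftrightarrow> zero_object E X"
  by (simp add: zero_object_def)

lemma indecomposable_opp: "indecomposable (opp E) X \<longleftrightarrow> indecomposable E X"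
  unfolding indecomposable_def direct_sum_opp zero_object_opp by simp

lemma direct_factor_opp: "direct_factor (opp E) X Y \<longleftrightarrow> direct_factor E X Y"
  unfolding direct_factor_def direct_sum_opp by simp

lemma indec_opp: "indec (opp E) T = indec E T"
  unfolding indec_def indecomposable_opp by simp

lemma inflation_opp: "inflation (opp E) X M f \<longleftrightarrow> deflation E M X f"
  unfolding inflation_def deflation_def opp_simps by blast

lemma deflation_opp: "deflation (opp E) X M f \<longleftrightarrow> inflation E M X f"
  unfolding inflation_def deflation_def opp_simps by blast

lemma is_kernel_opp: "is_kernel (opp E) X f M g Y \<longleftrightarrow> is_cokernel E Y g M f X"
  unfolding is_kernel_def is_cokernel_def by auto

lemma is_cokernel_opp: "is_cokernel (opp E) X f M g Y \<longleftrightarrow> is_kernel E Y g M f X"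
  unfolding is_kernel_def is_cokernel_def by auto

text \<open>The axioms mention the deflation in a fixed position of the square, and reversing the
  arrows moves it across the diagonal.\<close>

lemma pullback_transpose:
  "pullback_square E X M X' M' f a f' b \<longleftrightarrow> pullback_square E X X' M M' a f b f'"
proof -
  have key: "pullback_square E X X' M M' a f b f'" if h: "pullback_square E X M X' M' f a f' b" for X M X' M' f a f' b
    unfolding pullback_square_def
  proof (intro conjI ballI impI)
    fix W u v assume w: "W \<in> Ob E" "u \<in> Hom E W M" "v \<in> Hom E W X'" "cmp E b u = cmp E f' v"
    have "\<exists>!w. w \<in> Hom E W X \<and> cmp E a w = v \<and> cmp E f w = u"
      using h w(1-3) w(4)[symmetric] unfolding pullback_square_def by blast
    then show "\<exists>!w. w \<in> Hom E W X \<and> cmp E f w = u \<and> cmp E a w = v" by blast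
  qed (use h in \<open>auto simp: pullback_square_def\<close>)
  from key[of X M X' M' f a f' b] key[of X X' M M' a f b f'] show ?thesis by blast
qed

lemma pushout_transpose:
  "pushout_square E X M X' M' f a f' b \<longleftrightarrow> pushout_square E X X' M M' a f b f'"
proof -
  have key: "pushout_square E X X' M M' a f b f'" if h: "pushout_square E X M X' M' f a f' b" for X M X' M' f a f' b
    unfolding pushout_square_def
  proof (intro conjI ballI impI)
    fix W u v assume w: "W \<in> Ob E" "u \<in> Hom E M W" "v \<in> Hom E X' W" "cmp E u f = cmp E v a"
    have "\<exists>!w. w \<in> Hom E M' W \<and> cmp E w f' = v \<and> cmp E w b = u"
      using h w(1-3) w(4)[symmetric] unfolding pushout_square_def by blast
    then show "\<exists>!w. w \<in> Hom E M' W \<and> cmp E w b = u \<and> cmp E w f' = v" by blast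
  qed (use h in \<open>auto simp: pushout_square_def\<close>)
  from key[of X M X' M' f a f' b] key[of X X' M M' a f b f'] show ?thesis by blast
qed

lemma pushout_opp: "pushout_square (opp E) X M X' M' f a f' b \<longleftrightarrow> pullback_square E M' M X' X b f' a f"
  unfolding pushout_square_def pullback_square_def opp_simps by (auto simp: eq_commute conj_commute)

lemma pullback_opp: "pullback_square (opp E) X M X' M' f a f' b \<longleftrightarrow> pushout_square E M' M X' X b f' a f"
  unfolding pushout_square_def pullback_square_def opp_simps by (auto simp: eq_commute conj_commute)

lemma finite_exact_category_opp:
  assumes "finite_exact_category E" shows "finite_exact_category (opp E)"
proof -
  interpret finite_exact_category E by fact
  have lin: "linear_category (opp E)"
    by (rule linear_category_opp) (rule linear_category_axioms)
  have add: "additive_category (opp E)"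
    by (rule additive_category.intro[OF lin], unfold_locales)
      (use direct_sum_exists in \<open>auto simp: direct_sum_opp\<close>)
  have "exact_category (opp E)"
  proof (rule exact_category.intro[OF add], rule exact_category_axioms.intro, goal_cases)
    case (1 X f M g Y)
    then show ?case using Conf_Ob by auto
  next
    case (2 X f M g Y)
    then show ?case using Conf_cokernel by (auto simp: is_kernel_opp)
  next
    case (3 X f M g Y)
    then show ?case using Conf_kernel by (auto simp: is_cokernel_opp)
  next
    case (4 X f M g Y X' M' Y' f' g' a b c)
    then have C: "Conf E Y g M f X" by simp
    have O: "X \<in> Ob E" "M \<in> Ob E" "Y \<in> Ob E" using Conf_Ob[OF C] by auto
    show ?case unfolding opp_simps
      by (rule Conf_iso_back[OF C, of Y' c M' b X' a]) (use 4 O in \<open>auto simp: iso_mor_opp iso_mor_eq hom_eq\<close>)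
  next
    case (5 X)
    then show ?case using deflation_idm by (simp add: inflation_opp)
  next
    case (6 X)
    then show ?case using inflation_idm by (simp add: deflation_opp)
  next
    case (7 X Y f Z g)
    then show ?case using deflation_cmp by (simp add: inflation_opp)
  next
    case (8 X Y f Z g)
    then show ?case using inflation_cmp by (simp add: deflation_opp)
  next
    case (9 X M f X' a)
    then show ?case using deflation_pullback[of M X f X' a]
      unfolding inflation_opp pushout_opp opp_simps pullback_transpose[of E _ X' M] by blast
  next
    case (10 X' M' f' M b)
    then show ?case using inflation_pushout[of M' X' f' M b]
      unfolding deflation_opp pullback_opp opp_simps pushout_transpose[of E M' X' M] by blast
  qed
  then show ?thesis
  proof (rule finite_exact_category.intro, unfold_locales, goal_cases)
    case (1 X Y)
    then show ?case using Hom_finite by simp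
  next
    case (2 X e)
    then obtain Y p i where Y: "Y \<in> Ob E" "p \<in> Hom E X Y" "i \<in> Hom E Y X" "cmp E i p = e" "cmp E p i = idm E Y"
      using split_idempotents[of X e] by auto
    then show ?case unfolding opp_simps by (intro bexI[of _ Y] bexI[of _ i] bexI[of _ p] conjI)
  qed
qed

context finite_exact_category
begin

interpretation op: finite_exact_category "opp E"
  by (rule finite_exact_category_opp) (rule finite_exact_category_axioms)

lemma op_hom: "op.hom X Y = hom Y X"
  by (auto simp: op.hom_def hom_def)

lemma op_iso: "op.iso X Y f \<longleftrightarrow> iso Y X f"
  unfolding op.iso_def iso_def op_hom opp_simps by auto

lemma op_radical: assumes "X \<in> Ob E" "Y \<in> Ob E" shows "radical (opp E) X Y = radical E Y X"
proof -
  have "iso X X (idm E X - f \<cdot> g) \<longleftrightarrow> iso Y Y (idm E Y - g \<cdot> f)" if "f \<in> hom Y X" "g \<in> hom X Y" for f g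
    using iso_one_minus that by blast
  then show ?thesis using assms unfolding radical_def
    by (auto simp: hom_eq iso_mor_opp iso_mor_eq)
qed

lemma op_radical_sq: assumes "T \<subseteq> Ob E" "X \<in> Ob E" "Y \<in> Ob E" shows "radical_sq (opp E) T X Y = radical_sq E T Y X"
proof -
  have "{cmp (opp E) g f |Z f g. Z \<in> T \<and> f \<in> radical (opp E) X Z \<and> g \<in> radical (opp E) Z Y}
      = {g \<cdot> f |Z f g. Z \<in> T \<and> f \<in> radical E Y Z \<and> g \<in> radical E Z X}"
    using op_radical assms by auto blast+
  then show ?thesis unfolding radical_sq_def by simp
qed

lemma op_arrows: "T \<subseteq> Ob E \<Longrightarrow> X \<in> Ob E \<Longrightarrow> Y \<in> Ob E \<Longrightarrow> arrows (opp E) T X Y = arrows E T Y X"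
  unfolding arrows_def by (simp add: op_radical op_radical_sq)

lemma dim_hom_sum':
  "direct_sum E Y 2 A \<Longrightarrow> X \<in> Ob E \<Longrightarrow> vs.dim (hom Y X) = vs.dim (hom (A 1) X) + vs.dim (hom (A 2) X)"
  using op.dim_hom_sum[of Y A X] by (simp add: direct_sum_opp op_hom)

lemma dim_hom_iso': "isomorphic E Y Z \<Longrightarrow> X \<in> Ob E \<Longrightarrow> vs.dim (hom Y X) = vs.dim (hom Z X)"
  using op.dim_hom_iso[of Y Z X] isomorphic_sym by (simp add: isomorphic_opp op_hom)

lemma dim_hom_zero': "zero_object E Y \<Longrightarrow> X \<in> Ob E \<Longrightarrow> vs.dim (hom Y X) = 0"
  using op.dim_hom_zero[of Y X] by (simp add: zero_object_opp op_hom)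

text \<open>All four clauses are additive along a decomposition. The one about the radical pins
  \<open>\<mu> i\<close> down as the dimension of Hom modulo radical, which is later compared with a
  number of arrows.\<close>

lemma multiplicities_exist:
  assumes "built S Y" "finite J" "\<And>i. i \<in> J \<Longrightarrow> indecomposable E (T i)"
    and S: "\<And>Z. Z \<in> S \<Longrightarrow> indecomposable E Z \<and> (\<exists>i\<in>J. isomorphic E Z (T i))"
    and ni: "\<And>i j. i \<in> J \<Longrightarrow> j \<in> J \<Longrightarrow> i \<noteq> j \<Longrightarrow> \<not> isomorphic E (T i) (T j)"
  shows "\<exists>\<mu>. multiplicities J T \<mu> Y"
  using assms(1)
proof (induction rule: built.induct)
  case (built_zero Y)
  have Y: "Y \<in> Ob E" using built_zero by (simp add: zero_object_def)
  have "vs.dim (radical E (T i) Y) = 0" if "i \<in> J" for i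
  proof -
    have T: "T i \<in> Ob E" using that assms(3) indecomposable_Ob by blast
    have "radical E (T i) Y \<subseteq> hom (T i) Y" using radical_in[OF T Y] by auto
    then show ?thesis using vs.dim_mono_finite[OF subspace_hom[OF T Y], of _ "radical E (T i) Y"]
      hom_finite_span[OF T Y] radical_subspace[OF assms(3)[OF that] Y] dim_hom_zero[OF built_zero T] by auto
  qed
  then show ?case using dim_hom_zero[OF built_zero] dim_hom_zero'[OF built_zero] assms(3) indecomposable_Ob Y
    unfolding multiplicities_def by (intro exI[of _ "\<lambda>_. 0"]) auto
next
  case (built_one Y)
  then obtain j where j: "j \<in> J" "isomorphic E Y (T j)" and Y: "indecomposable E Y" using S by blast
  have "isomorphic E (T i) Y \<longleftrightarrow> i = j" if "i \<in> J" for i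
    using ni[OF that j(1)] j isomorphic_trans isomorphic_sym by blast
  then have "vs.dim (hom (T i) Y) = vs.dim (radical E (T i) Y) + (if i = j then 1 else 0)" if "i \<in> J" for i
    using dim_radical_indec[OF assms(3)[OF that] Y] that by simp
  moreover have "(\<Sum>i\<in>J. (if i = j then 1 else 0) * h i) = h j" for h :: "nat \<Rightarrow> nat"
    using j(1) assms(2) by (simp add: if_distrib[of "\<lambda>x. x * _"] cong: if_cong)
  ultimately show ?case using dim_hom_iso[OF j(2)] dim_hom_iso'[OF j(2)] indecomposable_Ob[OF Y]
    unfolding multiplicities_def by (intro exI[of _ "\<lambda>i. if i = j then 1 else 0"]) auto
next
  case (built_sum Y A)
  then obtain \<mu> \<nu> where m: "multiplicities J T \<mu> (A 1)" "multiplicities J T \<nu> (A 2)" by auto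
  have "Y \<in> Ob E" using built_sum by (simp add: direct_sum_def)
  moreover have "T i \<in> Ob E" if "i \<in> J" for i using assms(3) that indecomposable_Ob by blast
  ultimately have "multiplicities J T (\<lambda>i. \<mu> i + \<nu> i) Y" using m dim_hom_sum[OF built_sum(1)] dim_hom_sum'[OF built_sum(1)]
    dim_radical_sum[OF built_sum(1)] assms(3) unfolding multiplicities_def
    by (auto simp: sum.distrib add_mult_distrib)
  then show ?case by blast
qed

end

section \<open>Approximations\<close>

text \<open>The situation of an exchange: objects of \<open>S\<close> have no summand
  \<open>M\<close>, and \<open>g\<close> is a right \<open>S\<close>-approximation of
  \<open>M\<close>. The aim is that \<open>g\<close> is a sink map in \<open>T\<close>: as there is
  no loop at \<open>M\<close>, even the non-invertible endomorphisms of \<open>M\<close> factor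
  through it. Left approximations are handled by the same locale in \<open>opp E\<close>.\<close>

locale right_approximation = finite_exact_category E
  for E :: "('o, 'm::ab_group_add, 'k::alg_closed_field) exact_cat" (structure) +
  fixes T S :: "'o set" and M F :: 'o and g :: 'm
  assumes T: "closed_factors T" and M: "M \<in> indec E T" and S: "S \<subseteq> T"
    and TS: "\<And>Z. Z \<in> indec E T \<Longrightarrow> isomorphic E M Z \<or> Z \<in> S"
    and nr: "\<And>U i p. U \<in> S \<Longrightarrow> i \<in> hom M U \<Longrightarrow> p \<in> hom U M \<Longrightarrow> \<not> iso M M (p \<cdot> i)"
    and loop: "arrows E T M M = 0"
    and F: "F \<in> S" and g: "g \<in> hom F M"
    and approx: "\<And>U h. U \<in> S \<Longrightarrow> h \<in> hom U M \<Longrightarrow> \<exists>u \<in> hom U F. g \<cdot> u = h"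
begin

lemma M_indec: "indecomposable E M" and M_Ob: "M \<in> Ob E" and F_Ob: "F \<in> Ob E"
  using M g hom_dom hom_cod by (auto simp: indec_def)

lemma T_Ob: "Z \<in> T \<Longrightarrow> Z \<in> Ob E"
  using T by (auto simp: closed_factors_def)

definition K :: "'m set" where "K = {g \<cdot> u |u. u \<in> hom M F}"

abbreviation "J \<equiv> radical E M M"

lemma J_iff: "f \<in> J \<longleftrightarrow> f \<in> hom M M \<and> \<not> iso M M f"
  by (rule radical_iff_not_iso[OF M_indec M_indec])

lemma K_J: "K \<subseteq> J"
  using nr F g by (auto simp: K_def J_iff)

lemma J_mult_left: "j \<in> J \<Longrightarrow> a \<in> hom M M \<Longrightarrow> a \<cdot> j \<in> J"
  using radical_comp_left[OF M_indec _ M_Ob] by auto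

lemma J_mult_right: "j \<in> J \<Longrightarrow> a \<in> hom M M \<Longrightarrow> j \<cdot> a \<in> J"
  using radical_comp_right[OF M_indec M_indec _ M_Ob] by auto

lemma K_add: "k \<in> K \<Longrightarrow> k' \<in> K \<Longrightarrow> k + k' \<in> K"
  unfolding K_def using comp_add_right[OF _ _ g] add_in by (smt (verit) mem_Collect_eq)

text \<open>\<open>K\<close> is a right ideal by its form. It is also a left ideal, because ag
  starts in \<open>F\<close>, which belongs to \<open>S\<close>, and therefore factors through
  \<open>g\<close>.\<close>

lemma K_mult: assumes "k \<in> K" "a \<in> hom M M" shows "a \<cdot> k \<in> K"
proof -
  obtain u where u: "u \<in> hom M F" "k = g \<cdot> u" using assms by (auto simp: K_def)
  obtain w where w: "w \<in> hom F F" "g \<cdot> w = a \<cdot> g" using approx[OF F, of "a \<cdot> g"] assms g by auto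
  have "a \<cdot> k = g \<cdot> (w \<cdot> u)" using u w assoc[OF u(1) g assms(2)] assoc[OF u(1) w(1) g] by simp
  then show ?thesis using u w by (auto simp: K_def)
qed

lemma J_hom: "j \<in> J \<Longrightarrow> j \<in> hom M M" and K_hom: "j \<in> K \<Longrightarrow> j \<in> hom M M"
  using K_J J_iff by auto

lemma scl_eq: "q \<in> hom M M \<Longrightarrow> scl E c q = scl E c (idm E M) \<cdot> q"
  using comp_scl_left[OF _ id_in[OF M_Ob]] id_comp by simp

lemma K_scl: "k \<in> K \<Longrightarrow> scl E c k \<in> K"
  using K_mult[OF _ scl_in[OF id_in[OF M_Ob]]] scl_eq[OF K_hom] by simp

text \<open>Being radical, tested at the end \<open>M\<close>. In this form the property passes to
  every summand of a decomposable \<open>Z\<close>.\<close>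

definition rad_like :: "'o \<Rightarrow> 'm \<Rightarrow> bool" where
  "rad_like Z u \<longleftrightarrow> u \<in> hom Z M \<and> (\<forall>i \<in> hom M Z. \<not> iso M M (u \<cdot> i))"

text \<open>If \<open>v\<close> were a left inverse of ui, then 1 - ivu would be invertible by the
  radical condition and yet annihilate \<open>i\<close>.\<close>

lemma rad_like_radical: assumes Z: "Z \<in> Ob E" and u: "u \<in> radical E Z M" shows "rad_like Z u"
proof -
  have uh: "u \<in> hom Z M" using radical_in[OF Z M_Ob u] .
  have "\<not> iso M M (u \<cdot> i)" if i: "i \<in> hom M Z" for i
  proof
    assume "iso M M (u \<cdot> i)"
    then obtain v where v: "v \<in> hom M M" "v \<cdot> (u \<cdot> i) = idm E M" by (auto simp: iso_def)
    have iv: "i \<cdot> v \<in> hom M Z" using i v by auto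
    then have "iso Z Z (idm E Z - i \<cdot> v \<cdot> u)"
      using u Z M_Ob unfolding radical_def by (auto simp: hom_eq iso_mor_eq)
    then obtain w where w: "w \<in> hom Z Z" "w \<cdot> (idm E Z - i \<cdot> v \<cdot> u) = idm E Z" by (auto simp: iso_def)
    have ivu: "i \<cdot> v \<cdot> u \<in> hom Z Z" using iv uh by auto
    have "(idm E Z - i \<cdot> v \<cdot> u) \<cdot> i = i - (i \<cdot> v) \<cdot> (u \<cdot> i)"
      using comp_minus_left[OF i id_in[OF Z] ivu] id_comp[OF i] assoc[OF i uh iv] by simp
    also have "\<dots> = 0" using assoc[OF comp_in[OF i uh] v(1) i] v(2) comp_id[OF i] by simp
    finally have "w \<cdot> (idm E Z - i \<cdot> v \<cdot> u) \<cdot> i = 0"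
      using assoc[OF i minus_in[OF id_in[OF Z] ivu] w(1)] comp_zero_right[OF w(1)] by simp
    then have "i = 0" using w(2) id_comp[OF i] by simp
    then show False using v(2) comp_zero_right[OF uh] comp_zero_right[OF v(1)] indecomposable_nonzero[OF M_indec] by simp
  qed
  then show ?thesis using uh by (simp add: rad_like_def)
qed

lemma rad_like_comp:
  assumes u: "rad_like Z u" and i: "i \<in> hom Z' Z" shows "rad_like Z' (u \<cdot> i)"
proof -
  have uh: "u \<in> hom Z M" using u by (simp add: rad_like_def)
  have "\<not> iso M M (u \<cdot> i \<cdot> j)" if j: "j \<in> hom M Z'" for j
    using u assoc[OF j i uh] comp_in[OF j i] unfolding rad_like_def by metis
  then show ?thesis using uh i by (auto simp: rad_like_def)
qed

lemma rad_like_J: "rad_like M u \<longleftrightarrow> u \<in> J"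
proof
  assume u: "rad_like M u"
  then have "\<not> iso M M (u \<cdot> idm E M)" "u \<in> hom M M" using M_Ob by (auto simp: rad_like_def)
  then show "u \<in> J" unfolding J_iff using comp_id by metis
next
  assume u: "u \<in> J"
  then have "\<not> iso M M (u \<cdot> i)" if "i \<in> hom M M" for i using J_mult_right[OF u that] J_iff by auto
  then show "rad_like M u" using u by (auto simp: rad_like_def J_iff)
qed

lemma direct_sum_split:
  assumes "direct_sum E Y 2 A"
  obtains i1 i2 p1 p2 where "Y \<in> Ob E" "A 1 \<in> Ob E" "A 2 \<in> Ob E"
    "i1 \<in> hom (A 1) Y" "i2 \<in> hom (A 2) Y" "p1 \<in> hom Y (A 1)" "p2 \<in> hom Y (A 2)"
    "i1 \<cdot> p1 + i2 \<cdot> p2 = idm E Y"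
  by (rule direct_sum_2E[OF assms]) (rule that)

lemma zero_K: "0 \<in> K"
  using comp_zero_right[OF g] F_Ob M_Ob unfolding K_def by (auto intro!: exI[of _ 0])

abbreviation "JJ \<equiv> vs.span {j \<cdot> j' |j j'. j \<in> J \<and> j' \<in> J}"

lemma sum_split:
  assumes "i1 \<in> hom A1 Y" "i2 \<in> hom A2 Y" "p1 \<in> hom Y A1" "p2 \<in> hom Y A2"
    and "i1 \<cdot> p1 + i2 \<cdot> p2 = idm E Y" and u: "u \<in> hom Y Z"
  shows "u = (u \<cdot> i1) \<cdot> p1 + (u \<cdot> i2) \<cdot> p2"
  using comp_id[OF u] comp_add_right[OF comp_in[OF assms(3,1)] comp_in[OF assms(4,2)] u] assms(5)
    assoc[OF assms(3,1) u] assoc[OF assms(4,2) u] by simp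

text \<open>Along a summand of \<open>Z\<close> isomorphic to \<open>M\<close> the composite is a
  product of two elements of \<open>J\<close>; along any other summand \<open>u\<close> factors
  through \<open>g\<close>, and the composite lies in \<open>K\<close>.\<close>

lemma product_radicals:
  assumes "built (indec E T) Z" "f \<in> radical E M Z" "rad_like Z u"
  shows "\<exists>k \<in> K. \<exists>x \<in> JJ. u \<cdot> f = k + x"
  using assms
proof (induction arbitrary: f u rule: built.induct)
  case (built_zero Y)
  then have Y: "Y \<in> Ob E" "idm E Y = 0" by (auto simp: zero_object_def)
  have f: "f \<in> hom M Y" and u: "u \<in> hom Y M" using built_zero radical_in[OF M_Ob Y(1)] by (auto simp: rad_like_def)
  have "u \<cdot> f = 0" using comp_id[OF u] Y comp_zero_right[OF u] comp_zero_left[OF f] by simp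
  then show ?case using zero_K vs.span_zero by force
next
  case (built_one Y)
  have Y: "indecomposable E Y" "Y \<in> Ob E" using built_one indecomposable_Ob by (auto simp: indec_def)
  have f: "f \<in> hom M Y" and u: "u \<in> hom Y M" using built_one radical_in[OF M_Ob Y(2)] by (auto simp: rad_like_def)
  from TS[OF built_one(1)] show ?case
  proof
    assume "isomorphic E M Y"
    then obtain t t' where t: "iso M Y t" "iso Y M t'" "t \<cdot> t' = idm E Y" using iso_inv unfolding isomorphic_eq by blast
    note th = iso_in[OF t(1)] iso_in[OF t(2)]
    have "u \<cdot> f = (u \<cdot> t) \<cdot> (t' \<cdot> f)"
      using assoc4[OF f th(2,1) u] t(3) id_comp[OF f] by simp
    moreover have "u \<cdot> t \<in> J" using rad_like_comp[OF built_one(3) th(1)] rad_like_J by simp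
    moreover have "t' \<cdot> f \<in> J" using radical_comp_left[OF M_indec built_one(2) Y(2) th(2)] .
    ultimately have "u \<cdot> f \<in> JJ" by (intro vs.span_base) blast
    then show ?thesis using zero_K by (intro bexI[of _ 0] bexI[of _ "u \<cdot> f"]) auto
  next
    assume "Y \<in> S"
    then obtain w where w: "w \<in> hom Y F" "g \<cdot> w = u" using approx u by blast
    then have "u \<cdot> f = g \<cdot> (w \<cdot> f)" using assoc[OF f w(1) g] by simp
    then have "u \<cdot> f \<in> K" using f w by (auto simp: K_def)
    then show ?thesis using vs.span_zero by (intro bexI[of _ "u \<cdot> f"] bexI[of _ 0]) auto
  qed
next
  case (built_sum Y A)
  obtain i1 i2 p1 p2 where h: "Y \<in> Ob E" "A 1 \<in> Ob E" "A 2 \<in> Ob E"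
    "i1 \<in> hom (A 1) Y" "i2 \<in> hom (A 2) Y" "p1 \<in> hom Y (A 1)" "p2 \<in> hom Y (A 2)"
    "i1 \<cdot> p1 + i2 \<cdot> p2 = idm E Y"
    using direct_sum_split[OF built_sum(1)] .
  have f: "f \<in> hom M Y" and u: "u \<in> hom Y M" using built_sum radical_in[OF M_Ob h(1)] by (auto simp: rad_like_def)
  obtain k1 x1 where 1: "k1 \<in> K" "x1 \<in> JJ" "(u \<cdot> i1) \<cdot> (p1 \<cdot> f) = k1 + x1"
    using built_sum.IH(1)[OF radical_comp_left[OF M_indec built_sum.prems(1) h(1,6)] rad_like_comp[OF built_sum.prems(2) h(4)]] by blast
  obtain k2 x2 where 2: "k2 \<in> K" "x2 \<in> JJ" "(u \<cdot> i2) \<cdot> (p2 \<cdot> f) = k2 + x2"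
    using built_sum.IH(2)[OF radical_comp_left[OF M_indec built_sum.prems(1) h(1,7)] rad_like_comp[OF built_sum.prems(2) h(5)]] by blast
  have "u \<cdot> f = ((u \<cdot> i1) \<cdot> p1 + (u \<cdot> i2) \<cdot> p2) \<cdot> f"
    using sum_split[OF h(4-8) u] by simp
  also have "\<dots> = (u \<cdot> i1) \<cdot> (p1 \<cdot> f) + (u \<cdot> i2) \<cdot> (p2 \<cdot> f)"
    using comp_add_left[OF f comp_in[OF h(6) comp_in[OF h(4) u]] comp_in[OF h(7) comp_in[OF h(5) u]]]
      assoc[OF f h(6) comp_in[OF h(4) u]] assoc[OF f h(7) comp_in[OF h(5) u]] by simp
  finally have "u \<cdot> f = (k1 + k2) + (x1 + x2)" using 1 2 by simp
  then show ?case using K_add 1 2 vs.span_add by blast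
qed

text \<open>The left ideal of endomorphisms of \<open>M\<close> generated by \<open>K\<close> and
  \<open>W\<close>.\<close>

inductive_set Q :: "'m set \<Rightarrow> 'm set" for W where
  Q_K: "k \<in> K \<Longrightarrow> k \<in> Q W"
| Q_W: "w \<in> W \<Longrightarrow> w \<in> Q W"
| Q_add: "x \<in> Q W \<Longrightarrow> y \<in> Q W \<Longrightarrow> x + y \<in> Q W"
| Q_mult: "x \<in> Q W \<Longrightarrow> a \<in> hom M M \<Longrightarrow> a \<cdot> x \<in> Q W"

lemma Q_hom: "W \<subseteq> J \<Longrightarrow> x \<in> Q W \<Longrightarrow> x \<in> hom M M"
  by (rotate_tac, induction rule: Q.induct) (use K_J J_iff in blast)+

lemma Q_insert:
  assumes "insert w W \<subseteq> J" "x \<in> Q (insert w W)"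
  shows "\<exists>d \<in> hom M M. \<exists>q \<in> Q W. x = d \<cdot> w + q"
  using assms(2)
proof (induction rule: Q.induct)
  case (Q_K k)
  then show ?case using Q.Q_K[of k W] M_Ob assms J_iff comp_zero_left[of w M M]
    by (intro bexI[of _ 0] bexI[of _ k]) auto
next
  case (Q_W v)
  show ?case
  proof (cases "v = w")
    case True
    then show ?thesis using Q.Q_K[OF zero_K, of W] M_Ob assms J_iff id_comp[of w M M]
      by (intro bexI[of _ "idm E M"] bexI[of _ 0]) auto
  next
    case False
    then show ?thesis using Q.Q_W[of v W] Q_W M_Ob assms J_iff comp_zero_left[of w M M]
      by (intro bexI[of _ 0] bexI[of _ v]) auto
  qed
next
  case (Q_add x y)
  then obtain d q d' q' where d: "d \<in> hom M M" "q \<in> Q W" "x = d \<cdot> w + q" "d' \<in> hom M M" "q' \<in> Q W" "y = d' \<cdot> w + q'"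
    by blast
  have "x + y = (d + d') \<cdot> w + (q + q')"
    using d comp_add_left[of w M M d M d'] assms J_iff by auto
  then show ?case using d Q.Q_add by blast
next
  case (Q_mult x a)
  then obtain d q where d: "d \<in> hom M M" "q \<in> Q W" "x = d \<cdot> w + q" by blast
  have q: "q \<in> hom M M" and w: "w \<in> hom M M" using Q_hom[of W] d assms J_iff by auto
  have "a \<cdot> x = (a \<cdot> d) \<cdot> w + a \<cdot> q"
    using d(3) comp_add_right[OF comp_in[OF w d(1)] q Q_mult(2)] assoc[OF w d(1) Q_mult(2)] by simp
  then show ?case using d Q_mult Q.Q_mult by blast
qed

text \<open>Without loops the radical of \<open>M\<close> equals its square formed in
  \<open>T\<close>; splitting the intermediate objects turns this into J = K + JJ.\<close>

lemma J_products: "j \<in> J \<Longrightarrow> \<exists>k \<in> K. \<exists>x \<in> JJ. j = k + x"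
proof -
  assume j: "j \<in> J"
  obtain B where B: "finite B" "hom M M \<subseteq> vs.span B" using hom_finite_span[OF M_Ob M_Ob] by auto
  let ?P = "{g \<cdot> f |Z f g. Z \<in> T \<and> f \<in> radical E M Z \<and> g \<in> radical E Z M}"
  have "vs.subspace J" using radical_subspace[OF M_indec M_Ob] .
  moreover have "vs.span ?P \<subseteq> J"
  proof (intro vs.span_minimal \<open>vs.subspace J\<close> subsetI)
    fix x assume "x \<in> ?P"
    then obtain Z f u where "Z \<in> T" "f \<in> radical E M Z" "u \<in> radical E Z M" "x = u \<cdot> f" by blast
    then show "x \<in> J" using radical_comp_left[OF M_indec _ T_Ob radical_in[OF T_Ob M_Ob]] by simp
  qed
  moreover have "J \<subseteq> vs.span B" using B J_iff by auto
  moreover have "vs.dim J \<le> vs.dim (vs.span ?P)" using loop by (simp add: arrows_def radical_sq_def)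
  ultimately have "vs.span ?P = J"
    using vs.dim_mono_finite[of J B "vs.span ?P"] B(1) vs.subspace_span[of ?P] by force
  then have "j \<in> vs.span ?P" using j by simp
  then show ?thesis
  proof (induction rule: vs.span_induct_alt)
    case base
    show ?case using zero_K vs.span_zero by (intro bexI[of _ 0] bexI[of _ 0]) auto
  next
    case (step c x y)
    then obtain Z f u where Z: "Z \<in> T" "f \<in> radical E M Z" "u \<in> radical E Z M" "x = u \<cdot> f" by blast
    obtain k1 x1 where 1: "k1 \<in> K" "x1 \<in> JJ" "x = k1 + x1"
      using product_radicals[OF built_indec[OF T Z(1)] Z(2) rad_like_radical[OF T_Ob[OF Z(1)] Z(3)]] Z(4) by blast
    obtain k2 x2 where 2: "k2 \<in> K" "x2 \<in> JJ" "y = k2 + x2" using step by blast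
    have "scl E c k1 \<in> K" using K_scl[OF 1(1)] .
    moreover have "scl E c x + y = (scl E c k1 + k2) + (scl E c x1 + x2)"
      using 1 2 by (simp add: vs.scale_right_distrib)
    moreover have "scl E c x1 + x2 \<in> JJ" using 1(2) 2(2) vs.span_add[OF vs.span_scale] by blast
    ultimately show ?case using K_add 2(1) by blast
  qed
qed

text \<open>Nakayama's argument, discarding one generator at a time: J = K + JJ gives w = k + dw + q
  with \<open>d\<close> in \<open>J\<close> and \<open>q\<close> in the ideal of the other
  generators, and 1 - d is invertible.\<close>

lemma nakayama: "finite W \<Longrightarrow> W \<subseteq> J \<Longrightarrow> J \<subseteq> Q W \<Longrightarrow> J \<subseteq> K"
proof (induction W rule: finite_induct)
  case empty
  have "x \<in> K" if "x \<in> Q {}" for x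
    using that by (induction rule: Q.induct) (simp_all add: K_add K_mult)
  then show ?case using empty by auto
next
  case (insert w W)
  let ?D = "{d \<cdot> w + q |d q. d \<in> J \<and> q \<in> Q W}"
  have WJ: "w \<in> J" "w \<in> hom M M" "W \<subseteq> J" using insert J_iff by auto
  have Jh: "d \<in> hom M M" if "d \<in> J" for d using that J_iff by auto
  have sub: "vs.subspace J" using radical_subspace[OF M_indec M_Ob] .
  have JJD: "x \<in> ?D" if "x \<in> JJ" for x
    using that
  proof (induction rule: vs.span_induct_alt)
    case base
    have "0 = 0 \<cdot> w + 0" using comp_zero_left[OF WJ(2)] by simp
    then show ?case using vs.subspace_0[OF sub] Q.Q_K[OF zero_K, of W] by blast
  next
    case (step c x y)
    then obtain j j' where j: "j \<in> J" "j' \<in> J" "x = j \<cdot> j'" by blast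
    have "j' \<in> Q (insert w W)" using insert.prems j by auto
    then obtain d q where d: "d \<in> hom M M" "q \<in> Q W" "j' = d \<cdot> w + q" using Q_insert[OF insert.prems(1)] by blast
    obtain e p where e: "e \<in> J" "p \<in> Q W" "y = e \<cdot> w + p" using step(2) by auto
    have q: "q \<in> hom M M" "p \<in> hom M M" using Q_hom WJ d e by auto
    define a where "a = scl E c (idm E M)"
    have a: "a \<in> hom M M" unfolding a_def using M_Ob by auto
    have jd: "j \<cdot> d \<in> hom M M" "j \<cdot> q \<in> hom M M" "a \<cdot> (j \<cdot> d) \<in> hom M M" "a \<cdot> (j \<cdot> q) \<in> hom M M"
      using Jh[OF j(1)] d(1) q(1) a by auto
    have "scl E c x = a \<cdot> (j \<cdot> j')" using scl_eq[OF comp_in[OF Jh[OF j(2)] Jh[OF j(1)]]] j(3) unfolding a_def by simp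
    also have "j \<cdot> j' = (j \<cdot> d) \<cdot> w + j \<cdot> q"
      using d(3) comp_add_right[OF comp_in[OF WJ(2) d(1)] q(1) Jh[OF j(1)]] assoc[OF WJ(2) d(1) Jh[OF j(1)]] by simp
    also have "a \<cdot> ((j \<cdot> d) \<cdot> w + j \<cdot> q) = (a \<cdot> (j \<cdot> d)) \<cdot> w + a \<cdot> (j \<cdot> q)"
      using comp_add_right[OF comp_in[OF WJ(2) jd(1)] jd(2) a] assoc[OF WJ(2) jd(1) a] by simp
    finally have "scl E c x + y = (a \<cdot> (j \<cdot> d) + e) \<cdot> w + (a \<cdot> (j \<cdot> q) + p)"
      using comp_add_left[OF WJ(2) jd(3) Jh[OF e(1)]] e(3) by simp
    moreover have "a \<cdot> (j \<cdot> d) + e \<in> J"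
      using vs.subspace_add[OF sub J_mult_left[OF J_mult_right[OF j(1) d(1)] a] e(1)] .
    moreover have "a \<cdot> (j \<cdot> q) + p \<in> Q W" using Q.Q_add[OF Q.Q_mult[OF Q.Q_mult[OF d(2) Jh[OF j(1)]] a] e(2)] .
    ultimately show ?case by (intro CollectI exI conjI)
  qed
  obtain k x where kx: "k \<in> K" "x \<in> JJ" "w = k + x" using J_products[OF WJ(1)] by (elim bexE)
  obtain d q where "x = d \<cdot> w + q" "d \<in> J" "q \<in> Q W" using JJD[OF kx(2)] by (elim CollectE exE conjE)
  then have k: "k \<in> K" "d \<in> J" "q \<in> Q W" "w = k + (d \<cdot> w + q)" using kx(1,3) by simp_all
  have "(idm E M - d) \<cdot> w = w - d \<cdot> w"
    using comp_minus_left[OF WJ(2) id_in[OF M_Ob] Jh[OF k(2)]] id_comp[OF WJ(2)] by simp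
  also have "\<dots> = k + q" using k(4) by (simp add: algebra_simps)
  finally have 1: "(idm E M - d) \<cdot> w \<in> Q W" using k Q.Q_K Q.Q_add by auto
  obtain e where e: "e \<in> hom M M" "e \<cdot> (idm E M - d) = idm E M"
    using iso_inv[OF indecomposable_local[OF M_indec, of d]] k(2) J_iff iso_in by blast
  have "w = e \<cdot> ((idm E M - d) \<cdot> w)"
    using assoc[OF WJ(2) minus_in[OF id_in[OF M_Ob] Jh[OF k(2)]] e(1)] e(2) id_comp[OF WJ(2)] by simp
  then have w: "w \<in> Q W" using Q.Q_mult[OF 1 e(1)] by simp
  have "x \<in> Q W" if "x \<in> Q (insert w W)" for x
    using that
  proof (induction rule: Q.induct)
    case (Q_W v)
    then show ?case using w Q.Q_W[of v W] by (cases "v = w") simp_all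
  qed (rule Q.intros; assumption)+
  then show ?case using insert by auto
qed

lemma J_K: "J = K"
proof -
  obtain B where B: "finite B" "hom M M \<subseteq> vs.span B" using hom_finite_span[OF M_Ob M_Ob] by auto
  have sub: "vs.subspace J" using radical_subspace[OF M_indec M_Ob] .
  have "J \<subseteq> vs.span B" using B J_iff by auto
  then obtain W where W: "finite W" "W \<subseteq> J" "vs.span W = J"
    using vs.finite_dim_basis[OF sub B(1) _ empty_subsetI vs.independent_empty] by metis
  have "x \<in> Q W" if "x \<in> vs.span W" for x
    using that
  proof (induction rule: vs.span_induct_alt)
    case base
    then show ?case using Q.Q_K zero_K by auto
  next
    case (step c x y)
    then have "scl E c x = scl E c (idm E M) \<cdot> x"
      using W(2) scl_eq[OF J_hom] by auto
    then show ?case using Q.Q_add[OF Q.Q_mult[OF Q.Q_W[OF step(1)] scl_in[OF id_in[OF M_Ob]]] step(2)] by simp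
  qed
  then show ?thesis using nakayama[OF W(1,2)] W(3) K_J by blast
qed

lemma nonunit_factors: "u \<in> hom M M \<Longrightarrow> \<not> iso M M u \<Longrightarrow> \<exists>v \<in> hom M F. u = g \<cdot> v"
  using J_K J_iff by (auto simp: K_def)

lemma rad_like_factors:
  assumes "built (indec E T) Z" "rad_like Z u" shows "\<exists>v \<in> hom Z F. u = g \<cdot> v"
  using assms
proof (induction arbitrary: u rule: built.induct)
  case (built_zero Y)
  then have Y: "Y \<in> Ob E" "idm E Y = 0" "u \<in> hom Y M" by (auto simp: zero_object_def rad_like_def)
  then have "u = 0" using comp_id[OF Y(3)] comp_zero_right[OF Y(3)] by simp
  then show ?case using comp_zero_right[OF g] Y F_Ob by (intro bexI[of _ 0]) auto
next
  case (built_one Y)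
  have u: "u \<in> hom Y M" using built_one by (auto simp: rad_like_def)
  from TS[OF built_one(1)] show ?case
  proof
    assume "isomorphic E M Y"
    then obtain t t' where t: "iso M Y t" "iso Y M t'" "t \<cdot> t' = idm E Y" using iso_inv unfolding isomorphic_eq by blast
    note th = iso_in[OF t(1)] iso_in[OF t(2)]
    have "u \<cdot> t \<in> K" using rad_like_comp[OF built_one(2) th(1)] rad_like_J J_K by simp
    then obtain v where v: "v \<in> hom M F" "u \<cdot> t = g \<cdot> v" by (auto simp: K_def)
    have "u = u \<cdot> t \<cdot> t'" using assoc[OF th(2,1) u] t(3) comp_id[OF u] by simp
    also have "\<dots> = g \<cdot> (v \<cdot> t')" using v assoc[OF th(2) v(1) g] by simp
    finally show ?thesis using v th by blast
  next
    assume "Y \<in> S"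
    then show ?thesis using approx u by metis
  qed
next
  case (built_sum Y A)
  obtain i1 i2 p1 p2 where h: "Y \<in> Ob E" "A 1 \<in> Ob E" "A 2 \<in> Ob E"
    "i1 \<in> hom (A 1) Y" "i2 \<in> hom (A 2) Y" "p1 \<in> hom Y (A 1)" "p2 \<in> hom Y (A 2)"
    "i1 \<cdot> p1 + i2 \<cdot> p2 = idm E Y"
    using direct_sum_split[OF built_sum(1)] .
  have u: "u \<in> hom Y M" using built_sum by (auto simp: rad_like_def)
  obtain v1 where 1: "v1 \<in> hom (A 1) F" "u \<cdot> i1 = g \<cdot> v1"
    using built_sum.IH(1)[OF rad_like_comp[OF built_sum.prems h(4)]] by blast
  obtain v2 where 2: "v2 \<in> hom (A 2) F" "u \<cdot> i2 = g \<cdot> v2"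
    using built_sum.IH(2)[OF rad_like_comp[OF built_sum.prems h(5)]] by blast
  have "u = (u \<cdot> i1) \<cdot> p1 + (u \<cdot> i2) \<cdot> p2" using sum_split[OF h(4-8) u] .
  also have "\<dots> = g \<cdot> (v1 \<cdot> p1 + v2 \<cdot> p2)"
    using 1(2) 2(2) assoc[OF h(6) 1(1) g] assoc[OF h(7) 2(1) g]
      comp_add_right[OF comp_in[OF h(6) 1(1)] comp_in[OF h(7) 2(1)] g] by simp
  finally show ?case using 1 2 h by blast
qed

lemma radical_factors: "Z \<in> T \<Longrightarrow> u \<in> radical E Z M \<Longrightarrow> \<exists>v \<in> hom Z F. u = g \<cdot> v"
  using rad_like_factors[OF built_indec[OF T]] rad_like_radical T_Ob by blast

lemma g_linear: "x \<in> hom X F \<Longrightarrow> y \<in> hom X F \<Longrightarrow> g \<cdot> (x + y) = g \<cdot> x + g \<cdot> y"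
  "x \<in> hom X F \<Longrightarrow> g \<cdot> scl E c x = scl E c (g \<cdot> x)"
  using comp_add_right[OF _ _ g] comp_scl_right[OF _ g] by auto

text \<open>Only the invertible part of the endomorphisms escapes the approximation. This 1 is the
  origin of the unit vectors in \<open>coindex_Ts\<close> and \<open>index_Ts\<close>.\<close>

lemma dim_hom_M: "vs.dim (hom M M) = vs.dim ((\<lambda>u. g \<cdot> u) ` hom M F) + 1"
proof -
  have "(\<lambda>u. g \<cdot> u) ` hom M F = J" unfolding J_K K_def by auto
  then show ?thesis using dim_radical_indec[OF M_indec M_indec] isomorphic_refl[OF M_Ob] by simp
qed

lemma image_other: "X \<in> indec E T \<Longrightarrow> \<not> isomorphic E M X \<Longrightarrow> (\<lambda>u. g \<cdot> u) ` hom X F = hom X M"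
  using TS[of X] approx[of X] g by blast

text \<open>Composition with \<open>g\<close> maps Hom(X,F) onto Hom(X,M), which is all radical, and
  rad(X,F) onto the square of the radical. By minimality its kernel lies in rad(X,F), so the two
  quotients have equal dimension.\<close>

lemma arrows_eq:
  assumes X: "X \<in> indec E T" "\<not> isomorphic E M X"
    and minimal: "\<And>\<phi>. \<phi> \<in> hom F F \<Longrightarrow> g \<cdot> \<phi> = g \<Longrightarrow> iso F F \<phi>"
  shows "vs.dim (hom X F) = vs.dim (radical E X F) + arrows E T X M"
proof -
  have Xi: "indecomposable E X" and XO: "X \<in> Ob E" using X indecomposable_Ob by (auto simp: indec_def)
  obtain B where B: "finite B" "hom X F \<subseteq> vs.span B" using hom_finite_span[OF XO F_Ob] by auto
  have radhom: "radical E X F \<subseteq> hom X F" using radical_in[OF XO F_Ob] by auto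
  have subr: "vs.subspace (radical E X F)" using radical_subspace[OF Xi F_Ob] .
  \<comment> \<open>A kernel element outside the radical would split off a copy of \<open>X\<close>
    from \<open>F\<close>. Then 1 - wq fixes \<open>g\<close>, hence is invertible by minimality,
    although it annihilates \<open>w\<close>.\<close>
  have ker: "w \<in> radical E X F" if w: "w \<in> hom X F" "g \<cdot> w = 0" for w
  proof (rule ccontr)
    assume "w \<notin> radical E X F"
    then obtain p where p: "p \<in> hom F X" "iso X X (p \<cdot> w)" using radical_iff[OF Xi F_Ob] w by auto
    then obtain u where u: "u \<in> hom X X" "u \<cdot> (p \<cdot> w) = idm E X" by (auto simp: iso_def)
    define q where "q = u \<cdot> p"
    have q: "q \<in> hom F X" "q \<cdot> w = idm E X" unfolding q_def using u p assoc[OF w(1) p(1) u(1)] by auto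
    have wq: "w \<cdot> q \<in> hom F F" using w q by auto
    have "g \<cdot> (idm E F - w \<cdot> q) = g"
      using comp_minus_right[OF id_in[OF F_Ob] wq g] comp_id[OF g] assoc[OF q(1) w(1) g] w(2) comp_zero_left[OF q(1)] by simp
    then have "iso F F (idm E F - w \<cdot> q)" using minimal[OF minus_in[OF id_in[OF F_Ob] wq]] by simp
    then obtain v where v: "v \<in> hom F F" "v \<cdot> (idm E F - w \<cdot> q) = idm E F" by (auto simp: iso_def)
    have "(idm E F - w \<cdot> q) \<cdot> w = 0"
      using comp_minus_left[OF w(1) id_in[OF F_Ob] wq] id_comp[OF w(1)] assoc[OF w(1) q(1) w(1)] q(2) comp_id[OF w(1)] by simp
    then have "w = 0" using assoc[OF w(1) minus_in[OF id_in[OF F_Ob] wq] v(1)] v(2) id_comp[OF w(1)] comp_zero_right[OF v(1)] by simp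
    then show False using p(2) comp_zero_right[OF p(1)] not_iso_zero[OF Xi] by simp
  qed
  have k: "{v \<in> radical E X F. g \<cdot> v = 0} = {v \<in> hom X F. g \<cdot> v = 0}" using ker radhom by auto
  have d1: "vs.dim (hom X F) = vs.dim {v \<in> hom X F. g \<cdot> v = 0} + vs.dim (hom X M)"
    using vs.dim_kernel_image[OF subspace_hom[OF XO F_Ob] B, of "\<lambda>v. g \<cdot> v"] g_linear image_other[OF X] by simp
  have d2: "vs.dim (radical E X F) = vs.dim {v \<in> hom X F. g \<cdot> v = 0} + vs.dim ((\<lambda>v. g \<cdot> v) ` radical E X F)"
    unfolding k[symmetric]
    by (rule vs.dim_kernel_image[OF subr B(1) order_trans[OF radhom B(2)]])
      (rule g_linear(1)[OF subsetD[OF radhom] subsetD[OF radhom]] g_linear(2)[OF subsetD[OF radhom]]; assumption)+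
  have le: "vs.dim (radical E X F) \<le> vs.dim (hom X F)"
    using vs.dim_mono_finite[OF subspace_hom[OF XO F_Ob] B subr radhom] by simp
  have "radical E X M = hom X M"
    using radical_iff_not_iso[OF Xi M_indec] X(2) isomorphic_eq isomorphic_sym by blast
  moreover have "radical_sq E T X M = (\<lambda>v. g \<cdot> v) ` radical E X F"
  proof
    let ?P = "{g \<cdot> f |Z f g. Z \<in> T \<and> f \<in> radical E X Z \<and> g \<in> radical E Z M}"
    have "vs.subspace ((\<lambda>v. g \<cdot> v) ` radical E X F)"
    proof (rule vs.subspaceI)
      show "0 \<in> (\<lambda>v. g \<cdot> v) ` radical E X F" using vs.subspace_0[OF subr] comp_zero_right[OF g] by force
      fix x y assume "x \<in> (\<lambda>v. g \<cdot> v) ` radical E X F" "y \<in> (\<lambda>v. g \<cdot> v) ` radical E X F"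
      then obtain a b where "a \<in> radical E X F" "b \<in> radical E X F" "x = g \<cdot> a" "y = g \<cdot> b" by auto
      then show "x + y \<in> (\<lambda>v. g \<cdot> v) ` radical E X F"
        using vs.subspace_add[OF subr] g_linear(1)[OF subsetD[OF radhom] subsetD[OF radhom], of a b]
        by (intro image_eqI[of _ _ "a + b"]) auto
    next
      fix c x assume "x \<in> (\<lambda>v. g \<cdot> v) ` radical E X F"
      then obtain a where "a \<in> radical E X F" "x = g \<cdot> a" by auto
      then show "scl E c x \<in> (\<lambda>v. g \<cdot> v) ` radical E X F"
        using vs.subspace_scale[OF subr] g_linear(2)[of a X c] radhom by (auto intro!: image_eqI[of _ _ "scl E c a"])
    qed
    moreover have "?P \<subseteq> (\<lambda>v. g \<cdot> v) ` radical E X F"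
    proof
      fix x assume "x \<in> ?P"
      then obtain Z f u where Z: "Z \<in> T" "f \<in> radical E X Z" "u \<in> radical E Z M" "x = u \<cdot> f" by blast
      obtain v where v: "v \<in> hom Z F" "u = g \<cdot> v" using radical_factors[OF Z(1,3)] by auto
      have "x = g \<cdot> (v \<cdot> f)" using Z v assoc[OF radical_in[OF XO T_Ob[OF Z(1)] Z(2)] v(1) g] by simp
      moreover have "v \<cdot> f \<in> radical E X F" using radical_comp_left[OF Xi Z(2) T_Ob[OF Z(1)] v(1)] .
      ultimately show "x \<in> (\<lambda>v. g \<cdot> v) ` radical E X F" by blast
    qed
    ultimately show "radical_sq E T X M \<subseteq> (\<lambda>v. g \<cdot> v) ` radical E X F"
      unfolding radical_sq_def by (intro vs.span_minimal)
    \<comment> \<open>This shows that \<open>g\<close> itself is radical, \<open>M\<close> not being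
      a summand of \<open>F\<close>; so its composite with a radical morphism is a product of two
      radical ones.\<close>
    have "iso F F (idm E F - h \<cdot> g)" if "h \<in> hom M F" for h
      using iso_one_minus[OF that g] indecomposable_local[OF M_indec, of "g \<cdot> h"] nr[OF F that g] that g by auto
    then have "g \<in> radical E F M" using g F_Ob M_Ob unfolding radical_def by (auto simp: hom_eq iso_mor_eq)
    then show "(\<lambda>v. g \<cdot> v) ` radical E X F \<subseteq> radical_sq E T X M"
      unfolding radical_sq_def using F S by (auto intro!: vs.span_base)
  qed
  ultimately have "arrows E T X M = vs.dim (hom X M) - vs.dim ((\<lambda>v. g \<cdot> v) ` radical E X F)"
    by (simp add: arrows_def)
  then show ?thesis using d1 d2 le by simp
qed

end

section \<open>Extensions and 2-Calabi-Yau duality\<close>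

context finite_exact_category
begin

lemma Conf_hom: assumes "Conf E X f M g Y" shows "f \<in> hom X M" "g \<in> hom M Y" "g \<cdot> f = 0"
  using Conf_kernel[OF assms] Conf_Ob[OF assms] by (auto simp: is_kernel_def hom_eq)

lemma Conf_lift:
  assumes "Conf E X f M g Y" "h \<in> hom W M" "g \<cdot> h = 0"
  obtains u where "u \<in> hom W X" "f \<cdot> u = h"
proof -
  have "W \<in> Ob E" "h \<in> Hom E W M" "X \<in> Ob E" using homD[OF assms(2)] Conf_Ob[OF assms(1)] by auto
  then show thesis using Conf_kernel[OF assms(1)] assms(3) that unfolding is_kernel_def by (metis homI)
qed

lemma Conf_mono:
  assumes C: "Conf E X f M g Y" and u: "u \<in> hom W X" and v: "v \<in> hom W X" and e: "f \<cdot> u = f \<cdot> v"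
  shows "u = v"
proof -
  note h = Conf_hom[OF C]
  have W: "W \<in> Ob E" "u \<in> Hom E W X" "v \<in> Hom E W X" "f \<cdot> u \<in> Hom E W M"
    using homD u v comp_in[OF u h(1)] by blast+
  have "g \<cdot> (f \<cdot> u) = 0" using assoc[OF u h(1,2)] h(3) comp_zero_left[OF u] by simp
  then have "\<exists>!w. w \<in> Hom E W X \<and> f \<cdot> w = f \<cdot> u"
    using Conf_kernel[OF C] W unfolding is_kernel_def by blast
  then show ?thesis using W e by metis
qed

end

context finite_exact_category
begin

interpretation op: finite_exact_category "opp E"
  by (rule finite_exact_category_opp) (rule finite_exact_category_axioms)

lemma Conf_extend:
  assumes "Conf E X f M g Y" "h \<in> hom M W" "h \<cdot> f = 0"
  obtains u where "u \<in> hom Y W" "u \<cdot> g = h"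
  using op.Conf_lift[of Y g M f X h W] assms by (auto simp: op_hom)

lemma Conf_epi:
  "Conf E X f M g Y \<Longrightarrow> u \<in> hom Y W \<Longrightarrow> v \<in> hom Y W \<Longrightarrow> u \<cdot> g = v \<cdot> g \<Longrightarrow> u = v"
  using op.Conf_mono[of Y g M f X u W v] by (auto simp: op_hom)

text \<open>The axioms only provide a pulled back deflation with some kernel \<open>K\<close>.
  Comparison with \<open>i\<close> identifies \<open>K\<close> with \<open>B\<close>, so that the
  new conflation has the same left end.\<close>

lemma Conf_pullback:
  assumes C: "Conf E B i Q p Z" and \<beta>: "\<beta> \<in> hom A Z"
  obtains R j q b where "Conf E B j R q A" "b \<in> hom R Q" "p \<cdot> b = \<beta> \<cdot> q" "b \<cdot> j = i"
    "\<And>W u v. u \<in> hom W A \<Longrightarrow> v \<in> hom W Q \<Longrightarrow> \<beta> \<cdot> u = p \<cdot> v \<Longrightarrow> \<exists>w \<in> hom W R. q \<cdot> w = u \<and> b \<cdot> w = v"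
proof -
  note h = Conf_hom[OF C] and O = Conf_Ob[OF C]
  have A: "A \<in> Ob E" "\<beta> \<in> Hom E A Z" using homD[OF \<beta>] by auto
  have "deflation E Q Z p" using C by (auto simp: deflation_def)
  then obtain R q b where R: "R \<in> Ob E" "pullback_square E R A Q Z q b p \<beta>" "deflation E R A q"
    using deflation_pullback[OF _ A] by blast
  have qb: "q \<in> hom R A" "b \<in> hom R Q" "p \<cdot> b = \<beta> \<cdot> q"
    using R O A unfolding pullback_square_def by (auto simp: hom_eq)
  have un: "\<exists>!w. w \<in> hom W R \<and> b \<cdot> w = v \<and> q \<cdot> w = u" if uv: "u \<in> hom W A" "v \<in> hom W Q" "\<beta> \<cdot> u = p \<cdot> v" for W u v
  proof -
    have W: "W \<in> Ob E" "v \<in> Hom E W Q" "u \<in> Hom E W A" using homD uv by blast+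
    then show ?thesis using R(2) uv(3)[symmetric] unfolding pullback_square_def hom_eq[OF W(1) R(1)] by blast
  qed
  obtain K j' where K: "Conf E K j' R q A" using R(3) by (auto simp: deflation_def)
  note kh = Conf_hom[OF K] and KO = Conf_Ob[OF K]
  have "p \<cdot> (b \<cdot> j') = 0"
    using assoc[OF kh(1) qb(2) h(2)] qb(3) assoc[OF kh(1) qb(1) \<beta>] kh(3) comp_zero_right[OF \<beta>] by simp
  then obtain m where m: "m \<in> hom K B" "i \<cdot> m = b \<cdot> j'" using Conf_lift[OF C comp_in[OF kh(1) qb(2)]] by metis
  have "\<beta> \<cdot> 0 = p \<cdot> i" using comp_zero_right[OF \<beta>] h by simp
  then obtain j where j: "j \<in> hom B R" "b \<cdot> j = i" "q \<cdot> j = 0"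
    using un[of 0 B i] h(1) zero_in[OF hom_dom[OF h(1)] A(1)] by blast
  obtain n where n: "n \<in> hom B K" "j' \<cdot> n = j" using Conf_lift[OF K j(1,3)] .
  have "i \<cdot> (m \<cdot> n) = i \<cdot> idm E B"
    using assoc[OF n(1) m(1) h(1)] m(2) assoc[OF n(1) kh(1) qb(2)] n(2) j(2) comp_id[OF h(1)] by simp
  then have mn: "m \<cdot> n = idm E B" using Conf_mono[OF C comp_in[OF n(1) m(1)]] O by simp
  have jm: "j \<cdot> m \<in> hom K R" using j m by auto
  have "b \<cdot> (j \<cdot> m) = b \<cdot> j'" using assoc[OF m(1) j(1) qb(2)] j m by simp
  moreover have "q \<cdot> (j \<cdot> m) = q \<cdot> j'" using assoc[OF m(1) j(1) qb(1)] j(3) comp_zero_left[OF m(1)] kh(3) by simp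
  moreover have "\<beta> \<cdot> (q \<cdot> j') = p \<cdot> (b \<cdot> j')"
    using assoc[OF kh(1) qb(1) \<beta>] assoc[OF kh(1) qb(2) h(2)] qb(3) by simp
  ultimately have jmj: "j \<cdot> m = j'" using un[OF comp_in[OF kh(1) qb(1)] comp_in[OF kh(1) qb(2)]] jm kh(1) by metis
  then have "j' \<cdot> (n \<cdot> m) = j' \<cdot> idm E K" using assoc[OF m(1) n(1) kh(1)] n(2) comp_id[OF kh(1)] by simp
  then have nm: "n \<cdot> m = idm E K" using Conf_mono[OF K comp_in[OF m(1) n(1)]] KO by simp
  have "iso K B m" using m n mn nm by (auto simp: iso_def)
  then have im: "iso_mor E K B m" "iso_mor E R R (idm E R)" "iso_mor E A A (idm E A)"
    using iso_mor_eq O KO by auto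
  have "Conf E B j R q A"
    by (rule Conf_iso[OF K _ _ _ _ _ im])
      (use O KO j kh qb jmj id_comp[OF kh(1)] id_comp[OF qb(1)] comp_id[OF qb(1)] in \<open>auto dest: homD\<close>)
  then show thesis using that[of j R q b] qb j un by blast
qed

lemma Conf_pullback_square:
  assumes "Conf E B i Q p Z" "\<beta> \<in> hom A Z"
  obtains R j q b where "Conf E B j R q A" "b \<in> hom R Q" "p \<cdot> b = \<beta> \<cdot> q" "b \<cdot> j = i"
  by (rule Conf_pullback[OF assms]) (rule that)

text \<open>Vanishing of Ext^1(A,B), phrased as splitting so that pullbacks and pushouts apply to it
  directly.\<close>

definition ext0 :: "'o \<Rightarrow> 'o \<Rightarrow> bool" where
  "ext0 A B \<longleftrightarrow> (\<forall>i Q p. Conf E B i Q p A \<longrightarrow> (\<exists>s \<in> hom A Q. p \<cdot> s = idm E A))"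

lemma split_iff:
  assumes C: "Conf E B i Q p A"
  shows "(\<exists>s \<in> hom A Q. p \<cdot> s = idm E A) \<Longrightarrow> (\<exists>r \<in> hom Q B. r \<cdot> i = idm E B)"
proof -
  note h = Conf_hom[OF C] and O = Conf_Ob[OF C]
  assume "\<exists>s \<in> hom A Q. p \<cdot> s = idm E A"
  then obtain s where s: "s \<in> hom A Q" "p \<cdot> s = idm E A" by blast
  have sp: "s \<cdot> p \<in> hom Q Q" using s h by auto
  have d: "idm E Q - s \<cdot> p \<in> hom Q Q" using sp O by auto
  have "p \<cdot> (idm E Q - s \<cdot> p) = 0"
    using comp_minus_right[OF id_in sp h(2)] O comp_id[OF h(2)] assoc[OF h(2) s(1) h(2)] s(2) id_comp[OF h(2)] by simp
  then obtain r where r: "r \<in> hom Q B" "i \<cdot> r = idm E Q - s \<cdot> p" using Conf_lift[OF C d] by metis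
  have "i \<cdot> (r \<cdot> i) = (idm E Q - s \<cdot> p) \<cdot> i" using assoc[OF h(1) r(1) h(1)] r(2) by simp
  also have "\<dots> = i - s \<cdot> (p \<cdot> i)"
    using comp_minus_left[OF h(1) id_in sp] O id_comp[OF h(1)] assoc[OF h(1,2) s(1)] by simp
  also have "\<dots> = i \<cdot> idm E B" using h(3) comp_zero_right[OF s(1)] comp_id[OF h(1)] by simp
  finally have "r \<cdot> i = idm E B" using Conf_mono[OF C comp_in[OF h(1) r(1)] id_in] O by simp
  then show ?thesis using r by blast
qed

end

context finite_exact_category
begin

interpretation op: finite_exact_category "opp E"
  by (rule finite_exact_category_opp) (rule finite_exact_category_axioms)

lemma op_ext0: "op.ext0 A B \<longleftrightarrow> ext0 B A"
proof
  assume "op.ext0 A B"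
  then show "ext0 B A" unfolding op.ext0_def ext0_def op_hom opp_simps
    using op.split_iff by (simp add: op_hom)
next
  assume "ext0 B A"
  then show "op.ext0 A B" unfolding op.ext0_def ext0_def op_hom opp_simps
    using split_iff by blast
qed

lemma ext0_lift:
  assumes "ext0 A B" "Conf E B i Q p Z" "\<beta> \<in> hom A Z"
  obtains \<beta>' where "\<beta>' \<in> hom A Q" "p \<cdot> \<beta>' = \<beta>"
proof -
  obtain R j q b where R: "Conf E B j R q A" "b \<in> hom R Q" "p \<cdot> b = \<beta> \<cdot> q"
    by (rule Conf_pullback_square[OF assms(2,3)]) (rule that)
  obtain s where s: "s \<in> hom A R" "q \<cdot> s = idm E A" using assms(1) R(1) unfolding ext0_def by blast
  have "p \<cdot> (b \<cdot> s) = \<beta>"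
    using assoc[OF s(1) R(2) Conf_hom(2)[OF assms(2)]] R(3) assoc[OF s(1) Conf_hom(2)[OF R(1)] assms(3)] s(2)
      comp_id[OF assms(3)] by simp
  then show thesis using that R s by blast
qed

end

context finite_exact_category
begin

interpretation op: finite_exact_category "opp E"
  by (rule finite_exact_category_opp) (rule finite_exact_category_axioms)

lemma ext0_extend:
  assumes "ext0 A B" "Conf E Z i Q p A" "\<beta> \<in> hom Z B"
  obtains \<beta>' where "\<beta>' \<in> hom Q B" "\<beta>' \<cdot> i = \<beta>"
  using op.ext0_lift[of B A p Q i Z \<beta>] assms by (auto simp: op_ext0 op_hom)

lemma Conf_pushout:
  assumes C: "Conf E A i Q p Z" and \<alpha>: "\<alpha> \<in> hom A B"
  obtains R j q b where "Conf E B j R q Z" "b \<in> hom Q R" "b \<cdot> i = j \<cdot> \<alpha>" "q \<cdot> b = p"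
proof -
  have C': "Conf (opp E) Z p Q i A" and \<alpha>': "\<alpha> \<in> op.hom B A" using C \<alpha> by (simp_all add: op_hom)
  obtain R j q b where "Conf (opp E) Z j R q B" "b \<in> op.hom R Q" "cmp (opp E) i b = cmp (opp E) \<alpha> q" "cmp (opp E) b j = p"
    by (rule op.Conf_pullback[OF C' \<alpha>']) (rule that)
  then show thesis using that[of q R j b] by (simp add: op_hom)
qed

text \<open>The surjectivity part of the five lemma for the morphism \<open>h\<close> of
  conflations. The conflation is pulled back along py, a lift found on the pullback is corrected by
  a morphism from \<open>M\<close>, and it descends to \<open>X\<close> because \<open>h\<close> is
  monic.\<close>

lemma short_five_lift:
  assumes C: "Conf E M s F t N" and C': "Conf E M i Q p N"
    and h: "h \<in> hom F Q" "h \<cdot> s = i \<cdot> u" "p \<cdot> h = t" and u: "iso M M u" and y: "y \<in> hom X Q"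
  obtains z where "z \<in> hom X F" "h \<cdot> z = y"
proof -
  note ch = Conf_hom[OF C] and ch' = Conf_hom[OF C']
  obtain u' where u': "u' \<in> hom M M" "u \<cdot> u' = idm E M" using u by (auto simp: iso_def)
  note uh = iso_in[OF u]
  have mono: "f = 0" if f: "f \<in> hom W F" "h \<cdot> f = 0" for f W
  proof -
    have W: "W \<in> Ob E" using f hom_dom by auto
    have "t \<cdot> f = 0" using assoc[OF f(1) h(1) ch'(2)] h(3) f(2) comp_zero_right[OF ch'(2)] by simp
    then obtain m where m: "m \<in> hom W M" "s \<cdot> m = f" using Conf_lift[OF C f(1)] by metis
    have "i \<cdot> (u \<cdot> m) = i \<cdot> 0"
      using assoc[OF m(1) uh ch'(1)] h(2) assoc[OF m(1) ch(1) h(1)] m(2) f(2) comp_zero_right[OF ch'(1)] by simp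
    then have um: "u \<cdot> m = 0" using Conf_mono[OF C' comp_in[OF m(1) uh] zero_in[OF W hom_dom[OF uh]]] by simp
    obtain v where v: "v \<in> hom M M" "v \<cdot> u = idm E M" using u by (auto simp: iso_def)
    have "m = 0" using assoc[OF m(1) uh v(1)] v(2) id_comp[OF m(1)] um comp_zero_right[OF v(1)] by simp
    then show "f = 0" using m(2) comp_zero_right[OF ch(1)] by simp
  qed
  have py: "p \<cdot> y \<in> hom X N" using y ch' by auto
  obtain R j q b where R: "Conf E M j R q X" "b \<in> hom R F" "t \<cdot> b = (p \<cdot> y) \<cdot> q"
    by (rule Conf_pullback_square[OF C py]) (rule that)
  note rh = Conf_hom[OF R(1)]
  have d: "y \<cdot> q - h \<cdot> b \<in> hom R Q" using y rh h R by auto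
  have "p \<cdot> (y \<cdot> q - h \<cdot> b) = 0"
    using comp_minus_right[OF comp_in[OF rh(2) y] comp_in[OF R(2) h(1)] ch'(2)]
      assoc[OF rh(2) y ch'(2)] assoc[OF R(2) h(1) ch'(2)] h(3) R(3) by simp
  then obtain m where m: "m \<in> hom R M" "i \<cdot> m = y \<cdot> q - h \<cdot> b" using Conf_lift[OF C' d] by metis
  define z where "z = b + s \<cdot> (u' \<cdot> m)"
  have um: "u' \<cdot> m \<in> hom R M" using u' m by auto
  have z: "z \<in> hom R F" unfolding z_def using R um ch by auto
  have "h \<cdot> (s \<cdot> (u' \<cdot> m)) = i \<cdot> m"
    using assoc[OF um ch(1) h(1)] h(2) assoc[OF um uh ch'(1)] assoc[OF m(1) u'(1) uh] u'(2) id_comp[OF m(1)] by simp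
  then have hz: "h \<cdot> z = y \<cdot> q" unfolding z_def
    using comp_add_right[OF R(2) comp_in[OF um ch(1)] h(1)] m(2) by simp
  have "h \<cdot> (z \<cdot> j) = 0"
    using assoc[OF rh(1) z h(1)] hz assoc[OF rh(1,2) y] rh(3) comp_zero_right[OF y] by simp
  then have "z \<cdot> j = 0" using mono[OF comp_in[OF rh(1) z]] by simp
  then obtain z' where z': "z' \<in> hom X F" "z' \<cdot> q = z" using Conf_extend[OF R(1) z] by metis
  have "(h \<cdot> z') \<cdot> q = y \<cdot> q" using assoc[OF rh(2) z'(1) h(1)] z'(2) hz by simp
  then have "h \<cdot> z' = y" using Conf_epi[OF R(1) comp_in[OF z'(1) h(1)] y] by simp
  then show thesis using that z' by blast
qed

end

text \<open>2-Calabi-Yau duality as a bare equivalence: the left side says that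
  \<open>\<alpha>\<close> induces a nonzero map from Ext^1(B,N) to Ext^1(A,N), the right side that
  it induces a nonzero map from Ext^1(N,A) to Ext^1(N,B). These maps are transposes of each other.
  Reversing the arrows exchanges the two sides.\<close>

locale ext_duality = finite_exact_category E
  for E :: "('o, 'm::ab_group_add, 'k::alg_closed_field) exact_cat" (structure) +
  assumes duality: "\<alpha> \<in> hom A B \<Longrightarrow> N \<in> Ob E \<Longrightarrow>
    (\<exists>F i p. Conf E N i F p B \<and> \<not> (\<exists>\<alpha>' \<in> hom A F. p \<cdot> \<alpha>' = \<alpha>))
    \<longleftrightarrow> (\<exists>Q j q. Conf E A j Q q N \<and> \<not> (\<exists>\<alpha>' \<in> hom Q B. \<alpha>' \<cdot> j = \<alpha>))"
begin

text \<open>The extension dual to the obstruction against lifting \<open>\<alpha>\<close> is, after pushing it out along \<open>\<alpha>\<close>,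
  the second exchange conflation; since \<open>\<beta>\<close> lifts to the former, it lifts to the latter.\<close>

lemma exchange_lift:
  assumes C: "Conf E N i F p M" and C': "Conf E M s F' t N" and e: "ext0 F' M"
    and rad: "\<And>u. u \<in> hom M M \<Longrightarrow> \<not> iso M M u \<Longrightarrow> \<exists>v \<in> hom F' M. u = v \<cdot> s"
    and e': "ext0 X' X" and \<alpha>: "\<alpha> \<in> hom X M" "\<not> (\<exists>\<alpha>' \<in> hom X F. p \<cdot> \<alpha>' = \<alpha>)"
    and \<beta>: "\<beta> \<in> hom X' N"
  shows "\<exists>\<beta>' \<in> hom X' F'. t \<cdot> \<beta>' = \<beta>"
proof -
  have O: "N \<in> Ob E" "M \<in> Ob E" using Conf_Ob[OF C] by auto
  note ch' = Conf_hom[OF C']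
  obtain Q j q where Q: "Conf E X j Q q N" and ne: "\<not> (\<exists>\<alpha>' \<in> hom Q M. \<alpha>' \<cdot> j = \<alpha>)"
    using duality[OF \<alpha>(1) O(1)] C \<alpha>(2) by blast
  note qh = Conf_hom[OF Q]
  obtain Q' i' p' b where Q': "Conf E M i' Q' p' N" "b \<in> hom Q Q'" "b \<cdot> j = i' \<cdot> \<alpha>" "p' \<cdot> b = q"
    using Conf_pushout[OF Q \<alpha>(1)] .
  note qh' = Conf_hom[OF Q'(1)]
  \<comment> \<open>A splitting of the pushout would extend \<open>\<alpha>\<close> over
    \<open>Q\<close>, which has been excluded.\<close>
  have ns: "\<not> (\<exists>w \<in> hom N Q'. p' \<cdot> w = idm E N)"
  proof
    assume "\<exists>w \<in> hom N Q'. p' \<cdot> w = idm E N"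
    then obtain r where r: "r \<in> hom Q' M" "r \<cdot> i' = idm E M" using split_iff[OF Q'(1)] by blast
    have "(r \<cdot> b) \<cdot> j = \<alpha>"
      using assoc[OF qh(1) Q'(2) r(1)] Q'(3) assoc[OF \<alpha>(1) qh'(1) r(1)] r(2) id_comp[OF \<alpha>(1)] by simp
    then show False using ne r Q'(2) by blast
  qed
  obtain h where h: "h \<in> hom F' Q'" "p' \<cdot> h = t" using ext0_lift[OF e Q'(1) ch'(2)] .
  have "p' \<cdot> (h \<cdot> s) = 0" using assoc[OF ch'(1) h(1) qh'(2)] h(2) ch'(3) by simp
  then obtain u where u: "u \<in> hom M M" "i' \<cdot> u = h \<cdot> s" using Conf_lift[OF Q'(1) comp_in[OF ch'(1) h(1)]] by metis
  \<comment> \<open>A non-invertible \<open>u\<close> would factor through \<open>s\<close>;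
    subtracting that factorization from \<open>h\<close> gives a morphism which descends to
    \<open>N\<close> and splits the pushout.\<close>
  have iu: "iso M M u"
  proof (rule ccontr)
    assume "\<not> iso M M u"
    then obtain v where v: "v \<in> hom F' M" "u = v \<cdot> s" using rad u by blast
    have iv: "i' \<cdot> v \<in> hom F' Q'" using v qh' by auto
    have "(h - i' \<cdot> v) \<cdot> s = 0"
      using comp_minus_left[OF ch'(1) h(1) iv] assoc[OF ch'(1) v(1) qh'(1)] u(2) v(2) by simp
    then obtain w where w: "w \<in> hom N Q'" "w \<cdot> t = h - i' \<cdot> v" using Conf_extend[OF C' minus_in[OF h(1) iv]] by metis
    have "(p' \<cdot> w) \<cdot> t = p' \<cdot> (h - i' \<cdot> v)" using assoc[OF ch'(2) w(1) qh'(2)] w(2) by simp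
    also have "\<dots> = t"
      using comp_minus_right[OF h(1) iv qh'(2)] h(2) assoc[OF v(1) qh'(1,2)] qh'(3) comp_zero_left[OF v(1)] by simp
    finally have "(p' \<cdot> w) \<cdot> t = idm E N \<cdot> t" using id_comp[OF ch'(2)] by simp
    then have "p' \<cdot> w = idm E N" using Conf_epi[OF C' comp_in[OF w(1) qh'(2)] id_in] O by simp
    then show False using ns w by blast
  qed
  obtain \<gamma> where \<gamma>: "\<gamma> \<in> hom X' Q" "q \<cdot> \<gamma> = \<beta>" using ext0_lift[OF e' Q \<beta>] .
  obtain z where z: "z \<in> hom X' F'" "h \<cdot> z = b \<cdot> \<gamma>"
    using short_five_lift[OF C' Q'(1) h(1) u(2)[symmetric] h(2) iu comp_in[OF \<gamma>(1) Q'(2)]] .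
  have "t \<cdot> z = \<beta>"
    using assoc[OF z(1) h(1) qh'(2)] h(2) z(2) assoc[OF \<gamma>(1) Q'(2) qh'(2)] Q'(4) \<gamma>(2) by simp
  then show ?thesis using z by blast
qed

end

lemma ext_duality_opp:
  assumes "ext_duality E" shows "ext_duality (opp E)"
proof -
  interpret ext_duality E by fact
  interpret op: finite_exact_category "opp E"
    by (rule finite_exact_category_opp) (rule finite_exact_category_axioms)
  show ?thesis
  proof
    fix \<alpha> A B N assume "\<alpha> \<in> op.hom A B" "N \<in> Ob (opp E)"
    then show "(\<exists>F i p. Conf (opp E) N i F p B \<and> \<not> (\<exists>\<alpha>'\<in>op.hom A F. cmp (opp E) p \<alpha>' = \<alpha>)) \<longleftrightarrow>
        (\<exists>Q j q. Conf (opp E) A j Q q N \<and> \<not> (\<exists>\<alpha>'\<in>op.hom Q B. cmp (opp E) \<alpha>' j = \<alpha>))"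
      using duality[of \<alpha> B A N] unfolding op_hom opp_simps by blast
  qed
qed

section \<open>The stable category and the suspension\<close>

locale frobenius_2cy = frobenius_2cy_category E
  for E :: "('o, 'm::ab_group_add, 'k::alg_closed_field) exact_cat" (structure)

sublocale frobenius_2cy \<subseteq> finite_exact_category E
  using Hom_finite split_idempotents by unfold_locales blast+

context finite_exact_category
begin

interpretation op: finite_exact_category "opp E"
  by (rule finite_exact_category_opp) (rule finite_exact_category_axioms)

lemma split_iff':
  "Conf E B i Q p A \<Longrightarrow> \<exists>r \<in> hom Q B. r \<cdot> i = idm E B \<Longrightarrow> \<exists>s \<in> hom A Q. p \<cdot> s = idm E A"
  using op.split_iff[of A p Q i B] by (simp add: op_hom)

end

context frobenius_2cy
begin

abbreviation "PF \<equiv> proj_factoring E"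

lemma projective_lift:
  assumes "projective E P" "Conf E X f M g Y" "h \<in> hom P Y"
  obtains h' where "h' \<in> hom P M" "g \<cdot> h' = h"
proof -
  have "deflation E M Y g" "h \<in> Hom E P Y" "P \<in> Ob E" "M \<in> Ob E"
    using assms Conf_Ob[OF assms(2)] by (auto simp: deflation_def dest: homD)
  then show thesis using assms(1) that unfolding projective_def by (metis homI)
qed

lemma injective_extend:
  assumes "injective E I" "Conf E X f M g Y" "h \<in> hom X I"
  obtains h' where "h' \<in> hom M I" "h' \<cdot> f = h"
proof -
  have "inflation E X M f" "h \<in> Hom E X I" "I \<in> Ob E" "M \<in> Ob E"
    using assms Conf_Ob[OF assms(2)] by (auto simp: inflation_def dest: homD)
  then show thesis using assms(1) that unfolding injective_def by (metis homI)
qed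

lemma PF_I: "projective E P \<Longrightarrow> u \<in> hom X P \<Longrightarrow> v \<in> hom P Y \<Longrightarrow> v \<cdot> u \<in> PF X Y"
  unfolding proj_factoring_def using homD by blast

lemma PF_E:
  assumes "f \<in> PF X Y" "X \<in> Ob E" "Y \<in> Ob E"
  obtains P u v where "projective E P" "u \<in> hom X P" "v \<in> hom P Y" "f = v \<cdot> u"
proof -
  obtain P u v where h: "projective E P" "u \<in> Hom E X P" "v \<in> Hom E P Y" "f = v \<cdot> u"
    using assms(1) unfolding proj_factoring_def by blast
  then have "P \<in> Ob E" by (simp add: projective_def)
  then show thesis using that[OF h(1) _ _ h(4)] h assms homI by blast
qed

lemma PF_hom: "f \<in> PF X Y \<Longrightarrow> X \<in> Ob E \<Longrightarrow> Y \<in> Ob E \<Longrightarrow> f \<in> hom X Y"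
  by (erule PF_E) auto

lemma PF_left: assumes "f \<in> PF X Y" "X \<in> Ob E" "g \<in> hom Y Z" shows "g \<cdot> f \<in> PF X Z"
proof -
  obtain P u v where h: "projective E P" "u \<in> hom X P" "v \<in> hom P Y" "f = v \<cdot> u"
    using PF_E[OF assms(1,2) hom_dom[OF assms(3)]] .
  then show ?thesis using PF_I[OF h(1,2) comp_in[OF h(3) assms(3)]] assoc[OF h(2,3) assms(3)] by simp
qed

lemma PF_right: assumes "f \<in> PF X Y" "Y \<in> Ob E" "g \<in> hom W X" shows "f \<cdot> g \<in> PF W Y"
proof -
  obtain P u v where h: "projective E P" "u \<in> hom X P" "v \<in> hom P Y" "f = v \<cdot> u"
    using PF_E[OF assms(1) hom_cod[OF assms(3)] assms(2)] .
  then show ?thesis using PF_I[OF h(1) comp_in[OF assms(3) h(2)] h(3)] assoc[OF assms(3) h(2,3)] by simp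
qed

lemma PF_zero: assumes "X \<in> Ob E" "Y \<in> Ob E" shows "0 \<in> PF X Y"
proof -
  obtain P g where P: "projective E P" using enough_projectives[OF assms(1)] by blast
  then have "P \<in> Ob E" by (simp add: projective_def)
  then show ?thesis using PF_I[OF P zero_in zero_in, of X Y] assms comp_zero_right[OF zero_in] by simp
qed

lemma projective_sum:
  assumes "projective E P" "projective E P'"
  obtains R i1 i2 p1 p2 where "projective E R" "i1 \<in> hom P R" "i2 \<in> hom P' R" "p1 \<in> hom R P" "p2 \<in> hom R P'"
    "p1 \<cdot> i1 = idm E P" "p2 \<cdot> i2 = idm E P'" "p1 \<cdot> i2 = 0" "p2 \<cdot> i1 = 0"
proof -
  have O: "P \<in> Ob E" "P' \<in> Ob E" using assms by (auto simp: projective_def)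
  define A where "A n = (if n = (1::nat) then P else P')" for n
  have "A i \<in> Ob E" for i using O by (simp add: A_def)
  then obtain R where "direct_sum E R 2 A" using direct_sum_exists[of 2 A] by blast
  then obtain i1 i2 p1 p2 where h: "R \<in> Ob E" "A 1 \<in> Ob E" "A 2 \<in> Ob E"
    "i1 \<in> hom (A 1) R" "i2 \<in> hom (A 2) R" "p1 \<in> hom R (A 1)" "p2 \<in> hom R (A 2)"
    "p1 \<cdot> i1 = idm E (A 1)" "p2 \<cdot> i2 = idm E (A 2)" "p1 \<cdot> i2 = 0" "p2 \<cdot> i1 = 0"
    "i1 \<cdot> p1 + i2 \<cdot> p2 = idm E R"
    by (rule direct_sum_2E)
  then have k: "i1 \<in> hom P R" "i2 \<in> hom P' R" "p1 \<in> hom R P" "p2 \<in> hom R P'" by (simp_all add: A_def)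
  have "\<exists>w \<in> Hom E R M. g \<cdot> w = v" if "deflation E M Y g" "v \<in> Hom E R Y" for M Y g v
  proof -
    obtain X f where C: "Conf E X f M g Y" using \<open>deflation E M Y g\<close> by (auto simp: deflation_def)
    note ch = Conf_hom[OF C]
    have v: "v \<in> hom R Y" using that h Conf_Ob[OF C] homI by blast
    obtain a where a: "a \<in> hom P M" "g \<cdot> a = v \<cdot> i1" using projective_lift[OF assms(1) C comp_in[OF k(1) v]] .
    obtain b where b: "b \<in> hom P' M" "g \<cdot> b = v \<cdot> i2" using projective_lift[OF assms(2) C comp_in[OF k(2) v]] .
    have ab: "a \<cdot> p1 \<in> hom R M" "b \<cdot> p2 \<in> hom R M" using a b k by auto
    have "g \<cdot> (a \<cdot> p1 + b \<cdot> p2) = v \<cdot> (i1 \<cdot> p1) + v \<cdot> (i2 \<cdot> p2)"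
      using comp_add_right[OF ab ch(2)] assoc[OF k(3) a(1) ch(2)] assoc[OF k(4) b(1) ch(2)] a b
        assoc[OF k(3,1) v] assoc[OF k(4,2) v] by simp
    also have "\<dots> = v" using comp_add_right[OF comp_in[OF k(3,1)] comp_in[OF k(4,2)] v] h(12) comp_id[OF v] by simp
    finally show ?thesis using homD[OF add_in[OF ab]] by blast
  qed
  then have "projective E R" using h(1) by (auto simp: projective_def)
  then show thesis using that k h by (simp add: A_def)
qed

lemma PF_add: assumes "f \<in> PF X Y" "f' \<in> PF X Y" "X \<in> Ob E" "Y \<in> Ob E" shows "f + f' \<in> PF X Y"
proof -
  obtain P u v where h: "projective E P" "u \<in> hom X P" "v \<in> hom P Y" "f = v \<cdot> u" using PF_E[OF assms(1,3,4)] .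
  obtain P' u' v' where h': "projective E P'" "u' \<in> hom X P'" "v' \<in> hom P' Y" "f' = v' \<cdot> u'" using PF_E[OF assms(2-4)] .
  obtain R i1 i2 p1 p2 where R: "projective E R" "i1 \<in> hom P R" "i2 \<in> hom P' R" "p1 \<in> hom R P" "p2 \<in> hom R P'"
    "p1 \<cdot> i1 = idm E P" "p2 \<cdot> i2 = idm E P'" "p1 \<cdot> i2 = 0" "p2 \<cdot> i1 = 0" using projective_sum[OF h(1) h'(1)] .
  define a where "a = i1 \<cdot> u + i2 \<cdot> u'"
  have iu: "i1 \<cdot> u \<in> hom X R" "i2 \<cdot> u' \<in> hom X R" using h h' R by auto
  have a: "a \<in> hom X R" unfolding a_def using iu by auto
  have pa: "p1 \<cdot> a = u" "p2 \<cdot> a = u'" unfolding a_def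
    using comp_add_right[OF iu R(4)] comp_add_right[OF iu R(5)] assoc[OF h(2) R(2,4)] assoc[OF h'(2) R(3,4)]
      assoc[OF h(2) R(2,5)] assoc[OF h'(2) R(3,5)] R(6-9) id_comp[OF h(2)] id_comp[OF h'(2)]
      comp_zero_left[OF h(2)] comp_zero_left[OF h'(2)] by simp_all
  have vp: "v \<cdot> p1 \<in> hom R Y" "v' \<cdot> p2 \<in> hom R Y" using h h' R by auto
  have "(v \<cdot> p1 + v' \<cdot> p2) \<cdot> a = f + f'"
    using comp_add_left[OF a vp] assoc[OF a R(4) h(3)] assoc[OF a R(5) h'(3)] pa h h' by simp
  then show ?thesis using PF_I[OF R(1) a add_in[OF vp]] by simp
qed

lemma PF_uminus: assumes "f \<in> PF X Y" "X \<in> Ob E" "Y \<in> Ob E" shows "- f \<in> PF X Y"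
proof -
  have "(- idm E Y) \<cdot> f = - f"
    using comp_uminus_left[OF PF_hom[OF assms] id_in[OF assms(3)]] id_comp[OF PF_hom[OF assms]] by simp
  then show ?thesis using PF_left[OF assms(1,2) uminus_in[OF id_in[OF assms(3)]]] by simp
qed

lemma PF_diff: "f \<in> PF X Y \<Longrightarrow> f' \<in> PF X Y \<Longrightarrow> X \<in> Ob E \<Longrightarrow> Y \<in> Ob E \<Longrightarrow> f - f' \<in> PF X Y"
  using PF_add[of f X Y "- f'"] PF_uminus by simp

lemma mem_stable_class: "g \<in> stable_class E X Y f \<longleftrightarrow> g - f \<in> PF X Y"
  unfolding stable_class_def by (force simp: algebra_simps)

lemma stable_class_eq_iff:
  assumes "X \<in> Ob E" "Y \<in> Ob E"
  shows "stable_class E X Y f = stable_class E X Y f' \<longleftrightarrow> f - f' \<in> PF X Y"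
proof
  assume e: "stable_class E X Y f = stable_class E X Y f'"
  have "f \<in> stable_class E X Y f" using PF_zero[OF assms] by (simp add: mem_stable_class)
  then show "f - f' \<in> PF X Y" using e by (simp add: mem_stable_class)
next
  assume e: "f - f' \<in> PF X Y"
  have "g - f \<in> PF X Y \<longleftrightarrow> g - f' \<in> PF X Y" for g
    using PF_add[of "g - f" X Y "f - f'"] PF_diff[of "g - f'" X Y "f - f'"] e assms by auto
  then show "stable_class E X Y f = stable_class E X Y f'" by (auto simp: mem_stable_class)
qed

lemma stable_class_zero: "X \<in> Ob E \<Longrightarrow> Y \<in> Ob E \<Longrightarrow> f \<in> PF X Y \<Longrightarrow> stable_class E X Y f = PF X Y"
  using stable_class_eq_iff[of X Y f 0] by (simp add: stable_class_def)

lemma stable_class_PF: "X \<in> Ob E \<Longrightarrow> Y \<in> Ob E \<Longrightarrow> stable_class E X Y f = PF X Y \<longleftrightarrow> f \<in> PF X Y"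
  using stable_class_eq_iff[of X Y f 0] by (simp add: stable_class_def)

lemma stable_cmp_class:
  assumes f: "f \<in> hom X Y" and g: "g \<in> hom Y Z"
  shows "stable_cmp E X Z (stable_class E Y Z g) (stable_class E X Y f) = stable_class E X Z (g \<cdot> f)"
proof -
  have O: "X \<in> Ob E" "Y \<in> Ob E" "Z \<in> Ob E" using f g hom_dom hom_cod by auto
  have "stable_class E X Z (g' \<cdot> f') = stable_class E X Z (g \<cdot> f)"
    if h: "g' \<in> stable_class E Y Z g" "f' \<in> stable_class E X Y f" for g' f'
  proof -
    have p: "g' - g \<in> PF Y Z" "f' - f \<in> PF X Y" using h by (auto simp: mem_stable_class)
    note ph = PF_hom[OF p(1) O(2,3)] PF_hom[OF p(2) O(1,2)]
    have g': "g' \<in> hom Y Z" using add_in[OF ph(1) g] by simp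
    have f': "f' \<in> hom X Y" using add_in[OF ph(2) f] by simp
    have "g' \<cdot> f' - g \<cdot> f = (g' - g) \<cdot> f' + g \<cdot> (f' - f)"
      using comp_minus_left[OF f' g' g] comp_minus_right[OF f' f g] by simp
    also have "\<dots> \<in> PF X Z" using PF_add[OF PF_right[OF p(1) O(3) f'] PF_left[OF p(2) O(1) g] O(1,3)] .
    finally show ?thesis using stable_class_eq_iff O by simp
  qed
  moreover have "g \<in> stable_class E Y Z g" "f \<in> stable_class E X Y f"
    using PF_zero O by (auto simp: mem_stable_class)
  ultimately show ?thesis unfolding stable_cmp_def by blast
qed

end

locale suspension_data = frobenius_2cy E
  for E :: "('o, 'm::ab_group_add, 'k::alg_closed_field) exact_cat" (structure) +
  fixes D :: "('o, 'm) susp_data"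
  assumes D: "is_susp_data E D"
begin

abbreviation "\<Sigma> \<equiv> susp D"
abbreviation "\<iota> \<equiv> susp_in D"
abbreviation "\<rho> \<equiv> susp_out D"
abbreviation "IH \<equiv> susp_inj D"

lemma susp_Conf: "X \<in> Ob E \<Longrightarrow> Conf E X (\<iota> X) (IH X) (\<rho> X) (\<Sigma> X)"
  and susp_injective: "X \<in> Ob E \<Longrightarrow> injective E (IH X)"
  using D by (auto simp: is_susp_data_def)

lemma susp_projective: "X \<in> Ob E \<Longrightarrow> projective E (IH X)"
  using susp_injective projective_iff_injective by blast

lemma susp_Ob: "X \<in> Ob E \<Longrightarrow> \<Sigma> X \<in> Ob E" "X \<in> Ob E \<Longrightarrow> IH X \<in> Ob E"
  using Conf_Ob[OF susp_Conf] by auto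

lemmas susp_hom = Conf_hom[OF susp_Conf]

text \<open>Morphisms from projectives lift along the deflation \<rho> Y, and conversely
  \<open>IH Y\<close> is itself projective. Stable vanishing thus becomes a lifting property with a
  fixed target.\<close>

lemma PF_susp_iff:
  assumes X: "X \<in> Ob E" and Y: "Y \<in> Ob E"
  shows "f \<in> PF X (\<Sigma> Y) \<longleftrightarrow> (\<exists>w \<in> hom X (IH Y). f = \<rho> Y \<cdot> w)"
proof
  assume "f \<in> PF X (\<Sigma> Y)"
  then obtain P u v where h: "projective E P" "u \<in> hom X P" "v \<in> hom P (\<Sigma> Y)" "f = v \<cdot> u"
    using PF_E[OF _ X susp_Ob(1)[OF Y]] by blast
  obtain v' where v': "v' \<in> hom P (IH Y)" "\<rho> Y \<cdot> v' = v" using projective_lift[OF h(1) susp_Conf[OF Y] h(3)] .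
  then show "\<exists>w \<in> hom X (IH Y). f = \<rho> Y \<cdot> w" using h assoc[OF h(2) v'(1) susp_hom(2)[OF Y]]
    by (intro bexI[of _ "v' \<cdot> u"]) auto
qed (use PF_I[OF susp_projective[OF Y] _ susp_hom(2)[OF Y]] in auto)

lemma PF_suspE:
  assumes "f \<in> PF X (\<Sigma> Y)" "X \<in> Ob E" "Y \<in> Ob E"
  obtains w where "w \<in> hom X (IH Y)" "f = \<rho> Y \<cdot> w"
  using assms(1) unfolding PF_susp_iff[OF assms(2,3)] by blast

text \<open>Replaces the suspension of a coset by one representative with an explicit diagram: two
  choices differ by a morphism that factors through \<rho> Y.\<close>

lemma susp_map_class:
  assumes f: "f \<in> hom X Y" and h: "h \<in> hom (IH X) (IH Y)" and f': "f' \<in> hom (\<Sigma> X) (\<Sigma> Y)"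
    and 1: "h \<cdot> \<iota> X = \<iota> Y \<cdot> f" and 2: "f' \<cdot> \<rho> X = \<rho> Y \<cdot> h"
  shows "susp_map E D X Y (stable_class E X Y f) = stable_class E (\<Sigma> X) (\<Sigma> Y) f'"
proof (intro equalityI subsetI)
  have O: "X \<in> Ob E" "Y \<in> Ob E" using f hom_dom hom_cod by auto
  note O' = susp_Ob[OF O(1)] susp_Ob[OF O(2)]
  note sx = susp_hom[OF O(1)] and sy = susp_hom[OF O(2)]
  {
    fix g' assume "g' \<in> susp_map E D X Y (stable_class E X Y f)"
    then obtain g k where g: "g' \<in> hom (\<Sigma> X) (\<Sigma> Y)" "g - f \<in> PF X Y" "k \<in> hom (IH X) (IH Y)"
      "k \<cdot> \<iota> X = \<iota> Y \<cdot> g" "g' \<cdot> \<rho> X = \<rho> Y \<cdot> k"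
      using O' unfolding susp_map_def hom_eq[OF O'(1,3)] hom_eq[OF O'(2,4)] mem_Collect_eq
      by (elim conjE bexE) (simp add: mem_stable_class)
    obtain P u v where p: "projective E P" "u \<in> hom X P" "v \<in> hom P Y" "g - f = v \<cdot> u" using PF_E[OF g(2) O] .
    have gh: "g \<in> hom X Y" using add_in[OF PF_hom[OF g(2) O] f] by simp
    have iP: "injective E P" using p(1) projective_iff_injective by simp
    obtain u' where u': "u' \<in> hom (IH X) P" "u' \<cdot> \<iota> X = u" using injective_extend[OF iP susp_Conf[OF O(1)] p(2)] .
    define e where "e = \<iota> Y \<cdot> (v \<cdot> u')"
    have e: "e \<in> hom (IH X) (IH Y)" unfolding e_def using u' p sy by auto
    have kh: "k - h \<in> hom (IH X) (IH Y)" using g h by auto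
    have "e \<cdot> \<iota> X = \<iota> Y \<cdot> (g - f)" unfolding e_def
      using assoc[OF sx(1) comp_in[OF u'(1) p(3)] sy(1)] assoc[OF sx(1) u'(1) p(3)] u'(2) p(4) by simp
    then have "(k - h - e) \<cdot> \<iota> X = 0"
      using comp_minus_left[OF sx(1) kh e] comp_minus_left[OF sx(1) g(3) h] g(4) 1 comp_minus_right[OF gh f sy(1)] by simp
    then obtain w where w: "w \<in> hom (\<Sigma> X) (IH Y)" "w \<cdot> \<rho> X = k - h - e"
      using Conf_extend[OF susp_Conf[OF O(1)] minus_in[OF kh e]] by metis
    have "\<rho> Y \<cdot> e = 0" unfolding e_def
      using assoc[OF comp_in[OF u'(1) p(3)] sy(1,2)] sy(3) comp_zero_left[OF comp_in[OF u'(1) p(3)]] by simp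
    then have "(\<rho> Y \<cdot> w) \<cdot> \<rho> X = (g' - f') \<cdot> \<rho> X"
      using assoc[OF sx(2) w(1) sy(2)] w(2) comp_minus_right[OF kh e sy(2)] comp_minus_right[OF g(3) h sy(2)]
        comp_minus_left[OF sx(2) g(1) f'] g(5) 2 by simp
    then have "g' - f' = \<rho> Y \<cdot> w"
      using Conf_epi[OF susp_Conf[OF O(1)] comp_in[OF w(1) sy(2)] minus_in[OF g(1) f']] by simp
    then show "g' \<in> stable_class E (\<Sigma> X) (\<Sigma> Y) f'" unfolding mem_stable_class
      using PF_susp_iff[OF O'(1) O(2)] w by blast
  }
  fix g' assume "g' \<in> stable_class E (\<Sigma> X) (\<Sigma> Y) f'"
  then have "g' - f' \<in> PF (\<Sigma> X) (\<Sigma> Y)" by (simp add: mem_stable_class)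
  then obtain w where w: "w \<in> hom (\<Sigma> X) (IH Y)" "g' - f' = \<rho> Y \<cdot> w"
    unfolding PF_susp_iff[OF O'(1) O(2)] by blast
  have rw: "\<rho> Y \<cdot> w \<in> hom (\<Sigma> X) (\<Sigma> Y)" using w sy by auto
  have g'e: "g' = f' + \<rho> Y \<cdot> w" using w(2) by (simp add: algebra_simps)
  then have g': "g' \<in> hom (\<Sigma> X) (\<Sigma> Y)" using f' rw by auto
  have wr: "w \<cdot> \<rho> X \<in> hom (IH X) (IH Y)" using w sx by auto
  define k where "k = h + w \<cdot> \<rho> X"
  have k: "k \<in> hom (IH X) (IH Y)" unfolding k_def using h wr by auto
  have "k \<cdot> \<iota> X = \<iota> Y \<cdot> f" unfolding k_def
    using comp_add_left[OF sx(1) h wr] assoc[OF sx(1,2) w(1)] sx(3) comp_zero_right[OF w(1)] 1 by simp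
  moreover have "g' \<cdot> \<rho> X = \<rho> Y \<cdot> k" unfolding k_def g'e
    using comp_add_left[OF sx(2) f' rw] 2 assoc[OF sx(2) w(1) sy(2)] comp_add_right[OF h wr sy(2)] by simp
  moreover have "f \<in> stable_class E X Y f" using PF_zero[OF O] by (simp add: mem_stable_class)
  ultimately show "g' \<in> susp_map E D X Y (stable_class E X Y f)"
    unfolding susp_map_def using g' k homD by blast
qed

lemma susp_exists:
  assumes f: "f \<in> hom X Y"
  obtains h f' where "h \<in> hom (IH X) (IH Y)" "f' \<in> hom (\<Sigma> X) (\<Sigma> Y)" "h \<cdot> \<iota> X = \<iota> Y \<cdot> f" "f' \<cdot> \<rho> X = \<rho> Y \<cdot> h"
proof -
  have O: "X \<in> Ob E" "Y \<in> Ob E" using f hom_dom hom_cod by auto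
  note sx = susp_hom[OF O(1)] and sy = susp_hom[OF O(2)]
  obtain h where h: "h \<in> hom (IH X) (IH Y)" "h \<cdot> \<iota> X = \<iota> Y \<cdot> f"
    using injective_extend[OF susp_injective[OF O(2)] susp_Conf[OF O(1)] comp_in[OF f sy(1)]] .
  have "(\<rho> Y \<cdot> h) \<cdot> \<iota> X = 0"
    using assoc[OF sx(1) h(1) sy(2)] h(2) assoc[OF f sy(1,2)] sy(3) comp_zero_left[OF f] by simp
  then obtain f' where "f' \<in> hom (\<Sigma> X) (\<Sigma> Y)" "f' \<cdot> \<rho> X = \<rho> Y \<cdot> h"
    using Conf_extend[OF susp_Conf[OF O(1)] comp_in[OF h(1) sy(2)]] by metis
  then show thesis using that h by blast
qed

text \<open>The suspension is full, because the injective object \<open>IH X\<close> is projective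
  and f' can be lifted to the middle terms.\<close>

lemma desusp:
  assumes f': "f' \<in> hom (\<Sigma> X) (\<Sigma> Y)" and O: "X \<in> Ob E" "Y \<in> Ob E"
  obtains h f where "h \<in> hom (IH X) (IH Y)" "f \<in> hom X Y" "h \<cdot> \<iota> X = \<iota> Y \<cdot> f" "f' \<cdot> \<rho> X = \<rho> Y \<cdot> h"
proof -
  note sx = susp_hom[OF O(1)] and sy = susp_hom[OF O(2)]
  obtain h where h: "h \<in> hom (IH X) (IH Y)" "\<rho> Y \<cdot> h = f' \<cdot> \<rho> X"
    using projective_lift[OF susp_projective[OF O(1)] susp_Conf[OF O(2)] comp_in[OF sx(2) f']] .
  have "\<rho> Y \<cdot> (h \<cdot> \<iota> X) = 0"
    using assoc[OF sx(1) h(1) sy(2)] h(2) assoc[OF sx(1,2) f'] sx(3) comp_zero_right[OF f'] by simp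
  then obtain f where "f \<in> hom X Y" "\<iota> Y \<cdot> f = h \<cdot> \<iota> X"
    using Conf_lift[OF susp_Conf[OF O(2)] comp_in[OF sx(1) h(1)]] by metis
  then show thesis using that h by simp
qed

text \<open>Stable morphisms from \<open>B\<close> to the suspension of \<open>N\<close> classify
  the conflations from \<open>N\<close> to \<open>B\<close>. If \<open>\<alpha>\<close> does not
  lift along one with class \<delta>, then \<delta>\<alpha> is stably nonzero. Nondegeneracy pairs
  it nontrivially with some d', which desuspends to the class \<eta> of a conflation from
  \<open>A\<close> to \<open>N\<close>, and the symmetry of the form shows that
  \<open>\<alpha>\<close> does not extend along that one. The converse runs the same way.\<close>

lemma duality_aux:
  fixes t :: "'o \<Rightarrow> 'm set \<Rightarrow> 'k"
  assumes lin: "\<forall>X \<in> Ob E. \<forall>f \<in> Hom E X ((susp D ^^ 2) X). \<forall>g \<in> Hom E X ((susp D ^^ 2) X). \<forall>a b.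
          t X (stable_class E X ((susp D ^^ 2) X) (scl E a f + scl E b g))
          = a * t X (stable_class E X ((susp D ^^ 2) X) f)
            + b * t X (stable_class E X ((susp D ^^ 2) X) g)"
    and nondeg: "\<forall>X \<in> Ob E. \<forall>Y \<in> Ob E. \<forall>c \<in> stable_Hom E X Y.
          (\<forall>d \<in> stable_Hom E Y ((susp D ^^ 2) X). cy_pairing E D t X d c = 0)
          \<longrightarrow> c = PF X Y"
    and sym: "\<forall>p q. p + q = 2 \<longrightarrow> (\<forall>X \<in> Ob E. \<forall>Y \<in> Ob E.
          \<forall>d \<in> stable_Hom E Y ((susp D ^^ q) X). \<forall>c \<in> stable_Hom E X ((susp D ^^ p) Y).
            cy_pairing E D t X (susp_map_pow p E D Y ((susp D ^^ q) X) d) c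
            = (- 1) ^ (p * q) * cy_pairing E D t Y (susp_map_pow q E D X ((susp D ^^ p) Y) c) d)"
    and \<alpha>: "\<alpha> \<in> hom A B" and N: "N \<in> Ob E"
  shows "(\<exists>F i p. Conf E N i F p B \<and> \<not> (\<exists>\<alpha>' \<in> hom A F. p \<cdot> \<alpha>' = \<alpha>))
    \<longleftrightarrow> (\<exists>Q j q. Conf E A j Q q N \<and> \<not> (\<exists>\<alpha>' \<in> hom Q B. \<alpha>' \<cdot> j = \<alpha>))"
proof -
  have O: "A \<in> Ob E" "B \<in> Ob E" using \<alpha> hom_dom hom_cod by auto
  have two: "(\<Sigma> ^^ 2) X = \<Sigma> (\<Sigma> X)" for X by (simp add: numeral_2_eq_2)
  have one: "(\<Sigma> ^^ 1) X = \<Sigma> X" for X by (simp add: One_nat_def)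
  have t0: "t X (PF X (\<Sigma> (\<Sigma> X))) = 0" if X: "X \<in> Ob E" for X
  proof -
    have S: "\<Sigma> (\<Sigma> X) \<in> Ob E" using X susp_Ob by auto
    have z: "0 \<in> Hom E X ((\<Sigma> ^^ 2) X)" unfolding two using zero_in[OF X S] homD by blast
    have "t X (stable_class E X (\<Sigma> (\<Sigma> X)) (scl E 0 0 + scl E 0 0)) = 0"
      using lin[rule_format, OF X z z, of 0 0] unfolding two by simp
    then show ?thesis using stable_class_zero[OF X S PF_zero[OF X S]] by simp
  qed
  have pair: "cy_pairing E D t X (stable_class E Y (\<Sigma> (\<Sigma> X)) d) (stable_class E X Y c)
      = t X (stable_class E X (\<Sigma> (\<Sigma> X)) (d \<cdot> c))" if "c \<in> hom X Y" "d \<in> hom Y (\<Sigma> (\<Sigma> X))" for X Y c d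
    unfolding cy_pairing_def two using stable_cmp_class[OF that] by simp
  have nd: "\<exists>d \<in> hom Y (\<Sigma> (\<Sigma> X)). t X (stable_class E X (\<Sigma> (\<Sigma> X)) (d \<cdot> c)) \<noteq> 0"
    if c: "c \<in> hom X Y" "c \<notin> PF X Y" for c X Y
  proof -
    have O: "X \<in> Ob E" "Y \<in> Ob E" using c hom_dom hom_cod by auto
    have S: "\<Sigma> (\<Sigma> X) \<in> Ob E" using O susp_Ob by auto
    have 1: "stable_class E X Y c \<in> stable_Hom E X Y" using c homD unfolding stable_Hom_def by blast
    have 2: "stable_class E X Y c \<noteq> PF X Y" using stable_class_PF[OF O] c(2) by simp
    obtain d' where d': "d' \<in> stable_Hom E Y ((\<Sigma> ^^ 2) X)" "cy_pairing E D t X d' (stable_class E X Y c) \<noteq> 0"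
      using nondeg[rule_format, OF O 1] 2 by blast
    then obtain d where "d \<in> hom Y (\<Sigma> (\<Sigma> X))" "d' = stable_class E Y (\<Sigma> (\<Sigma> X)) d"
      unfolding two stable_Hom_def hom_eq[OF O(2) S] by blast
    then show ?thesis using d'(2) pair c(1) by auto
  qed
  \<comment> \<open>The symmetry for p = q = 1, where the sign is -1, expressed through
    representatives whose suspensions come with diagrams.\<close>
  have symm: "t X (stable_class E X (\<Sigma> (\<Sigma> X)) (d' \<cdot> c)) = - t Y (stable_class E Y (\<Sigma> (\<Sigma> Y)) (c' \<cdot> d))"
    if d: "d \<in> hom Y (\<Sigma> X)" and c: "c \<in> hom X (\<Sigma> Y)"
      and h: "h \<in> hom (IH Y) (IH (\<Sigma> X))" "d' \<in> hom (\<Sigma> Y) (\<Sigma> (\<Sigma> X))" "h \<cdot> \<iota> Y = \<iota> (\<Sigma> X) \<cdot> d" "d' \<cdot> \<rho> Y = \<rho> (\<Sigma> X) \<cdot> h"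
      and k: "k \<in> hom (IH X) (IH (\<Sigma> Y))" "c' \<in> hom (\<Sigma> X) (\<Sigma> (\<Sigma> Y))" "k \<cdot> \<iota> X = \<iota> (\<Sigma> Y) \<cdot> c" "c' \<cdot> \<rho> X = \<rho> (\<Sigma> Y) \<cdot> k"
    for X Y d c d' c' h k
  proof -
    have O: "X \<in> Ob E" "Y \<in> Ob E" using c d hom_dom by auto
    have "stable_class E Y (\<Sigma> X) d \<in> stable_Hom E Y ((\<Sigma> ^^ 1) X)" "stable_class E X (\<Sigma> Y) c \<in> stable_Hom E X ((\<Sigma> ^^ 1) Y)"
      using c d homD unfolding stable_Hom_def one by auto
    then have "cy_pairing E D t X (susp_map E D Y (\<Sigma> X) (stable_class E Y (\<Sigma> X) d)) (stable_class E X (\<Sigma> Y) c)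
        = - cy_pairing E D t Y (susp_map E D X (\<Sigma> Y) (stable_class E X (\<Sigma> Y) c)) (stable_class E Y (\<Sigma> X) d)"
      using sym[rule_format, of 1 1 X Y] O by (simp add: One_nat_def)
    then show ?thesis
      unfolding susp_map_class[OF d h] susp_map_class[OF c k] pair[OF c h(2)] pair[OF d k(2)] .
  qed
  note sA = susp_hom[OF O(1)] and sB = susp_hom[OF O(2)] and sN = susp_hom[OF N]
  have SA: "\<Sigma> A \<in> Ob E" and SN: "\<Sigma> N \<in> Ob E" and SB: "\<Sigma> B \<in> Ob E" using susp_Ob O N by auto
  note sSA = susp_hom[OF SA] and sSN = susp_hom[OF SN]
  show ?thesis
  proof
    assume "\<exists>F i p. Conf E N i F p B \<and> \<not> (\<exists>\<alpha>' \<in> hom A F. p \<cdot> \<alpha>' = \<alpha>)"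
    then obtain F i p where C: "Conf E N i F p B" and nl: "\<not> (\<exists>\<alpha>' \<in> hom A F. p \<cdot> \<alpha>' = \<alpha>)" by blast
    note ch = Conf_hom[OF C]
    obtain e where e: "e \<in> hom F (IH N)" "e \<cdot> i = \<iota> N" using injective_extend[OF susp_injective[OF N] C sN(1)] .
    have "(\<rho> N \<cdot> e) \<cdot> i = 0" using assoc[OF ch(1) e(1) sN(2)] e(2) sN(3) by simp
    then obtain \<delta> where \<delta>: "\<delta> \<in> hom B (\<Sigma> N)" "\<delta> \<cdot> p = \<rho> N \<cdot> e" using Conf_extend[OF C comp_in[OF e(1) sN(2)]] by metis
    define c where "c = \<delta> \<cdot> \<alpha>"
    have c: "c \<in> hom A (\<Sigma> N)" unfolding c_def using \<alpha> \<delta> by auto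
    have "c \<notin> PF A (\<Sigma> N)"
    proof
      assume cP: "c \<in> PF A (\<Sigma> N)"
      obtain w where w: "w \<in> hom A (IH N)" "c = \<rho> N \<cdot> w" using PF_suspE[OF cP O(1) N] .
      obtain R j q b where R: "Conf E N j R q A" "b \<in> hom R F" "p \<cdot> b = \<alpha> \<cdot> q" "b \<cdot> j = i"
        by (rule Conf_pullback_square[OF C \<alpha>]) (rule that)
      note rh = Conf_hom[OF R(1)]
      have d: "e \<cdot> b \<in> hom R (IH N)" "w \<cdot> q \<in> hom R (IH N)" using e R rh w by auto
      have "\<rho> N \<cdot> (e \<cdot> b) = \<rho> N \<cdot> (w \<cdot> q)"
        using assoc[OF R(2) e(1) sN(2)] \<delta>(2) assoc[OF R(2) ch(2) \<delta>(1)] R(3) assoc[OF rh(2) \<alpha> \<delta>(1)]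
          assoc[OF rh(2) w(1) sN(2)] w(2) by (simp add: c_def)
      then have "\<rho> N \<cdot> (e \<cdot> b - w \<cdot> q) = 0" using comp_minus_right[OF d sN(2)] by simp
      then obtain r where r: "r \<in> hom R N" "\<iota> N \<cdot> r = e \<cdot> b - w \<cdot> q"
        using Conf_lift[OF susp_Conf[OF N] minus_in[OF d]] by metis
      have "\<iota> N \<cdot> (r \<cdot> j) = (e \<cdot> b - w \<cdot> q) \<cdot> j" using assoc[OF rh(1) r(1) sN(1)] r(2) by simp
      also have "\<dots> = \<iota> N \<cdot> idm E N"
        using comp_minus_left[OF rh(1) d] assoc[OF rh(1) R(2) e(1)] R(4) e(2) assoc[OF rh(1,2) w(1)] rh(3)
          comp_zero_right[OF w(1)] comp_id[OF sN(1)] by simp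
      finally have "r \<cdot> j = idm E N" using Conf_mono[OF susp_Conf[OF N] comp_in[OF rh(1) r(1)] id_in[OF N]] by simp
      then obtain s where s: "s \<in> hom A R" "q \<cdot> s = idm E A" using split_iff'[OF R(1)] r(1) by blast
      have "p \<cdot> (b \<cdot> s) = \<alpha>"
        using assoc[OF s(1) R(2) ch(2)] R(3) assoc[OF s(1) rh(2) \<alpha>] s(2) comp_id[OF \<alpha>] by simp
      then show False using nl s R by blast
    qed
    then obtain d' where d': "d' \<in> hom (\<Sigma> N) (\<Sigma> (\<Sigma> A))" "t A (stable_class E A (\<Sigma> (\<Sigma> A)) (d' \<cdot> c)) \<noteq> 0"
      using nd[OF c] by blast
    obtain h \<eta> where h: "h \<in> hom (IH N) (IH (\<Sigma> A))" "\<eta> \<in> hom N (\<Sigma> A)" "h \<cdot> \<iota> N = \<iota> (\<Sigma> A) \<cdot> \<eta>" "d' \<cdot> \<rho> N = \<rho> (\<Sigma> A) \<cdot> h"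
      using desusp[OF d'(1) N SA] .
    obtain k c' where k: "k \<in> hom (IH A) (IH (\<Sigma> N))" "c' \<in> hom (\<Sigma> A) (\<Sigma> (\<Sigma> N))"
      "k \<cdot> \<iota> A = \<iota> (\<Sigma> N) \<cdot> c" "c' \<cdot> \<rho> A = \<rho> (\<Sigma> N) \<cdot> k"
      using susp_exists[OF c] .
    have ne: "t N (stable_class E N (\<Sigma> (\<Sigma> N)) (c' \<cdot> \<eta>)) \<noteq> 0"
      using symm[OF h(2) c h(1) d'(1) h(3,4) k] d'(2) by simp
    \<comment> \<open>The conflation with class \<eta>: the pullback along \<eta> of the conflation
      that defines the suspension of \<open>A\<close>.\<close>
    obtain Q j q a where Q: "Conf E A j Q q N" "a \<in> hom Q (IH A)" "\<rho> A \<cdot> a = \<eta> \<cdot> q" "a \<cdot> j = \<iota> A"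
      by (rule Conf_pullback_square[OF susp_Conf[OF O(1)] h(2)]) (rule that)
    note qh = Conf_hom[OF Q(1)]
    have "\<not> (\<exists>\<alpha>' \<in> hom Q B. \<alpha>' \<cdot> j = \<alpha>)"
    proof
      assume "\<exists>\<alpha>' \<in> hom Q B. \<alpha>' \<cdot> j = \<alpha>"
      then obtain \<alpha>' where a': "\<alpha>' \<in> hom Q B" "\<alpha>' \<cdot> j = \<alpha>" by blast
      \<comment> \<open>Subtracting \<open>g\<close> makes ka vanish on \<open>A\<close> without
        changing its image under \<rho>; hence c' \<eta> lifts along \<rho> and is stably
        zero.\<close>
      define g where "g = \<iota> (\<Sigma> N) \<cdot> (\<delta> \<cdot> \<alpha>')"
      have da: "\<delta> \<cdot> \<alpha>' \<in> hom Q (\<Sigma> N)" using a' \<delta> by auto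
      have g: "g \<in> hom Q (IH (\<Sigma> N))" unfolding g_def using da sSN by auto
      have ka: "k \<cdot> a \<in> hom Q (IH (\<Sigma> N))" using k Q by auto
      have "g \<cdot> j = \<iota> (\<Sigma> N) \<cdot> c" unfolding g_def c_def
        using assoc[OF qh(1) da sSN(1)] assoc[OF qh(1) a'(1) \<delta>(1)] a'(2) by simp
      then have "(k \<cdot> a - g) \<cdot> j = 0"
        using comp_minus_left[OF qh(1) ka g] assoc[OF qh(1) Q(2) k(1)] Q(4) k(3) by simp
      then obtain w where w: "w \<in> hom N (IH (\<Sigma> N))" "w \<cdot> q = k \<cdot> a - g" using Conf_extend[OF Q(1) minus_in[OF ka g]] by metis
      have rg: "\<rho> (\<Sigma> N) \<cdot> g = 0" unfolding g_def
        using assoc[OF da sSN(1,2)] sSN(3) comp_zero_left[OF da] by simp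
      have "(c' \<cdot> \<eta>) \<cdot> q = (\<rho> (\<Sigma> N) \<cdot> w) \<cdot> q"
        using assoc[OF qh(2) h(2) k(2)] Q(3) assoc[OF Q(2) sA(2) k(2)] k(4) assoc[OF Q(2) k(1) sSN(2)]
          assoc[OF qh(2) w(1) sSN(2)] w(2) comp_minus_right[OF ka g sSN(2)] rg by simp
      then have "c' \<cdot> \<eta> = \<rho> (\<Sigma> N) \<cdot> w"
        using Conf_epi[OF Q(1) comp_in[OF h(2) k(2)] comp_in[OF w(1) sSN(2)]] by simp
      then have "c' \<cdot> \<eta> \<in> PF N (\<Sigma> (\<Sigma> N))" using PF_susp_iff[OF N SN] w by blast
      then show False using ne stable_class_zero[OF N susp_Ob(1)[OF SN]] t0[OF N] by simp
    qed
    then show "\<exists>Q j q. Conf E A j Q q N \<and> \<not> (\<exists>\<alpha>' \<in> hom Q B. \<alpha>' \<cdot> j = \<alpha>)" using Q(1) by blast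
  next
    assume "\<exists>Q j q. Conf E A j Q q N \<and> \<not> (\<exists>\<alpha>' \<in> hom Q B. \<alpha>' \<cdot> j = \<alpha>)"
    then obtain Q j q where Q: "Conf E A j Q q N" and ne: "\<not> (\<exists>\<alpha>' \<in> hom Q B. \<alpha>' \<cdot> j = \<alpha>)" by blast
    note qh = Conf_hom[OF Q]
    obtain e where e: "e \<in> hom Q (IH A)" "e \<cdot> j = \<iota> A" using injective_extend[OF susp_injective[OF O(1)] Q sA(1)] .
    have "(\<rho> A \<cdot> e) \<cdot> j = 0" using assoc[OF qh(1) e(1) sA(2)] e(2) sA(3) by simp
    then obtain \<delta> where \<delta>: "\<delta> \<in> hom N (\<Sigma> A)" "\<delta> \<cdot> q = \<rho> A \<cdot> e" using Conf_extend[OF Q comp_in[OF e(1) sA(2)]] by metis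
    obtain h f' where h: "h \<in> hom (IH A) (IH B)" "f' \<in> hom (\<Sigma> A) (\<Sigma> B)" "h \<cdot> \<iota> A = \<iota> B \<cdot> \<alpha>" "f' \<cdot> \<rho> A = \<rho> B \<cdot> h"
      using susp_exists[OF \<alpha>] .
    define f where "f = f' \<cdot> \<delta>"
    have f: "f \<in> hom N (\<Sigma> B)" unfolding f_def using h \<delta> by auto
    have "f \<notin> PF N (\<Sigma> B)"
    proof
      assume fP: "f \<in> PF N (\<Sigma> B)"
      obtain w where w: "w \<in> hom N (IH B)" "f = \<rho> B \<cdot> w" using PF_suspE[OF fP N O(2)] .
      have d: "h \<cdot> e \<in> hom Q (IH B)" "w \<cdot> q \<in> hom Q (IH B)" using h e w qh by auto
      have "\<rho> B \<cdot> (h \<cdot> e) = \<rho> B \<cdot> (w \<cdot> q)"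
        using assoc[OF e(1) h(1) sB(2)] h(4) assoc[OF e(1) sA(2) h(2)] \<delta>(2) assoc[OF qh(2) \<delta>(1) h(2)]
          assoc[OF qh(2) w(1) sB(2)] w(2) by (simp add: f_def)
      then have "\<rho> B \<cdot> (h \<cdot> e - w \<cdot> q) = 0" using comp_minus_right[OF d sB(2)] by simp
      then obtain r where r: "r \<in> hom Q B" "\<iota> B \<cdot> r = h \<cdot> e - w \<cdot> q"
        using Conf_lift[OF susp_Conf[OF O(2)] minus_in[OF d]] by metis
      have "\<iota> B \<cdot> (r \<cdot> j) = (h \<cdot> e - w \<cdot> q) \<cdot> j" using assoc[OF qh(1) r(1) sB(1)] r(2) by simp
      also have "\<dots> = \<iota> B \<cdot> \<alpha>"
        using comp_minus_left[OF qh(1) d] assoc[OF qh(1) e(1) h(1)] e(2) h(3) assoc[OF qh(1,2) w(1)] qh(3)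
          comp_zero_right[OF w(1)] by simp
      finally have "r \<cdot> j = \<alpha>" using Conf_mono[OF susp_Conf[OF O(2)] comp_in[OF qh(1) r(1)] \<alpha>] by simp
      then show False using ne r by blast
    qed
    then obtain d' where d': "d' \<in> hom (\<Sigma> B) (\<Sigma> (\<Sigma> N))" "t N (stable_class E N (\<Sigma> (\<Sigma> N)) (d' \<cdot> f)) \<noteq> 0"
      using nd[OF f] by blast
    obtain k \<zeta> where k: "k \<in> hom (IH B) (IH (\<Sigma> N))" "\<zeta> \<in> hom B (\<Sigma> N)" "k \<cdot> \<iota> B = \<iota> (\<Sigma> N) \<cdot> \<zeta>" "d' \<cdot> \<rho> B = \<rho> (\<Sigma> N) \<cdot> k"
      using desusp[OF d'(1) O(2) SN] .
    obtain F i p b where C: "Conf E N i F p B" "b \<in> hom F (IH N)" "\<rho> N \<cdot> b = \<zeta> \<cdot> p"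
      by (rule Conf_pullback_square[OF susp_Conf[OF N] k(2)]) (rule that)
    note ch = Conf_hom[OF C(1)]
    have "\<not> (\<exists>\<alpha>' \<in> hom A F. p \<cdot> \<alpha>' = \<alpha>)"
    proof
      assume "\<exists>\<alpha>' \<in> hom A F. p \<cdot> \<alpha>' = \<alpha>"
      then obtain \<alpha>' where a': "\<alpha>' \<in> hom A F" "p \<cdot> \<alpha>' = \<alpha>" by blast
      have ba: "b \<cdot> \<alpha>' \<in> hom A (IH N)" using a' C by auto
      obtain g where g: "g \<in> hom (IH A) (IH N)" "g \<cdot> \<iota> A = b \<cdot> \<alpha>'"
        using injective_extend[OF susp_injective[OF N] susp_Conf[OF O(1)] ba] .
      have kh: "k \<cdot> h \<in> hom (IH A) (IH (\<Sigma> N))" using k h by auto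
      have rg: "\<rho> N \<cdot> g \<in> hom (IH A) (\<Sigma> N)" using g sN by auto
      have irg: "\<iota> (\<Sigma> N) \<cdot> (\<rho> N \<cdot> g) \<in> hom (IH A) (IH (\<Sigma> N))" using rg sSN by auto
      have "(k \<cdot> h) \<cdot> \<iota> A = \<iota> (\<Sigma> N) \<cdot> (\<zeta> \<cdot> \<alpha>)"
        using assoc[OF sA(1) h(1) k(1)] h(3) assoc[OF \<alpha> sB(1) k(1)] k(3) assoc[OF \<alpha> k(2) sSN(1)] by simp
      moreover have "\<zeta> \<cdot> \<alpha> = (\<rho> N \<cdot> g) \<cdot> \<iota> A"
        using a'(2) assoc[OF a'(1) ch(2) k(2)] C(3) assoc[OF a'(1) C(2) sN(2)] assoc[OF sA(1) g(1) sN(2)] g(2) by simp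
      ultimately have "(k \<cdot> h - \<iota> (\<Sigma> N) \<cdot> (\<rho> N \<cdot> g)) \<cdot> \<iota> A = 0"
        using comp_minus_left[OF sA(1) kh irg] assoc[OF sA(1) rg sSN(1)] by simp
      then obtain w where w: "w \<in> hom (\<Sigma> A) (IH (\<Sigma> N))" "w \<cdot> \<rho> A = k \<cdot> h - \<iota> (\<Sigma> N) \<cdot> (\<rho> N \<cdot> g)"
        using Conf_extend[OF susp_Conf[OF O(1)] minus_in[OF kh irg]] by metis
      have "\<rho> (\<Sigma> N) \<cdot> (\<iota> (\<Sigma> N) \<cdot> (\<rho> N \<cdot> g)) = 0"
        using assoc[OF rg sSN(1,2)] sSN(3) comp_zero_left[OF rg] by simp
      then have "(d' \<cdot> f') \<cdot> \<rho> A = (\<rho> (\<Sigma> N) \<cdot> w) \<cdot> \<rho> A"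
        using assoc[OF sA(2) h(2) d'(1)] h(4) assoc[OF h(1) sB(2) d'(1)] k(4) assoc[OF h(1) k(1) sSN(2)]
          assoc[OF sA(2) w(1) sSN(2)] w(2) comp_minus_right[OF kh irg sSN(2)] by simp
      then have "d' \<cdot> f' = \<rho> (\<Sigma> N) \<cdot> w"
        using Conf_epi[OF susp_Conf[OF O(1)] comp_in[OF h(2) d'(1)] comp_in[OF w(1) sSN(2)]] by simp
      then have "d' \<cdot> f = \<rho> (\<Sigma> N) \<cdot> (w \<cdot> \<delta>)"
        using assoc[OF \<delta>(1) h(2) d'(1)] assoc[OF \<delta>(1) w(1) sSN(2)] by (simp add: f_def)
      then have "d' \<cdot> f \<in> PF N (\<Sigma> (\<Sigma> N))" using PF_susp_iff[OF N SN] w \<delta> by blast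
      then show False using d'(2) stable_class_zero[OF N susp_Ob(1)[OF SN]] t0[OF N] by simp
    qed
    then show "\<exists>F i p. Conf E N i F p B \<and> \<not> (\<exists>\<alpha>' \<in> hom A F. p \<cdot> \<alpha>' = \<alpha>)" using C(1) by blast
  qed
qed

end

context frobenius_2cy
begin

theorem duality:
  assumes \<alpha>: "\<alpha> \<in> hom A B" and N: "N \<in> Ob E"
  shows "(\<exists>F i p. Conf E N i F p B \<and> \<not> (\<exists>\<alpha>' \<in> hom A F. p \<cdot> \<alpha>' = \<alpha>))
    \<longleftrightarrow> (\<exists>Q j q. Conf E A j Q q N \<and> \<not> (\<exists>\<alpha>' \<in> hom Q B. \<alpha>' \<cdot> j = \<alpha>))"
proof -
  obtain D :: "('o, 'm) susp_data" and t :: "'o \<Rightarrow> 'm set \<Rightarrow> 'k" where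
    D: "is_susp_data E D"
    and lin: "\<forall>X \<in> Ob E. \<forall>f \<in> Hom E X ((susp D ^^ 2) X). \<forall>g \<in> Hom E X ((susp D ^^ 2) X). \<forall>a b.
          t X (stable_class E X ((susp D ^^ 2) X) (scl E a f + scl E b g))
          = a * t X (stable_class E X ((susp D ^^ 2) X) f)
            + b * t X (stable_class E X ((susp D ^^ 2) X) g)"
    and nondeg: "\<forall>X \<in> Ob E. \<forall>Y \<in> Ob E. \<forall>c \<in> stable_Hom E X Y.
          (\<forall>d \<in> stable_Hom E Y ((susp D ^^ 2) X). cy_pairing E D t X d c = 0)
          \<longrightarrow> c = PF X Y"
    and sym: "\<forall>p q. p + q = 2 \<longrightarrow> (\<forall>X \<in> Ob E. \<forall>Y \<in> Ob E.
          \<forall>d \<in> stable_Hom E Y ((susp D ^^ q) X). \<forall>c \<in> stable_Hom E X ((susp D ^^ p) Y).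
            cy_pairing E D t X (susp_map_pow p E D Y ((susp D ^^ q) X) d) c
            = (- 1) ^ (p * q) * cy_pairing E D t Y (susp_map_pow q E D X ((susp D ^^ p) Y) c) d)"
    using stably_2cy unfolding stably_2_calabi_yau_def by (elim exE conjE) (rule that)
  have sd: "suspension_data E D" by unfold_locales (rule D)
  show ?thesis by (rule suspension_data.duality_aux[OF sd lin nondeg sym \<alpha> N])
qed

end

sublocale frobenius_2cy \<subseteq> ext_duality E
  by unfold_locales (rule duality)

section \<open>Cluster-tilting seeds and dimensions\<close>

context finite_exact_category
begin

definition dh :: "'o \<Rightarrow> 'o \<Rightarrow> int" where "dh X Y = int (vs.dim (hom X Y))"

lemma Conf_dim:
  assumes C: "Conf E X f Y g Z" and W: "W \<in> Ob E"
  shows "vs.dim (hom W Y) = vs.dim (hom W X) + vs.dim ((\<lambda>v. g \<cdot> v) ` hom W Y)"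
proof -
  note ch = Conf_hom[OF C] and O = Conf_Ob[OF C]
  obtain S where S: "finite S" "hom W Y \<subseteq> vs.span S" using hom_finite_span W O by metis
  obtain S' where S': "finite S'" "hom W X \<subseteq> vs.span S'" using hom_finite_span W O by metis
  have 1: "vs.dim (hom W Y) = vs.dim {v \<in> hom W Y. g \<cdot> v = 0} + vs.dim ((\<lambda>v. g \<cdot> v) ` hom W Y)"
    by (rule vs.dim_kernel_image[OF subspace_hom S])
      (use W O comp_add_right[OF _ _ ch(2)] comp_scl_right[OF _ ch(2)] in auto)
  have 2: "vs.dim (hom W X) = vs.dim {v \<in> hom W X. f \<cdot> v = 0} + vs.dim ((\<lambda>v. f \<cdot> v) ` hom W X)"
    by (rule vs.dim_kernel_image[OF subspace_hom S'])
      (use W O comp_add_right[OF _ _ ch(1)] comp_scl_right[OF _ ch(1)] in auto)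
  have "v = 0" if "v \<in> hom W X" "f \<cdot> v = 0" for v
    using Conf_mono[OF C that(1) zero_in] that(2) comp_zero_right[OF ch(1)] W O by simp
  then have 3: "{v \<in> hom W X. f \<cdot> v = 0} = {0}" using W O comp_zero_right[OF ch(1)] by auto
  have "(\<lambda>v. f \<cdot> v) ` hom W X = {v \<in> hom W Y. g \<cdot> v = 0}"
  proof (intro equalityI subsetI)
    fix v assume "v \<in> (\<lambda>v. f \<cdot> v) ` hom W X"
    then obtain u where u: "u \<in> hom W X" "v = f \<cdot> u" by blast
    then show "v \<in> {v \<in> hom W Y. g \<cdot> v = 0}"
      using assoc[OF u(1) ch(1,2)] ch comp_zero_left[OF u(1)] by auto
  next
    fix v assume "v \<in> {v \<in> hom W Y. g \<cdot> v = 0}"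
    then have v: "v \<in> hom W Y" "g \<cdot> v = 0" by auto
    obtain u where "u \<in> hom W X" "f \<cdot> u = v" using Conf_lift[OF C v] .
    then show "v \<in> (\<lambda>v. f \<cdot> v) ` hom W X" by blast
  qed
  then show ?thesis using 1 2 unfolding 3 by simp
qed

text \<open>The quantity is the dimension of the cokernel of composition with \<open>g\<close>, that
  is, the defect of exactness of Hom(W,-) on the conflation.\<close>

lemma Conf_dim_ge:
  assumes C: "Conf E X f Y g Z" and W: "W \<in> Ob E"
  shows "dh W X + dh W Z - dh W Y \<ge> 0"
    and "dh W X + dh W Z - dh W Y = int (vs.dim (hom W Z)) - int (vs.dim ((\<lambda>v. g \<cdot> v) ` hom W Y))"
    and "(\<forall>h \<in> hom W Z. \<exists>h' \<in> hom W Y. g \<cdot> h' = h) \<Longrightarrow> dh W X + dh W Z - dh W Y = 0"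
proof -
  note ch = Conf_hom[OF C] and O = Conf_Ob[OF C]
  show 2: "dh W X + dh W Z - dh W Y = int (vs.dim (hom W Z)) - int (vs.dim ((\<lambda>v. g \<cdot> v) ` hom W Y))"
    using Conf_dim[OF C W] by (simp add: dh_def)
  have sub: "(\<lambda>v. g \<cdot> v) ` hom W Y \<subseteq> hom W Z" using ch by auto
  have "vs.subspace ((\<lambda>v. g \<cdot> v) ` hom W Y)"
  proof (rule vs.subspaceI)
    show "0 \<in> (\<lambda>v. g \<cdot> v) ` hom W Y" using comp_zero_right[OF ch(2)] W O by (intro image_eqI[of _ _ 0]) auto
    fix x y assume "x \<in> (\<lambda>v. g \<cdot> v) ` hom W Y" "y \<in> (\<lambda>v. g \<cdot> v) ` hom W Y"
    then obtain a b where "a \<in> hom W Y" "b \<in> hom W Y" "x = g \<cdot> a" "y = g \<cdot> b" by auto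
    then show "x + y \<in> (\<lambda>v. g \<cdot> v) ` hom W Y"
      using comp_add_right[OF _ _ ch(2)] by (intro image_eqI[of _ _ "a + b"]) auto
  next
    fix c x assume "x \<in> (\<lambda>v. g \<cdot> v) ` hom W Y"
    then obtain a where "a \<in> hom W Y" "x = g \<cdot> a" by auto
    then show "scl E c x \<in> (\<lambda>v. g \<cdot> v) ` hom W Y"
      using comp_scl_right[OF _ ch(2)] by (intro image_eqI[of _ _ "scl E c a"]) auto
  qed
  moreover obtain S where "finite S" "hom W Z \<subseteq> vs.span S" using hom_finite_span W O by metis
  ultimately have "vs.dim ((\<lambda>v. g \<cdot> v) ` hom W Y) \<le> vs.dim (hom W Z)"
    using vs.dim_mono_finite(1)[OF subspace_hom[OF W] _ _ _ sub] O by blast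
  then show "dh W X + dh W Z - dh W Y \<ge> 0" using 2 by simp
  assume l: "\<forall>h \<in> hom W Z. \<exists>h' \<in> hom W Y. g \<cdot> h' = h"
  have "hom W Z \<subseteq> (\<lambda>v. g \<cdot> v) ` hom W Y"
  proof
    fix h assume h: "h \<in> hom W Z"
    obtain h' where "h' \<in> hom W Y" "g \<cdot> h' = h" using bspec[OF l h] by (elim bexE)
    then show "h \<in> (\<lambda>v. g \<cdot> v) ` hom W Y" by (intro image_eqI[of _ _ h']) simp_all
  qed
  then have "(\<lambda>v. g \<cdot> v) ` hom W Y = hom W Z" using sub by (rule equalityI[rotated])
  then show "dh W X + dh W Z - dh W Y = 0" using 2 by simp
qed

interpretation op: finite_exact_category "opp E"
  by (rule finite_exact_category_opp) (rule finite_exact_category_axioms)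

lemma in_add_closure:
  assumes "X \<in> S" "X \<in> Ob E" shows "X \<in> add_closure E S"
proof -
  have "direct_sum E X 1 (\<lambda>_. X)" unfolding direct_sum_def
    using assms id_in[OF assms(2)] cmp_idm[OF assms(2,2) idm_in_Hom] by (auto intro!: exI[of _ "\<lambda>_. idm E X"] idm_in_Hom)
  moreover have "direct_factor E X X"
    using retract_direct_factor[OF id_in[OF assms(2)] id_in[OF assms(2)]] comp_id[OF id_in[OF assms(2)]]
    unfolding direct_factor_def by metis
  ultimately show ?thesis unfolding add_closure_def mem_Collect_eq using assms(1)
    by (intro exI[of _ X] exI[of _ 1] exI[of _ "\<lambda>_. X"]) simp
qed

lemma retract_imp_factor: "i \<in> hom X Y \<Longrightarrow> p \<in> hom Y X \<Longrightarrow> p \<cdot> i = idm E X \<Longrightarrow> direct_factor E X Y"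
  unfolding direct_factor_def by (rule retract_direct_factor) auto

lemma iso_imp_factor: "isomorphic E X Y \<Longrightarrow> direct_factor E X Y"
  unfolding isomorphic_eq using retract_imp_factor unfolding iso_def by blast

lemma factor_retract:
  assumes "direct_factor E X Y" obtains i p where "i \<in> hom X Y" "p \<in> hom Y X" "p \<cdot> i = idm E X"
proof -
  obtain A where A: "A 1 = X" "direct_sum E Y 2 A" using assms unfolding direct_factor_def by blast
  show thesis by (rule direct_sum_2E[OF A(2)]) (use A that in auto)
qed

text \<open>The identity of \<open>Y\<close> is a sum over the components, so an automorphism of
  \<open>X\<close> through \<open>Y\<close> is a sum of endomorphisms through the components; by
  locality one of them is invertible.\<close>

lemma direct_sum_component:
  assumes X: "indecomposable E X" and ds: "direct_sum E Y m A"
    and i: "i \<in> hom X Y" and p: "p \<in> hom Y X" and pi: "iso X X (p \<cdot> i)"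
  obtains k u v where "k \<in> {1..m}" "u \<in> hom X (A k)" "v \<in> hom (A k) X" "iso X X (v \<cdot> u)"
proof -
  obtain a b where h: "Y \<in> Ob E" "\<forall>k\<in>{1..m}. A k \<in> Ob E" "\<forall>k\<in>{1..m}. a k \<in> Hom E (A k) Y \<and> b k \<in> Hom E Y (A k)"
    "(\<Sum>k = 1..m. a k \<cdot> b k) = idm E Y"
    using ds unfolding direct_sum_def by (elim conjE exE) (rule that)
  have ab: "a k \<in> hom (A k) Y" "b k \<in> hom Y (A k)" if "k \<in> {1..m}" for k using h that homI by auto
  have XO: "X \<in> Ob E" using i hom_dom by auto
  have abi: "a k \<cdot> b k \<in> hom Y Y" "(a k \<cdot> b k) \<cdot> i \<in> hom X Y" if "k \<in> {1..m}" for k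
    using ab[OF that] i by auto
  have "p \<cdot> i = p \<cdot> ((\<Sum>k = 1..m. a k \<cdot> b k) \<cdot> i)" using h(4) id_comp[OF i] by simp
  also have "(\<Sum>k = 1..m. a k \<cdot> b k) \<cdot> i = (\<Sum>k = 1..m. (a k \<cdot> b k) \<cdot> i)"
    using comp_sum_left[OF i h(1), of "{1..m}" "\<lambda>k. a k \<cdot> b k"] abi(1) by simp
  also have "p \<cdot> (\<Sum>k = 1..m. (a k \<cdot> b k) \<cdot> i) = (\<Sum>k = 1..m. p \<cdot> ((a k \<cdot> b k) \<cdot> i))"
    using comp_sum_right[OF p XO, of "{1..m}" "\<lambda>k. (a k \<cdot> b k) \<cdot> i"] abi(2) by simp
  also have "\<dots> = (\<Sum>k = 1..m. (p \<cdot> a k) \<cdot> (b k \<cdot> i))"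
  proof (rule sum.cong[OF refl])
    fix k assume k: "k \<in> {1..m}"
    show "p \<cdot> ((a k \<cdot> b k) \<cdot> i) = (p \<cdot> a k) \<cdot> (b k \<cdot> i)"
      by (rule assoc4[OF i ab(2)[OF k] ab(1)[OF k] p, symmetric])
  qed
  finally have s: "iso X X (\<Sum>k = 1..m. (p \<cdot> a k) \<cdot> (b k \<cdot> i))" using pi by simp
  have "(p \<cdot> a k) \<cdot> (b k \<cdot> i) \<in> hom X X" if "k \<in> {1..m}" for k using ab[OF that] i p by auto
  then obtain k where k: "k \<in> {1..m}" "iso X X ((p \<cdot> a k) \<cdot> (b k \<cdot> i))"
    using iso_sum_cases[OF X finite_atLeastAtMost _ s] by auto
  show thesis using that[OF k(1) comp_in[OF i ab(2)[OF k(1)]] comp_in[OF ab(1)[OF k(1)] p] k(2)] .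
qed

lemma indec_add_closure:
  assumes X: "indecomposable E X" and XS: "X \<in> add_closure E S" and S: "\<And>Z. Z \<in> S \<Longrightarrow> indecomposable E Z"
  obtains Z where "Z \<in> S" "isomorphic E X Z"
proof -
  obtain Y m A where h: "\<forall>k\<in>{1..m}. A k \<in> S" "direct_sum E Y m A" "direct_factor E X Y"
    using XS unfolding add_closure_def by blast
  obtain i p where ip: "i \<in> hom X Y" "p \<in> hom Y X" "p \<cdot> i = idm E X" using factor_retract[OF h(3)] .
  obtain k u v where k: "k \<in> {1..m}" "u \<in> hom X (A k)" "v \<in> hom (A k) X" "iso X X (v \<cdot> u)"
    using direct_sum_component[OF X h(2) ip(1,2)] ip(3) indecomposable_Ob[OF X] by (metis iso_id)
  have "iso X (A k) u" using indecomposable_split_iso(1)[OF indecomposable_nonzero[OF X] S k(2-4)] h(1) k(1) by blast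
  then show thesis using that h(1) k(1) isomorphic_eq by blast
qed

lemma add_closure_subset:
  assumes T: "closed_factors T" and sum: "\<And>X m A. \<forall>i \<in> {1..m}. A i \<in> T \<Longrightarrow> direct_sum E X m A \<Longrightarrow> X \<in> T"
    and S: "S \<subseteq> T"
  shows "add_closure E S \<subseteq> T"
  using assms unfolding add_closure_def closed_factors_def by blast

lemma cluster_tilting_Ob: "cluster_tilting_subcat E T \<Longrightarrow> T \<subseteq> Ob E"
  unfolding cluster_tilting_subcat_def by (elim conjE)

lemma cluster_tilting_iff:
  "cluster_tilting_subcat E T \<Longrightarrow> \<forall>X \<in> Ob E. X \<in> T \<longleftrightarrow> (\<forall>T' \<in> T. Ext1 E T' X = {Ext1_zero E T' X})"
  unfolding cluster_tilting_subcat_def by (elim conjE)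

lemma cluster_tilting_sums:
  "cluster_tilting_subcat E T \<Longrightarrow> \<forall>X m A. (\<forall>i \<in> {1..m}. A i \<in> T) \<and> direct_sum E X m A \<longrightarrow> X \<in> T"
  unfolding cluster_tilting_subcat_def by (elim conjE)

lemma cluster_tilting_closed: "cluster_tilting_subcat E T \<Longrightarrow> closed_factors T"
  unfolding cluster_tilting_subcat_def closed_factors_def by (elim conjE) (intro conjI)

lemma cluster_tilting_ext0:
  assumes T: "cluster_tilting_subcat E T" and XY: "X \<in> T" "Y \<in> T" shows "ext0 X Y"
proof -
  note r = cluster_tilting_iff[OF T]
  have O: "X \<in> Ob E" "Y \<in> Ob E" using XY cluster_tilting_Ob[OF T] by auto
  have e: "Ext1 E X Y = {Ext1_zero E X Y}" using bspec[OF r O(2)] XY by simp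
  show ?thesis unfolding ext0_def
  proof (intro allI impI)
    fix i Q p assume C: "Conf E Y i Q p X"
    note ch = Conf_hom[OF C] and CO = Conf_Ob[OF C]
    have x: "(Q, i, p) \<in> extensions E X Y" using C by (simp add: extensions_def)
    then have "ext_equiv E X Y `` {(Q, i, p)} \<in> Ext1 E X Y" unfolding Ext1_def by (rule quotientI)
    then have "ext_equiv E X Y `` {(Q, i, p)} = Ext1_zero E X Y" using e by simp
    moreover have "((Q, i, p), (Q, i, p)) \<in> ext_equiv E X Y"
    proof -
      have "Q \<in> Ob E" using CO by simp
      then have "iso_mor E Q Q (idm E Q)" using iso_mor_eq[of Q Q] by simp
      then have "\<exists>\<phi>. iso_mor E Q Q \<phi> \<and> \<phi> \<cdot> i = i \<and> p \<cdot> \<phi> = p"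
        using id_comp[OF ch(1)] comp_id[OF ch(2)] by (intro exI[of _ "idm E Q"] conjI)
      then show ?thesis using x by (simp add: ext_equiv_def)
    qed
    ultimately have "(Q, i, p) \<in> Ext1_zero E X Y" by blast
    then show "\<exists>s \<in> hom X Q. p \<cdot> s = idm E X" using O CO by (auto simp: Ext1_zero_def hom_eq)
  qed
qed

end

text \<open>\<open>T\<close> is the cluster-tilting subcategory and \<open>Ts 1, \<dots>, Ts n\<close> are its indecomposables, labelled
  compatibly with the matrix \<open>B\<close>.\<close>

definition cat_seed where
  "cat_seed E n r B T Ts \<longleftrightarrow> cluster_tilting_subcat E T
     \<and> (\<forall>i \<in> {1..n}. Ts i \<in> indec E T)
     \<and> (\<forall>i \<in> {1..n}. \<forall>j \<in> {1..n}. i \<noteq> j \<longrightarrow> \<not> isomorphic E (Ts i) (Ts j))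
     \<and> (\<forall>Z \<in> indec E T. \<exists>i \<in> {1..n}. isomorphic E Z (Ts i))
     \<and> (\<forall>i \<in> {1..n}. projective E (Ts i) \<longleftrightarrow> r < i)
     \<and> (\<forall>i \<in> {1..n}. \<forall>j \<in> {1..r}. B i j = quiver_matrix (arrows E T) (Ts i) (Ts j))"

lemma cat_seedD:
  assumes "cat_seed E n r B T Ts"
  shows "cluster_tilting_subcat E T" "i \<in> {1..n} \<Longrightarrow> Ts i \<in> indec E T"
    "i \<in> {1..n} \<Longrightarrow> j \<in> {1..n} \<Longrightarrow> i \<noteq> j \<Longrightarrow> \<not> isomorphic E (Ts i) (Ts j)"
    "Z \<in> indec E T \<Longrightarrow> \<exists>i \<in> {1..n}. isomorphic E Z (Ts i)"
    "i \<in> {1..n} \<Longrightarrow> projective E (Ts i) \<longleftrightarrow> r < i"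
    "i \<in> {1..n} \<Longrightarrow> j \<in> {1..r} \<Longrightarrow> B i j = quiver_matrix (arrows E T) (Ts i) (Ts j)"
  using assms unfolding cat_seed_def by blast+

locale realized = ext_duality E
  for E :: "('o, 'm::ab_group_add, 'k::alg_closed_field) exact_cat" (structure) +
  assumes cluster_structure: "cluster_structure E"
begin

lemma cluster_structureD:
  assumes "cluster_tilting_subcat E T"
  shows "M \<in> indec E T \<Longrightarrow> \<not> projective E M \<Longrightarrow> \<exists>N. exchange_partner E T M N"
    "M \<in> indec E T \<Longrightarrow> \<not> projective E M \<Longrightarrow> exchange_partner E T M N \<Longrightarrow>
      exchange_conflations E (T \<inter> mutate_subcat E T M N) M N"
    "M \<in> indec E T \<Longrightarrow> \<not> projective E M \<Longrightarrow> exchange_partner E T M N \<Longrightarrow>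
      quiver_mutation_compatible E T M N"
    "X \<in> indec E T \<Longrightarrow> arrows E T X X = 0"
    "X \<in> indec E T \<Longrightarrow> Y \<in> indec E T \<Longrightarrow> arrows E T X Y = 0 \<or> arrows E T Y X = 0"
  using cluster_structure assms unfolding cluster_structure_def by meson+

end

section \<open>One mutation of a cluster-tilting subcategory\<close>

locale exchange = realized E
  for E :: "('o, 'm::ab_group_add, 'k::alg_closed_field) exact_cat" (structure) +
  fixes n r :: nat and B :: "nat \<Rightarrow> nat \<Rightarrow> int" and T :: "'o set" and Ts :: "nat \<Rightarrow> 'o" and l :: nat and N :: 'o
  assumes rn: "r \<le> n" and seed: "cat_seed E n r B T Ts" and l: "l \<in> {1..r}"
    and partner: "exchange_partner E T (Ts l) N"
begin

abbreviation "M \<equiv> Ts l"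
abbreviation "T' \<equiv> mutate_subcat E T M N"
abbreviation "S \<equiv> T \<inter> T'"
abbreviation "Ts' \<equiv> Ts(l := N)"

lemmas seedD = cat_seedD[OF seed]

lemma ln: "l \<in> {1..n}" using l rn by auto

lemma M_indec_T: "M \<in> indec E T" using seedD(2) ln .
lemma M_indec: "indecomposable E M" and M_T: "M \<in> T" using M_indec_T by (auto simp: indec_def)
lemma M_Ob: "M \<in> Ob E" using indecomposable_Ob[OF M_indec] .
lemma M_np: "\<not> projective E M" using seedD(5)[OF ln] l by auto

lemma N_indec: "indecomposable E N" and N_np: "\<not> projective E N" and NM: "\<not> isomorphic E N M"
  and T'_ct: "cluster_tilting_subcat E T'"
  using partner by (auto simp: exchange_partner_def)

lemma T_closed: "closed_factors T" and T'_closed: "closed_factors T'"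
  using cluster_tilting_closed seedD(1) T'_ct by auto

lemma T_Ob: "X \<in> T \<Longrightarrow> X \<in> Ob E" and T'_Ob: "X \<in> T' \<Longrightarrow> X \<in> Ob E"
  using T_closed T'_closed unfolding closed_factors_def by auto

abbreviation "gens \<equiv> {X \<in> indec E T. \<not> isomorphic E X M} \<union> {N}"

lemma T'_eq: "T' = add_closure E gens"
  by (simp add: mutate_subcat_def)

lemma gens_indec: "Z \<in> gens \<Longrightarrow> indecomposable E Z"
  using N_indec by (auto simp: indec_def)

lemma gens_T': "Z \<in> gens \<Longrightarrow> Z \<in> T'"
  unfolding T'_eq by (rule in_add_closure[OF _ indecomposable_Ob[OF gens_indec]])

lemma M_notin_T': "M \<notin> T'"
proof
  assume "M \<in> T'"
  then have "M \<in> add_closure E gens" using T'_eq by simp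
  then obtain Z where Z: "Z \<in> gens" "isomorphic E M Z" by (rule indec_add_closure[OF M_indec _ gens_indec])
  then show False using isomorphic_sym[OF Z(2)] NM by auto
qed

text \<open>Otherwise all generators of \<open>T'\<close> lie in \<open>T\<close>, so extensions
  between \<open>T'\<close> and \<open>M\<close> vanish and maximality of \<open>T'\<close> would
  force \<open>M\<close> into it.\<close>

lemma N_not_Ts: assumes i: "i \<in> {1..n}" shows "\<not> isomorphic E N (Ts i)"
proof
  assume iso: "isomorphic E N (Ts i)"
  have "N \<in> T"
    using iso_imp_factor[OF iso] seedD(2)[OF i] T_closed by (auto simp: closed_factors_def indec_def)
  then have sub: "T' \<subseteq> T" unfolding T'_eq
    using cluster_tilting_sums[OF seedD(1)] by (intro add_closure_subset[OF T_closed]) (blast, auto simp: indec_def)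
  note r = cluster_tilting_iff[OF seedD(1)] and r' = cluster_tilting_iff[OF T'_ct]
  have "\<forall>T1 \<in> T. Ext1 E T1 M = {Ext1_zero E T1 M}" using bspec[OF r M_Ob] M_T by (rule iffD1)
  then have "\<forall>T1 \<in> T'. Ext1 E T1 M = {Ext1_zero E T1 M}" using sub by (meson subsetD)
  then have "M \<in> T'" using bspec[OF r' M_Ob] by (rule iffD2[rotated])
  then show False using M_notin_T' by simp
qed

lemma Ts'_indec: assumes i: "i \<in> {1..n}" shows "Ts' i \<in> indec E T'"
proof -
  have g: "Ts' i \<in> gens"
  proof (cases "i = l")
    case False
    then have "\<not> isomorphic E (Ts i) M" using seedD(3)[OF i ln] by blast
    then show ?thesis using seedD(2)[OF i] False by simp
  qed simp
  show ?thesis unfolding indec_def mem_Collect_eq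
    by (rule conjI[OF gens_T'[OF g] gens_indec[OF g]])
qed

lemma indec_T': assumes Z: "Z \<in> indec E T'" shows "\<exists>i \<in> {1..n}. isomorphic E Z (Ts' i)"
proof -
  have "indecomposable E Z" "Z \<in> add_closure E gens" using Z T'_eq by (auto simp: indec_def)
  then obtain X where X: "X \<in> gens" "isomorphic E Z X" by (rule indec_add_closure[OF _ _ gens_indec])
  show ?thesis
  proof (cases "X = N")
    case True
    then show ?thesis using X ln by (intro bexI[of _ l]) auto
  next
    case False
    then have "X \<in> indec E T" "\<not> isomorphic E X M" using X by auto
    moreover then obtain i where "i \<in> {1..n}" "isomorphic E X (Ts i)" using seedD(4) by blast
    ultimately show ?thesis using isomorphic_trans[OF X(2)] by (intro bexI[of _ i]) auto
  qed
qed

lemma Ts'_noniso: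
  assumes "i \<in> {1..n}" "j \<in> {1..n}" "i \<noteq> j" shows "\<not> isomorphic E (Ts' i) (Ts' j)"
  using seedD(3)[OF assms] N_not_Ts[OF assms(1)] N_not_Ts[OF assms(2)] assms(3) isomorphic_sym[of "Ts i" N]
  by (cases "i = l"; cases "j = l") auto

lemma Ts_eq_M: "i \<in> {1..n} \<Longrightarrow> Ts i = M \<longleftrightarrow> i = l"
  using seedD(3)[of i l] ln isomorphic_refl[OF M_Ob] by metis

text \<open>The cluster structure controls quivers only up to arrows between projective vertices.
  Columns with index in {1..r} are not affected, since \<open>Ts j\<close> and its replacement are
  not projective.\<close>

lemma mutated_matrix:
  assumes i: "i \<in> {1..n}" and j: "j \<in> {1..r}"
  shows "mutate_matrix l B i j = quiver_matrix (arrows E T') (Ts' i) (Ts' j)"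
proof -
  have jn: "j \<in> {1..n}" using j rn by auto
  define Q where "Q = remove_arrows (projective E) (arrows E T)"
  have qB: "quiver_matrix Q (Ts a) (Ts b) = B a b" if "a \<in> {1..n}" "b \<in> {1..r}" for a b
  proof -
    have b: "b \<in> {1..n}" using that rn by auto
    then have "\<not> projective E (Ts b)" using seedD(5)[OF b] that by auto
    then show ?thesis using seedD(6)[OF that] by (simp add: quiver_matrix_def Q_def remove_arrows_def)
  qed
  define V where "V = {X \<in> indec E T. X = M \<or> \<not> isomorphic E X M}"
  have V: "Ts a \<in> V" if "a \<in> {1..n}" for a
    using seedD(2)[OF that] seedD(3)[OF that ln] by (auto simp: V_def)
  define \<sigma> where "\<sigma> X = (if X = M then N else X)" for X
  have \<sigma>: "\<sigma> (Ts a) = Ts' a" if "a \<in> {1..n}" for a using Ts_eq_M[OF that] by (auto simp: \<sigma>_def)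
  have comp: "\<forall>X \<in> V. \<forall>Y \<in> V. remove_arrows (projective E) (arrows E T') (\<sigma> X) (\<sigma> Y)
      = remove_arrows (projective E) (mutate_quiver M Q) X Y"
    using cluster_structureD(3)[OF seedD(1) M_indec_T M_np partner]
    unfolding quiver_mutation_compatible_def Let_def V_def \<sigma>_def Q_def .
  have npj: "\<not> projective E (Ts j)" using seedD(5)[OF jn] j by auto
  have npj': "\<not> projective E (Ts' j)" using npj N_np by auto
  have eq: "arrows E T' (Ts' a) (Ts' b) = mutate_quiver M Q (Ts a) (Ts b)"
    if "a \<in> {1..n}" "b \<in> {1..n}" "a = j \<or> b = j" for a b
    using bspec[OF bspec[OF comp V[OF that(1)]] V[OF that(2)]] \<sigma>[OF that(1)] \<sigma>[OF that(2)] npj npj' that(3)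
    unfolding remove_arrows_def by auto
  have anti: "quiver_matrix Q X Y = - quiver_matrix Q Y X" for X Y by (simp add: quiver_matrix_def)
  \<comment> \<open>Both orders of the two vertices are needed, because \<open>mutate_quiver\<close>
    records only the positive part of the mutated matrix.\<close>
  have manti: "mutate_matrix M (quiver_matrix Q) (Ts j) (Ts i) = - mutate_matrix M (quiver_matrix Q) (Ts i) (Ts j)"
    unfolding mutate_matrix_def
    using anti[of "Ts i" "Ts j"] anti[of "Ts i" M] anti[of M "Ts j"] anti[of "Ts j" M]
    by (auto simp: sgn_if pos_part_def max_def mult_neg_neg zero_less_mult_iff mult_less_0_iff mult_le_0_iff zero_le_mult_iff)
  have "quiver_matrix (arrows E T') (Ts' i) (Ts' j) = mutate_matrix M (quiver_matrix Q) (Ts i) (Ts j)"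
    unfolding quiver_matrix_def[of "arrows E T'"] eq[OF i jn disjI2[OF refl]] eq[OF jn i disjI1[OF refl]]
      mutate_quiver_def manti by simp
  also have "\<dots> = mutate_matrix l B i j"
    unfolding mutate_matrix_def Ts_eq_M[OF i] Ts_eq_M[OF jn] qB[OF i j] qB[OF i l] qB[OF ln j] ..
  finally show ?thesis by simp
qed

lemma seed': "cat_seed E n r (mutate_matrix l B) T' Ts'"
  unfolding cat_seed_def
proof (intro conjI ballI impI)
  fix i assume i: "i \<in> {1..n}"
  show "projective E (Ts' i) \<longleftrightarrow> r < i" using seedD(5)[OF i] N_np l by auto
qed (use T'_ct Ts'_indec Ts'_noniso indec_T' mutated_matrix in blast)+

lemma S_closed: "closed_factors S"
  using T_closed T'_closed unfolding closed_factors_def by blast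

lemma indec_S: assumes Z: "Z \<in> indec E S" shows "\<exists>i \<in> {1..n} - {l}. isomorphic E Z (Ts i)"
proof -
  have Z': "Z \<in> indec E T" "Z \<in> T'" using Z by (auto simp: indec_def)
  obtain i where i: "i \<in> {1..n}" "isomorphic E Z (Ts i)" using seedD(4)[OF Z'(1)] by blast
  have "i \<noteq> l"
  proof
    assume "i = l"
    then have "direct_factor E M Z" using i isomorphic_sym iso_imp_factor by blast
    then show False using M_notin_T' Z'(2) T'_closed unfolding closed_factors_def by blast
  qed
  then show ?thesis using i by blast
qed

lemma other_S: "Z \<in> indec E T \<Longrightarrow> \<not> isomorphic E M Z \<Longrightarrow> Z \<in> S"
  using gens_T'[of Z] isomorphic_sym[of Z M] by (simp add: indec_def) blast

lemma no_M: assumes "U \<in> S" "i \<in> hom M U" "p \<in> hom U M" shows "\<not> iso M M (p \<cdot> i)"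
proof
  assume "iso M M (p \<cdot> i)"
  then obtain u where u: "u \<in> hom M M" "u \<cdot> (p \<cdot> i) = idm E M" by (auto simp: iso_def)
  have "direct_factor E M U"
    by (rule retract_imp_factor[OF assms(2), of "u \<cdot> p"]) (use u assms assoc[OF assms(2,3) u(1)] in auto)
  then show False using M_notin_T' assms(1) T'_closed unfolding closed_factors_def by blast
qed

end

section \<open>Dimensions along the two exchange conflations\<close>

locale exchange_pair = exchange E n r B T Ts l N
  for E :: "('o, 'm::ab_group_add, 'k::alg_closed_field) exact_cat" (structure)
    and n r B T Ts l N +
  fixes F F' :: 'o and f g s t :: 'm
  assumes C1: "Conf E N f F g (Ts l)" and C2: "Conf E (Ts l) s F' t N"
    and R: "min_right_approx E (T \<inter> mutate_subcat E T (Ts l) N) F (Ts l) g"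
    and L: "min_left_approx E (T \<inter> mutate_subcat E T (Ts l) N) (Ts l) F' s"
begin

interpretation op: ext_duality "opp E"
  by (rule ext_duality_opp) (rule ext_duality_axioms)

lemmas hom1 = Conf_hom[OF C1] and hom2 = Conf_hom[OF C2]

lemma F_S: "F \<in> S" and F'_S: "F' \<in> S" and F_Ob: "F \<in> Ob E" and F'_Ob: "F' \<in> Ob E" and N_Ob: "N \<in> Ob E"
  using R L Conf_Ob[OF C1] Conf_Ob[OF C2] by (auto simp: min_right_approx_def min_left_approx_def)

lemma right: "right_approximation E T S M F g"
proof (unfold_locales, goal_cases)
  case (4 Z)
  then show ?case using other_S[of Z] by blast
next
  case (5 U i p)
  then show ?case by (rule no_M)
next
  case 6
  show ?case using cluster_structureD(4)[OF seedD(1) M_indec_T] .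
next
  case (9 U h)
  then have "h \<in> Hom E U M" "U \<in> S" "U \<in> Ob E" using homD by auto
  then obtain u where "u \<in> Hom E U F" "g \<cdot> u = h" using R unfolding min_right_approx_def by metis
  then show ?case using homI \<open>U \<in> Ob E\<close> F_Ob by blast
qed (use T_closed M_indec_T F_S hom1 in blast)+

lemma op_indec: "indec (opp E) X = indec E X"
  by (rule indec_opp)

lemma left: "right_approximation (opp E) T S M F' s"
proof (unfold_locales, goal_cases)
  case 1
  show ?case using T_closed unfolding closed_factors_def op.closed_factors_def direct_factor_opp by simp
next
  case 2
  show ?case using M_indec_T by (simp add: op_indec)
next
  case 3
  show ?case by blast
next
  case (4 Z)
  then have Z: "Z \<in> indec E T" by (simp add: op_indec)
  then have "indecomposable E Z" "Z \<in> Ob E" using indecomposable_Ob by (auto simp: indec_def)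
  then show ?case unfolding isomorphic_opp using other_S[OF Z] isomorphic_sym[of M Z] by blast
next
  case (5 U i p)
  then have "i \<in> hom U M" "p \<in> hom M U" by (auto simp: op_hom)
  then show ?case using no_M[OF 5(1)] by (simp add: op_iso)
next
  case 6
  have "T \<subseteq> Ob E" using T_Ob by blast
  then show ?case using cluster_structureD(4)[OF seedD(1) M_indec_T] by (simp add: op_arrows M_Ob)
next
  case 7
  show ?case using F'_S .
next
  case 8
  show ?case using hom2 by (simp add: op_hom)
next
  case (9 U h)
  then have "h \<in> Hom E M U" "U \<in> S" "U \<in> Ob E" using homD by (auto simp: op_hom)
  then obtain u where "u \<in> Hom E F' U" "u \<cdot> s = h" using L unfolding min_left_approx_def by metis
  then show ?case using homI \<open>U \<in> Ob E\<close> F'_Ob by (auto simp: op_hom)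
qed

lemma ext0_T: "X \<in> T \<Longrightarrow> Y \<in> T \<Longrightarrow> ext0 X Y"
  using cluster_tilting_ext0[OF seedD(1)] .

text \<open>Without 2-cycles at most one of the two numbers of arrows is nonzero, so the parts of
  their difference recover both.\<close>

lemma B_arrows: assumes i: "i \<in> {1..n}"
  shows "pos_part (B i l) = int (arrows E T (Ts i) M)" "pos_part (- B i l) = int (arrows E T M (Ts i))"
proof -
  have "B i l = int (arrows E T (Ts i) M) - int (arrows E T M (Ts i))"
    using seedD(6)[OF i l] by (simp add: quiver_matrix_def)
  moreover have "arrows E T (Ts i) M = 0 \<or> arrows E T M (Ts i) = 0"
    using cluster_structureD(5)[OF seedD(1) seedD(2)[OF i] M_indec_T] .
  ultimately show "pos_part (B i l) = int (arrows E T (Ts i) M)" "pos_part (- B i l) = int (arrows E T M (Ts i))"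
    by (auto simp: pos_part_def)
qed

lemma B_ll: "B l l = 0"
  using seedD(6)[OF ln l] by (simp add: quiver_matrix_def)

lemma sum_other: "(\<Sum>i\<in>{1..n} - {l}. h (B i l) * k i) = (\<Sum>i = 1..n. h (B i l) * (k i :: int))" if "h 0 = (0::int)"
  by (rule sum.mono_neutral_left) (use that B_ll in auto)

lemma Ts_indec: "i \<in> {1..n} \<Longrightarrow> indecomposable E (Ts i)"
  using seedD(2) by (auto simp: indec_def)

lemma Ts_Ob: "i \<in> {1..n} \<Longrightarrow> Ts i \<in> Ob E"
  using Ts_indec indecomposable_Ob by blast

text \<open>By \<open>arrows_eq\<close> the multiplicity of \<open>Ts i\<close> in \<open>F\<close>
  is the number of arrows from \<open>Ts i\<close> to \<open>M\<close>. \<open>M\<close> itself does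
  not occur in \<open>F\<close>; it may be included in the sum because its coefficient
  \<open>B l l\<close> is 0.\<close>

lemma middle_dims:
  assumes X: "X \<in> Ob E"
  shows "dh X F = (\<Sum>i = 1..n. pos_part (B i l) * dh X (Ts i))"
    and "dh F X = (\<Sum>i = 1..n. pos_part (B i l) * dh (Ts i) X)"
proof -
  have "\<exists>\<mu>. multiplicities ({1..n} - {l}) Ts \<mu> F"
  proof (rule multiplicities_exist[OF built_indec[OF S_closed F_S]])
    fix Z assume Z: "Z \<in> indec E S"
    then show "indecomposable E Z \<and> (\<exists>i\<in>{1..n} - {l}. isomorphic E Z (Ts i))"
      using indec_S[OF Z] by (simp add: indec_def)
  qed (use Ts_indec seedD(3) in auto)
  then obtain \<mu> where \<mu>: "multiplicities ({1..n} - {l}) Ts \<mu> F" by blast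
  have m: "int (\<mu> i) = pos_part (B i l)" if i: "i \<in> {1..n} - {l}" for i
  proof -
    have i': "i \<in> {1..n}" "\<not> isomorphic E M (Ts i)" using i seedD(3)[of l i] ln by auto
    have "iso F F \<phi>" if "\<phi> \<in> hom F F" "g \<cdot> \<phi> = g" for \<phi>
      using R that F_Ob homD[OF that(1)] unfolding min_right_approx_def by (auto simp: iso_mor_eq)
    then have "vs.dim (hom (Ts i) F) = vs.dim (radical E (Ts i) F) + arrows E T (Ts i) M"
      using right_approximation.arrows_eq[OF right seedD(2)[OF i'(1)] i'(2)] by blast
    moreover have "vs.dim (hom (Ts i) F) = vs.dim (radical E (Ts i) F) + \<mu> i"
      using \<mu> i unfolding multiplicities_def by blast
    ultimately show ?thesis using B_arrows[OF i'(1)] by simp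
  qed
  have "dh X F = (\<Sum>i\<in>{1..n} - {l}. int (\<mu> i) * dh X (Ts i))"
    "dh F X = (\<Sum>i\<in>{1..n} - {l}. int (\<mu> i) * dh (Ts i) X)"
    using \<mu> X unfolding multiplicities_def by (simp_all add: dh_def)
  then show "dh X F = (\<Sum>i = 1..n. pos_part (B i l) * dh X (Ts i))"
    "dh F X = (\<Sum>i = 1..n. pos_part (B i l) * dh (Ts i) X)"
    using m sum_other[of pos_part] by (simp_all add: pos_part_def)
qed

lemma op_dh: "op.dh X Y = dh Y X"
  unfolding op.dh_def dh_def op_hom by simp

lemma middle_dims':
  assumes X: "X \<in> Ob E"
  shows "dh X F' = (\<Sum>i = 1..n. pos_part (- B i l) * dh X (Ts i))"
    and "dh F' X = (\<Sum>i = 1..n. pos_part (- B i l) * dh (Ts i) X)"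
proof -
  have S: "op.closed_factors S" using S_closed unfolding closed_factors_def op.closed_factors_def direct_factor_opp opp_simps .
  have "\<exists>\<mu>. op.multiplicities ({1..n} - {l}) Ts \<mu> F'"
  proof (rule op.multiplicities_exist[OF op.built_indec[OF S F'_S]])
    fix Z assume "Z \<in> indec (opp E) S"
    then have Z: "Z \<in> indec E S" by (simp add: op_indec)
    then obtain i where "i \<in> {1..n} - {l}" "isomorphic E Z (Ts i)" using indec_S by blast
    then show "indecomposable (opp E) Z \<and> (\<exists>i\<in>{1..n} - {l}. isomorphic (opp E) Z (Ts i))"
      using Z isomorphic_sym[of Z "Ts i"] unfolding isomorphic_opp indecomposable_opp by (auto simp: indec_def)
  next
    fix i j assume "i \<in> {1..n} - {l}" "j \<in> {1..n} - {l}" "i \<noteq> j"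
    then show "\<not> isomorphic (opp E) (Ts i) (Ts j)" using seedD(3)[of j i] unfolding isomorphic_opp by auto
  qed (use Ts_indec in \<open>auto simp: indecomposable_opp\<close>)
  then obtain \<mu> where \<mu>: "op.multiplicities ({1..n} - {l}) Ts \<mu> F'" by blast
  have m: "int (\<mu> i) = pos_part (- B i l)" if i: "i \<in> {1..n} - {l}" for i
  proof -
    have i': "i \<in> {1..n}" "\<not> isomorphic (opp E) M (Ts i)" using i seedD(3)[of i l] ln unfolding isomorphic_opp by auto
    have ii: "Ts i \<in> indec (opp E) T" using seedD(2)[OF i'(1)] by (simp add: op_indec)
    have TO: "T \<subseteq> Ob E" using T_Ob by blast
    have "op.iso F' F' \<phi>" if "\<phi> \<in> op.hom F' F'" "cmp (opp E) s \<phi> = s" for \<phi>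
      using L that F'_Ob homD[of \<phi> F' F'] unfolding min_left_approx_def op_iso op_hom opp_simps by (auto simp: iso_mor_eq)
    then have "vs.dim (hom F' (Ts i)) = vs.dim (radical (opp E) (Ts i) F') + arrows (opp E) T (Ts i) M"
      using right_approximation.arrows_eq[OF left ii i'(2)] unfolding op_hom opp_simps by blast
    moreover have "vs.dim (hom F' (Ts i)) = vs.dim (radical (opp E) (Ts i) F') + \<mu> i"
      using \<mu> i unfolding op.multiplicities_def op_hom opp_simps by blast
    ultimately show ?thesis using B_arrows[OF i'(1)] op_arrows[OF TO Ts_Ob[OF i'(1)] M_Ob] by simp
  qed
  have "dh X F' = (\<Sum>i\<in>{1..n} - {l}. int (\<mu> i) * dh X (Ts i))"
    "dh F' X = (\<Sum>i\<in>{1..n} - {l}. int (\<mu> i) * dh (Ts i) X)"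
    using \<mu> X unfolding op.multiplicities_def op_hom opp_simps by (simp_all add: dh_def)
  then show "dh X F' = (\<Sum>i = 1..n. pos_part (- B i l) * dh X (Ts i))"
    "dh F' X = (\<Sum>i = 1..n. pos_part (- B i l) * dh (Ts i) X)"
    using m sum_other[of "\<lambda>b. pos_part (- b)"] by (simp_all add: pos_part_def)
qed

text \<open>The difference of the defects of the two exchange conflations under Hom(X,-), the common
  part dh X M + dh X N cancelling. The next definition is the same for Hom(-,X).\<close>

definition coindex :: "'o \<Rightarrow> int" where "coindex X = - (\<Sum>i = 1..n. B i l * dh X (Ts i))"
definition index :: "'o \<Rightarrow> int" where "index X = - (\<Sum>i = 1..n. B i l * dh (Ts i) X)"

lemma coindex_eq: "X \<in> Ob E \<Longrightarrow> coindex X = dh X F' - dh X F"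
  and index_eq: "X \<in> Ob E \<Longrightarrow> index X = dh F' X - dh F X"
  unfolding middle_dims middle_dims' coindex_def index_def sum_subtractf[symmetric] sum_negf[symmetric]
  by (auto intro!: sum.cong simp: pos_part_def max_def algebra_simps)

text \<open>If some morphism from \<open>X\<close> to \<open>M\<close> does not lift,
  \<open>exchange_lift\<close> lifts every morphism from \<open>X'\<close> to \<open>N\<close>: a
  nonzero first defect at \<open>X\<close> excludes a nonzero second defect at
  \<open>X'\<close>.\<close>

lemma exchange_dichotomy:
  assumes e: "ext0 X' X" and O: "X \<in> Ob E" "X' \<in> Ob E"
  shows "dh X N + dh X M - dh X F = 0 \<or> dh X' M + dh X' N - dh X' F' = 0"
proof (cases "\<forall>h \<in> hom X M. \<exists>h' \<in> hom X F. g \<cdot> h' = h")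
  case True
  then show ?thesis using Conf_dim_ge(3)[OF C1 O(1)] by blast
next
  case False
  then obtain \<alpha> where \<alpha>: "\<alpha> \<in> hom X M" "\<not> (\<exists>h' \<in> hom X F. g \<cdot> h' = \<alpha>)" by blast
  have rad: "\<exists>v \<in> hom F' M. u = v \<cdot> s" if "u \<in> hom M M" "\<not> iso M M u" for u
    using right_approximation.nonunit_factors[OF left, of u] that unfolding op_hom op_iso opp_simps by blast
  have F'T: "F' \<in> T" using F'_S by blast
  have "\<forall>\<beta> \<in> hom X' N. \<exists>\<beta>' \<in> hom X' F'. t \<cdot> \<beta>' = \<beta>"
    using exchange_lift[OF C1 C2 ext0_T[OF F'T M_T] rad e \<alpha>] by blast
  then show ?thesis using Conf_dim_ge(3)[OF C2 O(2)] by blast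
qed

lemma exchange_dichotomy':
  assumes e: "ext0 X X'" and O: "X \<in> Ob E" "X' \<in> Ob E"
  shows "dh N X + dh M X - dh F' X = 0 \<or> dh M X' + dh N X' - dh F X' = 0"
proof -
  have C1': "Conf (opp E) M g F f N" and C2': "Conf (opp E) N t F' s M" using C1 C2 by simp_all
  have e': "op.ext0 X' X" using e by (simp add: op_ext0)
  have O': "X \<in> Ob (opp E)" "X' \<in> Ob (opp E)" using O by simp_all
  show ?thesis
  proof (cases "\<forall>h \<in> op.hom X M. \<exists>h' \<in> op.hom X F'. cmp (opp E) s h' = h")
    case True
    then show ?thesis using op.Conf_dim_ge(3)[OF C2' O'(1)] unfolding op_dh by blast
  next
    case False
    then obtain \<alpha> where \<alpha>: "\<alpha> \<in> op.hom X M" "\<not> (\<exists>h' \<in> op.hom X F'. cmp (opp E) s h' = \<alpha>)" by blast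
    have rad: "\<exists>v \<in> op.hom F M. u = cmp (opp E) v g" if "u \<in> op.hom M M" "\<not> op.iso M M u" for u
      using right_approximation.nonunit_factors[OF right, of u] that unfolding op_hom op_iso opp_simps by blast
    have FT: "F \<in> T" using F_S by blast
    have ef: "op.ext0 F M" using ext0_T[OF M_T FT] by (simp add: op_ext0)
    have "\<forall>\<beta> \<in> op.hom X' N. \<exists>\<beta>' \<in> op.hom X' F. cmp (opp E) f \<beta>' = \<beta>"
      using op.exchange_lift[OF C2' C1' ef rad e' \<alpha>] by blast
    then show ?thesis using op.Conf_dim_ge(3)[OF C1' O'(2)] unfolding op_dh by blast
  qed
qed

lemma op_Conf_ge:
  assumes X: "X \<in> Ob E" shows "dh N X + dh M X - dh F' X \<ge> 0" "dh M X + dh N X - dh F X \<ge> 0"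
proof -
  have C1': "Conf (opp E) M g F f N" and C2': "Conf (opp E) N t F' s M" using C1 C2 by simp_all
  show "dh N X + dh M X - dh F' X \<ge> 0" "dh M X + dh N X - dh F X \<ge> 0"
    using op.Conf_dim_ge(1)[OF C1', of X] op.Conf_dim_ge(1)[OF C2', of X] X unfolding op_dh by simp_all
qed

text \<open>Both defects are nonnegative, one of them is zero and their difference is the coindex;
  hence the first one is its positive part.\<close>

lemma coindex_sum:
  assumes X: "X \<in> Ob E" "ext0 X X"
  shows "dh X M + dh X N = (\<Sum>i = 1..n. pos_part (B i l) * dh X (Ts i)) + pos_part (coindex X)"
  using exchange_dichotomy[OF X(2,1,1)] Conf_dim_ge(1)[OF C1 X(1)] Conf_dim_ge(1)[OF C2 X(1)]
  unfolding middle_dims[OF X(1), symmetric] coindex_eq[OF X(1)] by (auto simp: pos_part_def)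

text \<open>A positive coindex means a nonzero first defect at \<open>X\<close> and therefore a
  vanishing second one at \<open>X'\<close>. This is the source of sign-coherence of
  c-vectors.\<close>

lemma coindex_coherent:
  assumes "X \<in> Ob E" "X' \<in> Ob E" "ext0 X' X" "coindex X > 0" shows "coindex X' \<ge> 0"
  using exchange_dichotomy[OF assms(3,1,2)] Conf_dim_ge(1)[OF C1 assms(1)] Conf_dim_ge(1)[OF C2 assms(1)]
    Conf_dim_ge(1)[OF C1 assms(2)] Conf_dim_ge(1)[OF C2 assms(2)] assms(4)
  unfolding coindex_eq[OF assms(1)] coindex_eq[OF assms(2)] by auto

lemma index_sum:
  assumes X: "X \<in> Ob E" "ext0 X X"
  shows "dh M X + dh N X = (\<Sum>i = 1..n. pos_part (B i l) * dh (Ts i) X) + pos_part (index X)"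
  using exchange_dichotomy'[OF X(2,1,1)] op_Conf_ge[OF X(1)]
  unfolding middle_dims(2)[OF X(1), symmetric] index_eq[OF X(1)] by (auto simp: pos_part_def)

lemma index_coherent:
  assumes "X \<in> Ob E" "X' \<in> Ob E" "ext0 X X'" "index X < 0" shows "index X' \<le> 0"
  using exchange_dichotomy'[OF assms(3,1,2)] op_Conf_ge[OF assms(1)] op_Conf_ge[OF assms(2)] assms(4)
  unfolding index_eq[OF assms(1)] index_eq[OF assms(2)] by auto

text \<open>Morphisms from summands of \<open>T\<close> to \<open>N\<close> lift along the second
  conflation by rigidity. The first one is exact on all \<open>Ts i\<close> except \<open>M\<close>,
  where just the endomorphisms modulo the radical are missed.\<close>

lemma coindex_Ts: assumes i: "i \<in> {1..n}" shows "coindex (Ts i) = (if i = l then 1 else 0)"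
proof -
  note O = Ts_Ob[OF i]
  have T: "Ts i \<in> T" using seedD(2)[OF i] by (simp add: indec_def)
  have "\<forall>h \<in> hom (Ts i) N. \<exists>h' \<in> hom (Ts i) F'. t \<cdot> h' = h"
    using ext0_lift[OF ext0_T[OF T M_T] C2] by metis
  then have 1: "dh (Ts i) M + dh (Ts i) N - dh (Ts i) F' = 0" using Conf_dim_ge(3)[OF C2 O] by blast
  have "dh (Ts i) N + dh (Ts i) M - dh (Ts i) F = (if i = l then 1 else 0)"
  proof (cases "i = l")
    case True
    then show ?thesis using right_approximation.dim_hom_M[OF right] Conf_dim_ge(2)[OF C1 O] by simp
  next
    case False
    then have "\<not> isomorphic E M (Ts i)" using seedD(3)[OF ln i] by blast
    then show ?thesis using right_approximation.image_other[OF right seedD(2)[OF i]] Conf_dim_ge(2)[OF C1 O] False by simp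
  qed
  then show ?thesis using 1 unfolding coindex_eq[OF O] by simp
qed

text \<open>Dual to \<open>coindex_Ts\<close>. The sign changes because it is now the second
  conflation whose exactness fails at \<open>M\<close>.\<close>

lemma index_Ts: assumes i: "i \<in> {1..n}" shows "index (Ts i) = (if i = l then - 1 else 0)"
proof -
  note O = Ts_Ob[OF i]
  have C1': "Conf (opp E) M g F f N" and C2': "Conf (opp E) N t F' s M" using C1 C2 by simp_all
  have O': "Ts i \<in> Ob (opp E)" using O by simp
  have T: "Ts i \<in> T" using seedD(2)[OF i] by (simp add: indec_def)
  have "\<forall>h \<in> op.hom (Ts i) N. \<exists>h' \<in> op.hom (Ts i) F. cmp (opp E) f h' = h"
    using ext0_extend[OF ext0_T[OF M_T T] C1] unfolding op_hom opp_simps by metis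
  then have 1: "dh M (Ts i) + dh N (Ts i) - dh F (Ts i) = 0" using op.Conf_dim_ge(3)[OF C1' O'] unfolding op_dh by blast
  have "dh N (Ts i) + dh M (Ts i) - dh F' (Ts i) = (if i = l then 1 else 0)"
  proof (cases "i = l")
    case True
    then show ?thesis using right_approximation.dim_hom_M[OF left] op.Conf_dim_ge(2)[OF C2' O'] unfolding op_dh by simp
  next
    case False
    then have "\<not> isomorphic (opp E) M (Ts i)" using seedD(3)[OF i ln] unfolding isomorphic_opp by blast
    moreover have "Ts i \<in> indec (opp E) T" using seedD(2)[OF i] by (simp add: op_indec)
    ultimately have "(\<lambda>u. cmp (opp E) s u) ` op.hom (Ts i) F' = op.hom (Ts i) M"
      by (intro right_approximation.image_other[OF left])
    then show ?thesis using op.Conf_dim_ge(2)[OF C2' O'] False unfolding op_dh by simp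
  qed
  then have "dh F' (Ts i) - dh F (Ts i) = - (if i = l then 1 else 0)" using 1 by linarith
  then show ?thesis unfolding index_eq[OF O] by (auto split: if_splits)
qed

end

section \<open>From categories to integers\<close>

definition ex_matrix where "ex_matrix n B w = fst (seed_at n B w)"

lemma seed_at_snoc: "seed_at n B (w @ [l]) = mutate_seed n l (seed_at n B w)"
  by (simp add: seed_at_def)

lemma ex_matrix_Nil [simp]: "ex_matrix n B [] = B"
  by (simp add: ex_matrix_def seed_at_def)

lemma ex_matrix_snoc: "ex_matrix n B (w @ [l]) = mutate_matrix l (ex_matrix n B w)"
  by (simp add: ex_matrix_def seed_at_snoc mutate_seed_def split: prod.split)

text \<open>The numerical shadow of a realization: \<open>d v i w k\<close> is the dimension of the space of morphisms
  from the \<open>i\<close>-th summand of the cluster-tilting object at \<open>v\<close> to the \<open>k\<close>-th summand of the one at \<open>w\<close>.\<close>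

locale hom_dimensions =
  fixes n r :: nat and B :: "nat \<Rightarrow> nat \<Rightarrow> int" and d :: "nat list \<Rightarrow> nat \<Rightarrow> nat list \<Rightarrow> nat \<Rightarrow> int"
  fixes cv :: "nat list \<Rightarrow> nat \<Rightarrow> nat list \<Rightarrow> nat \<Rightarrow> int" and gv :: "nat list \<Rightarrow> nat \<Rightarrow> nat list \<Rightarrow> nat \<Rightarrow> int"
  defines "cv v i w l \<equiv> - (\<Sum>k = 1..n. ex_matrix n B w k l * d v i w k)"
    and "gv v i w l \<equiv> (\<Sum>k = 1..n. ex_matrix n B w k l * d w k v i)"
  assumes rn: "r \<le> n"
    and cov_other: "\<lbrakk>set v \<subseteq> {1..r}; set w \<subseteq> {1..r}; l \<in> {1..r}; k \<noteq> l\<rbrakk> \<Longrightarrow> d v i (w @ [l]) k = d v i w k"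
    and cov_exchange: "\<lbrakk>set v \<subseteq> {1..r}; set w \<subseteq> {1..r}; l \<in> {1..r}; i \<in> {1..n}\<rbrakk> \<Longrightarrow>
      d v i w l + d v i (w @ [l]) l
        = (\<Sum>k = 1..n. pos_part (ex_matrix n B w k l) * d v i w k) + pos_part (cv v i w l)"
    and cov_coherent: "\<lbrakk>set v \<subseteq> {1..r}; set w \<subseteq> {1..r}; l \<in> {1..r}; i \<in> {1..n}; j \<in> {1..n}; cv v i w l > 0\<rbrakk>
      \<Longrightarrow> cv v j w l \<ge> 0"
    and con_other: "\<lbrakk>set v \<subseteq> {1..r}; set w \<subseteq> {1..r}; l \<in> {1..r}; k \<noteq> l\<rbrakk> \<Longrightarrow> d (w @ [l]) k v i = d w k v i"
    and con_exchange: "\<lbrakk>set v \<subseteq> {1..r}; set w \<subseteq> {1..r}; l \<in> {1..r}; i \<in> {1..n}\<rbrakk> \<Longrightarrow>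
      d w l v i + d (w @ [l]) l v i
        = (\<Sum>k = 1..n. pos_part (ex_matrix n B w k l) * d w k v i) + pos_part (- gv v i w l)"
    and con_coherent: "\<lbrakk>set v \<subseteq> {1..r}; set w \<subseteq> {1..r}; l \<in> {1..r}; i \<in> {1..n}; j \<in> {1..n}; gv v i w l > 0\<rbrakk>
      \<Longrightarrow> gv v j w l \<ge> 0"
    and cv_same: "\<lbrakk>set w \<subseteq> {1..r}; l \<in> {1..r}; i \<in> {1..n}\<rbrakk> \<Longrightarrow> cv w i w l = (if i = l then 1 else 0)"
    and gv_same: "\<lbrakk>set w \<subseteq> {1..r}; l \<in> {1..r}; i \<in> {1..n}\<rbrakk> \<Longrightarrow> gv w i w l = (if i = l then 1 else 0)"

context realized
begin

definition step :: "nat \<Rightarrow> 'o set \<times> (nat \<Rightarrow> 'o) \<Rightarrow> 'o set \<times> (nat \<Rightarrow> 'o)" where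
  "step l p = (case p of (T, Ts) \<Rightarrow> let N = (SOME N. exchange_partner E T (Ts l) N)
     in (mutate_subcat E T (Ts l) N, Ts(l := N)))"

definition cats :: "'o set \<times> (nat \<Rightarrow> 'o) \<Rightarrow> nat list \<Rightarrow> 'o set \<times> (nat \<Rightarrow> 'o)" where
  "cats p w = foldl (\<lambda>p l. step l p) p w"

lemma cats_snoc: "cats p (w @ [l]) = step l (cats p w)"
  by (simp add: cats_def)

lemma step_exchange:
  assumes "r \<le> n" "cat_seed E n r B (fst p) (snd p)" "l \<in> {1..r}"
  obtains N where "exchange E n r B (fst p) (snd p) l N"
    "step l p = (mutate_subcat E (fst p) (snd p l) N, (snd p)(l := N))"
proof -
  have ln: "l \<in> {1..n}" using assms by auto
  define N where "N = (SOME N. exchange_partner E (fst p) (snd p l) N)"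
  have "\<not> projective E (snd p l)" using cat_seedD(5)[OF assms(2) ln] assms(3) by auto
  then have "\<exists>N. exchange_partner E (fst p) (snd p l) N"
    using cluster_structureD(1)[OF cat_seedD(1)[OF assms(2)] cat_seedD(2)[OF assms(2) ln]] by blast
  then have "exchange_partner E (fst p) (snd p l) N" unfolding N_def by (rule someI_ex)
  then have "exchange E n r B (fst p) (snd p) l N" using assms by unfold_locales auto
  moreover have "step l p = (mutate_subcat E (fst p) (snd p l) N, (snd p)(l := N))"
    by (simp add: step_def N_def Let_def split: prod.split)
  ultimately show thesis using that by blast
qed

lemma cats_seed:
  assumes rn: "r \<le> n" and p: "cat_seed E n r B (fst p) (snd p)" and w: "set w \<subseteq> {1..r}"
  shows "cat_seed E n r (ex_matrix n B w) (fst (cats p w)) (snd (cats p w))"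
  using w
proof (induction w rule: rev_induct)
  case Nil
  then show ?case using p by (simp add: cats_def)
next
  case (snoc l w)
  then have s: "cat_seed E n r (ex_matrix n B w) (fst (cats p w)) (snd (cats p w))" and l: "l \<in> {1..r}" by auto
  obtain N where N: "exchange E n r (ex_matrix n B w) (fst (cats p w)) (snd (cats p w)) l N"
    "step l (cats p w) = (mutate_subcat E (fst (cats p w)) (snd (cats p w) l) N, (snd (cats p w))(l := N))"
    using step_exchange[OF rn s l] .
  show ?case using exchange.seed'[OF N(1)] unfolding cats_snoc N(2) ex_matrix_snoc fst_conv snd_conv .
qed

text \<open>For the exchange at \<open>w\<close> in direction \<open>l\<close>,
  \<open>cv v i w l\<close> is the coindex and \<open>gv v i w l\<close> is minus the index of the
  object at position \<open>i\<close> of \<open>v\<close>. The coherence axioms hold because the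
  summands at \<open>v\<close> have no extensions among each other.\<close>

lemma realized_hom_dimensions:
  assumes rn: "r \<le> n" and p: "cat_seed E n r B (fst p) (snd p)"
  shows "hom_dimensions n r B (\<lambda>v i w k. dh (snd (cats p v) i) (snd (cats p w) k))"
proof -
  define ob where "ob v i = snd (cats p v) i" for v i
  have pair: "\<exists>N F F' f g s t. exchange_pair E n r (ex_matrix n B w) (fst (cats p w)) (snd (cats p w)) l N F F' f g s t
      \<and> snd (cats p (w @ [l])) = (snd (cats p w))(l := N)"
    if w: "set w \<subseteq> {1..r}" and l: "l \<in> {1..r}" for w l
  proof -
    note s = cats_seed[OF rn p w]
    obtain N where N: "exchange E n r (ex_matrix n B w) (fst (cats p w)) (snd (cats p w)) l N"
      "step l (cats p w) = (mutate_subcat E (fst (cats p w)) (snd (cats p w) l) N, (snd (cats p w))(l := N))"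
      using step_exchange[OF rn s l] .
    interpret exchange E n r "ex_matrix n B w" "fst (cats p w)" "snd (cats p w)" l N by (rule N(1))
    have "exchange_conflations E S M N" using cluster_structureD(2)[OF seedD(1) M_indec_T M_np partner] .
    then obtain F f g F' s t where "Conf E N f F g M" "min_right_approx E S F M g" "Conf E M s F' t N" "min_left_approx E S M F' s"
      unfolding exchange_conflations_def by (elim exE conjE) (rule that)
    then have "exchange_pair E n r (ex_matrix n B w) (fst (cats p w)) (snd (cats p w)) l N F F' f g s t"
      by unfold_locales
    then show ?thesis unfolding cats_snoc N(2) snd_conv by (intro exI conjI) (assumption, rule refl)
  qed
  have Ob: "ob v i \<in> Ob E" and oT: "ob v i \<in> fst (cats p v)" if "set v \<subseteq> {1..r}" "i \<in> {1..n}" for v i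
    using cat_seedD(2)[OF cats_seed[OF rn p that(1)] that(2)] indecomposable_Ob by (auto simp: ob_def indec_def)
  have ext: "ext0 (ob v i) (ob v j)" if "set v \<subseteq> {1..r}" "i \<in> {1..n}" "j \<in> {1..n}" for v i j
    using cluster_tilting_ext0[OF cat_seedD(1)[OF cats_seed[OF rn p that(1)]] oT oT] that by blast
  show ?thesis unfolding ob_def[symmetric]
  proof (unfold_locales, goal_cases)
    case 1
    show ?case by (rule rn)
  next
    case (2 v w l k i)
    then show ?case using pair[of w l] by (auto simp: ob_def)
  next
    case (3 v w l i)
    obtain N F F' f g s t where e: "exchange_pair E n r (ex_matrix n B w) (fst (cats p w)) (snd (cats p w)) l N F F' f g s t"
      and N: "snd (cats p (w @ [l])) = (snd (cats p w))(l := N)" using pair[OF 3(2,3)] by blast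
    have "ob (w @ [l]) l = N" using N by (simp add: ob_def)
    then show ?case
      using exchange_pair.coindex_sum[OF e Ob[OF 3(1,4)] ext[OF 3(1,4,4)]]
      unfolding exchange_pair.coindex_def[OF e] by (simp add: ob_def)
  next
    case (4 v w l i j)
    obtain N F F' f g s t where e: "exchange_pair E n r (ex_matrix n B w) (fst (cats p w)) (snd (cats p w)) l N F F' f g s t"
      using pair[OF 4(2,3)] by blast
    show ?case
      using exchange_pair.coindex_coherent[OF e Ob[OF 4(1,4)] Ob[OF 4(1,5)] ext[OF 4(1,5,4)]] 4(6)
      unfolding exchange_pair.coindex_def[OF e] ob_def by blast
  next
    case (5 v w l k i)
    then show ?case using pair[of w l] by (auto simp: ob_def)
  next
    case (6 v w l i)
    obtain N F F' f g s t where e: "exchange_pair E n r (ex_matrix n B w) (fst (cats p w)) (snd (cats p w)) l N F F' f g s t"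
      and N: "snd (cats p (w @ [l])) = (snd (cats p w))(l := N)" using pair[OF 6(2,3)] by blast
    have "ob (w @ [l]) l = N" using N by (simp add: ob_def)
    then show ?case
      using exchange_pair.index_sum[OF e Ob[OF 6(1,4)] ext[OF 6(1,4,4)]]
      unfolding exchange_pair.index_def[OF e] by (simp add: ob_def)
  next
    case (7 v w l i j)
    obtain N F F' f g s t where e: "exchange_pair E n r (ex_matrix n B w) (fst (cats p w)) (snd (cats p w)) l N F F' f g s t"
      using pair[OF 7(2,3)] by blast
    show ?case
      using exchange_pair.index_coherent[OF e Ob[OF 7(1,4)] Ob[OF 7(1,5)] ext[OF 7(1,4,5)]] 7(6)
      unfolding exchange_pair.index_def[OF e] ob_def by simp
  next
    case (8 w l i)
    obtain N F F' f g s t where e: "exchange_pair E n r (ex_matrix n B w) (fst (cats p w)) (snd (cats p w)) l N F F' f g s t"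
      using pair[OF 8(1,2)] by blast
    show ?case using exchange_pair.coindex_Ts[OF e 8(3)]
      unfolding exchange_pair.coindex_def[OF e] ob_def .
  next
    case (9 w l i)
    obtain N F F' f g s t where e: "exchange_pair E n r (ex_matrix n B w) (fst (cats p w)) (snd (cats p w)) l N F F' f g s t"
      using pair[OF 9(1,2)] by blast
    show ?case using exchange_pair.index_Ts[OF e 9(3)]
      unfolding exchange_pair.index_def[OF e] ob_def by (auto split: if_splits)
  qed
qed

end

theorem realization_hom_dimensions:
  fixes E :: "('o, 'm::ab_group_add, 'k::alg_closed_field) exact_cat"
  assumes rn: "r \<le> n" and "frobenius_2cy_realization E T n r B"
  shows "\<exists>d. hom_dimensions n r B d"
proof -
  from assms(2) obtain Ts where f: "frobenius_2cy_category E" and cs: "cluster_structure E"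
    and ct: "cluster_tilting_object E T" and ds: "direct_sum E T n Ts"
    and ind: "\<forall>i \<in> {1..n}. indecomposable E (Ts i)"
    and ni: "\<forall>i \<in> {1..n}. \<forall>j \<in> {1..n}. i \<noteq> j \<longrightarrow> \<not> isomorphic E (Ts i) (Ts j)"
    and proj: "\<forall>i \<in> {1..n}. projective E (Ts i) \<longleftrightarrow> r < i"
    and B: "\<forall>i \<in> {1..n}. \<forall>j \<in> {1..r}. B i j = quiver_matrix (arrows E (add_closure E {T})) (Ts i) (Ts j)"
    unfolding frobenius_2cy_realization_def by (elim exE conjE) (rule that)
  interpret frobenius_2cy E using f by (simp add: frobenius_2cy_def)
  interpret realized E by unfold_locales (rule cs)
  have ctT: "cluster_tilting_subcat E (add_closure E {T})" using ct by (simp add: cluster_tilting_object_def)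
  have TO: "T \<in> Ob E" using ds by (simp add: direct_sum_def)
  have TT: "T \<in> add_closure E {T}" using in_add_closure TO by simp
  obtain a b where ab: "\<forall>i\<in>{1..n}. a i \<in> Hom E (Ts i) T \<and> b i \<in> Hom E T (Ts i)"
    "\<forall>i\<in>{1..n}. \<forall>j\<in>{1..n}. b i \<cdot> a j = (if i = j then idm E (Ts i) else 0)"
    using ds unfolding direct_sum_def by (elim conjE exE) (rule that)
  have Ts: "Ts i \<in> indec E (add_closure E {T})" if i: "i \<in> {1..n}" for i
  proof -
    have "direct_factor E (Ts i) T"
    proof (rule retract_imp_factor)
      show "a i \<in> hom (Ts i) T" "b i \<in> hom T (Ts i)" using ab(1) i TO indecomposable_Ob ind homI by blast+
      show "b i \<cdot> a i = idm E (Ts i)" using ab(2) i by simp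
    qed
    then show ?thesis using cluster_tilting_closed[OF ctT] TT ind i unfolding closed_factors_def indec_def by blast
  qed
  \<comment> \<open>Locality is used twice: an indecomposable retract of a sum of copies of
    \<open>T\<close> passes through one copy, and then through one of the summands
    \<open>Ts j\<close> of that copy.\<close>
  have all: "\<exists>i \<in> {1..n}. isomorphic E Z (Ts i)" if Z: "Z \<in> indec E (add_closure E {T})" for Z
  proof -
    have Zi: "indecomposable E Z" and "Z \<in> add_closure E {T}" using Z by (auto simp: indec_def)
    then obtain Y m A where h: "\<forall>k\<in>{1..m}. A k \<in> {T}" "direct_sum E Y m A" "direct_factor E Z Y"
      unfolding add_closure_def by blast
    note ZO = indecomposable_Ob[OF Zi]
    obtain i p where ip: "i \<in> hom Z Y" "p \<in> hom Y Z" "p \<cdot> i = idm E Z" using factor_retract[OF h(3)] .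
    obtain k u v where k: "k \<in> {1..m}" "u \<in> hom Z (A k)" "v \<in> hom (A k) Z" "iso Z Z (v \<cdot> u)"
      using direct_sum_component[OF Zi h(2) ip(1,2)] ip(3) iso_id[OF ZO] by metis
    then have uv: "u \<in> hom Z T" "v \<in> hom T Z" using h(1) by auto
    obtain j u' v' where j: "j \<in> {1..n}" "u' \<in> hom Z (Ts j)" "v' \<in> hom (Ts j) Z" "iso Z Z (v' \<cdot> u')"
      using direct_sum_component[OF Zi ds uv k(4)] .
    have "iso Z (Ts j) u'"
      using indecomposable_split_iso(1)[OF indecomposable_nonzero[OF Zi] _ j(2-4)] ind j(1) by blast
    then show ?thesis using j(1) isomorphic_eq by blast
  qed
  have "cat_seed E n r B (add_closure E {T}) Ts"
    unfolding cat_seed_def using ctT Ts ni all proj B by blast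
  then show ?thesis using realized_hom_dimensions[OF rn, of B "(add_closure E {T}, Ts)"] by auto
qed

section \<open>Laurent polynomials and seeds\<close>

type_synonym lpoly = "(nat \<Rightarrow>\<^sub>0 int) \<Rightarrow>\<^sub>0 rat"

abbreviation "lookup \<equiv> Poly_Mapping.lookup"
abbreviation "keys \<equiv> Poly_Mapping.keys"
abbreviation "single \<equiv> Poly_Mapping.single"

lemma expand_single: "P = (\<Sum>m\<in>keys P. single m (lookup P m))"
  by (rule poly_mapping_eqI) (auto simp: lookup_sum lookup_single when_def in_keys_iff)

lemma mult_expand:
  "(P :: 'a::monoid_add \<Rightarrow>\<^sub>0 'b::semiring_0) * Q
    = (\<Sum>m\<in>keys P. \<Sum>k\<in>keys Q. single (m + k) (lookup P m * lookup Q k))"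
  by (subst (1) expand_single[of P], subst (1) expand_single[of Q]) (simp add: sum_product mult_single)

lemma rconst_simps [simp]:
  "rconst 0 = 0" "rconst 1 = 1" "rconst (a + b) = rconst a + rconst b" "rconst (a * b) = rconst a * rconst b"
  by (simp_all add: rconst_def single_zero Zero_fract_def One_fract_def single_add mult_single)

lemma rconst_eq_0_iff [simp]: "rconst a = 0 \<longleftrightarrow> a = 0"
proof
  assume "rconst a = 0"
  then have "single 0 a = (0 :: mpoly)" by (simp add: rconst_def Zero_fract_def eq_fract)
  then show "a = 0" by (metis lookup_single_eq lookup_zero)
qed simp

lemma rconst_uminus [simp]: "rconst (- a) = - rconst a"
  using rconst_simps(3)[of a "- a"] by (simp add: eq_neg_iff_add_eq_0 add.commute)

lemma rconst_of_nat: "rconst (of_nat k) = of_nat k"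
  by (induction k) auto

lemma rconst_of_int: "rconst (of_int k) = of_int k"
  by (cases k rule: int_cases2) (simp_all add: rconst_of_nat)

text \<open>Common core of \<open>lev\<close> with integer exponents and of \<open>peval\<close>
  with natural exponents, for an arbitrary function on the exponents.\<close>

definition gev :: "('a \<Rightarrow> ratfun) \<Rightarrow> ('a \<Rightarrow>\<^sub>0 rat) \<Rightarrow> ratfun" where
  "gev \<phi> P = (\<Sum>m\<in>keys P. rconst (lookup P m) * \<phi> m)"

lemma gev_superset: "finite A \<Longrightarrow> keys P \<subseteq> A \<Longrightarrow> gev \<phi> P = (\<Sum>m\<in>A. rconst (lookup P m) * \<phi> m)"
  unfolding gev_def by (rule sum.mono_neutral_left) (auto simp: in_keys_iff)

lemma gev_0 [simp]: "gev \<phi> 0 = 0"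
  by (simp add: gev_def)

lemma gev_add: "gev \<phi> (P + Q) = gev \<phi> P + gev \<phi> Q"
proof -
  let ?A = "keys P \<union> keys Q"
  have "gev \<phi> (P + Q) = (\<Sum>m\<in>?A. rconst (lookup (P + Q) m) * \<phi> m)"
    by (rule gev_superset) (auto dest: subsetD[OF keys_add])
  also have "\<dots> = gev \<phi> P + gev \<phi> Q"
    by (subst (1 2) gev_superset[of ?A]) (auto simp: lookup_add algebra_simps sum.distrib)
  finally show ?thesis .
qed

lemma gev_single [simp]: "gev \<phi> (single m c) = rconst c * \<phi> m"
  by (cases "c = 0") (auto simp: gev_def)

lemma gev_sum: "gev \<phi> (\<Sum>i\<in>I. P i) = (\<Sum>i\<in>I. gev \<phi> (P i))"
  by (induction I rule: infinite_finite_induct) (auto simp: gev_add)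

lemma gev_mult:
  fixes P Q :: "'a::cancel_comm_monoid_add \<Rightarrow>\<^sub>0 rat"
  assumes "\<And>m k. \<phi> (m + k) = \<phi> m * \<phi> k" shows "gev \<phi> (P * Q) = gev \<phi> P * gev \<phi> Q"
proof -
  have "gev \<phi> (P * Q) = (\<Sum>m\<in>keys P. \<Sum>k\<in>keys Q. (rconst (lookup P m) * \<phi> m) * (rconst (lookup Q k) * \<phi> k))"
    unfolding mult_expand[of P Q] by (simp add: gev_sum assms mult_ac)
  then show ?thesis by (simp add: gev_def sum_product)
qed

definition lmono :: "(nat \<Rightarrow> ratfun) \<Rightarrow> (nat \<Rightarrow>\<^sub>0 int) \<Rightarrow> ratfun" where
  "lmono x m = (\<Prod>i\<in>keys m. x i powi lookup m i)"

lemma lmono_superset: "finite A \<Longrightarrow> keys m \<subseteq> A \<Longrightarrow> lmono x m = (\<Prod>i\<in>A. x i powi lookup m i)"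
  unfolding lmono_def by (rule prod.mono_neutral_left) (auto simp: in_keys_iff)

lemma lmono_0 [simp]: "lmono x 0 = 1"
  by (simp add: lmono_def)

lemma lmono_single [simp]: "lmono x (single i k) = x i powi k"
  by (cases "k = 0") (auto simp: lmono_def)

lemma lmono_add: assumes "\<And>i. x i \<noteq> 0" shows "lmono x (m + k) = lmono x m * lmono x k"
proof -
  let ?A = "keys m \<union> keys k"
  have "lmono x (m + k) = (\<Prod>i\<in>?A. x i powi lookup (m + k) i)"
    by (rule lmono_superset) (auto dest: subsetD[OF keys_add])
  also have "\<dots> = lmono x m * lmono x k"
    by (subst (1 2) lmono_superset[of ?A]) (auto simp: lookup_add power_int_add assms prod.distrib)
  finally show ?thesis .
qed

lemma lmono_nonzero: assumes "\<And>i. x i \<noteq> 0" shows "lmono x m \<noteq> 0"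
  using assms by (auto simp: lmono_def)

lemma lmono_uminus: assumes "\<And>i. x i \<noteq> 0" shows "lmono x (- m) = inverse (lmono x m)"
  using lmono_add[of x "- m" m] lmono_nonzero[of x m] assms by (simp add: field_simps)

lemma lmono_sum: assumes "\<And>i. x i \<noteq> 0" shows "lmono x (\<Sum>i\<in>I. m i) = (\<Prod>i\<in>I. lmono x (m i))"
  by (induction I rule: infinite_finite_induct) (auto simp: lmono_add assms)

lemma lmono_fun_upd: "lookup m s = 0 \<Longrightarrow> lmono (x(s := y)) m = lmono x m"
  unfolding lmono_def by (rule prod.cong) (auto simp: in_keys_iff)

definition lev :: "(nat \<Rightarrow> ratfun) \<Rightarrow> lpoly \<Rightarrow> ratfun" where "lev x = gev (lmono x)"

lemma lev_simps [simp]: "lev x 0 = 0" "lev x (single m c) = rconst c * lmono x m" "lev x (P + Q) = lev x P + lev x Q"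
  "lev x (\<Sum>i\<in>I. p i) = (\<Sum>i\<in>I. lev x (p i))" "lev x 1 = 1"
  by (simp_all add: lev_def gev_add gev_sum flip: single_one)

lemma lev_uminus [simp]: "lev x (- P) = - lev x P"
  using lev_simps(3)[of x "- P" P] by (simp add: eq_neg_iff_add_eq_0)

lemma lev_diff [simp]: "lev x (P - Q) = lev x P - lev x Q"
  using lev_simps(3)[of x P "- Q"] by simp

lemma lev_mult: "(\<And>i. x i \<noteq> 0) \<Longrightarrow> lev x (P * Q) = lev x P * lev x Q"
  unfolding lev_def by (rule gev_mult) (rule lmono_add)

lemma lev_power: "(\<And>i. x i \<noteq> 0) \<Longrightarrow> lev x (P ^ k) = lev x P ^ k"
  by (induction k) (auto simp: lev_mult)

definition emono :: "(nat \<Rightarrow> ratfun) \<Rightarrow> (nat \<Rightarrow>\<^sub>0 nat) \<Rightarrow> ratfun" where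
  "emono v m = (\<Prod>i\<in>keys m. v i ^ lookup m i)"

lemma emono_superset: "finite A \<Longrightarrow> keys m \<subseteq> A \<Longrightarrow> emono v m = (\<Prod>i\<in>A. v i ^ lookup m i)"
  unfolding emono_def by (rule prod.mono_neutral_left) (auto simp: in_keys_iff)

lemma emono_add: "emono v (m + k) = emono v m * emono v k"
proof -
  let ?A = "keys m \<union> keys k"
  have "emono v (m + k) = (\<Prod>i\<in>?A. v i ^ lookup (m + k) i)"
    by (rule emono_superset) (auto dest: subsetD[OF keys_add])
  also have "\<dots> = emono v m * emono v k"
    by (subst (1 2) emono_superset[of ?A]) (auto simp: lookup_add power_add prod.distrib)
  finally show ?thesis .
qed

lemma peval_eq_gev: "peval v = gev (emono v)"
  by (rule ext) (simp add: peval_def gev_def emono_def)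

lemma peval_simps [simp]: "peval v 0 = 0" "peval v (single m c) = rconst c * emono v m"
  "peval v (P + Q) = peval v P + peval v Q" "peval v (P * Q) = peval v P * peval v Q" "peval v 1 = 1"
  by (simp_all add: peval_eq_gev gev_add gev_mult emono_add flip: single_one) (simp add: emono_def)

section \<open>Weights, valuations and homogeneous parts\<close>

definition wt :: "(nat \<Rightarrow>\<^sub>0 int) \<Rightarrow> (nat \<Rightarrow>\<^sub>0 int) \<Rightarrow> int" where
  "wt u m = (\<Sum>i\<in>keys u. lookup u i * lookup m i)"

lemma wt_simps [simp]: "wt u 0 = 0" "wt u (m + k) = wt u m + wt u k" "wt u (- m) = - wt u m" "wt u (m - k) = wt u m - wt u k"
  by (simp_all add: wt_def lookup_add lookup_minus algebra_simps sum.distrib sum_subtractf sum_negf)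

lemma wt_single: "wt u (single i k) = lookup u i * k"
proof -
  have "wt u (single i k) = (\<Sum>j\<in>keys u. if j = i then lookup u i * k else 0)"
    unfolding wt_def by (intro sum.cong) (auto simp: lookup_single when_def)
  then show ?thesis by (auto simp: in_keys_iff)
qed

lemma wt_single_left: "wt (single i k) m = k * lookup m i"
  by (cases "k = 0") (auto simp: wt_def)

text \<open>Only meaningful for \<open>P \<noteq> 0\<close>, the minimum of the empty set being unspecified.\<close>

definition val :: "(nat \<Rightarrow>\<^sub>0 int) \<Rightarrow> lpoly \<Rightarrow> int" where
  "val u P = Min (wt u ` keys P)"

lemma val_le: "m \<in> keys P \<Longrightarrow> val u P \<le> wt u m"
  unfolding val_def by (intro Min_le) auto

lemma val_attained: "P \<noteq> 0 \<Longrightarrow> \<exists>m\<in>keys P. wt u m = val u P"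
proof -
  assume "P \<noteq> 0"
  then have "val u P \<in> wt u ` keys P" unfolding val_def by (intro Min_in) auto
  then show ?thesis by auto
qed

lemma val_eqI: "m \<in> keys P \<Longrightarrow> wt u m = a \<Longrightarrow> (\<And>k. k \<in> keys P \<Longrightarrow> a \<le> wt u k) \<Longrightarrow> val u P = a"
  using val_le[of m P u] val_attained[of P u] by force

definition part :: "(nat \<Rightarrow>\<^sub>0 int) \<Rightarrow> int \<Rightarrow> lpoly \<Rightarrow> lpoly" where
  "part u e P = (\<Sum>m \<in> {m \<in> keys P. wt u m = e}. single m (lookup P m))"

lemma lookup_part: "lookup (part u e P) m = (if wt u m = e then lookup P m else 0)"
  unfolding part_def by (auto simp: lookup_sum lookup_single when_def in_keys_iff)

lemma keys_part: "keys (part u e P) = {m \<in> keys P. wt u m = e}"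
  by (auto simp: in_keys_iff lookup_part split: if_splits)

lemma part_add: "part u e (P + Q) = part u e P + part u e Q"
  by (rule poly_mapping_eqI) (simp add: lookup_part lookup_add)

lemma part_mult_homogeneous:
  assumes "\<And>m. m \<in> keys P \<Longrightarrow> wt u m = a"
  shows "part u e (P * Q) = P * part u (e - a) Q"
proof -
  note PQ = mult_expand[of P]
  have z: "part u e 0 = 0" by (simp add: part_def)
  have ps: "part u e (\<Sum>i\<in>I. p i) = (\<Sum>i\<in>I. part u e (p i))" for I :: "(nat \<Rightarrow>\<^sub>0 int) set" and p
    by (induction I rule: infinite_finite_induct) (auto simp: part_add z)
  have s: "part u e (single m c) = (if wt u m = e then single m c else 0)" for m c
    by (rule poly_mapping_eqI) (auto simp: lookup_part lookup_single when_def)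
  have "part u e (P * Q) = (\<Sum>m\<in>keys P. \<Sum>k\<in>keys Q. if wt u k = e - a then single (m + k) (lookup P m * lookup Q k) else 0)"
    unfolding PQ[of Q] ps s using assms by (intro sum.cong refl) (auto simp: algebra_simps)
  also have "\<dots> = (\<Sum>m\<in>keys P. \<Sum>k\<in>keys (part u (e - a) Q). single (m + k) (lookup P m * lookup (part u (e - a) Q) k))"
    unfolding keys_part lookup_part by (subst sum.inter_filter) (auto intro!: sum.cong)
  also have "\<dots> = P * part u (e - a) Q" unfolding PQ ..
  finally show ?thesis .
qed

text \<open>The lowest homogeneous parts have a nonzero product, as Laurent polynomials have no zero
  divisors, and all other products are of larger weight.\<close>

lemma val_mult:
  assumes "P \<noteq> 0" "Q \<noteq> 0" shows "val u (P * Q) = val u P + val u Q"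
proof -
  let ?a = "val u P" and ?b = "val u Q"
  define P1 where "P1 = part u ?a P"
  have P1: "P1 \<noteq> 0" using val_attained[OF assms(1), of u] unfolding P1_def by (metis (mono_tags, lifting) empty_iff keys_part keys_zero mem_Collect_eq)
  have Q1: "part u ?b Q \<noteq> 0" using val_attained[OF assms(2), of u] by (metis (mono_tags, lifting) empty_iff keys_part keys_zero mem_Collect_eq)
  have "P1 * part u ?b Q \<noteq> 0" using P1 Q1 by simp
  moreover have "part u (?a + ?b) (P1 * Q) = P1 * part u ?b Q"
    using part_mult_homogeneous[of P1 u ?a "?a + ?b" Q] by (simp add: P1_def keys_part)
  moreover have "part u (?a + ?b) ((P - P1) * Q) = 0"
  proof -
    have "wt u m > ?a + ?b" if mk: "m \<in> keys ((P - P1) * Q)" for m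
    proof -
      obtain k l where kl: "m = k + l" "k \<in> keys (P - P1)" "l \<in> keys Q" using keys_mult[of "P - P1" Q] mk by auto
      have "k \<in> keys P" "wt u k \<noteq> ?a" using kl(2) by (auto simp: in_keys_iff lookup_minus P1_def lookup_part split: if_splits)
      then have "wt u k > ?a" using val_le[of k P u] by simp
      then show ?thesis using kl val_le[of l Q u] by simp
    qed
    then have "keys (part u (?a + ?b) ((P - P1) * Q)) = {}" unfolding keys_part by force
    then show ?thesis by simp
  qed
  ultimately have "part u (?a + ?b) (P * Q) \<noteq> 0"
    using part_add[of u "?a + ?b" "P1 * Q" "(P - P1) * Q"] by (simp add: algebra_simps)
  then have "keys (part u (?a + ?b) (P * Q)) \<noteq> {}" by simp
  then obtain m where "m \<in> keys (P * Q)" "wt u m = ?a + ?b" unfolding keys_part by auto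
  moreover have "?a + ?b \<le> wt u m" if m: "m \<in> keys (P * Q)" for m
  proof -
    obtain k l where kl: "m = k + l" "k \<in> keys P" "l \<in> keys Q" using keys_mult[of P Q] m by auto
    then show ?thesis using val_le[of k P u] val_le[of l Q u] by simp
  qed
  ultimately show ?thesis by (rule val_eqI)
qed

text \<open>Translates \<open>matrix_rank\<close>, whose matrices are indexed from 0, into the
  relations between columns used from here on.\<close>

lemma full_rank_columns:
  assumes rank: "matrix_rank n r B = r" and c: "\<forall>i\<in>{1..n}. (\<Sum>j = 1..r. B i j * c j) = (0::int)" and j: "j \<in> {1..r}"
  shows "c j = 0"
proof (rule ccontr)
  assume cj: "c j \<noteq> 0"
  define A where "A = mat n r (\<lambda>(i, j). rat_of_int (B (Suc i) (Suc j)))"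
  have A: "A \<in> carrier_mat n r" by (simp add: A_def)
  have rk: "vec_space.rank n A = r" using rank by (simp add: matrix_rank_def A_def)
  define v where "v = vec r (\<lambda>j. rat_of_int (c (Suc j)))"
  have v: "v \<in> carrier_vec r" by (simp add: v_def)
  have "v $ (j - 1) \<noteq> 0" using j cj by (auto simp: v_def)
  then have v0: "v \<noteq> 0\<^sub>v r" using j by auto
  have "A *\<^sub>v v = 0\<^sub>v n"
  proof (rule eq_vecI)
    fix i assume "i < dim_vec (0\<^sub>v n :: rat vec)"
    then have i: "i < n" by simp
    have "(A *\<^sub>v v) $ i = (\<Sum>j = 0..<r. rat_of_int (B (Suc i) (Suc j) * c (Suc j)))"
      using i by (simp add: A_def v_def scalar_prod_def)
    also have "\<dots> = rat_of_int (\<Sum>j = 0..<r. B (Suc i) (Suc j) * c (Suc j))" by simp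
    also have "(\<Sum>j = 0..<r. B (Suc i) (Suc j) * c (Suc j)) = (\<Sum>j = 1..r. B (Suc i) j * c j)"
      using sum.shift_bounds_Suc_ivl[of "\<lambda>j. B (Suc i) j * c j" 0 r]
      by (simp add: atLeastLessThanSuc_atLeastAtMost One_nat_def)
    also have "\<dots> = 0" using c i by simp
    finally show "(A *\<^sub>v v) $ i = 0\<^sub>v n $ i" using i by simp
  qed (simp add: A_def)
  interpret vec_space "TYPE(rat)" n .
  \<comment> \<open>Independence concerns the set of columns, so the columns have to be distinct.
    They are, since the rank is the size of a maximal independent set of columns and so at most the
    number of distinct ones.\<close>
  obtain S where S: "maximal S (\<lambda>T. T \<subseteq> set (cols A) \<and> lin_indpt T)"
    using maximal_exists[of "(\<lambda>T. T \<subseteq> set (cols A) \<and> lin_indpt T)" "card (set (cols A))" "{}"]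
    by (meson List.finite_set card_mono empty_iff empty_subsetI finite_lin_indpt2 rev_finite_subset)
  then have "card S \<le> card (set (cols A))" by (simp add: card_mono maximal_def)
  then have "r \<le> card (set (cols A))" using rank_card_indpt[OF A S] rk by simp
  then have d: "distinct (cols A)"
    using A by (intro card_distinct) (metis card_length carrier_matD(2) cols_length le_antisym)
  show False using lin_depI[OF A v v0 \<open>A *\<^sub>v v = 0\<^sub>v n\<close> d] full_rank_lin_indpt[OF A rk d] by simp
qed

lemma lookup_col_sum: "lookup (\<Sum>i = 1..n::nat. single i (f i)) k = (if k \<in> {1..n} then f k else 0)"
  by (simp add: lookup_sum lookup_single when_def)

definition column :: "nat \<Rightarrow> (nat \<Rightarrow> int) \<Rightarrow> nat \<Rightarrow>\<^sub>0 int" where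
  "column n f = (\<Sum>i = 1..n. single i (f i))"

lemma lookup_column: "lookup (column n f) k = (if k \<in> {1..n} then f k else 0)"
  unfolding column_def by (rule lookup_col_sum)

lemma lmono_column: "(\<And>i. x i \<noteq> 0) \<Longrightarrow> lmono x (column n f) = (\<Prod>i = 1..n. x i powi f i)"
  unfolding column_def by (simp add: lmono_sum)

lemma pos_part_nonneg [simp]: "pos_part a \<ge> 0"
  by (simp add: pos_part_def)

lemma prod_pos_part: "(\<And>i. x i \<noteq> 0) \<Longrightarrow> (\<Prod>i = 1..n. x i ^ nat (pos_part (f i))) = lmono x (column n (\<lambda>i. pos_part (f i)))"
  by (subst lmono_column) (auto simp: power_int_nonneg_exp)

definition cpos where "cpos n b s = column n (\<lambda>i. pos_part (b i s))"
definition cneg where "cneg n b s = column n (\<lambda>i. pos_part (- b i s))"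
definition ccol where "ccol n b s = column n (\<lambda>i. b i s)"

lemma ccol_eq: "ccol n b s = cpos n b s - cneg n b s"
  by (rule poly_mapping_eqI) (auto simp: ccol_def cpos_def cneg_def lookup_column lookup_minus pos_part_def)

definition bin :: "nat \<Rightarrow> (nat \<Rightarrow> nat \<Rightarrow> int) \<Rightarrow> nat \<Rightarrow> lpoly" where
  "bin n b s = single (cpos n b s) 1 + single (cneg n b s) 1"

lemma bin_nonzero: "bin n b s \<noteq> 0"
proof
  assume "bin n b s = 0"
  then have "lookup (bin n b s) (cpos n b s) = 0" by simp
  then show False by (simp add: bin_def lookup_add lookup_single when_def split: if_splits)
qed

text \<open>Splits the mutation term into a summand linear in \<open>c\<close> and one linear in
  \<open>a\<close>, so that sums over rows or columns can be mutated without distinguishing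
  signs.\<close>

lemma mutate_entry: "sgn a * pos_part (a * c) = pos_part a * c + a * pos_part (- c)" for a c :: int
  by (cases a "0::int" rule: linorder_cases; cases c "0::int" rule: linorder_cases)
    (simp_all add: pos_part_def sgn_if max_def mult_le_0_iff zero_le_mult_iff)

section \<open>Seeds with algebraically independent variables\<close>

text \<open>The invariant carried through mutations: \<open>inj\<close> is algebraic independence of
  the variables, \<open>indep\<close> is full rank of the exchange matrix. All \<open>x i\<close>
  must be nonzero, also outside {1..n}, because exponents are indexed by all natural
  numbers.\<close>

locale good_seed =
  fixes n r :: nat and b :: "nat \<Rightarrow> nat \<Rightarrow> int" and x :: "nat \<Rightarrow> ratfun"
  assumes rn: "r \<le> n" and nz: "\<And>i. x i \<noteq> 0" and inj: "\<And>P. lev x P = 0 \<Longrightarrow> P = 0"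
    and anti: "\<And>i j. i \<in> {1..r} \<Longrightarrow> j \<in> {1..r} \<Longrightarrow> b i j = - b j i"
    and indep: "\<And>c j. \<forall>i\<in>{1..n}. (\<Sum>j = 1..r. b i j * c j) = 0 \<Longrightarrow> j \<in> {1..r} \<Longrightarrow> c j = 0"
begin

lemma lev_mult': "lev x (P * Q) = lev x P * lev x Q"
  by (rule lev_mult) (rule nz)

lemma lev_eq_iff: "lev x P = lev x Q \<longleftrightarrow> P = Q"
  using inj[of "P - Q"] by auto

lemma lev_0_iff: "lev x P = 0 \<longleftrightarrow> P = 0"
  using inj by auto

lemma lmono_add': "lmono x (m + k) = lmono x m * lmono x k"
  by (rule lmono_add) (rule nz)

lemma diag: "s \<in> {1..r} \<Longrightarrow> b s s = 0"
  using anti[of s s] by simp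

abbreviation "x' s \<equiv> snd (mutate_seed n s (b, x))"
abbreviation "b' s \<equiv> mutate_matrix s b"

lemma x'_eq: "x' s = x(s := lev x (bin n b s) / x s)"
  by (simp add: mutate_seed_def bin_def cpos_def cneg_def prod_pos_part[OF nz])

lemma x'_nz: "x' s i \<noteq> 0"
  using nz bin_nonzero by (simp add: x'_eq lev_0_iff)

lemma b'_simps: "j \<noteq> s \<Longrightarrow> i \<noteq> s \<Longrightarrow> b' s i j = b i j + sgn (b i s) * pos_part (b i s * b s j)"
  "b' s s j = - b s j" "b' s i s = - b i s"
  by (simp_all add: mutate_matrix_def)

lemma b'_anti:
  assumes "s \<in> {1..r}" "i \<in> {1..r}" "j \<in> {1..r}" shows "b' s i j = - b' s j i"
proof (cases "i = s \<or> j = s")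
  case True
  then show ?thesis using anti[OF assms(2,3)] True by (auto simp: mutate_matrix_def)
next
  case False
  have e: "b j s = - b s j" "b s i = - b i s" "b j i = - b i j"
    by (rule anti; rule assms)+
  have "sgn p * pos_part (p * q) = sgn q * pos_part (p * q)" for p q :: int
  proof (cases "p * q > 0")
    case True
    then have "sgn p = sgn q" by (auto simp: zero_less_mult_iff)
    then show ?thesis by simp
  next
    case False
    then show ?thesis by (simp add: pos_part_def)
  qed
  from this[of "b i s" "b s j"] show ?thesis using False by (simp add: mutate_matrix_def e sgn_minus mult.commute)
qed

lemma b'_indep:
  assumes s: "s \<in> {1..r}" and c: "\<forall>i\<in>{1..n}. (\<Sum>j = 1..r. b' s i j * c j) = 0" and j: "j \<in> {1..r}"
  shows "c j = 0"
proof -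
  have sn: "s \<in> {1..n}" using s rn by auto
  define J where "J = {1..r} - {s}"
  have split: "(\<Sum>j = 1..r. h j) = h s + (\<Sum>j\<in>J. h j)" for h :: "nat \<Rightarrow> int"
    unfolding J_def using s by (subst sum.remove[of _ s]) auto
  have row: "(\<Sum>j\<in>J. b s j * c j) = 0"
    using bspec[OF c sn] split[of "\<lambda>j. b' s s j * c j"] diag[OF s] by (simp add: b'_simps sum_negf)
  \<comment> \<open>The coefficients of the corresponding relation between the columns of
    \<open>b\<close>. In a row other than \<open>s\<close>, mutation adds multiples of column
    \<open>s\<close> and of row \<open>s\<close>; the latter contribute nothing by
    \<open>row\<close>.\<close>
  define e where "e = (\<lambda>j. if j = s then (\<Sum>j\<in>J. pos_part (- b s j) * c j) - c s else c j)"
  have eJ: "(\<Sum>j\<in>J. h j * e j) = (\<Sum>j\<in>J. h j * c j)" for h by (rule sum.cong) (auto simp: J_def e_def)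
  have "(\<Sum>j = 1..r. b i j * e j) = 0" if i: "i \<in> {1..n}" for i
  proof (cases "i = s")
    case True
    then show ?thesis using row split[of "\<lambda>j. b i j * e j"] eJ[of "b s"] diag[OF s] by simp
  next
    case False
    have "(\<Sum>j\<in>J. b' s i j * c j) = (\<Sum>j\<in>J. b i j * c j + pos_part (b i s) * (b s j * c j) + b i s * (pos_part (- b s j) * c j))"
      by (rule sum.cong) (use False in \<open>auto simp: J_def b'_simps mutate_entry algebra_simps\<close>)
    also have "\<dots> = (\<Sum>j\<in>J. b i j * c j) + b i s * (\<Sum>j\<in>J. pos_part (- b s j) * c j)"
      by (simp add: sum.distrib sum_distrib_left[symmetric] row)
    finally have "(\<Sum>j\<in>J. b i j * c j) + b i s * (\<Sum>j\<in>J. pos_part (- b s j) * c j) - b i s * c s = 0"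
      using bspec[OF c i] split[of "\<lambda>j. b' s i j * c j"] by (simp add: b'_simps)
    then show ?thesis using split[of "\<lambda>j. b i j * e j"] eJ[of "b i"] by (simp add: e_def algebra_simps)
  qed
  then have e0: "e j = 0" if "j \<in> {1..r}" for j using indep that by blast
  have cJ: "c k = 0" if "k \<in> J" for k using e0[of k] that by (auto simp: J_def e_def)
  then have "(\<Sum>j\<in>J. pos_part (- b s j) * c j) = 0" by (intro sum.neutral) auto
  then have "c s = 0" using e0[OF s] by (simp add: e_def)
  then show ?thesis using cJ j by (cases "j = s") (auto simp: J_def)
qed

lemma bin_degree: assumes "s \<in> {1..r}" "m \<in> keys (bin n b s ^ k)" shows "lookup m s = 0"
  using assms(2)
proof (induction k arbitrary: m)
  case 0
  then show ?case by (simp flip: single_one split: if_splits)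
next
  case (Suc k)
  then obtain a c where ac: "m = a + c" "a \<in> keys (bin n b s)" "c \<in> keys (bin n b s ^ k)"
    using keys_mult[of "bin n b s" "bin n b s ^ k"] by auto
  have "a = cpos n b s \<or> a = cneg n b s"
    using ac(2) by (auto simp: bin_def in_keys_iff lookup_add lookup_single when_def split: if_splits)
  then have "lookup a s = 0" using diag[OF assms(1)] by (auto simp: cpos_def cneg_def lookup_column pos_part_def)
  then show ?case using ac Suc.IH by (simp add: lookup_add)
qed

lemma lmono_split: "lmono y m = lmono y (m - single s (lookup m s)) * y s powi lookup m s" if "\<And>i. y i \<noteq> 0"
  using lmono_add[of y "m - single s (lookup m s)" "single s (lookup m s)", OF that] by simp

text \<open>Clearing denominators in \<open>lev (x' s) P = 0\<close> gives a relation between the \<open>x i\<close> whose part of highest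
  degree in \<open>x s\<close> is the part of \<open>P\<close> of lowest degree.\<close>

lemma x'_inj: assumes s: "s \<in> {1..r}" and P: "lev (x' s) P = 0" shows "P = 0"
proof (rule ccontr)
  assume "P \<noteq> 0"
  let ?N = "bin n b s"
  define e where "e = val (single s 1) P"
  obtain m0 where m0: "m0 \<in> keys P" "lookup m0 s = e" using val_attained[OF \<open>P \<noteq> 0\<close>, of "single s 1"] by (auto simp: e_def wt_single_left)
  have ge: "e \<le> lookup m s" if "m \<in> keys P" for m using val_le[OF that, of "single s 1"] by (simp add: e_def wt_single_left)
  \<comment> \<open>Substituting the exchange quotient reverses the exponent at \<open>s\<close>:
    \<open>f m\<close> is the resulting monomial, and \<open>k m\<close> is the power of the
    exchange binomial left after its power with exponent \<open>e\<close> has been taken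
    out.\<close>
  define f where "f m = m - single s (2 * lookup m s)" for m :: "nat \<Rightarrow>\<^sub>0 int"
  define k where "k m = nat (lookup m s - e)" for m :: "nat \<Rightarrow>\<^sub>0 int"
  define R where "R = (\<Sum>m\<in>keys P. single (f m) (lookup P m) * ?N ^ k m)"
  have "lmono (x' s) m = lmono x (f m) * lev x ?N powi lookup m s" for m
  proof -
    have "lmono (x' s) m = lmono x (m - single s (lookup m s)) * (lev x ?N / x s) powi lookup m s"
      by (subst lmono_split[of _ m s, OF x'_nz]) (simp add: x'_eq lmono_fun_upd lookup_minus)
    also have "\<dots> = lmono x (f m) * lev x ?N powi lookup m s"
    proof -
      have "f m = (m - single s (lookup m s)) + single s (- lookup m s)"
        by (rule poly_mapping_eqI) (auto simp: f_def lookup_minus lookup_add lookup_single when_def)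
      then have "lmono x (f m) = lmono x (m - single s (lookup m s)) * x s powi (- lookup m s)"
        by (simp only: lmono_add' lmono_single)
      then show ?thesis by (simp add: power_int_divide_distrib power_int_minus field_simps)
    qed
    finally show ?thesis .
  qed
  moreover have "lev x ?N powi lookup m s = lev x ?N powi e * lev x ?N ^ k m" if "m \<in> keys P" for m
    using ge[OF that] bin_nonzero[of n b s] power_int_add[of "lev x ?N" e "lookup m s - e"]
    by (simp add: k_def power_int_nonneg_exp lev_0_iff)
  ultimately have "lev (x' s) P = lev x ?N powi e * lev x R"
    unfolding R_def lev_simps lev_mult' lev_power[OF nz] sum_distrib_left
    by (subst lev_def, subst gev_def, intro sum.cong) auto
  then have "R = 0" using P bin_nonzero[of n b s] by (simp add: lev_0_iff)
  moreover have "lookup R (f m0) = lookup P m0"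
  proof -
    \<comment> \<open>Only \<open>m0\<close> contributes at \<open>f m0\<close>: the binomial does
      not involve \<open>x s\<close>, so terms with another exponent at \<open>s\<close> stay
      apart.\<close>
    have "lookup (single (f m) (lookup P m) * ?N ^ k m) (f m0) = (if m = m0 then lookup P m0 else 0)" if m: "m \<in> keys P" for m
    proof (cases "lookup m s = e")
      case True
      then have "k m = 0" by (simp add: k_def)
      moreover have "f m = f m0 \<longleftrightarrow> m = m0" using True m0(2) by (auto simp: f_def)
      ultimately show ?thesis by (auto simp: lookup_single)
    next
      case False
      have "f m0 \<notin> keys (single (f m) (lookup P m) * ?N ^ k m)"
      proof
        assume "f m0 \<in> keys (single (f m) (lookup P m) * ?N ^ k m)"
        then obtain a c where ac: "f m0 = a + c" "a \<in> keys (single (f m) (lookup P m))" "c \<in> keys (?N ^ k m)"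
          using keys_mult[of "single (f m) (lookup P m)" "?N ^ k m"] by blast
        then have "a = f m" "lookup c s = 0" using bin_degree[OF s] by (auto split: if_splits)
        then have "lookup (f m0) s = lookup (f m) s" using ac by (simp add: lookup_add)
        then show False using False m0(2) by (simp add: f_def lookup_minus)
      qed
      then show ?thesis using False m0 by (auto simp: in_keys_iff)
    qed
    then show ?thesis unfolding R_def lookup_sum using m0(1) by simp
  qed
  ultimately show False using m0 by (simp add: in_keys_iff)
qed

lemma good_mutate: "s \<in> {1..r} \<Longrightarrow> good_seed n r (b' s) (x' s)"
  by (rule good_seed.intro) (rule rn x'_nz x'_inj b'_anti b'_indep; assumption)+

lemma b_involution: "s \<in> {1..r} \<Longrightarrow> mutate_matrix s (b' s) = b"
  by (intro ext) (auto simp: mutate_matrix_def sgn_minus)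

lemma bin_b': assumes s: "s \<in> {1..r}" shows "bin n (b' s) s = bin n b s"
proof -
  have "cpos n (b' s) s = cneg n b s" "cneg n (b' s) s = cpos n b s"
    by (simp_all add: cpos_def cneg_def b'_simps)
  then show ?thesis by (simp add: bin_def add.commute)
qed

lemma lev_bin: "s \<in> {1..r} \<Longrightarrow> lev (x(s := y)) (bin n b s) = lev x (bin n b s)"
  using diag by (simp add: bin_def lmono_fun_upd cpos_def cneg_def lookup_column pos_part_def)

lemma mutate_involution:
  assumes s: "s \<in> {1..r}" shows "mutate_seed n s (mutate_seed n s (b, x)) = (b, x)"
proof -
  interpret m: good_seed n r "b' s" "x' s" by (rule good_mutate[OF s])
  have 1: "mutate_seed n s (b, x) = (b' s, x' s)" by (simp add: mutate_seed_def)
  have x1: "x' s s = lev x (bin n b s) / x s" by (simp only: x'_eq fun_upd_same)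
  have "lev x (bin n b s) \<noteq> 0" using bin_nonzero[of n b s] by (simp only: lev_0_iff not_False_eq_True)
  then have x2: "lev x (bin n b s) / x' s s = x s" unfolding x1 using nz[of s] by (simp add: field_simps)
  have "snd (mutate_seed n s (b' s, x' s)) = (x' s)(s := lev (x' s) (bin n (b' s) s) / x' s s)"
    by (rule m.x'_eq)
  also have "lev (x' s) (bin n (b' s) s) = lev x (bin n b s)"
    unfolding bin_b'[OF s] x'_eq by (rule lev_bin[OF s])
  also have "(x' s)(s := lev x (bin n b s) / x' s s) = x" unfolding x2 by (simp add: x'_eq)
  finally have 2: "snd (mutate_seed n s (b' s, x' s)) = x" .
  have "fst (mutate_seed n s (b' s, x' s)) = b" using b_involution[OF s] by (simp add: mutate_seed_def)
  with 2 show ?thesis by (subst 1) (rule prod_eqI, simp_all only: fst_conv snd_conv)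
qed

end



text \<open>For algebraic independence, a vanishing Laurent polynomial is multiplied by the monomial
  \<open>M\<close>, whose exponents \<open>K\<close> are large enough to make all exponents
  nonnegative. The result is a polynomial with the same coefficients that is zero in the fraction
  field.\<close>

lemma good_initial:
  assumes rn: "r \<le> n" and anti: "\<forall>i\<in>{1..r}. \<forall>j\<in>{1..r}. B i j = - B j i" and rank: "matrix_rank n r B = r"
  shows "good_seed n r B xvar"
proof
  show nz: "xvar i \<noteq> 0" for i
  proof
    assume "xvar i = 0"
    then have "pvar i = 0" by (simp add: xvar_def Zero_fract_def eq_fract)
    then show False by (metis pvar_def lookup_single_eq lookup_zero zero_neq_one)
  qed
  fix P assume P: "lev xvar P = 0"
  show "P = 0"
  proof (rule ccontr)
    assume "P \<noteq> 0"
    then obtain m0 where m0: "m0 \<in> keys P" by fastforce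
    define I where "I = (\<Union>m\<in>keys P. keys m)"
    have I: "finite I" by (simp add: I_def)
    define K where "K = (\<Sum>m\<in>keys P. \<Sum>i\<in>I. \<bar>lookup m i\<bar>)"
    have K: "- K \<le> lookup m i" if "m \<in> keys P" "i \<in> I" for m i
    proof -
      have "\<bar>lookup m i\<bar> \<le> (\<Sum>i\<in>I. \<bar>lookup m i\<bar>)" using that I by (intro member_le_sum) auto
      also have "\<dots> \<le> K" unfolding K_def using that by (intro member_le_sum sum_nonneg) auto
      finally show ?thesis by simp
    qed
    define M where "M = (\<Sum>i\<in>I. single i K)"
    define f where "f m = (\<Sum>i\<in>I. single i (nat (lookup m i + K)))" for m :: "nat \<Rightarrow>\<^sub>0 int"
    have lf: "lookup (f m) i = (if i \<in> I then nat (lookup m i + K) else 0)" for m i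
      unfolding f_def using I by (auto simp: lookup_sum lookup_single when_def)
    have km: "keys m \<subseteq> I" if "m \<in> keys P" for m using that by (auto simp: I_def)
    have fract_prod: "(\<Prod>i\<in>J. xvar i ^ k i) = Fract (single (\<Sum>i\<in>J. single i (k i)) 1) 1" if "finite J" for J k
      using that
    proof (induction J rule: finite_induct)
      case empty
      then show ?case by (simp add: One_fract_def)
    next
      case (insert j J)
      have p: "xvar j ^ c = Fract (single (single j c) 1) 1" for c
      proof (induction c)
        case 0
        show ?case by (simp add: One_fract_def)
      next
        case (Suc c)
        have "single j (Suc c) = single j 1 + single j c" by (simp flip: single_add add: plus_1_eq_Suc)
        then show ?case unfolding power_Suc Suc by (simp add: xvar_def pvar_def mult_single)
      qed
      show ?case using insert by (simp add: p mult_single)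
    qed
    have mon: "lmono xvar m * lmono xvar M = Fract (single (f m) 1) 1" if m: "m \<in> keys P" for m
    proof -
      have "lmono xvar m * lmono xvar M = (\<Prod>i\<in>I. xvar i powi (lookup m i + K))"
      proof -
        have "xvar i powi (lookup m i + K) = xvar i powi lookup m i * lmono xvar (single i K)" for i
          using nz[of i] by (simp add: power_int_add)
        then show ?thesis unfolding M_def lmono_sum[OF nz] lmono_superset[OF I km[OF m]] by (simp only: prod.distrib)
      qed
      also have "\<dots> = (\<Prod>i\<in>I. xvar i ^ nat (lookup m i + K))"
      proof (rule prod.cong[OF refl])
        fix i assume "i \<in> I"
        then have "0 \<le> lookup m i + K" using K[OF m] by force
        then show "xvar i powi (lookup m i + K) = xvar i ^ nat (lookup m i + K)" by (simp only: power_int_nonneg_exp)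
      qed
      finally show ?thesis using fract_prod[OF I] by (simp add: f_def)
    qed
    have fract_sum: "(\<Sum>m\<in>A. Fract (g m) 1) = Fract (\<Sum>m\<in>A. g m) 1" for A :: "(nat \<Rightarrow>\<^sub>0 int) set" and g :: "_ \<Rightarrow> mpoly"
      by (induction A rule: infinite_finite_induct) (simp_all add: Zero_fract_def)
    define P0 where "P0 = (\<Sum>m\<in>keys P. single (f m) (lookup P m))"
    have "lev xvar P * lmono xvar M = Fract P0 1"
    proof -
      have "lev xvar P * lmono xvar M = (\<Sum>m\<in>keys P. rconst (lookup P m) * (lmono xvar m * lmono xvar M))"
        unfolding lev_def gev_def by (simp add: sum_distrib_right mult.assoc)
      also have "\<dots> = (\<Sum>m\<in>keys P. Fract (single (f m) (lookup P m)) 1)"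
        by (rule sum.cong) (simp_all add: mon rconst_def mult_single)
      also have "\<dots> = Fract (\<Sum>m\<in>keys P. single (f m) (lookup P m)) 1"
        by (rule fract_sum)
      finally show ?thesis by (simp add: P0_def)
    qed
    then have "Fract P0 1 = 0" using P by simp
    then have "P0 = 0" by (simp add: Zero_fract_def eq_fract)
    have f_inj: "f m = f m0 \<longleftrightarrow> m = m0" if m: "m \<in> keys P" for m
    proof
      assume e: "f m = f m0"
      show "m = m0"
      proof (rule poly_mapping_eqI)
        fix i
        show "lookup m i = lookup m0 i"
        proof (cases "i \<in> I")
          case True
          have "nat (lookup m i + K) = nat (lookup m0 i + K)" using arg_cong[OF e, of "\<lambda>q. lookup q i"] True by (simp add: lf)
          then show ?thesis using K[OF m True] K[OF m0 True] by linarith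
        next
          case False
          then show ?thesis using km[OF m] km[OF m0] by (metis in_keys_iff subsetD)
        qed
      qed
    qed simp
    have "lookup P0 (f m0) = (\<Sum>m\<in>keys P. if f m = f m0 then lookup P m else 0)"
      unfolding P0_def lookup_sum lookup_single when_def ..
    also have "\<dots> = (\<Sum>m\<in>keys P. if m = m0 then lookup P m else 0)"
      by (intro sum.cong refl) (simp only: f_inj)
    also have "\<dots> = lookup P m0" using m0 by (simp add: sum.delta)
    finally show False using \<open>P0 = 0\<close> m0 by (simp add: in_keys_iff)
  qed
next
  show "B i j = - B j i" if "i \<in> {1..r}" "j \<in> {1..r}" for i j using anti that by blast
  show "c j = 0" if "\<forall>i\<in>{1..n}. (\<Sum>j = 1..r. B i j * c j) = 0" "j \<in> {1..r}" for c j
    by (rule full_rank_columns[OF rank that])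
qed (rule rn)

section \<open>The Laurent phenomenon\<close>

text \<open>\<open>Q\<close> is a nonzerodivisor modulo \<open>P\<close>. This replaces coprimality
  and is enough to cancel powers of \<open>Q\<close> in a divisibility by powers of
  \<open>P\<close>.\<close>

definition nzd :: "'a::comm_ring_1 \<Rightarrow> 'a \<Rightarrow> bool" where
  "nzd P Q \<longleftrightarrow> (\<forall>F. P dvd Q * F \<longrightarrow> P dvd F)"

lemma nzd_mult: "nzd P Q \<Longrightarrow> nzd P R \<Longrightarrow> nzd P (Q * R)"
  unfolding nzd_def by (metis mult.assoc)

lemma nzd_power: "nzd P Q \<Longrightarrow> nzd P (Q ^ k)"
proof (induction k)
  case 0
  show ?case unfolding nzd_def power_0 mult_1 by blast
next
  case (Suc k)
  then show ?case unfolding power_Suc by (intro nzd_mult)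
qed

lemma nzd_add_multiple: assumes "nzd P Q" shows "nzd P (Q + P * H)"
  unfolding nzd_def
proof (intro allI impI)
  fix F assume "P dvd (Q + P * H) * F"
  also have "(Q + P * H) * F = Q * F + P * (H * F)" by (simp add: algebra_simps)
  finally have "P dvd Q * F" by (rule iffD1[OF dvd_add_left_iff[OF dvd_triv_left]])
  then show "P dvd F" by (rule mp[OF spec[OF assms[unfolded nzd_def]]])
qed

lemma single_unit: "single m 1 * single (- m) 1 = (1 :: lpoly)"
  by (simp add: mult_single)

lemma nzd_monomial: "nzd P (single m 1 :: lpoly)"
  unfolding nzd_def
proof (intro allI impI)
  fix F :: lpoly assume "P dvd single m 1 * F"
  then have "P dvd single (- m) 1 * (single m 1 * F)" by (rule dvd_mult)
  also have "single (- m) 1 * (single m 1 * F) = (single m 1 * single (- m) 1) * F" by (simp only: mult_ac)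
  also have "\<dots> = F" unfolding single_unit by simp
  finally show "P dvd F" .
qed

lemma nzd_dvd_power:
  fixes P :: "'a::idom"
  assumes "nzd P Q" "P \<noteq> 0" shows "P ^ a dvd U * Q ^ c \<Longrightarrow> P ^ a dvd U"
proof (induction a arbitrary: U)
  case (Suc a)
  have "P dvd Q ^ c * U" using Suc.prems dvd_mult_left[of P "P ^ a"] by (simp add: mult.commute)
  then obtain V where V: "U = P * V" using nzd_power[OF assms(1)] unfolding nzd_def by blast
  have "P * P ^ a dvd P * (V * Q ^ c)" using Suc.prems by (simp only: V power_Suc mult.assoc)
  then have "P ^ a dvd V * Q ^ c" using assms(2) by (blast dest: iffD1[OF dvd_mult_cancel_left])
  then have "P ^ a dvd V" by (rule Suc.IH)
  then show ?case unfolding V power_Suc by (rule mult_dvd_mono[OF dvd_refl])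
qed simp

lemma dvd_power_binomial: "\<exists>K. (D + G) ^ e = D ^ e + G * (K :: 'a::comm_ring_1)"
proof (induction e)
  case (Suc e)
  then obtain K where "(D + G) ^ e = D ^ e + G * K" by blast
  then have "(D + G) ^ Suc e = D ^ Suc e + G * (D ^ e + D * K + G * K)" by (simp add: algebra_simps)
  then show ?case by blast
qed (rule exI[of _ 0], simp)

lemma part_multiple:
  assumes "\<And>m. m \<in> keys P \<Longrightarrow> wt u m = a" "P dvd G" shows "P dvd part u e G"
  using assms(2) part_mult_homogeneous[OF assms(1)] by (metis dvdE dvd_triv_left)

lemma sum_parts: "F = (\<Sum>e \<in> wt u ` keys F. part u e F)"
  by (rule poly_mapping_eqI) (auto simp: lookup_sum lookup_part in_keys_iff)

lemma keys_binomial: "m \<in> keys (single \<mu> c + single \<nu> (d :: rat)) \<Longrightarrow> m = \<mu> \<or> m = \<nu>"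
  by (auto simp: in_keys_iff lookup_add lookup_single when_def split: if_splits)

text \<open>The weight \<open>u\<close> makes the first binomial homogeneous and the second one not.
  Starting from the lowest weight, divisibility of each homogeneous part of \<open>F\<close> follows
  from that of a lower part.\<close>

lemma nzd_binomials_aux:
  assumes N: "wt u \<nu>1 = wt u \<nu>2" and M: "wt u \<mu>1 < wt u \<mu>2"
  shows "nzd (single \<nu>1 1 + single \<nu>2 1 :: lpoly) (single \<mu>1 1 + single \<mu>2 1)"
  unfolding nzd_def
proof (intro allI impI)
  let ?N = "single \<nu>1 1 + single \<nu>2 1 :: lpoly"
  fix F assume d: "?N dvd (single \<mu>1 1 + single \<mu>2 1) * F"
  have hom: "wt u m = wt u \<nu>1" if "m \<in> keys ?N" for m using keys_binomial[OF that] N by auto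
  have "?N dvd part u e F" for e
  proof (induction "nat (e - val u F + 1)" arbitrary: e rule: less_induct)
    case less
    show ?case
    proof (cases "e < val u F")
      case True
      then have "keys (part u e F) = {}" unfolding keys_part using val_le[of _ F u] by force
      then show ?thesis by simp
    next
      case False
      let ?d = "wt u \<mu>2 - wt u \<mu>1"
      have IH: "?N dvd part u (e - ?d) F" using False M by (intro less) auto
      have "part u (e + wt u \<mu>1) ((single \<mu>1 1 + single \<mu>2 1) * F)
          = single \<mu>1 1 * part u e F + single \<mu>2 1 * part u (e - ?d) F"
        using part_mult_homogeneous[of "single \<mu>1 1" u "wt u \<mu>1" "e + wt u \<mu>1" F]
          part_mult_homogeneous[of "single \<mu>2 1" u "wt u \<mu>2" "e + wt u \<mu>1" F]
        by (simp add: distrib_right part_add algebra_simps)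
      then have "?N dvd single \<mu>1 1 * part u e F + single \<mu>2 1 * part u (e - ?d) F"
        using part_multiple[OF hom d, of "e + wt u \<mu>1"] by simp
      then have "?N dvd single \<mu>1 1 * part u e F" using IH by (simp add: dvd_add_left_iff)
      then show ?thesis using nzd_monomial unfolding nzd_def by blast
    qed
  qed
  then show "?N dvd F" by (subst sum_parts[of F u]) (rule dvd_sum)
qed

lemma nzd_binomials:
  assumes "wt u \<nu>1 = wt u \<nu>2" "wt u \<mu>1 \<noteq> wt u \<mu>2"
  shows "nzd (single \<nu>1 1 + single \<nu>2 1 :: lpoly) (single \<mu>1 1 + single \<mu>2 1)"
  using nzd_binomials_aux[OF assms(1), of \<mu>1 \<mu>2] nzd_binomials_aux[OF assms(1), of \<mu>2 \<mu>1] assms(2)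
  by (cases "wt u \<mu>1 < wt u \<mu>2") (auto simp: add.commute)

lemma wt_add_left: "wt (u + v) m = wt u m + wt v m"
proof -
  let ?A = "keys u \<union> keys v"
  have s: "wt w m = (\<Sum>i\<in>?A. lookup w i * lookup m i)" if "keys w \<subseteq> ?A" for w
    unfolding wt_def by (rule sum.mono_neutral_left) (use that in \<open>auto simp: in_keys_iff\<close>)
  have "wt (u + v) m = (\<Sum>i\<in>?A. lookup (u + v) i * lookup m i)" by (rule s) (rule keys_add)
  then show ?thesis using s[of u] s[of v] by (simp add: lookup_add distrib_right sum.distrib)
qed

text \<open>The weight is supported on the coordinates \<open>k\<close> and \<open>l\<close> and
  orthogonal to \<beta>; it does not annihilate \<alpha> because the minor is nonzero.\<close>

lemma nzd_binomials_minor: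
  assumes "\<alpha> = \<mu>1 - \<mu>2" "\<beta> = \<nu>1 - \<nu>2" "lookup \<alpha> k * lookup \<beta> l \<noteq> lookup \<alpha> l * lookup \<beta> k"
  shows "nzd (single \<nu>1 1 + single \<nu>2 1 :: lpoly) (single \<mu>1 1 + single \<mu>2 1)"
proof (rule nzd_binomials)
  let ?u = "single k (lookup \<beta> l) + single l (- lookup \<beta> k)"
  have "wt ?u \<nu>1 - wt ?u \<nu>2 = wt ?u \<beta>" "wt ?u \<mu>1 - wt ?u \<mu>2 = wt ?u \<alpha>" by (simp_all add: assms(1,2))
  moreover have "wt ?u \<beta> = 0" "wt ?u \<alpha> \<noteq> 0" using assms(3) by (auto simp: wt_add_left wt_single_left mult.commute)
  ultimately show "wt ?u \<nu>1 = wt ?u \<nu>2" "wt ?u \<mu>1 \<noteq> wt ?u \<mu>2" by linarith+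
qed

lemma nzd_unit_left: "nzd N Q \<Longrightarrow> nzd (single m 1 * N) (Q :: lpoly)"
proof -
  have d: "single m 1 * N dvd F \<longleftrightarrow> N dvd F" for F
  proof
    assume "N dvd F"
    then obtain G where "F = N * G" by blast
    moreover have "single m 1 * N * (single (- m) 1 * G) = (single m 1 * single (- m) 1) * (N * G)"
      by (simp only: mult_ac)
    ultimately have "F = single m 1 * N * (single (- m) 1 * G)" unfolding single_unit by simp
    then show "single m 1 * N dvd F" by (rule dvdI)
  qed (metis dvd_mult_right)
  show "nzd N Q \<Longrightarrow> nzd (single m 1 * N) Q" unfolding nzd_def d .
qed

definition laurent :: "(nat \<Rightarrow> ratfun) \<Rightarrow> ratfun set" where "laurent x = range (lev x)"

lemma mutate_matrix_neg: "mutate_matrix s (\<lambda>i j. - b i j) = (\<lambda>i j. - mutate_matrix s b i j)"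
  by (intro ext) (simp add: mutate_matrix_def sgn_minus)

lemma mutate_seed_neg: "snd (mutate_seed n s (\<lambda>i j. - b i j, x)) = snd (mutate_seed n s (b, x))"
  by (simp add: mutate_seed_def add.commute)

context good_seed
begin

lemma neg: "good_seed n r (\<lambda>i j. - b i j) x"
proof (rule good_seed.intro)
  show "- b i j = - (- b j i)" if "i \<in> {1..r}" "j \<in> {1..r}" for i j using anti[OF that] by simp
  show "c j = 0" if c: "\<forall>i\<in>{1..n}. (\<Sum>j = 1..r. - b i j * c j) = 0" and j: "j \<in> {1..r}" for c j
    by (rule indep[OF _ j]) (use c in \<open>simp add: sum_negf\<close>)
qed (rule rn nz inj; assumption?)+

lemma laurent_ops:
  "lmono x m \<in> laurent x" "z \<in> laurent x \<Longrightarrow> w \<in> laurent x \<Longrightarrow> z + w \<in> laurent x"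
  "z \<in> laurent x \<Longrightarrow> w \<in> laurent x \<Longrightarrow> z * w \<in> laurent x" "rconst c \<in> laurent x"
proof -
  show "lmono x m \<in> laurent x" unfolding laurent_def by (rule image_eqI[of _ _ "single m 1"]) auto
  show "rconst c \<in> laurent x" unfolding laurent_def by (rule image_eqI[of _ _ "single 0 c"]) auto
qed (auto simp: laurent_def image_iff simp flip: lev_simps(3) lev_mult')

lemma laurent_prod: "(\<And>i. i \<in> I \<Longrightarrow> f i \<in> laurent x) \<Longrightarrow> (\<Prod>i\<in>I. f i) \<in> laurent x"
  using laurent_ops(1)[of 0] by (induction I rule: infinite_finite_induct) (auto intro: laurent_ops(3))

lemma laurent_power: "z \<in> laurent x \<Longrightarrow> z ^ k \<in> laurent x"
  using laurent_prod[of "{..<k}" "\<lambda>_. z"] by simp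

lemma laurent_sum: "(\<And>i. i \<in> I \<Longrightarrow> f i \<in> laurent x) \<Longrightarrow> (\<Sum>i\<in>I. f i) \<in> laurent x"
  using laurent_ops(4)[of 0] by (induction I rule: infinite_finite_induct) (auto intro: laurent_ops(2))

lemma var_laurent: "x i \<in> laurent x" "x i powi k \<in> laurent x"
  using laurent_ops(1)[of "single i 1"] laurent_ops(1)[of "single i k"] by simp_all

text \<open>One exponent \<open>a\<close> serves all monomials and all variables in
  \<open>S\<close>: the sum of the absolute values of the exponents at \<open>S\<close>.\<close>

lemma clear_denominator:
  assumes y: "\<And>i. y i \<noteq> 0" "\<And>i. y i \<in> laurent x" "\<And>i. i \<notin> S \<Longrightarrow> y i = x i" and S: "finite S"
    and z: "z \<in> laurent y"
  shows "\<exists>a. z * (\<Prod>i\<in>S. y i) ^ a \<in> laurent x"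
proof -
  obtain F where F: "z = lev y F" using z by (auto simp: laurent_def)
  define a where "a = (\<Sum>m\<in>keys F. \<Sum>i\<in>S. nat \<bar>lookup m i\<bar>)"
  have le: "0 \<le> lookup m i + int a" if "m \<in> keys F" "i \<in> S" for m i
  proof -
    have "nat \<bar>lookup m i\<bar> \<le> (\<Sum>i\<in>S. nat \<bar>lookup m i\<bar>)" using that S by (intro member_le_sum) auto
    also have "\<dots> \<le> a" unfolding a_def using that by (intro member_le_sum) auto
    finally show ?thesis by linarith
  qed
  have "lmono y m * (\<Prod>i\<in>S. y i) ^ a \<in> laurent x" if m: "m \<in> keys F" for m
  proof -
    let ?A = "keys m \<union> S"
    have "lmono y m * (\<Prod>i\<in>S. y i) ^ a = (\<Prod>i\<in>?A. y i powi lookup m i) * (\<Prod>i\<in>?A. if i \<in> S then y i ^ a else 1)"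
      using S by (subst lmono_superset[of ?A]) (auto simp: prod_power_distrib prod.inter_restrict[symmetric] Int_absorb1)
    also have "\<dots> = (\<Prod>i\<in>?A. y i powi lookup m i * (if i \<in> S then y i ^ a else 1))"
      by (simp only: prod.distrib)
    also have "\<dots> \<in> laurent x"
    proof (rule laurent_prod)
      fix i assume "i \<in> ?A"
      show "y i powi lookup m i * (if i \<in> S then y i ^ a else 1) \<in> laurent x"
      proof (cases "i \<in> S")
        case True
        have "y i powi lookup m i * y i ^ a = y i powi (lookup m i + int a)" using y(1)[of i] by (simp add: power_int_add)
        also have "\<dots> = y i ^ nat (lookup m i + int a)" using le[OF m True] by (simp only: power_int_nonneg_exp)
        finally show ?thesis using True laurent_power[OF y(2)[of i]] by simp
      next
        case False
        then show ?thesis using y(3)[OF False] var_laurent(2) by simp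
      qed
    qed
    finally show ?thesis .
  qed
  then have "(\<Sum>m\<in>keys F. rconst (lookup F m) * (lmono y m * (\<Prod>i\<in>S. y i) ^ a)) \<in> laurent x"
    by (intro laurent_sum laurent_ops(3)[OF laurent_ops(4)]) simp
  then show ?thesis unfolding F lev_def gev_def by (intro exI[of _ a]) (simp add: sum_distrib_right mult.assoc)
qed

end

context good_seed
begin

lemma seed_eq: "mutate_seed n s (b, x) = (b' s, x' s)"
  by (simp add: mutate_seed_def)

lemma x'_simps: "x' s s = lev x (bin n b s) / x s" "q \<noteq> s \<Longrightarrow> x' s q = x q"
  by (simp_all add: x'_eq)

lemma lmono_x'_other: "lookup m s = 0 \<Longrightarrow> lmono (x' s) m = lmono x m"
  by (simp add: x'_eq lmono_fun_upd)

text \<open>If all minors vanished, the two columns would be proportional, contradicting their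
  independence.\<close>

lemma ccol_minor:
  assumes "i \<in> {1..r}" "j \<in> {1..r}" "i \<noteq> j"
  shows "\<exists>k l. lookup (ccol n b j) k * lookup (ccol n b i) l \<noteq> lookup (ccol n b j) l * lookup (ccol n b i) k"
proof (rule ccontr)
  assume "\<not> ?thesis"
  then have par: "lookup (ccol n b j) k * lookup (ccol n b i) l = lookup (ccol n b j) l * lookup (ccol n b i) k" for k l by blast
  obtain l where l: "l \<in> {1..n}" "b l i \<noteq> 0"
  proof (rule ccontr)
    assume "\<not> thesis"
    then have "\<forall>l\<in>{1..n}. b l i = 0" using that by blast
    then have "\<forall>k\<in>{1..n}. (\<Sum>q = 1..r. b k q * (if q = i then 1 else 0)) = 0" using assms(1) by simp
    from indep[OF this assms(1)] show False by simp
  qed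
  let ?c = "\<lambda>q. if q = j then b l i else if q = i then - b l j else 0"
  have "(\<Sum>q = 1..r. b k q * ?c q) = 0" if k: "k \<in> {1..n}" for k
  proof -
    have "(\<Sum>q = 1..r. b k q * ?c q) = (\<Sum>q\<in>{i, j}. b k q * ?c q)"
      using assms by (intro sum.mono_neutral_right) auto
    also have "\<dots> = b k j * b l i - b k i * b l j" using assms(3) by simp
    also have "\<dots> = 0" using par[of k l] k l by (simp add: ccol_def lookup_column mult.commute)
    finally show ?thesis .
  qed
  then have "b l i = 0" using indep[of ?c j] assms(2) by simp
  then show False using l(2) by simp
qed

lemma ccol_entry: assumes "i \<in> {1..r}" obtains l where "l \<in> {1..n}" "b l i \<noteq> 0"
proof (rule ccontr)
  assume "\<not> thesis"
  then have "\<forall>l\<in>{1..n}. b l i = 0" using that by blast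
  then have "\<forall>k\<in>{1..n}. (\<Sum>q = 1..r. b k q * (if q = i then 1 else 0)) = 0" using assms by simp
  from indep[OF this assms] show False by simp
qed

text \<open>The new variable of the mutation at \<open>i\<close>, as a Laurent polynomial in the old
  variables.\<close>

definition pol :: "nat \<Rightarrow> lpoly" where "pol i = single (- single i 1) 1 * bin n b i"

lemma lev_pol: "x' i i = lev x (pol i)"
  by (simp add: x'_eq pol_def lev_mult' lmono_uminus[OF nz] field_simps)

lemma pol_nonzero: "pol i \<noteq> 0"
  using lev_pol[of i] x'_nz[of i i] by auto

lemma nzd_pol: "nzd (bin n b i) Q \<Longrightarrow> nzd (pol i) Q"
  unfolding pol_def by (rule nzd_unit_left)

lemma nzd_pol_binomial:
  assumes "lookup (\<mu>1 - \<mu>2) k * lookup (ccol n b i) l \<noteq> lookup (\<mu>1 - \<mu>2) l * lookup (ccol n b i) k"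
  shows "nzd (pol i) (single \<mu>1 1 + single \<mu>2 1)"
  unfolding bin_def by (rule nzd_pol) (unfold bin_def, rule nzd_binomials_minor[OF refl ccol_eq assms])

lemma lmono_x': "lmono (x' s) m = lmono x (m - single s (lookup m s)) * x' s s powi lookup m s"
  by (subst lmono_split[of _ m s, OF x'_nz]) (simp add: x'_eq lmono_fun_upd lookup_minus)

abbreviation "x2 i j \<equiv> snd (mutate_seed n j (b' i, x' i))"
abbreviation "b2 i j \<equiv> mutate_matrix j (b' i)"
abbreviation "x3 i j \<equiv> snd (mutate_seed n i (b2 i j, x2 i j))"

text \<open>When \<open>b i j = 0\<close> the two mutations commute: \<open>j\<close> is mutated as
  if \<open>i\<close> had not been, and the third mutation restores \<open>x i\<close>.\<close>

lemma third_variables_disjoint: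
  assumes i: "i \<in> {1..r}" and j: "j \<in> {1..r}" and ij: "i \<noteq> j" and z: "b i j = 0"
  shows "\<exists>Q2 Q3. x2 i j j = lev x Q2 \<and> x3 i j i = lev x Q3 \<and> nzd (pol i) Q2 \<and> nzd (pol i) Q3"
proof -
  interpret m: good_seed n r "b' i" "x' i" by (rule good_mutate[OF i])
  interpret m2: good_seed n r "b2 i j" "x2 i j" by (rule m.good_mutate[OF j])
  have z': "b j i = 0" using anti[OF j i] z by simp
  have "bin n (b' i) j = bin n b j"
  proof -
    have "b' i k j = b k j" for k using z ij by (simp add: mutate_matrix_def pos_part_def)
    then show ?thesis by (simp add: bin_def cpos_def cneg_def)
  qed
  moreover have "lev (x' i) (bin n b j) = lev x (bin n b j)"
    using z by (simp add: bin_def lmono_x'_other cpos_def cneg_def lookup_column pos_part_def)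
  ultimately have e2: "x2 i j j = lev x (pol j)"
    using ij by (simp add: m.x'_simps x'_simps pol_def lev_mult' lmono_uminus[OF nz] field_simps)
  have "bin n (b2 i j) i = bin n b i"
  proof -
    have "b2 i j k i = - b k i" for k using z z' ij by (simp add: mutate_matrix_def pos_part_def)
    then show ?thesis by (simp add: bin_def cpos_def cneg_def add.commute)
  qed
  moreover have "lev (x2 i j) (bin n b i) = lev x (bin n b i)"
    using z' diag[OF i] by (simp add: m.lmono_x'_other lmono_x'_other bin_def cpos_def cneg_def lookup_column pos_part_def)
  ultimately have "x3 i j i = x i"
    using ij nz[of i] bin_nonzero[of n b i] by (simp add: m2.x'_simps m.x'_simps x'_simps lev_0_iff)
  then have e3: "x3 i j i = lev x (single (single i 1) 1)" by simp
  obtain k l where "lookup (ccol n b j) k * lookup (ccol n b i) l \<noteq> lookup (ccol n b j) l * lookup (ccol n b i) k"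
    using ccol_minor[OF i j ij] by blast
  then have "nzd (pol i) (bin n b j)" unfolding bin_def[of n b j] ccol_eq[of n b j] by (rule nzd_pol_binomial)
  then have "nzd (pol i) (pol j)" unfolding pol_def[of j] by (rule nzd_mult[OF nzd_monomial])
  then show ?thesis using e2 e3 nzd_monomial by blast
qed

lemma lmono_scale: "lmono x (column n (\<lambda>k. int e * f k)) = lmono x (column n f) ^ e"
  unfolding lmono_column[OF nz] by (simp add: prod_power_distrib power_int_mult mult.commute[of "int e"])

text \<open>In the interesting case \<open>x3 i j i\<close> becomes a Laurent polynomial because the two monomials of its
  exchange relation add up to a multiple of \<open>x' i i\<close> modulo \<open>x' i i\<close> itself.\<close>

lemma third_variables_positive:
  assumes i: "i \<in> {1..r}" and j: "j \<in> {1..r}" and ij: "i \<noteq> j" and pos: "b i j > 0"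
  shows "\<exists>Q2 Q3. x2 i j j = lev x Q2 \<and> x3 i j i = lev x Q3 \<and> nzd (pol i) Q2 \<and> nzd (pol i) Q3"
proof -
  interpret m: good_seed n r "b' i" "x' i" by (rule good_mutate[OF i])
  interpret m2: good_seed n r "b2 i j" "x2 i j" by (rule m.good_mutate[OF j])
  define e where "e = nat (b i j)"
  have e: "b i j = int e" "e > 0" "b j i = - int e" using pos anti[OF j i] by (simp_all add: e_def)
  have iN: "i \<in> {1..n}" and jN: "j \<in> {1..n}" using i j rn by auto
  have bk: "b' i k j = b k j + int e * pos_part (b k i)" if "k \<noteq> i" for k
    using that ij e by (simp add: mutate_matrix_def mutate_entry pos_part_def[of "- int e"])
  have b'ij: "b' i i j = - int e" "b' i j i = int e" using e by (simp_all add: mutate_matrix_def)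
  have b2k: "b2 i j k i = - b k i + int e * pos_part (b' i k j)" if "k \<noteq> j" for k
    using that ij e b'ij(2) by (simp add: mutate_matrix_def[of j] mutate_entry pos_part_def[of "- int e"] b'_simps)
  have b2ij: "b2 i j j i = - int e" using b'ij(2) by (simp add: mutate_matrix_def[of j])
  have b'jj: "b' i j j = 0" using m.diag[OF j] .
  have b2ii: "b2 i j i i = 0" using m2.diag[OF i] .
  let ?p = "x' i i" and ?Y = "x2 i j j"
  define m2 where "m2 = cpos n (b' i) j"
  define m1 where "m1 = cneg n (b' i) j - single i (int e)"
  define a where "a = cpos n (b2 i j) i"
  define c where "c = cneg n (b2 i j) i - single j (int e)"
  define N2 where "N2 = column n (\<lambda>k. int e * pos_part (b' i k j))"
  have N2: "lmono x N2 = lmono x m2 ^ e" unfolding N2_def m2_def cpos_def by (rule lmono_scale)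
  have l_m2: "lookup m2 i = 0" "lookup m2 j = 0" using b'ij b'jj by (simp_all add: m2_def cpos_def lookup_column pos_part_def)
  have l_m1: "lookup m1 i = 0" using b'ij iN by (simp add: m1_def cneg_def lookup_column lookup_minus lookup_single pos_part_def)
  have Y: "?Y = (lmono x m2 + lmono x m1 * ?p ^ e) / x j"
  proof -
    have "lmono (x' i) m2 = lmono x m2" using l_m2(1) by (simp add: lmono_x')
    moreover have "lmono (x' i) (cneg n (b' i) j) = lmono x m1 * ?p ^ e"
      using b'ij iN by (simp add: lmono_x' m1_def cneg_def lookup_column pos_part_def)
    ultimately show ?thesis using ij by (simp add: m.x'_simps bin_def m2_def x'_simps)
  qed
  have X3: "x3 i j i * ?p = lmono x a + lmono x c * ?Y ^ e"
  proof -
    have "lookup a j = 0" "lookup a i = 0" using b2ij b2ii by (simp_all add: a_def cpos_def lookup_column pos_part_def)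
    then have "lmono (x2 i j) a = lmono x a" by (simp add: m.lmono_x' lmono_x')
    moreover have "lmono (x2 i j) (cneg n (b2 i j) i) = lmono x c * ?Y ^ e"
    proof -
      have "lookup (cneg n (b2 i j) i) j = int e" using b2ij jN by (simp add: cneg_def lookup_column pos_part_def)
      moreover have "lookup c i = 0" using b2ii ij by (simp add: c_def cneg_def lookup_column lookup_minus lookup_single pos_part_def)
      ultimately show ?thesis by (simp add: m.lmono_x' lmono_x' flip: c_def)
    qed
    ultimately have "lev (x2 i j) (bin n (b2 i j) i) = lmono x a + lmono x c * ?Y ^ e" by (simp add: bin_def a_def)
    moreover have "x3 i j i = lev (x2 i j) (bin n (b2 i j) i) / ?p"
      using ij by (simp only: m2.x'_simps m.x'_simps not_False_eq_True)
    ultimately show ?thesis using x'_nz[of i i] by simp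
  qed
  define c0 where "c0 = c - single j (int e)"
  have lc0: "lookup c0 k = lookup (cneg n (b2 i j) i) k - (if k = j then 2 * int e else 0)" for k
    unfolding c0_def c_def lookup_minus lookup_single when_def by auto
  have c0: "lmono x c0 = lmono x c * lmono x (- single j (int e))"
    unfolding c0_def diff_conv_add_uminus by (rule lmono_add')
  \<comment> \<open>Modulo the new variable \<open>?p\<close>, the other monomial of the third
    exchange relation has the exponent c0 + N2. The two thus differ by the inverse of the
    \<open>i\<close>-th y-hat monomial.\<close>
  have a: "a = c0 + (N2 + - ccol n b i)"
  proof (rule poly_mapping_eqI)
    fix k
    show "lookup a k = lookup (c0 + (N2 + - ccol n b i)) k"
    proof (cases "k \<in> {1..n}")
      case False
      then show ?thesis using jN by (auto simp: a_def lc0 N2_def cpos_def cneg_def ccol_def lookup_add lookup_minus lookup_column lookup_single when_def)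
    next
      case True
      have "pos_part (b2 i j k i) - pos_part (- b2 i j k i) = b2 i j k i" by (simp add: pos_part_def)
      then show ?thesis using True b2k[of k] b2ij b'jj e ij
        by (cases "k = j") (simp_all add: a_def lc0 N2_def cpos_def cneg_def ccol_def lookup_add lookup_minus lookup_column lookup_single when_def pos_part_def[of "- int e"] pos_part_def[of "int e"] pos_part_def[of 0])
    qed
  qed
  \<comment> \<open>The exchange relation for \<open>i\<close>, rewritten: 1 plus the inverse of the
    \<open>i\<close>-th y-hat monomial is a monomial multiple of \<open>?p\<close>. This is what
    makes the division by \<open>?p\<close> possible.\<close>
  have beta: "lmono x (- ccol n b i) + 1 = ?p * lmono x (single i 1 - cpos n b i)"
  proof -
    have "lmono x (cpos n b i) * lmono x (- ccol n b i) = lmono x (cneg n b i)"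
      by (simp add: ccol_eq flip: lmono_add')
    moreover have "lmono x (single i 1 - cpos n b i) * lmono x (cpos n b i) = x i" by (simp flip: lmono_add')
    moreover have "?p * x i = lmono x (cpos n b i) + lmono x (cneg n b i)" using nz[of i] by (simp add: x'_simps bin_def)
    ultimately have "(lmono x (- ccol n b i) + 1) * lmono x (cpos n b i) = ?p * lmono x (single i 1 - cpos n b i) * lmono x (cpos n b i)"
      by (simp only: mult.assoc distrib_right mult_1 mult.commute[of "lmono x (- ccol n b i)"] add.commute)
    then show ?thesis using lmono_nonzero[of x "cpos n b i", OF nz] by (simp only: mult_cancel_right simp_thms)
  qed
  define D where "D = (single m2 1 :: lpoly)"
  define G where "G = pol i ^ e * single m1 1"
  \<comment> \<open>For \<open>e = 1\<close> the cofactor is fixed to be 1: then the second term of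
    \<open>R\<close> no longer vanishes modulo \<open>pol i\<close>, and \<open>R\<close> has to be
    an explicit binomial.\<close>
  obtain K where K: "(D + G) ^ e = D ^ e + G * K" "e = 1 \<Longrightarrow> K = 1"
  proof (cases "e = 1")
    case True
    then show ?thesis using that[of 1] by simp
  next
    case False
    then show ?thesis using dvd_power_binomial[of D G e] that by blast
  qed
  define R where "R = single (N2 + (single i 1 - cpos n b i)) 1 + pol i ^ (e - 1) * (single m1 1 * K)"
  define Q3 where "Q3 = single c0 1 * R"
  have Yl: "?Y = lev x (single (- single j 1) 1 * (D + G))"
    unfolding Y D_def G_def by (simp add: lev_mult' lev_power[OF nz] lev_pol lmono_uminus[OF nz] divide_simps nz mult.commute)
  have Ye: "?Y ^ e = lmono x (- single j (int e)) * (lmono x N2 + ?p ^ e * lmono x m1 * lev x K)"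
  proof -
    have "?Y ^ e = (lev x (D + G) / x j) ^ e" by (simp add: Y D_def G_def lev_mult' lev_power[OF nz] lev_pol mult.commute)
    also have "\<dots> = lev x ((D + G) ^ e) / x j ^ e" by (simp only: lev_power[OF nz] power_divide)
    also have "lev x ((D + G) ^ e) = lmono x N2 + ?p ^ e * lmono x m1 * lev x K"
      unfolding K(1) N2 by (simp add: D_def G_def lev_mult' lev_power[OF nz] lev_pol)
    finally show ?thesis by (simp add: lmono_uminus[OF nz] field_simps)
  qed
  have pe: "?p ^ e = ?p * ?p ^ (e - 1)" using e(2) by (simp flip: power_Suc)
  have "x3 i j i * ?p = lmono x c0 * (lmono x N2 * (lmono x (- ccol n b i) + 1) + ?p ^ e * lmono x m1 * lev x K)"
    unfolding X3 Ye a c0 lmono_add' by (simp only: distrib_left distrib_right mult_ac add_ac mult_1_right mult_1_left)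
  also have "\<dots> = lev x Q3 * ?p"
    unfolding beta pe unfolding Q3_def R_def lev_mult' lev_simps lev_power[OF nz] lev_pol lmono_add' rconst_simps mult_1
    by (simp only: distrib_left distrib_right mult_ac)
  finally have X3l: "x3 i j i = lev x Q3" using x'_nz[of i i] by simp
  have "nzd (pol i) (D + G)"
  proof -
    have "G = pol i * (pol i ^ (e - 1) * single m1 1)" using e(2) by (simp add: G_def mult.assoc[symmetric] flip: power_Suc)
    then show ?thesis using nzd_add_multiple[OF nzd_monomial] by (simp add: D_def)
  qed
  then have n2: "nzd (pol i) (single (- single j 1) 1 * (D + G))" by (rule nzd_mult[OF nzd_monomial])
  have "nzd (pol i) R"
  proof (cases "e = 1")
    case True
    obtain l where l: "l \<in> {1..n}" "b l i \<noteq> 0" using ccol_entry[OF i] .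
    \<comment> \<open>At the coordinate \<open>i\<close> the difference of the exponents is 1, while
      column \<open>i\<close> of \<open>b\<close> is 0 there; so the minor is the entry
      \<open>b l i\<close>.\<close>
    have "lookup (N2 + (single i 1 - cpos n b i) - m1) i * lookup (ccol n b i) l
        \<noteq> lookup (N2 + (single i 1 - cpos n b i) - m1) l * lookup (ccol n b i) i"
      using l l_m1 diag[OF i] iN b'ij
      by (simp add: lookup_add lookup_minus N2_def lookup_column lookup_single cpos_def ccol_def pos_part_def)
    from nzd_pol_binomial[OF this] show ?thesis using True K(2) by (simp add: R_def)
  next
    case False
    then have "pol i ^ (e - 1) = pol i * pol i ^ (e - 2)" using e(2)
      by (subst power_Suc[symmetric]) (rule arg_cong[where f = "power (pol i)"], simp)
    then show ?thesis unfolding R_def using nzd_add_multiple[OF nzd_monomial] by (simp add: mult.assoc)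
  qed
  then have "nzd (pol i) Q3" unfolding Q3_def by (rule nzd_mult[OF nzd_monomial])
  then show ?thesis using Yl X3l n2 by blast
qed

end

lemma (in good_seed) third_variables:
  assumes i: "i \<in> {1..r}" and j: "j \<in> {1..r}" and ij: "i \<noteq> j"
  shows "\<exists>Q2 Q3. x2 i j j = lev x Q2 \<and> x3 i j i = lev x Q3 \<and> nzd (pol i) Q2 \<and> nzd (pol i) Q3"
proof (cases "b i j" "0::int" rule: linorder_cases)
  case less
  interpret neg: good_seed n r "\<lambda>i j. - b i j" x by (rule neg)
  have "neg.pol i = pol i" by (simp add: neg.pol_def pol_def bin_def cpos_def cneg_def add.commute)
  then show ?thesis using neg.third_variables_positive[OF i j ij] less by (simp add: mutate_matrix_neg mutate_seed_neg)
qed (use third_variables_disjoint[OF i j ij] third_variables_positive[OF i j ij] in auto)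

abbreviation "mutations n \<equiv> foldl (\<lambda>\<Sigma> s. mutate_seed n s \<Sigma>)"

text \<open>Induction on the length of the word with three seeds. From the seed after
  \<open>i\<close> the remaining path is shorter, so only powers of \<open>pol i\<close> can be
  denominators. From the seed after i, j, i the target is also closer, so a power of Q2 Q3 clears
  the denominator. As Q2 and Q3 are nonzerodivisors modulo \<open>pol i\<close>, no denominator
  remains.\<close>

theorem laurent_phenomenon:
  assumes "good_seed n r b x" "set ls \<subseteq> {1..r}"
  shows "snd (mutations n (b, x) ls) k \<in> laurent x"
  using assms
proof (induction "length ls" arbitrary: ls b x rule: less_induct)
  case less
  interpret good_seed n r b x by (rule less.prems)
  show ?case
  proof (cases ls)
    case Nil
    then show ?thesis by (simp add: var_laurent)
  next
    case (Cons i ls')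
    then have i: "i \<in> {1..r}" using less.prems by simp
    have p: "x' i q \<in> laurent x" for q
      using var_laurent lev_pol[of i] by (cases "q = i") (auto simp: laurent_def x'_simps)
    show ?thesis
    proof (cases ls')
      case Nil
      then show ?thesis using Cons p by simp
    next
      case (Cons j rest)
      then have j: "j \<in> {1..r}" and rest: "set rest \<subseteq> {1..r}" and ls: "ls = i # j # rest"
        using less.prems \<open>ls = i # ls'\<close> by auto
      show ?thesis
      proof (cases "i = j")
        case True
        then have "mutations n (b, x) ls = mutations n (b, x) rest" using mutate_involution[OF i] by (simp add: ls)
        then show ?thesis using less.hyps[OF _ less.prems(1) rest] by (simp add: ls)
      next
        case False
        interpret m: good_seed n r "b' i" "x' i" by (rule good_mutate[OF i])
        interpret m2: good_seed n r "b2 i j" "x2 i j" by (rule m.good_mutate[OF j])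
        interpret m3: good_seed n r "mutate_matrix i (b2 i j)" "x3 i j" by (rule m2.good_mutate[OF i])
        let ?z = "snd (mutations n (b, x) ls) k"
        obtain Q2 Q3 where Q: "x2 i j j = lev x Q2" "x3 i j i = lev x Q3" "nzd (pol i) Q2" "nzd (pol i) Q3"
          using third_variables[OF i j False] by blast
        have z1: "?z = snd (mutations n (b' i, x' i) (j # rest)) k" by (simp add: ls flip: seed_eq)
        have "?z \<in> laurent (x' i)" unfolding z1
          using less.hyps[OF _ m.good_seed_axioms, of "j # rest"] j rest by (simp add: ls)
        then obtain a where "?z * x' i i ^ a \<in> laurent x"
          using clear_denominator[where y = "x' i" and S = "{i}", OF x'_nz p _ _ \<open>?z \<in> laurent (x' i)\<close>]
          by (auto simp: x'_simps)
        then obtain U where U: "?z * lev x (pol i) ^ a = lev x U" unfolding laurent_def using lev_pol by auto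
        \<comment> \<open>Mutating back at \<open>i\<close> leads from the third seed to the one
          after i, j. Hence the word i # rest, one letter shorter than \<open>ls\<close>, reaches
          the target.\<close>
        have "mutations n (mutate_matrix i (b2 i j), x3 i j) (i # rest) = mutations n (b2 i j, x2 i j) rest"
          unfolding foldl.simps m2.seed_eq[of i, symmetric] m2.mutate_involution[OF i] ..
        then have z3: "?z = snd (mutations n (mutate_matrix i (b2 i j), x3 i j) (i # rest)) k"
          unfolding z1 by (simp flip: m.seed_eq)
        have "?z \<in> laurent (x3 i j)" unfolding z3
          using less.hyps[OF _ m3.good_seed_axioms, of "i # rest"] i rest by (simp add: ls)
        moreover have "x3 i j q \<in> laurent x" for q
          using False var_laurent(1) Q(1,2) by (cases "q = i"; cases "q = j") (auto simp: laurent_def m2.x'_simps m.x'_simps x'_simps)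
        moreover have "x3 i j q = x q" if "q \<notin> {i, j}" for q using that by (simp add: m2.x'_simps m.x'_simps x'_simps)
        ultimately obtain c where "?z * (\<Prod>q\<in>{i, j}. x3 i j q) ^ c \<in> laurent x"
          using clear_denominator[where y = "x3 i j" and S = "{i, j}" and z = ?z, OF m3.nz] by blast
        moreover have "(\<Prod>q\<in>{i, j}. x3 i j q) = lev x (Q3 * Q2)" using False Q(1,2) by (simp add: lev_mult' m2.x'_simps)
        ultimately obtain W where W: "?z * lev x (Q3 * Q2) ^ c = lev x W" unfolding laurent_def by auto
        have "lev x (U * (Q3 * Q2) ^ c) = ?z * lev x (pol i) ^ a * lev x (Q3 * Q2) ^ c"
          unfolding U by (simp add: lev_mult' lev_power[OF nz])
        also have "\<dots> = lev x (pol i) ^ a * (?z * lev x (Q3 * Q2) ^ c)" by (simp only: mult_ac)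
        also have "\<dots> = lev x (pol i ^ a * W)" unfolding W by (simp add: lev_mult' lev_power[OF nz])
        finally have "U * (Q3 * Q2) ^ c = pol i ^ a * W" by (simp only: lev_eq_iff)
        then have "pol i ^ a dvd U * (Q3 * Q2) ^ c" by simp
        then have "pol i ^ a dvd U" by (rule nzd_dvd_power[OF nzd_mult[OF Q(4,3)] pol_nonzero])
        then obtain V where "U = pol i ^ a * V" by blast
        then have "?z * lev x (pol i) ^ a = lev x V * lev x (pol i) ^ a" unfolding U by (simp add: lev_mult' lev_power[OF nz])
        then have "?z = lev x V" using pol_nonzero[of i] by (simp add: lev_0_iff)
        then show ?thesis by (simp add: laurent_def)
      qed
    qed
  qed
qed

section \<open>Tropical mutation and separation of variables\<close>

text \<open>The step \<open>f \<leadsto> f'\<close> is the tropical exchange relation; \<open>f\<close> is a row or a column of dimensions.\<close>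

definition trop_step :: "nat \<Rightarrow> nat \<Rightarrow> (nat \<Rightarrow> nat \<Rightarrow> int) \<Rightarrow> (nat \<Rightarrow> int) \<Rightarrow> (nat \<Rightarrow> int) \<Rightarrow> bool" where
  "trop_step n l b f f' \<longleftrightarrow> (\<forall>k. k \<noteq> l \<longrightarrow> f' k = f k)
     \<and> f l + f' l = (\<Sum>k = 1..n. pos_part (b k l) * f k) + pos_part (- (\<Sum>k = 1..n. b k l * f k))"

lemma pos_part_uminus: "pos_part (- a) = pos_part a - a"
  by (simp add: pos_part_def)

lemma sum_mutated_column:
  fixes n l :: nat and f f' :: "nat \<Rightarrow> int"
  assumes "l \<in> {1..n}" "b l l = 0" "\<And>k. k \<noteq> l \<Longrightarrow> f' k = f k"
  shows "(\<Sum>k = 1..n. mutate_matrix l b k l * f' k) = - (\<Sum>k = 1..n. b k l * f k)"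
proof -
  have "(\<Sum>k = 1..n. mutate_matrix l b k l * f' k) = (\<Sum>k = 1..n. - (b k l * f k))"
  proof (rule sum.cong[OF refl])
    fix k show "mutate_matrix l b k l * f' k = - (b k l * f k)"
      using assms(2) assms(3)[of k] by (cases "k = l") (simp_all add: mutate_matrix_def)
  qed
  then show ?thesis by (simp add: sum_negf)
qed

text \<open>Kept free of the tropical relation: \<open>f' l\<close> is arbitrary and its deviation
  from the exchange sum appears as a correction. So it serves dimensions as well as the matrix
  \<open>H\<close> of \<open>expansion_step\<close>, whose exchange relation depends on a
  sign.\<close>

lemma sum_mutated:
  fixes n l :: nat and f f' :: "nat \<Rightarrow> int"
  assumes l: "l \<in> {1..n}" and "b l l = 0" "p \<noteq> l" and f: "\<And>k. k \<noteq> l \<Longrightarrow> f' k = f k"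
  shows "(\<Sum>k = 1..n. mutate_matrix l b k p * f' k) = (\<Sum>k = 1..n. b k p * f k)
    + pos_part (- b l p) * (\<Sum>k = 1..n. b k l * f k)
    - b l p * (f l + f' l - (\<Sum>k = 1..n. pos_part (b k l) * f k))"
proof -
  define J where "J = {1..n} - {l}"
  have split: "(\<Sum>k = 1..n. h k) = h l + (\<Sum>k\<in>J. h k)" for h :: "nat \<Rightarrow> int"
    unfolding J_def using l by (subst sum.remove[of _ l]) auto
  have "(\<Sum>k\<in>J. mutate_matrix l b k p * f' k)
      = (\<Sum>k\<in>J. b k p * f k + b l p * (pos_part (b k l) * f k) + pos_part (- b l p) * (b k l * f k))"
    by (rule sum.cong) (use assms(3) f in \<open>auto simp: J_def mutate_matrix_def mutate_entry algebra_simps\<close>)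
  also have "\<dots> = (\<Sum>k\<in>J. b k p * f k) + b l p * (\<Sum>k\<in>J. pos_part (b k l) * f k) + pos_part (- b l p) * (\<Sum>k\<in>J. b k l * f k)"
    by (simp add: sum.distrib sum_distrib_left)
  finally show ?thesis using assms(2)
    by (simp add: split mutate_matrix_def[of l b l] pos_part_def[of 0] algebra_simps)
qed

lemma trop_step_sym:
  assumes "l \<in> {1..n}" "b l l = 0" "trop_step n l b f f'" shows "trop_step n l (mutate_matrix l b) f' f"
proof -
  have f: "f' k = f k" if "k \<noteq> l" for k using assms(3) that by (simp add: trop_step_def)
  have "(\<Sum>k = 1..n. pos_part (mutate_matrix l b k l) * f' k) = (\<Sum>k = 1..n. pos_part (- b k l) * f k)"
  proof (rule sum.cong[OF refl])
    fix k show "pos_part (mutate_matrix l b k l) * f' k = pos_part (- b k l) * f k"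
      using assms(2) f[of k] by (cases "k = l") (simp_all add: mutate_matrix_def pos_part_def)
  qed
  also have "\<dots> = (\<Sum>k = 1..n. pos_part (b k l) * f k - b k l * f k)"
    by (simp only: pos_part_uminus left_diff_distrib)
  also have "\<dots> = (\<Sum>k = 1..n. pos_part (b k l) * f k) - (\<Sum>k = 1..n. b k l * f k)" by (rule sum_subtractf)
  finally show ?thesis using assms(3) sum_mutated_column[where b = b and f = f and f' = f', OF assms(1,2) f]
      pos_part_uminus[of "\<Sum>k = 1..n. b k l * f k"]
    by (simp add: trop_step_def)
qed

lemma trop_step_mutated:
  assumes "l \<in> {1..n}" "b l l = 0" "trop_step n l b f f'" "p \<noteq> l"
  shows "(\<Sum>k = 1..n. mutate_matrix l b k p * f' k) = (\<Sum>k = 1..n. b k p * f k)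
    + pos_part (- b l p) * (\<Sum>k = 1..n. b k l * f k) - b l p * pos_part (- (\<Sum>k = 1..n. b k l * f k))"
  using sum_mutated[where b = b and f = f and f' = f', OF assms(1,2,4)] assms(3) by (simp add: trop_step_def)

definition mm :: "nat \<Rightarrow> (nat \<Rightarrow> nat \<Rightarrow> int) \<Rightarrow> (nat \<Rightarrow> nat \<Rightarrow> int) \<Rightarrow> nat \<Rightarrow> nat \<Rightarrow> int" where
  "mm r A D p q = (\<Sum>j = 1..r. A p j * D j q)"

definition unimodular :: "nat \<Rightarrow> (nat \<Rightarrow> nat \<Rightarrow> int) \<Rightarrow> bool" where
  "unimodular r A \<longleftrightarrow> (\<exists>D. \<forall>p\<in>{1..r}. \<forall>q\<in>{1..r}. mm r A D p q = (if p = q then 1 else 0) \<and> mm r D A p q = (if p = q then 1 else 0))"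

text \<open>The new matrix is LA, where L is the identity except for row \<open>l\<close>, which is
  \<open>e\<close> with -1 in position \<open>l\<close>. L is an involution, so DL is the inverse of
  LA; this is D'.\<close>

lemma unimodular_row_operation:
  assumes A: "unimodular r A" and l: "l \<in> {1..r}" and e: "e l = 0"
    and A': "\<And>j. j \<in> {1..r} \<Longrightarrow> A' l j = - A l j + (\<Sum>p = 1..r. e p * A p j)" "\<And>p j. p \<noteq> l \<Longrightarrow> j \<in> {1..r} \<Longrightarrow> A' p j = A p j"
  shows "unimodular r A'"
proof -
  obtain D where D: "\<And>p q. p \<in> {1..r} \<Longrightarrow> q \<in> {1..r} \<Longrightarrow> mm r A D p q = (if p = q then 1 else 0)"
    "\<And>p q. p \<in> {1..r} \<Longrightarrow> q \<in> {1..r} \<Longrightarrow> mm r D A p q = (if p = q then 1 else 0)"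
    using A unfolding unimodular_def by blast
  define D' where "D' j q = (if q = l then - D j l else D j q + e q * D j l)" for j q
  define J where "J = {1..r} - {l}"
  have split: "(\<Sum>k = 1..r. h k) = h l + (\<Sum>k\<in>J. h k)" for h :: "nat \<Rightarrow> int"
    unfolding J_def using l by (subst sum.remove[of _ l]) auto
  have AD: "mm r A D' p q = (if q = l then - (if p = l then 1 else 0) else (if p = q then 1 else 0) + e q * (if p = l then 1 else 0))"
    if "p \<in> {1..r}" "q \<in> {1..r}" for p q
  proof -
    have "mm r A D' p q = (if q = l then - mm r A D p l else mm r A D p q + e q * mm r A D p l)"
      by (auto simp: mm_def D'_def sum_negf sum.distrib sum_distrib_left algebra_simps)
    then show ?thesis using D(1) that l by simp
  qed
  have 1: "mm r A' D' p q = (if p = q then 1 else 0)" if p: "p \<in> {1..r}" and q: "q \<in> {1..r}" for p q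
  proof (cases "p = l")
    case False
    then have "mm r A' D' p q = mm r A D' p q" using A'(2) by (auto simp: mm_def intro!: sum.cong)
    then show ?thesis using AD[OF p q] False by auto
  next
    case True
    have "mm r A' D' l q = (\<Sum>j = 1..r. - (A l j * D' j q) + (\<Sum>p = 1..r. e p * (A p j * D' j q)))"
      unfolding mm_def by (rule sum.cong) (auto simp: A'(1) algebra_simps sum_distrib_left)
    also have "\<dots> = - mm r A D' l q + (\<Sum>p = 1..r. e p * mm r A D' p q)"
      unfolding sum.distrib mm_def sum_negf sum_distrib_left by (subst sum.swap) simp
    also have "(\<Sum>p = 1..r. e p * mm r A D' p q) = (\<Sum>p = 1..r. if p = q then (if q = l then 0 else e q) else 0)"
      by (rule sum.cong[OF refl]) (use AD[OF _ q] e in auto)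
    also have "\<dots> = (if q = l then 0 else e q)" using q by simp
    finally show ?thesis using AD[OF l q] True by auto
  qed
  have 2: "mm r D' A' p q = (if p = q then 1 else 0)" if p: "p \<in> {1..r}" and q: "q \<in> {1..r}" for p q
  proof -
    have J: "(\<Sum>j\<in>J. D' p j * A' j q) = (\<Sum>j\<in>J. D p j * A j q) + D p l * (\<Sum>j\<in>J. e j * A j q)"
    proof -
      have "(\<Sum>j\<in>J. D' p j * A' j q) = (\<Sum>j\<in>J. D p j * A j q + D p l * (e j * A j q))"
        by (rule sum.cong) (use A'(2)[OF _ q] in \<open>auto simp: J_def D'_def algebra_simps\<close>)
      then show ?thesis by (simp add: sum.distrib sum_distrib_left)
    qed
    have "D' p l * A' l q = D p l * A l q - D p l * (\<Sum>j\<in>J. e j * A j q)"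
      using A'(1)[OF q] e by (simp add: D'_def split) (simp only: right_diff_distrib right_diff_distrib')
    then have "mm r D' A' p q = mm r D A p q" unfolding mm_def split J by simp
    then show ?thesis using D(2)[OF p q] by simp
  qed
  show ?thesis unfolding unimodular_def using 1 2 by blast
qed

lemma unimodular_one: "unimodular r (\<lambda>p q. if p = q then 1 else 0)"
  unfolding unimodular_def mm_def
  by (rule exI[of _ "\<lambda>p q. if p = q then 1 else 0"]) (simp add: if_distrib[of "\<lambda>z. z * _"] sum.delta cong: if_cong)

lemma unimodular_left_kernel:
  assumes "unimodular r A" and w: "\<And>j. j \<in> {1..r} \<Longrightarrow> (\<Sum>p = 1..r. w p * A p j) = 0" and p: "p \<in> {1..r}"
  shows "w p = (0::int)"
proof -
  obtain D where D: "\<forall>p\<in>{1..r}. \<forall>q\<in>{1..r}. mm r A D p q = (if p = q then 1 else 0)"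
    using assms(1) unfolding unimodular_def by blast
  have "0 = (\<Sum>j = 1..r. (\<Sum>q = 1..r. w q * A q j) * D j p)" using w by simp
  also have "\<dots> = (\<Sum>q = 1..r. w q * mm r A D q p)"
    unfolding mm_def sum_distrib_left sum_distrib_right by (subst sum.swap) (simp add: mult.assoc)
  also have "\<dots> = (\<Sum>q = 1..r. w q * (if q = p then 1 else 0))" using D p by (intro sum.cong refl) simp
  also have "\<dots> = (\<Sum>q = 1..r. if q = p then w q else 0)" by (intro sum.cong refl) simp
  also have "\<dots> = w p" using p by simp
  finally show ?thesis by simp
qed

section \<open>Mutation rules for c-vectors and g-vectors\<close>

locale cluster_setup = hom_dimensions +
  assumes anti: "\<forall>i\<in>{1..r}. \<forall>j\<in>{1..r}. B i j = - B j i" and rank: "matrix_rank n r B = r"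
begin

abbreviation "M w \<equiv> ex_matrix n B w"
abbreviation "X w \<equiv> snd (seed_at n B w)"

lemma seed_eq: "seed_at n B w = (M w, X w)"
  by (simp add: ex_matrix_def)

lemma good: "set w \<subseteq> {1..r} \<Longrightarrow> good_seed n r (M w) (X w)"
proof (induction w rule: rev_induct)
  case Nil
  have "seed_at n B [] = (B, xvar)" by (simp add: seed_at_def)
  then show ?case using good_initial[OF rn anti rank] by (simp add: ex_matrix_def)
next
  case (snoc l w)
  then have g: "good_seed n r (M w) (X w)" and l: "l \<in> {1..r}" by auto
  have "seed_at n B (w @ [l]) = mutate_seed n l (M w, X w)" unfolding seed_eq[symmetric] by (rule seed_at_snoc)
  also have "\<dots> = (mutate_matrix l (M w), snd (mutate_seed n l (M w, X w)))" by (simp add: mutate_seed_def)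
  finally show ?case using good_seed.good_mutate[OF g l] by (simp add: ex_matrix_def)
qed

text \<open>Adjacency for words that need not be reduced. The relation is symmetric, and since seed
  mutation is an involution, the same rule holds in both directions.\<close>

definition nb :: "nat \<Rightarrow> nat list \<Rightarrow> nat list \<Rightarrow> bool" where
  "nb l w w' \<longleftrightarrow> l \<in> {1..r} \<and> set w \<subseteq> {1..r} \<and> set w' \<subseteq> {1..r} \<and> (w' = w @ [l] \<or> w = w' @ [l])"

lemma nb_sym: "nb l w w' \<Longrightarrow> nb l w' w"
  by (auto simp: nb_def)

lemma nb_step:
  assumes "\<And>w. l \<in> {1..r} \<Longrightarrow> set w \<subseteq> {1..r} \<Longrightarrow> Q w (w @ [l])" "\<And>w w'. nb l w w' \<Longrightarrow> Q w w' \<Longrightarrow> Q w' w" "nb l w w'"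
  shows "Q w w'"
  using assms(3)
proof -
  have "w' = w @ [l] \<or> w = w' @ [l]" using assms(3) by (simp add: nb_def)
  then show ?thesis
  proof
    assume "w' = w @ [l]"
    then show ?thesis using assms(1)[of w] assms(3) by (simp add: nb_def)
  next
    assume w: "w = w' @ [l]"
    then have "Q w' w" using assms(1)[of w'] assms(3) by (simp add: nb_def)
    then show ?thesis by (rule assms(2)[OF nb_sym[OF assms(3)]])
  qed
qed

lemma nb_seed: "nb l w w' \<Longrightarrow> mutate_seed n l (M w, X w) = (M w', X w')"
proof (rule nb_step[where Q = "\<lambda>w w'. mutate_seed n l (M w, X w) = (M w', X w')"])
  show "mutate_seed n l (M w, X w) = (M (w @ [l]), X (w @ [l]))" for w
    unfolding seed_eq[symmetric] by (rule seed_at_snoc[symmetric])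
  fix w w' assume nb: "nb l w w'" and e: "mutate_seed n l (M w, X w) = (M w', X w')"
  have "good_seed n r (M w) (X w)" using nb by (intro good) (simp add: nb_def)
  then show "mutate_seed n l (M w', X w') = (M w, X w)"
    unfolding e[symmetric] by (rule good_seed.mutate_involution) (use nb in \<open>simp add: nb_def\<close>)
qed

lemma nb_M: "nb l w w' \<Longrightarrow> M w' = mutate_matrix l (M w)"
  using nb_seed[of l w w'] by (simp add: mutate_seed_def)

lemma nb_X: "nb l w w' \<Longrightarrow> X w' = snd (mutate_seed n l (M w, X w))"
  using nb_seed[of l w w'] by simp

lemma M_diag: "set w \<subseteq> {1..r} \<Longrightarrow> l \<in> {1..r} \<Longrightarrow> M w l l = 0"
  using good_seed.diag[OF good] by blast

text \<open>Lets any word serve as base point: the property is carried from \<open>v\<close> back to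
  the empty word and from there on to \<open>w\<close>.\<close>

lemma reach:
  assumes v: "set v \<subseteq> {1..r}" and w: "set w \<subseteq> {1..r}" and P: "P v" and step: "\<And>l u u'. nb l u u' \<Longrightarrow> P u \<Longrightarrow> P u'"
  shows "P w"
proof -
  have "P []" using v P
  proof (induction v rule: rev_induct)
    case (snoc l v)
    then have "nb l (v @ [l]) v" by (simp add: nb_def)
    then show ?case using snoc step by simp
  qed
  then show ?thesis using w
  proof (induction w rule: rev_induct)
    case (snoc l w)
    then have "nb l w (w @ [l])" by (simp add: nb_def)
    then show ?case using snoc step by simp
  qed
qed

lemma cov_step:
  assumes v: "set v \<subseteq> {1..r}" and i: "i \<in> {1..n}" and nb: "nb l w w'"
  shows "trop_step n l (M w) (\<lambda>k. d v i w k) (\<lambda>k. d v i w' k)"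
proof (rule nb_step[where Q = "\<lambda>w w'. trop_step n l (M w) (\<lambda>k. d v i w k) (\<lambda>k. d v i w' k)", OF _ _ nb])
  show "trop_step n l (M w) (\<lambda>k. d v i w k) (\<lambda>k. d v i (w @ [l]) k)" if "l \<in> {1..r}" "set w \<subseteq> {1..r}" for w
    unfolding trop_step_def using cov_other[OF v that(2,1)] cov_exchange[OF v that(2,1) i] by (simp add: cv_def)
  fix w w' assume nb: "nb l w w'" and t: "trop_step n l (M w) (\<lambda>k. d v i w k) (\<lambda>k. d v i w' k)"
  have "l \<in> {1..n}" "M w l l = 0" using nb M_diag rn by (auto simp: nb_def)
  then show "trop_step n l (M w') (\<lambda>k. d v i w' k) (\<lambda>k. d v i w k)"
    unfolding nb_M[OF nb] by (rule trop_step_sym) (rule t)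
qed

lemma con_step:
  assumes v: "set v \<subseteq> {1..r}" and i: "i \<in> {1..n}" and nb: "nb l w w'"
  shows "trop_step n l (M w) (\<lambda>k. d w k v i) (\<lambda>k. d w' k v i)"
proof (rule nb_step[where Q = "\<lambda>w w'. trop_step n l (M w) (\<lambda>k. d w k v i) (\<lambda>k. d w' k v i)", OF _ _ nb])
  show "trop_step n l (M w) (\<lambda>k. d w k v i) (\<lambda>k. d (w @ [l]) k v i)" if "l \<in> {1..r}" "set w \<subseteq> {1..r}" for w
    unfolding trop_step_def using con_other[OF v that(2,1)] con_exchange[OF v that(2,1) i] by (simp add: gv_def)
  fix w w' assume nb: "nb l w w'" and t: "trop_step n l (M w) (\<lambda>k. d w k v i) (\<lambda>k. d w' k v i)"
  have "l \<in> {1..n}" "M w l l = 0" using nb M_diag rn by (auto simp: nb_def)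
  then show "trop_step n l (M w') (\<lambda>k. d w' k v i) (\<lambda>k. d w k v i)"
    unfolding nb_M[OF nb] by (rule trop_step_sym) (rule t)
qed

lemma cv_step:
  assumes v: "set v \<subseteq> {1..r}" and i: "i \<in> {1..n}" and nb: "nb l w w'"
  shows "cv v i w' l = - cv v i w l"
    "p \<noteq> l \<Longrightarrow> cv v i w' p = cv v i w p + pos_part (- M w l p) * cv v i w l + M w l p * pos_part (cv v i w l)"
proof -
  have l: "l \<in> {1..n}" "M w l l = 0" using nb M_diag rn by (auto simp: nb_def)
  note t = cov_step[OF assms]
  have "(\<Sum>k = 1..n. mutate_matrix l (M w) k l * d v i w' k) = - (\<Sum>k = 1..n. M w k l * d v i w k)"
    by (rule sum_mutated_column[where b = "M w", OF l]) (use t in \<open>simp add: trop_step_def\<close>)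
  then show "cv v i w' l = - cv v i w l" unfolding cv_def nb_M[OF nb] by simp
  show "cv v i w' p = cv v i w p + pos_part (- M w l p) * cv v i w l + M w l p * pos_part (cv v i w l)" if "p \<noteq> l"
    unfolding cv_def nb_M[OF nb] trop_step_mutated[OF l t that] by simp
qed

text \<open>The variable \<open>i\<close> at \<open>v\<close> stays and the reference seed moves
  from \<open>w\<close> to \<open>w'\<close>: up to signs this is the rule for changing the initial
  seed in part (c).\<close>

lemma gv_step:
  assumes v: "set v \<subseteq> {1..r}" and i: "i \<in> {1..n}" and nb: "nb l w w'"
  shows "gv v i w' l = - gv v i w l"
    "p \<noteq> l \<Longrightarrow> gv v i w' p = gv v i w p + pos_part (- M w l p) * gv v i w l - M w l p * pos_part (- gv v i w l)"
proof -
  have l: "l \<in> {1..n}" "M w l l = 0" using nb M_diag rn by (auto simp: nb_def)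
  note t = con_step[OF assms]
  have "(\<Sum>k = 1..n. mutate_matrix l (M w) k l * d w' k v i) = - (\<Sum>k = 1..n. M w k l * d w k v i)"
    by (rule sum_mutated_column[where b = "M w", OF l]) (use t in \<open>simp add: trop_step_def\<close>)
  then show "gv v i w' l = - gv v i w l" unfolding gv_def nb_M[OF nb] by simp
  show "gv v i w' p = gv v i w p + pos_part (- M w l p) * gv v i w l - M w l p * pos_part (- gv v i w l)" if "p \<noteq> l"
    unfolding gv_def nb_M[OF nb] trop_step_mutated[OF l t that] by simp
qed

end

section \<open>Polynomials in the y-hats\<close>

definition emb :: "(nat \<Rightarrow>\<^sub>0 nat) \<Rightarrow> nat \<Rightarrow>\<^sub>0 int" where "emb = Poly_Mapping.map int"

lemma lookup_emb [simp]: "lookup (emb m) i = int (lookup m i)"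
  by (simp add: emb_def Poly_Mapping.map.rep_eq when_def)

lemma keys_emb [simp]: "keys (emb m) = keys m"
  by (auto simp: in_keys_iff)

lemma emb_add: "emb (m + k) = emb m + emb k"
  by (rule poly_mapping_eqI) (simp add: lookup_add)

lemma emb_inj: "emb m = emb k \<longleftrightarrow> m = k"
  by (metis lookup_emb of_nat_eq_iff poly_mapping_eqI)

lemma emono_eq_lmono: "emono y m = lmono y (emb m)"
  by (simp add: emono_def lmono_def)

text \<open>The exponent vector, in the cluster, of the monomial in the y-hats with exponents
  \<open>a\<close>.\<close>

definition col :: "nat \<Rightarrow> nat \<Rightarrow> (nat \<Rightarrow> nat \<Rightarrow> int) \<Rightarrow> (nat \<Rightarrow>\<^sub>0 int) \<Rightarrow> nat \<Rightarrow>\<^sub>0 int" where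
  "col n r b a = column n (\<lambda>i. \<Sum>j = 1..r. b i j * lookup a j)"

lemma lookup_col: "lookup (col n r b a) i = (if i \<in> {1..n} then \<Sum>j = 1..r. b i j * lookup a j else 0)"
  unfolding col_def by (rule lookup_column)

lemma col_simps [simp]: "col n r b 0 = 0" "col n r b (a + c) = col n r b a + col n r b c" "col n r b (a - c) = col n r b a - col n r b c"
  by (rule poly_mapping_eqI; simp add: lookup_col lookup_add lookup_minus algebra_simps sum.distrib sum_subtractf)+

text \<open>Constant term 1 is stronger than not being divisible by any variable and, unlike the
  latter, survives the sums that arise from exchange relations.\<close>

definition unit_poly :: "nat \<Rightarrow> mpoly \<Rightarrow> bool" where
  "unit_poly r P \<longleftrightarrow> poly_in {1..r} P \<and> lookup P 0 = 1"

lemma poly_in_ops: "poly_in V P \<Longrightarrow> poly_in V Q \<Longrightarrow> poly_in V (P + Q)" "poly_in V P \<Longrightarrow> poly_in V Q \<Longrightarrow> poly_in V (P * Q)"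
  "keys m \<subseteq> V \<Longrightarrow> poly_in V (single m c)"
proof -
  show "poly_in V (P + Q)" if "poly_in V P" "poly_in V Q"
    using that keys_add[of P Q] unfolding poly_in_def by blast
  show "poly_in V (P * Q)" if PQ: "poly_in V P" "poly_in V Q"
    unfolding poly_in_def
  proof
    fix m assume "m \<in> keys (P * Q)"
    then obtain a c where m: "m = a + c" "a \<in> keys P" "c \<in> keys Q" using keys_mult[of P Q] by blast
    then show "keys m \<subseteq> V" using PQ keys_add[of a c] unfolding poly_in_def by blast
  qed
qed (auto simp: poly_in_def)

lemma add_eq_0_nat: "(a :: nat \<Rightarrow>\<^sub>0 nat) + c = 0 \<longleftrightarrow> a = 0 \<and> c = 0"
proof
  assume "a + c = 0"
  then have "lookup a i = 0 \<and> lookup c i = 0" for i by (metis lookup_add lookup_zero add_is_0)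
  then show "a = 0 \<and> c = 0" by (auto intro: poly_mapping_eqI)
qed simp

lemma prod_powi: "(\<Prod>i\<in>I. f i) powi k = (\<Prod>i\<in>I. f i powi (k :: int) :: 'a :: field)"
  by (induction I rule: infinite_finite_induct) (auto simp: power_int_mult_distrib)

lemma powi_sum: "(z :: 'a :: field) \<noteq> 0 \<Longrightarrow> z powi (\<Sum>i\<in>I. f i) = (\<Prod>i\<in>I. z powi f i)"
  by (induction I rule: infinite_finite_induct) (auto simp: power_int_add)

lemma lookup_mult_0: "lookup (P * Q) 0 = lookup P 0 * lookup (Q :: mpoly) 0"
proof -
  have "lookup (P * Q) 0 = (\<Sum>a\<in>keys P. \<Sum>c\<in>keys Q. if c = 0 then (if a = 0 then lookup P 0 * lookup Q 0 else 0) else 0)"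
    by (auto simp: mult_expand[of P Q] lookup_sum lookup_single when_def add_eq_0_nat intro!: sum.cong)
  also have "\<dots> = (\<Sum>a\<in>keys P. if a = 0 then lookup P 0 * lookup Q 0 else 0)"
    by (intro sum.cong refl) (auto simp: in_keys_iff)
  also have "\<dots> = lookup P 0 * lookup Q 0" by (auto simp: in_keys_iff)
  finally show ?thesis .
qed

lemma unit_poly_mult: "unit_poly r P \<Longrightarrow> unit_poly r Q \<Longrightarrow> unit_poly r (P * Q)"
  by (simp add: unit_poly_def poly_in_ops lookup_mult_0)

lemma unit_poly_one: "unit_poly r 1"
  by (simp add: unit_poly_def poly_in_def lookup_one)

lemma unit_poly_add: "unit_poly r P \<Longrightarrow> keys a \<subseteq> {1..r} \<Longrightarrow> a \<noteq> 0 \<Longrightarrow> poly_in {1..r} Q \<Longrightarrow> unit_poly r (single a 1 * Q + P)"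
  by (simp add: unit_poly_def poly_in_ops lookup_add lookup_mult_0 lookup_single when_def)

lemma unit_poly_nonzero: "unit_poly r P \<Longrightarrow> P \<noteq> 0"
  by (auto simp: unit_poly_def)

lemma pvar_dvd_const: "pvar j dvd P \<Longrightarrow> lookup P 0 = 0"
  by (auto simp: lookup_mult_0 pvar_def lookup_single when_def elim!: dvdE)
    (metis lookup_single_eq lookup_zero zero_neq_one)

lemma pvar_dvdI: assumes "\<And>m. m \<in> keys P \<Longrightarrow> lookup m j \<noteq> 0" shows "pvar j dvd P"
proof -
  have "P = (\<Sum>m\<in>keys P. pvar j * single (m - single j 1) (lookup P m))"
  proof (subst (1) expand_single[of P], rule sum.cong[OF refl])
    fix m assume "m \<in> keys P"
    then have "single j 1 + (m - single j 1) = m"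
      using assms[OF \<open>m \<in> keys P\<close>] by (intro poly_mapping_eqI) (auto simp: lookup_add lookup_minus lookup_single when_def)
    then show "single m (lookup P m) = pvar j * single (m - single j 1) (lookup P m)" by (simp add: pvar_def mult_single)
  qed
  then have "P = pvar j * (\<Sum>m\<in>keys P. single (m - single j 1) (lookup P m))" by (simp add: sum_distrib_left)
  then show ?thesis by (rule dvdI)
qed

context good_seed
begin

definition yh :: "nat \<Rightarrow> ratfun" where "yh j = (\<Prod>i = 1..n. x i powi b i j)"

lemma lmono_yh: assumes "keys a \<subseteq> {1..r}" shows "lmono yh a = lmono x (col n r b a)"
proof -
  have "lmono yh a = (\<Prod>j = 1..r. \<Prod>i = 1..n. x i powi (b i j * lookup a j))"
    unfolding lmono_superset[OF finite_atLeastAtMost assms] yh_def by (simp add: prod_powi power_int_mult)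
  also have "\<dots> = (\<Prod>i = 1..n. x i powi (\<Sum>j = 1..r. b i j * lookup a j))"
    by (subst prod.swap) (simp add: powi_sum nz)
  finally show ?thesis unfolding col_def lmono_column[OF nz] .
qed

lemma col_inj: assumes "keys a \<subseteq> {1..r}" "keys c \<subseteq> {1..r}" "col n r b a = col n r b c" shows "a = c"
proof (rule poly_mapping_eqI)
  fix j
  have "(\<Sum>j = 1..r. b i j * (lookup a j - lookup c j)) = 0" if "i \<in> {1..n}" for i
    using arg_cong[OF assms(3), of "\<lambda>q. lookup q i"] that by (simp add: lookup_col right_diff_distrib sum_subtractf)
  then have "lookup a j - lookup c j = 0" if "j \<in> {1..r}" using indep[of "\<lambda>j. lookup a j - lookup c j" j] that by blast
  moreover have "lookup a j = 0" "lookup c j = 0" if "j \<notin> {1..r}" using assms(1,2) that by (auto simp: in_keys_iff)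
  ultimately show "lookup a j = lookup c j" by (cases "j \<in> {1..r}") auto
qed

text \<open>\<open>P\<close> evaluated at the y-hats, as a Laurent polynomial in the cluster. By
  full rank, distinct monomials of \<open>P\<close> land on distinct exponents, so coefficients are
  not mixed.\<close>

definition hat :: "mpoly \<Rightarrow> lpoly" where "hat P = (\<Sum>m\<in>keys P. single (col n r b (emb m)) (lookup P m))"

lemma lev_hat: assumes "poly_in {1..r} P" shows "lev x (hat P) = peval yh P"
proof -
  have "lmono x (col n r b (emb m)) = emono yh m" if "m \<in> keys P" for m
    using lmono_yh[of "emb m"] assms that by (simp add: emono_eq_lmono poly_in_def)
  then show ?thesis unfolding hat_def peval_eq_gev gev_def by (auto simp: gev_def intro!: sum.cong)
qed

lemma lookup_hat:
  assumes "poly_in {1..r} P" "keys m \<subseteq> {1..r}" shows "lookup (hat P) (col n r b (emb m)) = lookup P m"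
proof -
  have "(col n r b (emb k) = col n r b (emb m)) = (k = m)" if "k \<in> keys P" for k
    using col_inj[of "emb k" "emb m"] assms that by (auto simp: poly_in_def emb_inj)
  then have "lookup (hat P) (col n r b (emb m)) = (\<Sum>k\<in>keys P. if k = m then lookup P k else 0)"
    unfolding hat_def lookup_sum lookup_single when_def by (intro sum.cong) auto
  then show ?thesis by (auto simp: in_keys_iff)
qed

lemma keys_hat: assumes "q \<in> keys (hat P)" obtains m where "m \<in> keys P" "q = col n r b (emb m)"
proof -
  have "\<exists>m\<in>keys P. q = col n r b (emb m)"
  proof (rule ccontr)
    assume "\<not> ?thesis"
    then have "lookup (hat P) q = 0" unfolding hat_def lookup_sum lookup_single when_def by (intro sum.neutral) auto
    then show False using assms by (simp add: in_keys_iff)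
  qed
  then show thesis using that by blast
qed

lemma peval_yh_eq_0: assumes "poly_in {1..r} P" "peval yh P = 0" shows "P = 0"
proof (rule ccontr)
  assume "P \<noteq> 0"
  then obtain m where m: "m \<in> keys P" by fastforce
  have "hat P = 0" using assms lev_hat[of P] by (simp add: lev_0_iff)
  then show False using lookup_hat[OF assms(1), of m] m assms(1) by (auto simp: poly_in_def in_keys_iff)
qed

text \<open>The multiplicative group in which a cluster variable divided by its monomial part will
  lie.\<close>

definition yunits :: "ratfun set" where
  "yunits = {peval yh P / peval yh Q | P Q. unit_poly r P \<and> unit_poly r Q}"

lemma yunitsE:
  assumes "z \<in> yunits" obtains P Q where "unit_poly r P" "unit_poly r Q" "peval yh P \<noteq> 0" "peval yh Q \<noteq> 0" "z = peval yh P / peval yh Q"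
proof -
  obtain P Q where PQ: "unit_poly r P" "unit_poly r Q" "z = peval yh P / peval yh Q" using assms by (auto simp: yunits_def)
  then have "peval yh P \<noteq> 0" "peval yh Q \<noteq> 0"
    using peval_yh_eq_0[of P] peval_yh_eq_0[of Q] unit_poly_nonzero[of r] unfolding unit_poly_def by blast+
  then show thesis using that PQ by blast
qed

lemma yunitsI: "unit_poly r P \<Longrightarrow> unit_poly r Q \<Longrightarrow> z = peval yh P / peval yh Q \<Longrightarrow> z \<in> yunits"
  by (auto simp: yunits_def)

lemma yunits_one: "1 \<in> yunits"
  by (rule yunitsI[of 1 1]) (simp_all add: unit_poly_one)

lemma yunits_mult: assumes "z \<in> yunits" "w \<in> yunits" shows "z * w \<in> yunits"
proof -
  obtain P Q where "unit_poly r P" "unit_poly r Q" "z = peval yh P / peval yh Q" using assms(1) by (rule yunitsE)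
  moreover obtain P' Q' where "unit_poly r P'" "unit_poly r Q'" "w = peval yh P' / peval yh Q'" using assms(2) by (rule yunitsE)
  ultimately show ?thesis by (intro yunitsI[of "P * P'" "Q * Q'"]) (simp_all add: unit_poly_mult)
qed

lemma yunits_inverse: assumes "z \<in> yunits" shows "inverse z \<in> yunits"
proof -
  obtain P Q where "unit_poly r P" "unit_poly r Q" "z = peval yh P / peval yh Q" using assms by (rule yunitsE)
  then show ?thesis by (intro yunitsI[of Q P]) simp_all
qed

lemma yunits_prod: "(\<And>i. i \<in> I \<Longrightarrow> f i \<in> yunits) \<Longrightarrow> (\<Prod>i\<in>I. f i) \<in> yunits"
  by (induction I rule: infinite_finite_induct) (auto simp: yunits_one yunits_mult)

lemma yunits_power_int: assumes "z \<in> yunits" shows "z powi k \<in> yunits"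
proof -
  have p: "w ^ m \<in> yunits" if "w \<in> yunits" for w m
    using yunits_prod[of "{..<m}" "\<lambda>_. w"] that by simp
  then show ?thesis unfolding power_int_def using assms yunits_inverse by auto
qed

lemma yunits_one_plus:
  assumes "z \<in> yunits" "keys a \<subseteq> {1..r}" "a \<noteq> 0" shows "1 + emono yh a * z \<in> yunits"
proof -
  obtain P Q where PQ: "unit_poly r P" "unit_poly r Q" "peval yh P \<noteq> 0" "peval yh Q \<noteq> 0" "z = peval yh P / peval yh Q"
    using assms(1) by (rule yunitsE)
  have "1 + emono yh a * z = peval yh (single a 1 * P + Q) / peval yh Q"
    unfolding PQ(5) using PQ(4) by (simp add: field_simps)
  then show ?thesis using PQ(1,2) assms(2,3) by (intro yunitsI[OF unit_poly_add]) (simp_all add: unit_poly_def)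
qed

end

section \<open>Separation of variables\<close>

context cluster_setup
begin

definition expansion :: "nat list \<Rightarrow> nat list \<Rightarrow> (nat \<Rightarrow> nat \<Rightarrow> int) \<Rightarrow> bool" where
  "expansion v w H \<longleftrightarrow>
     (\<forall>k\<in>{1..n}. \<exists>U\<in>good_seed.yunits n r (M v) (X v). X w k = U * lmono (X v) (column n (H k)))
     \<and> (\<forall>k\<in>{1..n}. \<forall>j\<in>{1..r}. H k j = gv w k v j)
     \<and> (\<forall>k\<in>{1..n}. r < k \<longrightarrow> X w k = X v k \<and> (\<forall>m\<in>{1..n}. H k m = (if m = k then 1 else 0)))
     \<and> (\<forall>m\<in>{1..n}. \<forall>l\<in>{1..r}. (\<Sum>i = 1..n. M w i l * H i m) = (\<Sum>j = 1..r. M v m j * cv v j w l))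
     \<and> unimodular r H"

lemma expansion_refl:
  assumes v: "set v \<subseteq> {1..r}" shows "expansion v v (\<lambda>k m. if k = m then 1 else 0)"
proof -
  interpret g: good_seed n r "M v" "X v" by (rule good[OF v])
  have "\<exists>U\<in>g.yunits. X v k = U * lmono (X v) (column n (\<lambda>m. if k = m then 1 else 0))" if k: "k \<in> {1..n}" for k
  proof (rule bexI[OF _ g.yunits_one])
    have "column n (\<lambda>m. if k = m then 1 else 0) = single k 1"
      using k by (intro poly_mapping_eqI) (auto simp: lookup_column lookup_single when_def)
    then show "X v k = 1 * lmono (X v) (column n (\<lambda>m. if k = m then 1 else 0))" by simp
  qed
  moreover have "(if k = j then 1 else 0) = gv v k v j" if "k \<in> {1..n}" "j \<in> {1..r}" for k j
    using gv_same[OF v that(2,1)] by simp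
  moreover have "(\<Sum>i = 1..n. M v i l * (if i = m then 1 else 0)) = (\<Sum>j = 1..r. M v m j * cv v j v l)"
    if m: "m \<in> {1..n}" and l: "l \<in> {1..r}" for m l
  proof -
    have "(\<Sum>j = 1..r. M v m j * cv v j v l) = (\<Sum>j = 1..r. if j = l then M v m l else 0)"
      using cv_same[OF v l] rn by (intro sum.cong) auto
    also have "\<dots> = M v m l" using l by simp
    also have "\<dots> = (\<Sum>i = 1..n. if i = m then M v m l else 0)" using m by simp
    also have "\<dots> = (\<Sum>i = 1..n. M v i l * (if i = m then 1 else 0))" by (intro sum.cong) auto
    finally show ?thesis by simp
  qed
  ultimately show ?thesis unfolding expansion_def using unimodular_one by auto
qed

text \<open>If the c-vector were zero, column \<open>l\<close> of the matrix at \<open>w\<close>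
  would be in the left kernel of \<open>H\<close>, which is block triangular with a unimodular block
  and an identity block. But that column is nonzero.\<close>

lemma column_cv_nonzero:
  assumes v: "set v \<subseteq> {1..r}" and w: "set w \<subseteq> {1..r}" and E: "expansion v w H" and l: "l \<in> {1..r}"
  shows "\<exists>j\<in>{1..r}. cv v j w l \<noteq> 0"
proof (rule ccontr)
  assume "\<not> ?thesis"
  then have z: "(\<Sum>i = 1..n. M w i l * H i m) = 0" if "m \<in> {1..n}" for m
    using E l that by (simp add: expansion_def)
  have H: "H k m = (if m = k then 1 else 0)" if "k \<in> {r<..n}" "m \<in> {1..n}" for k m
    using E that by (auto simp: expansion_def)
  have split: "(\<Sum>i = 1..n. f i) = (\<Sum>i = 1..r. f i) + (\<Sum>i\<in>{r<..n}. f i)" for f :: "nat \<Rightarrow> int"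
    using rn by (subst sum.union_disjoint[symmetric]) (auto intro: sum.cong)
  have "(\<Sum>p = 1..r. M w p l * H p j) = 0" if j: "j \<in> {1..r}" for j
  proof -
    have "(\<Sum>i\<in>{r<..n}. M w i l * H i j) = 0" by (rule sum.neutral) (use H j rn in auto)
    then show ?thesis using z[of j] j rn split[of "\<lambda>i. M w i l * H i j"] by simp
  qed
  then have 1: "M w p l = 0" if "p \<in> {1..r}" for p
    using unimodular_left_kernel[of r H "\<lambda>p. M w p l"] E that by (simp add: expansion_def)
  have 2: "M w m l = 0" if m: "m \<in> {r<..n}" for m
  proof -
    have "(\<Sum>i\<in>{r<..n}. M w i l * H i m) = (\<Sum>i\<in>{r<..n}. if i = m then M w m l else 0)"
      by (rule sum.cong[OF refl]) (use H m in auto)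
    also have "\<dots> = M w m l" using m by simp
    finally show ?thesis using z[of m] m split[of "\<lambda>i. M w i l * H i m"] 1 by simp
  qed
  obtain k where "k \<in> {1..n}" "M w k l \<noteq> 0" using good_seed.ccol_entry[OF good[OF w] l] .
  then show False using 1[of k] 2[of k] by (cases "k \<le> r") auto
qed

text \<open>\<open>s\<close> is the sign of the \<open>l\<close>-th column of c-vectors; by coherence, the exchange binomial is a monomial
  times \<open>1\<close> plus a product of nonnegative powers of the \<open>yh j\<close> and a unit.\<close>

lemma expansion_step:
  assumes v: "set v \<subseteq> {1..r}" and nb: "nb l w w'" and E: "expansion v w H" and s: "s = 1 \<or> s = - 1"
    and sc: "\<And>i. i \<in> {1..n} \<Longrightarrow> 0 \<le> s * cv v i w l"
  shows "expansion v w' (\<lambda>k m. if k = l then - H l m + (\<Sum>i = 1..n. pos_part (- s * M w i l) * H i m) else H k m)"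
    (is "expansion v w' ?H")
proof -
  have w: "set w \<subseteq> {1..r}" and l: "l \<in> {1..r}" "l \<in> {1..n}" using nb rn by (auto simp: nb_def)
  interpret g: good_seed n r "M v" "X v" by (rule good[OF v])
  interpret gw: good_seed n r "M w" "X w" by (rule good[OF w])
  have "\<forall>k\<in>{1..n}. \<exists>U. U \<in> g.yunits \<and> X w k = U * lmono (X v) (column n (H k))"
    using E unfolding expansion_def by blast
  from bchoice[OF this] obtain U where U: "\<And>k. k \<in> {1..n} \<Longrightarrow> U k \<in> g.yunits"
    "\<And>k. k \<in> {1..n} \<Longrightarrow> X w k = U k * lmono (X v) (column n (H k))"
    by blast
  have Hg: "\<And>k j. k \<in> {1..n} \<Longrightarrow> j \<in> {1..r} \<Longrightarrow> H k j = gv w k v j"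
    and Hf: "\<And>k m. k \<in> {1..n} \<Longrightarrow> r < k \<Longrightarrow> m \<in> {1..n} \<Longrightarrow> H k m = (if m = k then 1 else 0)"
    and Xf: "\<And>k. k \<in> {1..n} \<Longrightarrow> r < k \<Longrightarrow> X w k = X v k"
    and Hs: "\<And>m p. m \<in> {1..n} \<Longrightarrow> p \<in> {1..r} \<Longrightarrow> (\<Sum>i = 1..n. M w i p * H i m) = (\<Sum>j = 1..r. M v m j * cv v j w p)"
    and Hu: "unimodular r H"
    using E unfolding expansion_def by auto
  \<comment> \<open>The exponents of the monomial factored out of the exchange binomial: the
    negative part of the column for s = 1, the positive part for s = -1.\<close>
  define a where "a i = pos_part (- s * M w i l)" for i
  have al: "a l = 0" using M_diag[OF w l(1)] by (simp add: a_def pos_part_def)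
  have pa: "pos_part (M w i l) - a i = (if s = 1 then M w i l else 0)" for i
    using s by (auto simp: a_def pos_part_def)
  have Hl: "?H l m = - H l m + (\<Sum>i = 1..n. a i * H i m)" for m by (simp add: a_def)
  have X': "X w' k = X w k" if "k \<noteq> l" for k using that by (simp add: nb_X[OF nb] gw.x'_simps)
  have monomial: "(\<Prod>i = 1..n. X w i powi e i) = (\<Prod>i = 1..n. U i powi e i) * lmono (X v) (column n (\<lambda>m. \<Sum>i = 1..n. e i * H i m))" for e
  proof -
    have "(\<Prod>i = 1..n. X w i powi e i) = (\<Prod>i = 1..n. U i powi e i * (\<Prod>m = 1..n. X v m powi (e i * H i m)))"
    proof (rule prod.cong[OF refl])
      fix i assume "i \<in> {1..n}"
      then have "X w i = U i * (\<Prod>m = 1..n. X v m powi H i m)" using U(2) by (simp add: lmono_column[OF g.nz])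
      then show "X w i powi e i = U i powi e i * (\<Prod>m = 1..n. X v m powi (e i * H i m))"
        by (simp only: power_int_mult_distrib prod_powi power_int_mult mult.commute[of "e i"])
    qed
    also have "\<dots> = (\<Prod>i = 1..n. U i powi e i) * (\<Prod>m = 1..n. \<Prod>i = 1..n. X v m powi (e i * H i m))"
      unfolding prod.distrib by (subst (2) prod.swap) simp
    also have "(\<Prod>m = 1..n. \<Prod>i = 1..n. X v m powi (e i * H i m)) = lmono (X v) (column n (\<lambda>m. \<Sum>i = 1..n. e i * H i m))"
      unfolding lmono_column[OF g.nz] by (simp only: powi_sum[OF g.nz])
    finally show ?thesis .
  qed
  \<comment> \<open>The c-vector without its sign, as an exponent in the y-hats. It is nonzero, so 1
    plus this monomial times a unit is again a unit.\<close>
  define aa where "aa = (\<Sum>j = 1..r. single j (nat (s * cv v j w l)))"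
  have laa: "lookup aa j = (if j \<in> {1..r} then nat (s * cv v j w l) else 0)" for j
    unfolding aa_def by (rule lookup_col_sum)
  have kaa: "keys aa \<subseteq> {1..r}" by (auto simp: in_keys_iff laa split: if_splits)
  have aa0: "aa \<noteq> 0"
  proof -
    obtain j where j: "j \<in> {1..r}" "cv v j w l \<noteq> 0" using column_cv_nonzero[OF v w E l(1)] by blast
    then have "0 < s * cv v j w l" using sc[of j] s rn by auto
    then have "lookup aa j \<noteq> 0" using j by (simp add: laa)
    then show ?thesis by auto
  qed
  have yaa: "lmono (X v) (column n (\<lambda>m. \<Sum>i = 1..n. s * M w i l * H i m)) = emono g.yh aa"
  proof -
    have "column n (\<lambda>m. \<Sum>i = 1..n. s * M w i l * H i m) = col n r (M v) (emb aa)"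
    proof (rule poly_mapping_eqI)
      fix m
      show "lookup (column n (\<lambda>m. \<Sum>i = 1..n. s * M w i l * H i m)) m = lookup (col n r (M v) (emb aa)) m"
      proof (cases "m \<in> {1..n}")
        case True
        have "(\<Sum>j = 1..r. M v m j * lookup (emb aa) j) = (\<Sum>j = 1..r. s * (M v m j * cv v j w l))"
        proof (rule sum.cong[OF refl])
          fix j assume j: "j \<in> {1..r}"
          then have "int (nat (s * cv v j w l)) = s * cv v j w l" using sc[of j] rn by simp
          then show "M v m j * lookup (emb aa) j = s * (M v m j * cv v j w l)" using j by (simp add: laa)
        qed
        also have "\<dots> = s * (\<Sum>i = 1..n. M w i l * H i m)" unfolding Hs[OF True l(1)] by (simp only: sum_distrib_left)
        also have "\<dots> = (\<Sum>i = 1..n. s * M w i l * H i m)" by (simp only: sum_distrib_left mult.assoc)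
        finally show ?thesis using True by (simp add: lookup_column lookup_col)
      qed (auto simp: lookup_column lookup_col)
    qed
    then show ?thesis using g.lmono_yh[of "emb aa"] kaa by (simp add: emono_eq_lmono)
  qed
  define V where "V = (\<Prod>i = 1..n. U i powi a i) * (1 + emono g.yh aa * (\<Prod>i = 1..n. U i powi (s * M w i l))) * inverse (U l)"
  have V: "V \<in> g.yunits" unfolding V_def using U(1) l
    by (intro g.yunits_mult g.yunits_inverse g.yunits_one_plus g.yunits_prod g.yunits_power_int kaa aa0) auto
  have Xl: "X w' l = V * lmono (X v) (column n (?H l))"
  proof -
    have b: "lev (X w) (bin n (M w) l) = (\<Prod>i = 1..n. X w i powi a i) * (1 + (\<Prod>i = 1..n. X w i powi (s * M w i l)))"
    proof -
      have "(\<Prod>i = 1..n. X w i powi a i) * (\<Prod>i = 1..n. X w i powi (s * M w i l)) = (\<Prod>i = 1..n. X w i powi pos_part (s * M w i l))"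
      proof -
        have "a i + s * M w i l = pos_part (s * M w i l)" for i by (simp add: a_def pos_part_def)
        then have "X w i powi a i * X w i powi (s * M w i l) = X w i powi pos_part (s * M w i l)" for i
          by (simp add: gw.nz flip: power_int_add)
        then show ?thesis by (simp flip: prod.distrib)
      qed
      then show ?thesis using s
        by (auto simp: bin_def cpos_def cneg_def lmono_column[OF gw.nz] distrib_left a_def)
    qed
    have "column n (?H l) = column n (\<lambda>m. \<Sum>i = 1..n. a i * H i m) - column n (H l)"
      by (rule poly_mapping_eqI) (simp add: lookup_column lookup_minus a_def)
    then have "lmono (X v) (column n (?H l)) = lmono (X v) (column n (\<lambda>m. \<Sum>i = 1..n. a i * H i m)) * inverse (lmono (X v) (column n (H l)))"
      by (simp only: diff_conv_add_uminus g.lmono_add' lmono_uminus[OF g.nz])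
    moreover have "X w' l = lev (X w) (bin n (M w) l) / X w l" by (simp only: nb_X[OF nb] gw.x'_simps)
    ultimately show ?thesis
      unfolding b monomial yaa V_def U(2)[OF l(2)] by (simp add: field_simps)
  qed
  have "\<exists>W\<in>g.yunits. X w' k = W * lmono (X v) (column n (?H k))" if "k \<in> {1..n}" for k
    using U[OF that] X'[of k] V Xl by (cases "k = l") auto
  moreover have "?H k j = gv w' k v j" if k: "k \<in> {1..n}" and j: "j \<in> {1..r}" for k j
  proof (cases "k = l")
    case False
    have "d v m w' k = d v m w k" if "m \<in> {1..n}" for m
      using cov_step[OF v that nb] False by (simp add: trop_step_def)
    then have "gv w' k v j = gv w k v j" unfolding gv_def by (intro sum.cong) auto
    then show ?thesis using False Hg[OF k j] by simp
  next
    case True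
    have "gv w' l v j = (\<Sum>m = 1..n. M v m j * (- d v m w l + (\<Sum>i = 1..n. pos_part (M w i l) * d v m w i) + (if s = 1 then cv v m w l else 0)))"
      unfolding gv_def
    proof (rule sum.cong[OF refl])
      fix m assume m: "m \<in> {1..n}"
      have "pos_part (cv v m w l) = (if s = 1 then cv v m w l else 0)" using sc[OF m] s by (auto simp: pos_part_def)
      then have "d v m w' l = - d v m w l + (\<Sum>i = 1..n. pos_part (M w i l) * d v m w i) + (if s = 1 then cv v m w l else 0)"
        using cov_step[OF v m nb] by (simp add: trop_step_def cv_def)
      then show "M v m j * d v m w' l = M v m j * (- d v m w l + (\<Sum>i = 1..n. pos_part (M w i l) * d v m w i) + (if s = 1 then cv v m w l else 0))"
        by simp
    qed
    \<comment> \<open>The relation for dimensions uses the positive part of the column. Replacing it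
      by \<open>a\<close> absorbs the term with \<open>cv\<close>, which is minus the corresponding
      column sum of dimensions.\<close>
    also have "\<dots> = (\<Sum>m = 1..n. M v m j * (- d v m w l + (\<Sum>i = 1..n. a i * d v m w i)))"
    proof (rule sum.cong[OF refl])
      fix m
      have "(\<Sum>i = 1..n. pos_part (M w i l) * d v m w i) - (\<Sum>i = 1..n. a i * d v m w i)
          = (\<Sum>i = 1..n. (pos_part (M w i l) - a i) * d v m w i)" by (simp only: left_diff_distrib sum_subtractf)
      also have "\<dots> = - (if s = 1 then cv v m w l else 0)" unfolding pa by (simp add: cv_def)
      finally show "M v m j * (- d v m w l + (\<Sum>i = 1..n. pos_part (M w i l) * d v m w i) + (if s = 1 then cv v m w l else 0))
        = M v m j * (- d v m w l + (\<Sum>i = 1..n. a i * d v m w i))" by simp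
    qed
    also have "\<dots> = - gv w l v j + (\<Sum>i = 1..n. a i * gv w i v j)"
      unfolding gv_def distrib_left sum.distrib sum_distrib_left
      by (subst (2) sum.swap) (simp add: sum_negf mult.left_commute)
    also have "(\<Sum>i = 1..n. a i * gv w i v j) = (\<Sum>i = 1..n. a i * H i j)"
      by (rule sum.cong[OF refl]) (simp only: Hg[OF _ j])
    finally show ?thesis using True Hl[of j] Hg[OF l(2) j] by simp
  qed
  moreover have "X w' k = X v k \<and> (\<forall>m\<in>{1..n}. ?H k m = (if m = k then 1 else 0))" if "k \<in> {1..n}" "r < k" for k
  proof -
    have "k \<noteq> l" using that l by auto
    then show ?thesis using X'[of k] Xf[OF that] Hf[OF that] by simp
  qed
  moreover have "(\<Sum>i = 1..n. M w' i p * ?H i m) = (\<Sum>j = 1..r. M v m j * cv v j w' p)" if m: "m \<in> {1..n}" and p: "p \<in> {1..r}" for m p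
  proof (cases "p = l")
    case True
    have "(\<Sum>i = 1..n. M w' i l * ?H i m) = - (\<Sum>i = 1..n. M w i l * H i m)"
      unfolding nb_M[OF nb]
      by (rule sum_mutated_column[where b = "M w" and f = "\<lambda>i. H i m" and f' = "\<lambda>i. ?H i m", OF l(2) M_diag[OF w l(1)]]) simp
    moreover have "(\<Sum>j = 1..r. M v m j * cv v j w' l) = (\<Sum>j = 1..r. - (M v m j * cv v j w l))"
      using cv_step(1)[OF v _ nb] rn by (intro sum.cong) auto
    ultimately show ?thesis using Hs[OF m l(1)] True by (simp add: sum_negf)
  next
    case False
    \<comment> \<open>The deviation required by \<open>sum_mutated\<close>: minus the column sum for
      s = 1 and zero for s = -1, matching the positive part of the c-vector.\<close>
    have "H l m + ?H l m - (\<Sum>i = 1..n. pos_part (M w i l) * H i m) = - (\<Sum>i = 1..n. (pos_part (M w i l) - a i) * H i m)"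
      unfolding Hl by (simp only: left_diff_distrib sum_subtractf)
    also have "\<dots> = - (if s = 1 then \<Sum>i = 1..n. M w i l * H i m else 0)" unfolding pa by simp
    finally have t: "H l m + ?H l m - (\<Sum>i = 1..n. pos_part (M w i l) * H i m) = - (if s = 1 then \<Sum>i = 1..n. M w i l * H i m else 0)" .
    have "(\<Sum>i = 1..n. M w' i p * ?H i m) = (\<Sum>i = 1..n. M w i p * H i m) + pos_part (- M w l p) * (\<Sum>i = 1..n. M w i l * H i m)
        - M w l p * - (if s = 1 then \<Sum>i = 1..n. M w i l * H i m else 0)"
      unfolding nb_M[OF nb] t[symmetric]
      by (rule sum_mutated[where b = "M w" and f = "\<lambda>i. H i m" and f' = "\<lambda>i. ?H i m", OF l(2) M_diag[OF w l(1)] False]) simp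
    also have "\<dots> = (\<Sum>j = 1..r. M v m j * (cv v j w p + pos_part (- M w l p) * cv v j w l + M w l p * (if s = 1 then cv v j w l else 0)))"
      unfolding Hs[OF m p] Hs[OF m l(1)] by (simp add: distrib_left sum.distrib sum_distrib_left mult.left_commute)
    also have "\<dots> = (\<Sum>j = 1..r. M v m j * cv v j w' p)"
    proof (rule sum.cong[OF refl])
      fix j assume "j \<in> {1..r}"
      then have j: "j \<in> {1..n}" using rn by auto
      have "pos_part (cv v j w l) = (if s = 1 then cv v j w l else 0)" using sc[OF j] s by (auto simp: pos_part_def)
      then show "M v m j * (cv v j w p + pos_part (- M w l p) * cv v j w l + M w l p * (if s = 1 then cv v j w l else 0)) = M v m j * cv v j w' p"
        using cv_step(2)[OF v j nb False] by simp
    qed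
    finally show ?thesis .
  qed
  moreover have "unimodular r ?H"
  proof (rule unimodular_row_operation[where e = a, OF Hu l(1) al])
    fix j assume j: "j \<in> {1..r}"
    have "(\<Sum>i = 1..n. a i * H i j) = (\<Sum>i = 1..r. a i * H i j)"
      using rn j Hf by (intro sum.mono_neutral_right) auto
    then show "?H l j = - H l j + (\<Sum>p = 1..r. a p * H p j)" using Hl[of j] by simp
  qed simp
  ultimately show ?thesis unfolding expansion_def by blast
qed

theorem expansion_exists:
  assumes v: "set v \<subseteq> {1..r}" and w: "set w \<subseteq> {1..r}" shows "\<exists>H. expansion v w H"
proof (rule reach[OF v w])
  show "\<exists>H. expansion v v H" using expansion_refl[OF v] by blast
  fix l u u' assume nb: "nb l u u'" and "\<exists>H. expansion v u H"
  then obtain H where H: "expansion v u H" by blast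
  have u: "set u \<subseteq> {1..r}" "l \<in> {1..r}" using nb by (auto simp: nb_def)
  show "\<exists>H. expansion v u' H"
  proof (cases "\<exists>i\<in>{1..n}. cv v i u l > 0")
    case True
    then have "0 \<le> 1 * cv v i u l" if "i \<in> {1..n}" for i using cov_coherent[OF v u] that by auto
    from expansion_step[OF v nb H _ this] show ?thesis by blast
  next
    case False
    then have "0 \<le> - 1 * cv v i u l" if "i \<in> {1..n}" for i using that by force
    from expansion_step[OF v nb H _ this] show ?thesis by blast
  qed
qed

end

section \<open>Valuations and cluster monomials\<close>

lemma lookup_single_mult: "lookup (single m c * F) k = c * lookup (F :: lpoly) (k - m)"
proof -
  have "single m c * F = (\<Sum>q\<in>keys F. single (m + q) (c * lookup F q))"
    by (subst expand_single[of F]) (simp add: sum_distrib_left mult_single)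
  then have "lookup (single m c * F) k = (\<Sum>q\<in>keys F. if q = k - m then c * lookup F (k - m) else 0)"
    by (auto simp: lookup_sum lookup_single when_def algebra_simps intro!: sum.cong)
  then show ?thesis by (auto simp: in_keys_iff)
qed

lemma lookup_mult_diff: "lookup (P * Q :: lpoly) k = (\<Sum>m\<in>keys P. lookup P m * lookup Q (k - m))"
proof -
  have "P * Q = (\<Sum>m\<in>keys P. single m (lookup P m) * Q)"
    by (subst expand_single[of P]) (simp add: sum_distrib_right)
  then show ?thesis by (simp add: lookup_sum lookup_single_mult)
qed

lemma emb_0 [simp]: "emb 0 = 0"
  by (rule poly_mapping_eqI) simp

text \<open>With nonnegative coefficients nothing cancels in a sum, so the valuation of a sum is
  exactly the minimum.\<close>

definition nonneg_poly :: "lpoly \<Rightarrow> bool" where "nonneg_poly F \<longleftrightarrow> F \<noteq> 0 \<and> (\<forall>m. 0 \<le> lookup F m)"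

lemma nonneg_poly_mult: assumes "nonneg_poly F" "nonneg_poly G" shows "nonneg_poly (F * G)"
  using assms unfolding nonneg_poly_def by (simp add: lookup_mult_diff sum_nonneg)

lemma val_add:
  assumes "nonneg_poly F" "nonneg_poly G"
  shows "nonneg_poly (F + G)" "val u (F + G) = min (val u F) (val u G)"
proof -
  have k: "keys (F + G) = keys F \<union> keys G"
    using assms by (auto simp: in_keys_iff lookup_add nonneg_poly_def add_nonneg_eq_0_iff)
  then show "nonneg_poly (F + G)" using assms by (auto simp: nonneg_poly_def lookup_add)
  have "keys F \<noteq> {}" "keys G \<noteq> {}" using assms by (auto simp: nonneg_poly_def)
  then show "val u (F + G) = min (val u F) (val u G)" unfolding val_def k image_Un by (intro Min_Un) auto
qed

lemma val_single: "c \<noteq> 0 \<Longrightarrow> val u (single m c) = wt u m"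
  by (simp add: val_def)

lemma nonneg_single: "c > 0 \<Longrightarrow> nonneg_poly (single m c)"
  by (simp add: nonneg_poly_def lookup_single when_def) (metis lookup_single_eq lookup_zero less_irrefl)

lemma nonneg_one [simp]: "nonneg_poly 1" and val_one [simp]: "val u 1 = 0"
  using nonneg_single[of 1 0] val_single[of 1 u 0] by simp_all

context good_seed
begin

text \<open>Divisibility by no variable pins down the monomial factor: comparing exponents of \<open>yh j\<close> on both
  sides, each component of the difference of the two monomials is both nonnegative and nonpositive.\<close>

lemma exponents_le:
  assumes A: "poly_in {1..r} A" "poly_in {1..r} A'" and j: "\<not> pvar j dvd A"
    and e: "peval yh A * lmono x h = peval yh A' * lmono x h'"
  shows "\<exists>a. keys a \<subseteq> {1..r} \<and> h' - h = col n r b a \<and> lookup a j \<le> 0"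
proof -
  obtain m where m: "m \<in> keys A" "lookup m j = 0" using pvar_dvdI[of A j] j by auto
  have "lev x (hat A * single h 1) = lev x (hat A' * single h' 1)" using e by (simp add: lev_mult' lev_hat A)
  then have "single h 1 * hat A = single h' 1 * hat A'" unfolding lev_eq_iff by (simp add: mult.commute)
  then have "lookup (single h 1 * hat A) (h + col n r b (emb m)) = lookup (hat A') (h + col n r b (emb m) - h')"
    by (simp add: lookup_single_mult)
  then have "lookup (hat A') (h + col n r b (emb m) - h') = lookup A m"
    using lookup_hat[OF A(1), of m] m A(1) by (simp add: lookup_single_mult poly_in_def)
  then have "h + col n r b (emb m) - h' \<in> keys (hat A')" using m by (simp add: in_keys_iff)
  then obtain m' where m': "m' \<in> keys A'" "h + col n r b (emb m) - h' = col n r b (emb m')" by (rule keys_hat)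
  have "h' - h = col n r b (emb m - emb m')" using m'(2) by (simp add: algebra_simps)
  moreover have "keys (emb m - emb m') \<subseteq> {1..r}"
  proof -
    have "keys m \<subseteq> {1..r}" "keys m' \<subseteq> {1..r}" using m(1) m'(1) A unfolding poly_in_def by blast+
    then show ?thesis using keys_diff[of "emb m" "emb m'"] by (simp only: keys_emb) (rule order_trans, assumption, simp)
  qed
  moreover have "lookup (emb m - emb m') j \<le> 0" using m(2) by (simp add: lookup_minus)
  ultimately show ?thesis by blast
qed

text \<open>The vector \<open>a\<close> with h' - h = col a is unique and thus the same for every
  \<open>j\<close>. Using \<open>exponents_le\<close> in both directions bounds each of its entries
  from both sides.\<close>

lemma exponents_unique:
  assumes A: "poly_in {1..r} A" "poly_in {1..r} A'" and j: "\<And>j. j \<in> {1..r} \<Longrightarrow> \<not> pvar j dvd A \<and> \<not> pvar j dvd A'"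
    and e: "peval yh A * lmono x h = peval yh A' * lmono x h'"
    and r1: "1 \<in> {1..r}"
  shows "h = h'"
proof -
  obtain a where a: "keys a \<subseteq> {1..r}" "h' - h = col n r b a" using exponents_le[OF A _ e, of 1] j[OF r1] by blast
  have "lookup a j = 0" for j
  proof (cases "j \<in> {1..r}")
    case True
    obtain c where c: "keys c \<subseteq> {1..r}" "h' - h = col n r b c" "lookup c j \<le> 0"
      using exponents_le[OF A _ e, of j] j[OF True] by blast
    obtain c' where c': "keys c' \<subseteq> {1..r}" "h - h' = col n r b c'" "lookup c' j \<le> 0"
      using exponents_le[OF A(2,1) _ e[symmetric], of j] j[OF True] by blast
    have e1: "a = c" by (rule col_inj[OF a(1) c(1)]) (use a(2) c(2) in simp)
    have e2: "a = - c'"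
    proof (rule col_inj[OF a(1)])
      show "keys (- c') \<subseteq> {1..r}" using c'(1) by (simp add: keys_minus)
      have "col n r b (- c') = - col n r b c'" using col_simps(3)[of n r b 0 c'] by simp
      then show "col n r b a = col n r b (- c')" using a(2) c'(2) by (metis minus_diff_eq)
    qed
    have "lookup a j = lookup c j" by (simp only: e1)
    moreover have "lookup a j = - lookup c' j" unfolding e2 by simp
    ultimately show ?thesis using c(3) c'(3) by linarith
  next
    case False
    then show ?thesis using a(1) by (auto simp: in_keys_iff)
  qed
  then have "a = 0" by (intro poly_mapping_eqI) simp
  then show ?thesis using a(2) by simp
qed

text \<open>The monomial \<open>\<phi>\<close> occurs in \<open>R\<close> with coefficient \<open>1\<close>: otherwise consider \<open>\<phi> - col a\<close> in the support
  of \<open>R\<close> with \<open>a \<ge> 0\<close> as large as possible.\<close>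

lemma lookup_unit_multiple:
  assumes U: "U \<in> yunits" and R: "lev x R = U * lmono x \<phi>"
  shows "lookup R \<phi> = 1"
proof -
  obtain P Q where PQ: "unit_poly r P" "unit_poly r Q" "peval yh Q \<noteq> 0" "U = peval yh P / peval yh Q"
    using U by (rule yunitsE)
  have p: "poly_in {1..r} P" "poly_in {1..r} Q" "lookup P 0 = 1" "lookup Q 0 = 1" using PQ by (auto simp: unit_poly_def)
  have "lev x (hat Q * R) = lev x (single \<phi> 1 * hat P)" using R PQ(3,4) by (simp add: lev_mult' lev_hat p)
  then have RQ: "hat Q * R = single \<phi> 1 * hat P" by (simp only: lev_eq_iff)
  have h0: "lookup (hat P) 0 = 1" "lookup (hat Q) 0 = 1"
    using lookup_hat[of P 0] lookup_hat[of Q 0] p by simp_all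
  define c where "c a = col n r b (emb a)" for a
  define D where "D = {a. keys a \<subseteq> {1..r} \<and> \<phi> - c a \<in> keys R}"
  have c_inj: "a = a'" if "keys a \<subseteq> {1..r}" "keys a' \<subseteq> {1..r}" "c a = c a'" for a a'
    using col_inj[of "emb a" "emb a'"] that by (simp add: c_def emb_inj)
  have "inj_on (\<lambda>a. \<phi> - c a) D" by (rule inj_onI) (auto simp: D_def intro: c_inj)
  then have D: "finite D" by (rule inj_on_finite[of _ _ "keys R"]) (auto simp: D_def)
  have coeff: "(\<Sum>m\<in>keys (hat Q). lookup (hat Q) m * lookup R (k - m)) = lookup (hat P) (k - \<phi>)" for k
    using arg_cong[OF RQ, of "\<lambda>F. lookup F k"] by (simp add: lookup_single_mult lookup_mult_diff)
  have hatQ: "\<exists>a. keys a \<subseteq> {1..r} \<and> m = c a" if "m \<in> keys (hat Q)" for m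
    using that p(2) by (elim keys_hat) (auto simp: c_def poly_in_def)
  have cadd: "c (a + a') = c a + c a'" for a a' by (simp add: c_def emb_add)
  \<comment> \<open>At a position extremal in the support of \<open>R\<close> only the constant term
    of \<open>hat Q\<close> contributes to the product.\<close>
  have top: "lookup R (\<phi> - c a) = lookup (hat P) (- c a)" if a: "keys a \<subseteq> {1..r}" and mx: "\<And>a'. a' \<in> D \<Longrightarrow> (\<Sum>j = 1..r. lookup a' j) \<le> (\<Sum>j = 1..r. lookup a j)" for a
  proof -
    have "lookup (hat Q) m * lookup R (\<phi> - c a - m) = (if m = 0 then lookup R (\<phi> - c a) else 0)" if mQ: "m \<in> keys (hat Q)" for m
    proof (cases "m = 0")
      case False
      obtain a' where a': "keys a' \<subseteq> {1..r}" "m = c a'" using hatQ[OF mQ] by blast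
      then have "a' \<noteq> 0" using False by (auto simp: c_def)
      then have "keys a' \<noteq> {}" by simp
      then obtain j where "j \<in> keys a'" by blast
      then have j: "lookup a' j \<noteq> 0" "j \<in> {1..r}" using subsetD[OF a'(1)] by (simp_all add: in_keys_iff del: atLeastAtMost_iff)
      have "(\<Sum>j = 1..r. lookup (a + a') j) = (\<Sum>j = 1..r. lookup a j) + (\<Sum>j = 1..r. lookup a' j)" by (simp add: lookup_add sum.distrib)
      moreover have "(\<Sum>j = 1..r. lookup a' j) > 0" using j by (intro sum_pos2[of _ j]) auto
      ultimately have "a + a' \<notin> D" using mx[of "a + a'"] by linarith
      moreover have "keys (a + a') \<subseteq> {1..r}" using a a'(1) keys_add[of a a'] by blast
      ultimately have "\<phi> - c (a + a') \<notin> keys R" by (simp add: D_def)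
      then show ?thesis using False a'(2) by (simp add: cadd in_keys_iff diff_diff_eq)
    qed (simp add: h0)
    then have "(\<Sum>m\<in>keys (hat Q). lookup (hat Q) m * lookup R (\<phi> - c a - m)) = (\<Sum>m\<in>keys (hat Q). if m = 0 then lookup R (\<phi> - c a) else 0)"
      by (intro sum.cong refl)
    also have "\<dots> = lookup R (\<phi> - c a)" using h0 by (simp add: in_keys_iff)
    finally show ?thesis using coeff[of "\<phi> - c a"] by simp
  qed
  have c0: "c 0 = 0" by (simp add: c_def)
  have "lookup R (\<phi> - c a) = 0" if a: "a \<noteq> 0" "keys a \<subseteq> {1..r}" "\<And>a'. a' \<in> D \<Longrightarrow> (\<Sum>j = 1..r. lookup a' j) \<le> (\<Sum>j = 1..r. lookup a j)" for a
  proof -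
    have "- c a \<notin> keys (hat P)"
    proof
      assume "- c a \<in> keys (hat P)"
      then obtain m where m: "m \<in> keys P" "- c a = c m" by (elim keys_hat) (auto simp: c_def)
      then have "c (a + m) = c 0" by (simp add: cadd c0 flip: m(2))
      moreover have "keys m \<subseteq> {1..r}" using m p(1) by (auto simp: poly_in_def)
      ultimately have "a + m = 0" using a(2) keys_add[of a m] by (intro c_inj) auto
      then show False using a(1) by (simp add: add_eq_0_nat)
    qed
    then show ?thesis using top[OF a(2,3)] by (simp add: in_keys_iff)
  qed
  note not_max = this
  have "D \<subseteq> {0}"
  proof (rule ccontr)
    assume nD: "\<not> D \<subseteq> {0}"
    then have "D \<noteq> {}" by auto
    then obtain a where a: "a \<in> D" "\<And>a'. a' \<in> D \<Longrightarrow> (\<Sum>j = 1..r. lookup a' j) \<le> (\<Sum>j = 1..r. lookup a j)"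
    proof -
      let ?f = "\<lambda>a. \<Sum>j = 1..r. lookup a j"
      have "Max (?f ` D) \<in> ?f ` D" using D \<open>D \<noteq> {}\<close> by (intro Max_in) auto
      then obtain a where "a \<in> D" "?f a = Max (?f ` D)" by auto
      then show thesis using that[of a] D by simp
    qed
    have "a \<noteq> 0"
    proof
      assume "a = 0"
      obtain a' where a': "a' \<in> D" "a' \<noteq> 0" using nD by blast
      then have "(\<Sum>j = 1..r. lookup a' j) = 0" using a(2)[OF a'(1)] \<open>a = 0\<close> by simp
      then have "\<forall>j\<in>{1..r}. lookup a' j = 0" by (subst (asm) sum_eq_0_iff) auto
      then show False using a' by (auto simp: D_def in_keys_iff intro!: poly_mapping_eqI) 
    qed
    then have "lookup R (\<phi> - c a) = 0" using not_max[of a] a by (auto simp: D_def)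
    then show False using a(1) by (simp add: D_def in_keys_iff)
  qed
  then have "lookup R (\<phi> - c 0) = lookup (hat P) (- c 0)" by (intro top) auto
  then show ?thesis using h0 by (simp add: c0)
qed

section \<open>Valuations of subtraction-free expressions\<close>

text \<open>A relation rather than a function, since a value exists only for elements that can be
  written without subtraction. It does not depend on the way of writing, see
  \<open>pval_unique\<close>.\<close>

definition pval :: "(nat \<Rightarrow>\<^sub>0 int) \<Rightarrow> ratfun \<Rightarrow> int \<Rightarrow> bool" where
  "pval u z c \<longleftrightarrow> (\<exists>F G. nonneg_poly F \<and> nonneg_poly G \<and> z = lev x F / lev x G \<and> c = val u F - val u G)"

lemma pvalI: "nonneg_poly F \<Longrightarrow> nonneg_poly G \<Longrightarrow> z = lev x F / lev x G \<Longrightarrow> c = val u F - val u G \<Longrightarrow> pval u z c"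
  by (auto simp: pval_def)

lemma pvalE:
  assumes "pval u z c"
  obtains F G where "nonneg_poly F" "nonneg_poly G" "F \<noteq> 0" "G \<noteq> 0" "lev x F \<noteq> 0" "lev x G \<noteq> 0" "z = lev x F / lev x G" "c = val u F - val u G"
  using assms by (auto simp: pval_def nonneg_poly_def lev_0_iff)

text \<open>Connects the two notions: for a Laurent polynomial that is also a subtraction-free
  fraction, the tropical value is the honest valuation, even if its coefficients have mixed
  signs.\<close>

lemma pval_lev: assumes "pval u (lev x R) c" shows "R \<noteq> 0" "c = val u R"
proof -
  obtain F G where FG: "F \<noteq> 0" "G \<noteq> 0" "lev x F \<noteq> 0" "lev x G \<noteq> 0" "lev x R = lev x F / lev x G" "c = val u F - val u G"
    using assms by (rule pvalE)
  then have "lev x (R * G) = lev x F" by (simp add: lev_mult')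
  then have RG: "R * G = F" by (simp only: lev_eq_iff)
  then show "R \<noteq> 0" using FG by auto
  then show "c = val u R" using val_mult[of R G u] RG FG by simp
qed

lemma pval_mult: assumes "pval u z c" "pval u w e" shows "pval u (z * w) (c + e)"
proof -
  obtain F G where 1: "nonneg_poly F" "nonneg_poly G" "F \<noteq> 0" "G \<noteq> 0" "z = lev x F / lev x G" "c = val u F - val u G"
    using assms(1) by (rule pvalE)
  obtain F' G' where 2: "nonneg_poly F'" "nonneg_poly G'" "F' \<noteq> 0" "G' \<noteq> 0" "w = lev x F' / lev x G'" "e = val u F' - val u G'"
    using assms(2) by (rule pvalE)
  show ?thesis by (rule pvalI[of "F * F'" "G * G'"]) (use 1 2 in \<open>auto simp: nonneg_poly_mult lev_mult' val_mult\<close>)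
qed

lemma pval_inverse: assumes "pval u z c" shows "pval u (inverse z) (- c)"
proof -
  obtain F G where 1: "nonneg_poly F" "nonneg_poly G" "z = lev x F / lev x G" "c = val u F - val u G"
    using assms by (rule pvalE)
  show ?thesis by (rule pvalI[of G F]) (use 1 in auto)
qed

lemma pval_add: assumes "pval u z c" "pval u w e" shows "pval u (z + w) (min c e)"
proof -
  obtain F G where 1: "nonneg_poly F" "nonneg_poly G" "F \<noteq> 0" "G \<noteq> 0" "lev x G \<noteq> 0" "z = lev x F / lev x G" "c = val u F - val u G"
    using assms(1) by (rule pvalE)
  obtain F' G' where 2: "nonneg_poly F'" "nonneg_poly G'" "F' \<noteq> 0" "G' \<noteq> 0" "lev x G' \<noteq> 0" "w = lev x F' / lev x G'" "e = val u F' - val u G'"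
    using assms(2) by (rule pvalE)
  have n: "nonneg_poly (F * G')" "nonneg_poly (F' * G)" using 1 2 by (simp_all add: nonneg_poly_mult)
  show ?thesis
  proof (rule pvalI[of "F * G' + F' * G" "G * G'"])
    show "z + w = lev x (F * G' + F' * G) / lev x (G * G')"
      unfolding 1(6) 2(6) lev_simps lev_mult' by (rule add_frac_eq[OF 1(5) 2(5)])
    show "min c e = val u (F * G' + F' * G) - val u (G * G')" using 1 2 by (simp add: val_add(2)[OF n] val_mult)
  qed (use 1 2 n in \<open>simp_all add: val_add nonneg_poly_mult\<close>)
qed

lemma pval_const: "c > 0 \<Longrightarrow> pval u (rconst c) 0"
  by (rule pvalI[of "single 0 c" "single 0 1"]) (simp_all add: nonneg_single val_single)

lemma pval_var: "pval u (x i) (lookup u i)"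
  by (rule pvalI[of "single (single i 1) 1" "single 0 1"]) (simp_all add: nonneg_single val_single wt_single)

lemma pval_prod: assumes "finite I" "\<And>i. i \<in> I \<Longrightarrow> pval u (f i) (c i)" shows "pval u (\<Prod>i\<in>I. f i) (\<Sum>i\<in>I. c i)"
  using assms by (induction I rule: finite_induct) (use pval_const[of 1] in \<open>auto intro: pval_mult\<close>)

lemma pval_power: assumes "pval u z c" shows "pval u (z ^ k) (int k * c)"
  using pval_prod[of "{..<k}" u "\<lambda>_. z" "\<lambda>_. c"] assms by simp

lemma pval_powi: assumes "pval u z c" shows "pval u (z powi k) (k * c)"
  using pval_power[OF assms, of "nat k"] pval_power[OF pval_inverse[OF assms], of "nat (- k)"]
  by (cases "k \<ge> 0") (auto simp: power_int_def)

lemma pval_unique: assumes "pval u z c" "pval u z e" shows "c = e"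
proof -
  have "z \<noteq> 0" using assms(1) by (elim pvalE) simp
  then have "pval u (lev x 1) (c - e)" using pval_mult[OF assms(1) pval_inverse[OF assms(2)]] by simp
  from pval_lev(2)[OF this] show ?thesis by simp
qed

text \<open>Tropical evaluation: if u' collects the values of the elements \<open>y k\<close>, then
  subtraction-free polynomials in them are valued by u'. This transports valuations between
  clusters.\<close>

lemma pval_substitution:
  assumes y: "\<And>k. pval u (y k) (lookup u' k)" and F: "nonneg_poly F"
  shows "pval u (lev y F) (val u' F)"
proof -
  have m: "pval u (lmono y m) (wt u' m)" for m
  proof -
    let ?A = "keys m \<union> keys u'"
    have "wt u' m = (\<Sum>i\<in>?A. lookup m i * lookup u' i)"
      unfolding wt_def by (intro sum.mono_neutral_cong_left) (auto simp: in_keys_iff)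
    moreover have "lmono y m = (\<Prod>i\<in>?A. y i powi lookup m i)" by (rule lmono_superset) auto
    ultimately show ?thesis using pval_prod[of ?A u "\<lambda>i. y i powi lookup m i" "\<lambda>i. lookup m i * lookup u' i"] pval_powi[OF y] by simp
  qed
  have "pval u (\<Sum>m\<in>K. rconst (c m) * lmono y m) (Min (wt u' ` K))" if "finite K" "K \<noteq> {}" "\<And>m. m \<in> K \<Longrightarrow> c m > 0" for K c
    using that
  proof (induction K rule: finite_ne_induct)
    case (singleton k)
    then show ?case using pval_mult[OF pval_const[of "c k"] m[of k]] by simp
  next
    case (insert k K)
    then have "pval u (rconst (c k) * lmono y k + (\<Sum>m\<in>K. rconst (c m) * lmono y m)) (min (wt u' k) (Min (wt u' ` K)))"
      using pval_add[OF pval_mult[OF pval_const[of "c k"] m[of k]]] by simp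
    then show ?case using insert by simp
  qed
  from this[of "keys F" "lookup F"] show ?thesis
    using F unfolding lev_def gev_def val_def nonneg_poly_def by (metis finite_keys in_keys_iff keys_eq_empty less_eq_rat_def)
qed

end

lemma pvar_dvd_keys: assumes "pvar j dvd P" "m \<in> keys P" shows "lookup m j \<noteq> 0"
proof -
  obtain S where S: "P = pvar j * S" using assms(1) by (rule dvdE)
  then obtain a c where "m = a + c" "a \<in> keys (pvar j)" using assms(2) keys_mult[of "pvar j" S] by blast
  then show ?thesis by (auto simp: pvar_def lookup_add)
qed

text \<open>The variables are prime: inside Laurent polynomials, non-divisibility means that the
  valuation along \<open>j\<close> is at most zero, and valuations add in products.\<close>

lemma pvar_dvd_mult: assumes "pvar j dvd P * Q" shows "pvar j dvd P \<or> pvar j dvd Q"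
proof (rule ccontr)
  assume n: "\<not> ?thesis"
  define f :: "mpoly \<Rightarrow> lpoly" where "f P = (\<Sum>m\<in>keys P. single (emb m) (lookup P m))" for P
  have lf: "lookup (f P) (emb m) = lookup P m" for P m
    unfolding f_def lookup_sum lookup_single when_def emb_inj by (auto simp: in_keys_iff)
  have kf: "\<exists>m\<in>keys P. k = emb m" if k: "k \<in> keys (f P)" for P k
  proof (rule ccontr)
    assume "\<not> ?thesis"
    then have "lookup (f P) k = 0" unfolding f_def lookup_sum lookup_single when_def by (intro sum.neutral) auto
    then show False using k by (simp add: in_keys_iff)
  qed
  have val_0: "\<exists>m\<in>keys P. lookup m j = 0" if "\<not> pvar j dvd P" for P using pvar_dvdI[of P j] that by metis
  have v: "f P \<noteq> 0 \<and> val (single j 1) (f P) \<le> 0" if P: "\<not> pvar j dvd P" for P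
  proof -
    obtain m where m: "m \<in> keys P" "lookup m j = 0" using val_0[OF P] by blast
    then have k: "emb m \<in> keys (f P)" by (simp add: in_keys_iff lf)
    then show ?thesis using val_le[OF k, of "single j 1"] m(2) by (auto simp: wt_single_left)
  qed
  have "f (P * Q) = f P * f Q"
  proof -
    have add: "f (A + C) = f A + f C" for A C
    proof (rule poly_mapping_eqI)
      fix k show "lookup (f (A + C)) k = lookup (f A + f C) k"
      proof (cases "\<exists>m. k = emb m")
        case True
        then show ?thesis by (auto simp: lf lookup_add)
      next
        case False
        then have "lookup (f D) k = 0" for D using kf[of k D] by (auto simp: in_keys_iff)
        then show ?thesis by (simp add: lookup_add)
      qed
    qed
    have f0: "f 0 = 0" and fs: "f (single m c) = single (emb m) c" for m c
      by (simp add: f_def) (cases "c = 0"; simp add: f_def)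
    have fsum: "f (\<Sum>i\<in>I. g i) = (\<Sum>i\<in>I. f (g i))" for I :: "(nat \<Rightarrow>\<^sub>0 nat) set" and g
      by (induction I rule: infinite_finite_induct) (simp_all add: f0 add)
    have "f (P * Q) = (\<Sum>a\<in>keys P. \<Sum>c\<in>keys Q. single (emb (a + c)) (lookup P a * lookup Q c))"
      by (simp add: mult_expand[of P Q] fsum fs)
    then show ?thesis by (simp add: f_def sum_product mult_single emb_add)
  qed
  then have "val (single j 1) (f (P * Q)) \<le> 0" "f (P * Q) \<noteq> 0"
    using v[of P] v[of Q] n val_mult[of "f P" "f Q" "single j 1"] by auto
  then obtain k where k: "k \<in> keys (f (P * Q))" "wt (single j 1) k \<le> 0" using val_attained[of "f (P * Q)" "single j 1"] by auto
  obtain m where m: "m \<in> keys (P * Q)" "k = emb m" using kf[OF k(1)] by blast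
  then show False using k(2) pvar_dvd_keys[OF assms m(1)] by (simp add: wt_single_left)
qed

section \<open>Cluster monomials and their g-vectors\<close>

context cluster_setup
begin

definition mono_at :: "nat list \<Rightarrow> (nat \<Rightarrow> nat) \<Rightarrow> ratfun" where
  "mono_at w a = (\<Prod>j = 1..r. X w j ^ a j)"

definition gsum :: "nat list \<Rightarrow> nat list \<Rightarrow> (nat \<Rightarrow> nat) \<Rightarrow> nat \<Rightarrow> int" where
  "gsum v w a j = (\<Sum>k = 1..r. int (a k) * gv w k v j)"

lemma yhat_eq: "set v \<subseteq> {1..r} \<Longrightarrow> yhat n (seed_at n B v) = good_seed.yh n (M v) (X v)"
proof (rule ext)
  fix j assume v: "set v \<subseteq> {1..r}"
  have "yhat n (M v, X v) j = good_seed.yh n (M v) (X v) j" by (simp only: yhat_def prod.case good_seed.yh_def[OF good[OF v]])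
  then show "yhat n (seed_at n B v) j = good_seed.yh n (M v) (X v) j" by (simp only: seed_eq[symmetric])
qed

text \<open>The exponent \<open>h\<close> also has frozen entries, about which nothing is claimed;
  controlling them is the task of \<open>mono_at_unique\<close>.\<close>

lemma mono_expansion:
  assumes v: "set v \<subseteq> {1..r}" and w: "set w \<subseteq> {1..r}"
  shows "\<exists>U\<in>good_seed.yunits n r (M v) (X v). \<exists>h. mono_at w a = U * lmono (X v) (column n h) \<and> (\<forall>j\<in>{1..r}. h j = gsum v w a j)"
proof -
  interpret g: good_seed n r "M v" "X v" by (rule good[OF v])
  obtain H where E: "expansion v w H" using expansion_exists[OF v w] by blast
  then have "\<forall>k\<in>{1..n}. \<exists>U. U \<in> g.yunits \<and> X w k = U * lmono (X v) (column n (H k))"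
    unfolding expansion_def by blast
  from bchoice[OF this] obtain U where U: "\<And>k. k \<in> {1..n} \<Longrightarrow> U k \<in> g.yunits"
    "\<And>k. k \<in> {1..n} \<Longrightarrow> X w k = U k * lmono (X v) (column n (H k))"
    by blast
  have kn: "k \<in> {1..n}" if "k \<in> {1..r}" for k using that rn by auto
  define h where "h m = (\<Sum>k = 1..r. int (a k) * H k m)" for m
  have col_h: "column n h = (\<Sum>k = 1..r. column n (\<lambda>m. int (a k) * H k m))"
  proof (rule poly_mapping_eqI)
    fix m show "lookup (column n h) m = lookup (\<Sum>k = 1..r. column n (\<lambda>m. int (a k) * H k m)) m"
      by (cases "m \<in> {1..n}") (auto simp: lookup_column lookup_sum h_def intro: sum.neutral)
  qed
  have "mono_at w a = (\<Prod>k = 1..r. U k ^ a k * lmono (X v) (column n (\<lambda>m. int (a k) * H k m)))"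
    unfolding mono_at_def by (rule prod.cong[OF refl]) (simp only: U(2)[OF kn] power_mult_distrib g.lmono_scale)
  also have "\<dots> = (\<Prod>k = 1..r. U k ^ a k) * lmono (X v) (column n h)"
    unfolding prod.distrib col_h lmono_sum[OF g.nz] ..
  finally have "mono_at w a = (\<Prod>k = 1..r. U k ^ a k) * lmono (X v) (column n h)" .
  moreover have "(\<Prod>k = 1..r. U k ^ a k) \<in> g.yunits"
    using g.yunits_power_int[OF U(1)[OF kn], of _ "int (a _)"] by (intro g.yunits_prod) simp
  moreover have "h j = gsum v w a j" if "j \<in> {1..r}" for j
    unfolding h_def gsum_def using E that kn by (intro sum.cong refl) (auto simp: expansion_def)
  ultimately show ?thesis by blast
qed

lemma is_g_vector_mono:
  assumes v: "set v \<subseteq> {1..r}" and w: "set w \<subseteq> {1..r}"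
  shows "is_g_vector n r (seed_at n B v) (mono_at w a) (column r (gsum v w a))"
proof -
  interpret g: good_seed n r "M v" "X v" by (rule good[OF v])
  obtain U h where U: "U \<in> g.yunits" "mono_at w a = U * lmono (X v) (column n h)" "\<forall>j\<in>{1..r}. h j = gsum v w a j"
    using mono_expansion[OF v w] by blast
  obtain P Q where PQ: "unit_poly r P" "unit_poly r Q" "peval g.yh Q \<noteq> 0" "U = peval g.yh P / peval g.yh Q"
    using U(1) by (rule g.yunitsE)
  have nd: "\<not> pvar j dvd P" "\<not> pvar j dvd Q" for j
    using PQ(1,2) pvar_dvd_const[of j P] pvar_dvd_const[of j Q] unfolding unit_poly_def by fastforce+
  have kg: "keys (column r (gsum v w a)) \<subseteq> {1..r}" by (auto simp: in_keys_iff lookup_column split: if_splits)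
  have "mono_at w a = peval g.yh P / peval g.yh Q * (\<Prod>i = 1..n. X v i powi h i)"
    using U(2) PQ(4) by (simp only: lmono_column[OF g.nz])
  moreover have "\<forall>i\<in>{1..r}. h i = lookup (column r (gsum v w a)) i" using U(3) by (simp add: lookup_column)
  ultimately show ?thesis unfolding is_g_vector_def yhat_eq[OF v] int_lattice_def
    using PQ(1-3) nd kg unfolding unit_poly_def by blast
qed

text \<open>Cross-multiplying two representations keeps all polynomials indivisible by the
  variables, because these are prime, and \<open>exponents_unique\<close> compares the
  monomials.\<close>

lemma is_g_vector_unique:
  assumes v: "set v \<subseteq> {1..r}" and r: "1 \<le> r"
    and z: "is_g_vector n r (seed_at n B v) z g" "is_g_vector n r (seed_at n B v) z g'"
  shows "g = g'"
proof -
  interpret g: good_seed n r "M v" "X v" by (rule good[OF v])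
  obtain P Q h where 1: "poly_in {1..r} P" "poly_in {1..r} Q" "\<forall>j\<in>{1..r}. \<not> pvar j dvd P \<and> \<not> pvar j dvd Q"
    "peval g.yh Q \<noteq> 0" "\<forall>i\<in>{1..r}. h i = lookup g i" "z = peval g.yh P / peval g.yh Q * (\<Prod>i = 1..n. X v i powi h i)"
    "keys g \<subseteq> {1..r}"
    using z(1) unfolding is_g_vector_def yhat_eq[OF v] int_lattice_def by blast
  obtain P' Q' h' where 2: "poly_in {1..r} P'" "poly_in {1..r} Q'" "\<forall>j\<in>{1..r}. \<not> pvar j dvd P' \<and> \<not> pvar j dvd Q'"
    "peval g.yh Q' \<noteq> 0" "\<forall>i\<in>{1..r}. h' i = lookup g' i" "z = peval g.yh P' / peval g.yh Q' * (\<Prod>i = 1..n. X v i powi h' i)"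
    "keys g' \<subseteq> {1..r}"
    using z(2) unfolding is_g_vector_def yhat_eq[OF v] int_lattice_def by blast
  have "peval g.yh P / peval g.yh Q * lmono (X v) (column n h) = peval g.yh P' / peval g.yh Q' * lmono (X v) (column n h')"
    using 1(6) 2(6) by (simp only: lmono_column[OF g.nz])
  then have "peval g.yh (P * Q') * lmono (X v) (column n h) = peval g.yh (P' * Q) * lmono (X v) (column n h')"
    using 1(4) 2(4) by (simp add: field_simps)
  then have "column n h = column n h'"
  proof (rule g.exponents_unique[rotated 3])
    show "\<not> pvar j dvd P * Q' \<and> \<not> pvar j dvd P' * Q" if "j \<in> {1..r}" for j
      using 1(3) 2(3) that by (blast dest: pvar_dvd_mult)
  qed (use 1 2 r in \<open>auto intro: poly_in_ops\<close>)
  then have h: "h i = h' i" if "i \<in> {1..r}" for i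
  proof -
    have "i \<in> {1..n}" using that rn by auto
    then show ?thesis using arg_cong[OF \<open>column n h = column n h'\<close>, of "\<lambda>q. lookup q i"] by (simp add: lookup_column)
  qed
  show ?thesis
  proof (rule poly_mapping_eqI)
    fix i show "lookup g i = lookup g' i"
    proof (cases "i \<in> {1..r}")
      case True
      then show ?thesis using h[OF True] 1(5) 2(5) by simp
    next
      case False
      then have "i \<notin> keys g" "i \<notin> keys g'" using 1(7) 2(7) by blast+
      then show ?thesis by (simp add: in_keys_iff)
    qed
  qed
qed

lemma g_vector_mono:
  assumes "set v \<subseteq> {1..r}" "set w \<subseteq> {1..r}" "1 \<le> r"
  shows "g_vector n r (seed_at n B v) (mono_at w a) = column r (gsum v w a)"
  unfolding g_vector_def using is_g_vector_mono[OF assms(1,2)] is_g_vector_unique[OF assms(1,3)] by (intro the_equality) blast+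

text \<open>Exchange relations contain no subtraction, so values propagate along mutations. If
  \<open>u\<close> is concentrated at one index outside {1..r}, all cluster variables have value 0:
  by the sign of the matrix entry, one of the two exchange monomials does not involve that
  variable.\<close>

lemma X_valuation:
  assumes v: "set v \<subseteq> {1..r}" and w: "set w \<subseteq> {1..r}"
  shows "\<exists>\<nu>. \<forall>k. good_seed.pval (X v) u (X w k) (\<nu> k) \<and> (k \<notin> {1..r} \<longrightarrow> \<nu> k = lookup u k)
    \<and> (k \<in> {1..r} \<longrightarrow> (\<exists>f. f \<notin> {1..r} \<and> u = single f 1) \<longrightarrow> \<nu> k = 0)"
    (is "?P w")
proof -
  interpret g: good_seed n r "M v" "X v" by (rule good[OF v])
  show ?thesis
  proof (rule reach[of v w ?P, OF v w])
    show "?P v" by (rule exI[of _ "lookup u"]) (auto simp: g.pval_var lookup_single when_def)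
    fix l w w' assume nb: "nb l w w'" and "?P w"
    then obtain \<nu> where \<nu>: "\<And>k. g.pval u (X w k) (\<nu> k)" "\<And>k. k \<notin> {1..r} \<Longrightarrow> \<nu> k = lookup u k"
      "\<And>k. k \<in> {1..r} \<Longrightarrow> \<exists>f. f \<notin> {1..r} \<and> u = single f 1 \<Longrightarrow> \<nu> k = 0" by blast
    have l: "l \<in> {1..r}" and w: "set w \<subseteq> {1..r}" using nb by (auto simp: nb_def)
    interpret gw: good_seed n r "M w" "X w" by (rule good[OF w])
    define c where "c s = (\<Sum>i = 1..n. pos_part (s * M w i l) * \<nu> i)" for s
    have "g.pval u (lmono (X w) (cpos n (M w) l)) (c 1)" "g.pval u (lmono (X w) (cneg n (M w) l)) (c (- 1))"
      unfolding cpos_def cneg_def lmono_column[OF gw.nz] c_def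
      using g.pval_prod[OF _ g.pval_powi[OF \<nu>(1)], of "{1..n}"] by simp_all
    then have "g.pval u (lev (X w) (bin n (M w) l)) (min (c 1) (c (- 1)))"
      unfolding bin_def using g.pval_add by simp
    then have "g.pval u (lev (X w) (bin n (M w) l) * inverse (X w l)) (min (c 1) (c (- 1)) + - \<nu> l)"
      by (rule g.pval_mult[OF _ g.pval_inverse[OF \<nu>(1)]])
    then have pl: "g.pval u (X w' l) (min (c 1) (c (- 1)) - \<nu> l)"
      by (simp add: nb_X[OF nb] gw.x'_simps divide_inverse)
    have X': "X w' k = X w k" if "k \<noteq> l" for k using that by (simp add: nb_X[OF nb] gw.x'_simps)
    have z: "min (c 1) (c (- 1)) - \<nu> l = 0" if f: "f \<notin> {1..r}" "u = single f 1" for f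
    proof -
      have nu: "\<nu> i = (if i = f then 1 else 0)" for i
        using \<nu>(2,3)[of i] f by (cases "i \<in> {1..r}") (auto simp: lookup_single when_def)
      have "c s = (if f \<in> {1..n} then pos_part (s * M w f l) else 0)" for s
        unfolding c_def nu by (simp add: if_distrib cong: if_cong)
      then show ?thesis using nu[of l] l f(1) by (auto simp: pos_part_def)
    qed
    show "?P w'"
    proof (intro exI[of _ "\<lambda>k. if k = l then min (c 1) (c (- 1)) - \<nu> l else \<nu> k"] allI conjI impI)
      fix k
      show "g.pval u (X w' k) (if k = l then min (c 1) (c (- 1)) - \<nu> l else \<nu> k)" using \<nu>(1)[of k] pl X'[of k] by (cases "k = l") simp_all
      show "(if k = l then min (c 1) (c (- 1)) - \<nu> l else \<nu> k) = lookup u k" if "k \<notin> {1..r}" using \<nu>(2)[OF that] that l by auto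
      show "(if k = l then min (c 1) (c (- 1)) - \<nu> l else \<nu> k) = 0" if k: "k \<in> {1..r}" and f: "\<exists>f. f \<notin> {1..r} \<and> u = single f 1"
      proof -
        obtain f where "f \<notin> {1..r}" "u = single f 1" using f by blast
        then show ?thesis using z[of f] \<nu>(3)[OF k f] by simp
      qed
    qed
  qed
qed

lemma mutations_back: "set w \<subseteq> {1..r} \<Longrightarrow> mutations n (M w, X w) (rev w) = (B, xvar)"
proof (induction w rule: rev_induct)
  case Nil
  then show ?case by (simp add: seed_at_def)
next
  case (snoc l w)
  then have "nb l (w @ [l]) w" by (simp add: nb_def)
  from nb_seed[OF this] show ?case using snoc by simp
qed

text \<open>Walking from \<open>v\<close> back to the root and then along \<open>w\<close> makes the
  seed at \<open>v\<close> the initial one.\<close>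

lemma X_laurent:
  assumes v: "set v \<subseteq> {1..r}" and w: "set w \<subseteq> {1..r}" shows "X w k \<in> laurent (X v)"
proof -
  have "mutations n (M v, X v) (rev v @ w) = seed_at n B w" using mutations_back[OF v] by (simp add: seed_at_def)
  moreover have "snd (mutations n (M v, X v) (rev v @ w)) k \<in> laurent (X v)"
    by (rule laurent_phenomenon[OF good[OF v]]) (use v w in auto)
  ultimately show ?thesis by simp
qed

lemma mono_at_nz: "set w \<subseteq> {1..r} \<Longrightarrow> mono_at w a \<noteq> 0"
  using good_seed.nz[OF good] by (simp add: mono_at_def)

lemma gsum_same: "set w \<subseteq> {1..r} \<Longrightarrow> j \<in> {1..r} \<Longrightarrow> gsum w w a j = int (a j)"
proof -
  assume w: "set w \<subseteq> {1..r}" and j: "j \<in> {1..r}"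
  have "gsum w w a j = (\<Sum>k = 1..r. if k = j then int (a j) else 0)"
    unfolding gsum_def using gv_same[OF w j] rn by (intro sum.cong) auto
  then show ?thesis using j by simp
qed

text \<open>Tropical mutation is additive on the g-vectors of the variables of one cluster, since these are
  row sign-coherent.\<close>

lemma gsum_step:
  assumes w: "set w \<subseteq> {1..r}" and nb: "nb l t t'"
  shows "gsum t' w a l = - gsum t w a l"
    "j \<noteq> l \<Longrightarrow> gsum t' w a j = gsum t w a j + pos_part (- M t l j) * gsum t w a l - M t l j * pos_part (- gsum t w a l)"
proof -
  have kn: "k \<in> {1..n}" if "k \<in> {1..r}" for k using that rn by auto
  have t: "set t \<subseteq> {1..r}" "l \<in> {1..r}" using nb by (auto simp: nb_def)
  have "gsum t' w a l = (\<Sum>k = 1..r. - (int (a k) * gv w k t l))"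
    unfolding gsum_def by (rule sum.cong[OF refl]) (simp add: gv_step(1)[OF w kn nb])
  then show "gsum t' w a l = - gsum t w a l" by (simp add: gsum_def sum_negf)
  have pp: "(\<Sum>k = 1..r. int (a k) * pos_part (- gv w k t l)) = pos_part (- gsum t w a l)"
  proof (cases "\<exists>k\<in>{1..r}. gv w k t l > 0")
    case True
    then have p: "gv w k t l \<ge> 0" if "k \<in> {1..r}" for k using con_coherent[OF w t kn kn[OF that]] by blast
    then have "gsum t w a l \<ge> 0" unfolding gsum_def by (intro sum_nonneg) auto
    then show ?thesis using p by (simp add: pos_part_def max_def)
  next
    case False
    then have p: "gv w k t l \<le> 0" if "k \<in> {1..r}" for k using that by force
    then have "gsum t w a l \<le> 0" unfolding gsum_def by (intro sum_nonpos) (simp add: mult_nonneg_nonpos)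
    moreover have "(\<Sum>k = 1..r. int (a k) * pos_part (- gv w k t l)) = (\<Sum>k = 1..r. - (int (a k) * gv w k t l))"
    proof (rule sum.cong[OF refl])
      fix k assume "k \<in> {1..r}"
      from p[OF this] have "pos_part (- gv w k t l) = - gv w k t l" by (simp add: pos_part_def)
      then show "int (a k) * pos_part (- gv w k t l) = - (int (a k) * gv w k t l)" by simp
    qed
    ultimately show ?thesis by (simp add: gsum_def sum_negf pos_part_def)
  qed
  assume j: "j \<noteq> l"
  have "gsum t' w a j = (\<Sum>k = 1..r. int (a k) * gv w k t j + pos_part (- M t l j) * (int (a k) * gv w k t l)
      - M t l j * (int (a k) * pos_part (- gv w k t l)))"
    unfolding gsum_def by (rule sum.cong[OF refl]) (simp add: gv_step(2)[OF w kn nb j] algebra_simps)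
  also have "\<dots> = gsum t w a j + pos_part (- M t l j) * gsum t w a l - M t l j * pos_part (- gsum t w a l)"
    unfolding pp[symmetric] by (simp add: gsum_def sum.distrib sum_subtractf sum_distrib_left)
  finally show "gsum t' w a j = gsum t w a j + pos_part (- M t l j) * gsum t w a l - M t l j * pos_part (- gsum t w a l)" .
qed

lemma gsum_eq_everywhere:
  assumes v: "set v \<subseteq> {1..r}" and t: "set t \<subseteq> {1..r}" and w: "set w \<subseteq> {1..r}" "set w' \<subseteq> {1..r}"
    and e: "\<forall>j\<in>{1..r}. gsum v w a j = gsum v w' a' j"
  shows "\<forall>j\<in>{1..r}. gsum t w a j = gsum t w' a' j"
proof (rule reach[where P = "\<lambda>t. \<forall>j\<in>{1..r}. gsum t w a j = gsum t w' a' j", OF v t e])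
  fix l u u' assume nb: "nb l u u'" and e: "\<forall>j\<in>{1..r}. gsum u w a j = gsum u w' a' j"
  have "l \<in> {1..r}" using nb by (simp add: nb_def)
  then show "\<forall>j\<in>{1..r}. gsum u' w a j = gsum u' w' a' j"
    using e gsum_step[OF w(1) nb] gsum_step[OF w(2) nb] by metis
qed

end

context cluster_setup
begin

lemma mono_at_lmono:
  assumes w: "set w \<subseteq> {1..r}"
  shows "mono_at w a = lmono (X w) (column n (\<lambda>m. if m \<in> {1..r} then int (a m) else 0))"
proof -
  have "(\<Prod>j = 1..n. X w j powi (if j \<in> {1..r} then int (a j) else 0)) = (\<Prod>j = 1..r. X w j powi int (a j))"
    using rn by (intro prod.mono_neutral_cong_right) auto
  then show ?thesis unfolding mono_at_def lmono_column[OF good_seed.nz[OF good[OF w]]] by simp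
qed

text \<open>The monomial with exponents \<open>a\<close> has g-vector \<open>a\<close> in its own
  cluster, so the unfrozen exponents cancel in the quotient, leaving a unit times a frozen monomial
  \<phi>. Then \<phi> occurs with coefficient 1.\<close>

lemma quotient_laurent:
  assumes w: "set w \<subseteq> {1..r}" and w': "set w' \<subseteq> {1..r}" and e: "\<forall>j\<in>{1..r}. gsum w w a j = gsum w w' a' j"
  obtains R \<phi> where "lev (X w) R = mono_at w' a' / mono_at w a" "lookup R \<phi> = 1" "keys \<phi> \<subseteq> {r<..n}"
proof -
  interpret g: good_seed n r "M w" "X w" by (rule good[OF w])
  obtain U h where U: "U \<in> g.yunits" "mono_at w' a' = U * lmono (X w) (column n h)" "\<forall>j\<in>{1..r}. h j = gsum w w' a' j"
    using mono_expansion[OF w w'] by blast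
  define \<alpha> where "\<alpha> = column n (\<lambda>m. if m \<in> {1..r} then int (a m) else 0)"
  have z: "mono_at w a = lmono (X w) \<alpha>" unfolding \<alpha>_def by (rule mono_at_lmono[OF w])
  have "mono_at w' a' \<in> laurent (X w)" unfolding mono_at_def
    by (intro g.laurent_prod g.laurent_power X_laurent[OF w w'])
  then obtain R' where R': "mono_at w' a' = lev (X w) R'" by (auto simp: laurent_def)
  have R: "lev (X w) (R' * single (- \<alpha>) 1) = mono_at w' a' / mono_at w a"
    unfolding g.lev_mult' R'[symmetric] z by (simp add: lmono_uminus[OF g.nz] divide_inverse)
  have k: "keys (column n h - \<alpha>) \<subseteq> {r<..n}"
  proof
    fix m assume "m \<in> keys (column n h - \<alpha>)"
    then have m: "lookup (column n h - \<alpha>) m \<noteq> 0" by (simp add: in_keys_iff)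
    then have mn: "m \<in> {1..n}" by (auto simp: \<alpha>_def lookup_minus lookup_column split: if_splits)
    have "m \<notin> {1..r}"
    proof
      assume mr: "m \<in> {1..r}"
      then have "h m = int (a m)" using U(3) e gsum_same[OF w mr, of a] by simp
      then show False using m mr mn by (simp add: \<alpha>_def lookup_minus lookup_column)
    qed
    then show "m \<in> {r<..n}" using mn by auto
  qed
  have "lev (X w) (R' * single (- \<alpha>) 1) = U * lmono (X w) (column n h - \<alpha>)"
    unfolding R U(2) z by (simp only: diff_conv_add_uminus g.lmono_add' lmono_uminus[OF g.nz] divide_inverse mult.assoc)
  then have "lookup (R' * single (- \<alpha>) 1) (column n h - \<alpha>) = 1" by (rule g.lookup_unit_multiple[OF U(1)])
  then show thesis using that R k by blast
qed

lemma pval_quotient: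
  assumes v: "set v \<subseteq> {1..r}" and w: "set w \<subseteq> {1..r}" and w': "set w' \<subseteq> {1..r}"
  shows "\<exists>c. good_seed.pval (X v) u (mono_at w a / mono_at w' a') c
    \<and> ((\<exists>f. f \<notin> {1..r} \<and> u = single f 1) \<longrightarrow> c = 0)"
proof -
  interpret g: good_seed n r "M v" "X v" by (rule good[OF v])
  obtain \<nu> where \<nu>: "\<And>k. g.pval u (X w k) (\<nu> k)" "\<And>k. k \<in> {1..r} \<Longrightarrow> \<exists>f. f \<notin> {1..r} \<and> u = single f 1 \<Longrightarrow> \<nu> k = 0"
    using X_valuation[OF v w, of u] by blast
  obtain \<nu>' where \<nu>': "\<And>k. g.pval u (X w' k) (\<nu>' k)" "\<And>k. k \<in> {1..r} \<Longrightarrow> \<exists>f. f \<notin> {1..r} \<and> u = single f 1 \<Longrightarrow> \<nu>' k = 0"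
    using X_valuation[OF v w', of u] by blast
  let ?c = "\<Sum>k = 1..r. int (a k) * \<nu> k" and ?c' = "\<Sum>k = 1..r. int (a' k) * \<nu>' k"
  have "g.pval u (mono_at w a) ?c" "g.pval u (mono_at w' a') ?c'"
    unfolding mono_at_def by (intro g.pval_prod g.pval_power \<nu>(1) \<nu>'(1); simp)+
  then have "g.pval u (mono_at w a / mono_at w' a') (?c + - ?c')"
    unfolding divide_inverse by (intro g.pval_mult g.pval_inverse)
  moreover have "?c + - ?c' = 0" if "\<exists>f. f \<notin> {1..r} \<and> u = single f 1" using \<nu>(2)[OF _ that] \<nu>'(2)[OF _ that] by simp
  ultimately show ?thesis by blast
qed

lemma wt_all_le: assumes "\<And>u. wt u m \<le> wt u k" shows "m = k"
proof (rule poly_mapping_eqI)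
  fix i show "lookup m i = lookup k i"
    using assms[of "single i 1"] assms[of "single i (- 1)"] by (simp add: wt_single_left)
qed

text \<open>The quotient \<open>\<rho>\<close> of two cluster monomials with equal g-vectors, and its inverse, are Laurent
  polynomials in one cluster each, both containing a frozen monomial.  Their valuations are therefore
  bounded above by those of the frozen monomials, and as the valuations add up to zero, both bounds are sharp.\<close>

theorem mono_at_unique:
  assumes v: "set v \<subseteq> {1..r}" and w: "set w \<subseteq> {1..r}" and w': "set w' \<subseteq> {1..r}"
    and e: "\<forall>j\<in>{1..r}. gsum v w a j = gsum v w' a' j"
  shows "mono_at w a = mono_at w' a'"
proof -
  interpret g: good_seed n r "M w" "X w" by (rule good[OF w])
  interpret g': good_seed n r "M w'" "X w'" by (rule good[OF w'])
  let ?\<rho> = "mono_at w' a' / mono_at w a" and ?\<sigma> = "mono_at w a / mono_at w' a'"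
  have nz: "mono_at w a \<noteq> 0" "mono_at w' a' \<noteq> 0" using mono_at_nz w w' by auto
  obtain R \<phi> where R: "lev (X w) R = ?\<rho>" "lookup R \<phi> = 1" "keys \<phi> \<subseteq> {r<..n}"
    using quotient_laurent[OF w w' gsum_eq_everywhere[OF v w w w' e]] .
  have e': "\<forall>j\<in>{1..r}. gsum v w' a' j = gsum v w a j" using e by simp
  obtain R' \<phi>' where R': "lev (X w') R' = ?\<sigma>" "lookup R' \<phi>' = 1" "keys \<phi>' \<subseteq> {r<..n}"
    using quotient_laurent[OF w' w gsum_eq_everywhere[OF v w' w' w e']] .
  have bound: "g.pval u ?\<rho> (val u R)" "- val u R \<le> wt u \<phi>'" for u
  proof -
    obtain c where c: "g.pval u ?\<rho> c" using pval_quotient[OF w w' w] by blast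
    then have cR: "c = val u R" using g.pval_lev(2) unfolding R(1)[symmetric] by blast
    then show "g.pval u ?\<rho> (val u R)" using c by simp
    obtain \<nu> where \<nu>: "\<And>k. g.pval u (X w' k) (\<nu> k)" "\<And>k. k \<notin> {1..r} \<Longrightarrow> \<nu> k = lookup u k"
      using X_valuation[OF w w', of u] by blast
    \<comment> \<open>The weight \<open>u\<close> as seen from the cluster at \<open>w'\<close>: its
      entries are the values of the variables there.\<close>
    define u' where "u' = (\<Sum>k\<in>keys u \<union> {1..r}. single k (\<nu> k))"
    have lu': "lookup u' k = \<nu> k" for k
      using \<nu>(2)[of k] unfolding u'_def by (auto simp: lookup_sum lookup_single when_def in_keys_iff)
    obtain c' where "g'.pval u' ?\<sigma> c'" using pval_quotient[OF w' w w'] by blast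
    then obtain F G where FG: "nonneg_poly F" "nonneg_poly G" "?\<sigma> = lev (X w') F / lev (X w') G" "c' = val u' F - val u' G"
      by (rule g'.pvalE)
    have c': "c' = val u' R'" using g'.pval_lev(2)[of u' R' c'] \<open>g'.pval u' ?\<sigma> c'\<close> by (simp only: R'(1))
    have s: "g.pval u (lev (X w') K) (val u' K)" if "nonneg_poly K" for K
      using g.pval_substitution[OF _ that, of u "X w'" u'] \<nu>(1) lu' by simp
    have "g.pval u (lev (X w') F * inverse (lev (X w') G)) (val u' F + - val u' G)"
      by (intro g.pval_mult g.pval_inverse s FG)
    then have "g.pval u ?\<sigma> (val u' R')"
      unfolding FG(3) divide_inverse[of "lev (X w') F"] c'[symmetric] FG(4) by simp
    then have "g.pval u (?\<rho> * ?\<sigma>) (c + val u' R')" by (rule g.pval_mult[OF c])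
    moreover have "?\<rho> * ?\<sigma> = lev (X w) 1" using nz by simp
    ultimately have "c + val u' R' = 0" using g.pval_lev(2)[of u 1] by simp
    moreover have "val u' R' \<le> wt u' \<phi>'" using R'(2) by (intro val_le) (simp add: in_keys_iff)
    \<comment> \<open>The monomial involves frozen variables only, and their values are the same in
      both clusters.\<close>
    moreover have "wt u' \<phi>' = wt u \<phi>'"
    proof -
      have i: "lookup u' i * lookup \<phi>' i = lookup u i * lookup \<phi>' i" for i
        using \<nu>(2)[of i] lu'[of i] R'(3) by (cases "i \<in> {1..r}") (auto simp: in_keys_iff subset_iff)
      have q: "wt q \<phi>' = (\<Sum>i\<in>keys u \<union> keys u'. lookup q i * lookup \<phi>' i)" if "keys q \<subseteq> keys u \<union> keys u'" for q
        unfolding wt_def using that by (intro sum.mono_neutral_left) (auto simp: in_keys_iff)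
      show ?thesis unfolding q[of u, OF Un_upper1] q[of u', OF Un_upper2] by (rule sum.cong[OF refl i])
    qed
    ultimately show "- val u R \<le> wt u \<phi>'" using cR by simp
  qed
  have le: "val u R \<le> wt u \<phi>" for u using R(2) by (intro val_le) (simp add: in_keys_iff)
  have "wt u (- \<phi>') \<le> wt u \<phi>" for u using le[of u] bound(2)[of u] by simp
  then have "- \<phi>' = \<phi>" by (rule wt_all_le)
  then have eq: "val u R = wt u \<phi>" for u using le[of u] bound(2)[of u] by auto
  have "m = \<phi>" if m: "m \<in> keys R" for m
    using val_le[OF m] by (intro wt_all_le[symmetric]) (simp add: eq)
  then have "keys R \<subseteq> {\<phi>}" by blast
  then have "R = single \<phi> 1" using R(2) by (intro poly_mapping_eqI) (auto simp: lookup_single when_def in_keys_iff)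
  then have \<rho>: "?\<rho> = lmono (X w) \<phi>" using R(1) by simp
  \<comment> \<open>The quotient is now a frozen monomial. Weights concentrated at a single frozen
    variable give it value 0, so each of its exponents vanishes.\<close>
  have "\<phi> = 0"
  proof (rule poly_mapping_eqI)
    fix f show "lookup \<phi> f = lookup 0 f"
    proof (cases "f \<in> {1..r}")
      case True
      then show ?thesis using R(3) by (auto simp: in_keys_iff)
    next
      case False
      obtain c where "g.pval (single f 1) ?\<rho> c" "c = 0" using pval_quotient[OF w w' w, of "single f 1"] False by blast
      then have "val (single f 1) R = 0" using g.pval_unique[OF bound(1)] by simp
      then show ?thesis using eq[of "single f 1"] by (simp add: wt_single_left)
    qed
  qed
  then show ?thesis using \<rho> nz by (simp add: field_simps)
qed

lemma tree_vertex_set: "tree_vertex r t \<Longrightarrow> set t \<subseteq> {1..r}"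
  by (simp add: tree_vertex_def)

lemma cluster_monomialE:
  assumes "z \<in> cluster_monomials n r B" obtains w a where "set w \<subseteq> {1..r}" "z = mono_at w a"
proof -
  obtain t a where "z = (\<Prod>j = 1..r. X t j ^ a j)" "tree_vertex r t" using assms by (auto simp: cluster_monomials_def)
  then show thesis using that[of t a] tree_vertex_set by (simp add: mono_at_def)
qed

lemma linear_relation_trivial:
  assumes v: "set v \<subseteq> {1..r}" and t: "finite t" "t \<subseteq> cluster_monomials n r B" and e: "(\<Sum>z\<in>t. rconst (c z) * z) = 0" and z: "z \<in> t"
  shows "c z = 0"
proof (rule ccontr)
  assume "c z \<noteq> 0"
  define S where "S = {z \<in> t. c z \<noteq> 0}"
  interpret g: good_seed n r "M v" "X v" by (rule good[OF v])
  define G where "G z w a P Q h \<longleftrightarrow> set w \<subseteq> {1..r} \<and> z = mono_at w a \<and> unit_poly r P \<and> unit_poly r Q \<and> peval g.yh Q \<noteq> 0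
      \<and> z = peval g.yh P / peval g.yh Q * lmono (X v) (column n h) \<and> (\<forall>j\<in>{1..r}. h j = gsum v w a j)" for z w a P Q h
  have "\<forall>z\<in>S. \<exists>p. case p of (w, a, P, Q, h) \<Rightarrow> G z w a P Q h"
  proof
    fix z assume "z \<in> S"
    then have "z \<in> cluster_monomials n r B" using t(2) by (auto simp: S_def)
    then obtain w a where w: "set w \<subseteq> {1..r}" "z = mono_at w a" by (rule cluster_monomialE)
    obtain U h where U: "U \<in> g.yunits" "mono_at w a = U * lmono (X v) (column n h)" "\<forall>j\<in>{1..r}. h j = gsum v w a j"
      using mono_expansion[OF v w(1)] by blast
    obtain P Q where "unit_poly r P" "unit_poly r Q" "peval g.yh Q \<noteq> 0" "U = peval g.yh P / peval g.yh Q"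
      using U(1) by (rule g.yunitsE)
    then have "G z w a P Q h" unfolding G_def using w U(2,3) by simp
    then show "\<exists>p. case p of (w, a, P, Q, h) \<Rightarrow> G z w a P Q h" by (intro exI[of _ "(w, a, P, Q, h)"]) simp
  qed
  from bchoice[OF this] obtain p where p: "\<forall>z\<in>S. case p z of (w, a, P, Q, h) \<Rightarrow> G z w a P Q h" ..
  define W where "W z = fst (p z)" for z
  define a where "a z = fst (snd (p z))" for z
  define P where "P z = fst (snd (snd (p z)))" for z
  define Q where "Q z = fst (snd (snd (snd (p z))))" for z
  define h where "h z = snd (snd (snd (snd (p z))))" for z
  have G: "G z (W z) (a z) (P z) (Q z) (h z)" if "z \<in> S" for z
    using p that by (auto simp: W_def a_def P_def Q_def h_def split: prod.splits)
  have W: "\<And>z. z \<in> S \<Longrightarrow> set (W z) \<subseteq> {1..r}" "\<And>z. z \<in> S \<Longrightarrow> z = mono_at (W z) (a z)"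
    and PQ: "\<And>z. z \<in> S \<Longrightarrow> unit_poly r (P z)" "\<And>z. z \<in> S \<Longrightarrow> unit_poly r (Q z)" "\<And>z. z \<in> S \<Longrightarrow> peval g.yh (Q z) \<noteq> 0"
    and zeq: "\<And>z. z \<in> S \<Longrightarrow> z = peval g.yh (P z) / peval g.yh (Q z) * lmono (X v) (column n (h z))"
    and h: "\<And>z j. z \<in> S \<Longrightarrow> j \<in> {1..r} \<Longrightarrow> h z j = gsum v (W z) (a z) j"
    using G unfolding G_def by blast+
  define \<phi> where "\<phi> z = column n (h z)" for z
  have \<phi>_inj: "z = z'" if "z \<in> S" "z' \<in> S" "\<phi> z = \<phi> z'" for z z'
  proof -
    have "gsum v (W z) (a z) j = gsum v (W z') (a z') j" if j: "j \<in> {1..r}" for j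
    proof -
      have "j \<in> {1..n}" using j rn by auto
      then have "h z j = h z' j" using arg_cong[OF \<open>\<phi> z = \<phi> z'\<close>, of "\<lambda>q. lookup q j"] by (simp add: \<phi>_def lookup_column)
      then show ?thesis using h j \<open>z \<in> S\<close> \<open>z' \<in> S\<close> by simp
    qed
    then have "mono_at (W z) (a z) = mono_at (W z') (a z')" using mono_at_unique[OF v] W(1) that by blast
    then show ?thesis using W(2) that by metis
  qed
  define cc where "cc k = col n r (M v) (emb k)" for k
  \<comment> \<open>The dominance order: the exponents differ by a nonzero monomial in the y-hats
    with nonnegative exponents. It is asymmetric by full rank.\<close>
  define less where "less z z' \<longleftrightarrow> (\<exists>k. keys k \<subseteq> {1..r} \<and> k \<noteq> 0 \<and> \<phi> z' = \<phi> z + cc k)" for z z'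
  have cadd: "cc (k + k') = cc k + cc k'" for k k' by (simp add: cc_def emb_add)
  have keys_plus: "keys (k + k') \<subseteq> {1..r}" if "keys k \<subseteq> {1..r}" "keys k' \<subseteq> {1..r}" for k k' :: "nat \<Rightarrow>\<^sub>0 nat"
    using that keys_add[of k k'] by blast
  have cc0: "k = 0" if "keys k \<subseteq> {1..r}" "cc k = 0" for k
    using g.col_inj[of "emb k" "emb 0"] that by (simp add: cc_def) (metis emb_0 emb_inj)
  have "asymp_on S less"
  proof (rule asymp_onI)
    fix z z' assume "less z z'"
    then obtain k where k: "keys k \<subseteq> {1..r}" "k \<noteq> 0" "\<phi> z' = \<phi> z + cc k" by (auto simp: less_def)
    show "\<not> less z' z"
    proof
      assume "less z' z"
      then obtain k' where k': "keys k' \<subseteq> {1..r}" "\<phi> z = \<phi> z' + cc k'" by (auto simp: less_def)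
      then have "cc (k + k') = 0" using k(3) by (simp add: cadd)
      then have "k + k' = 0" using cc0 keys_plus[OF k(1) k'(1)] by blast
      then show False using k(2) by (simp add: add_eq_0_nat)
    qed
  qed
  moreover have "transp_on S less"
  proof (rule transp_onI)
    fix x y z assume "less x y" "less y z"
    then obtain k k' where k: "keys k \<subseteq> {1..r}" "k \<noteq> 0" "\<phi> y = \<phi> x + cc k" "keys k' \<subseteq> {1..r}" "\<phi> z = \<phi> y + cc k'"
      by (auto simp: less_def)
    then have "keys (k + k') \<subseteq> {1..r} \<and> k + k' \<noteq> 0 \<and> \<phi> z = \<phi> x + cc (k + k')"
      using keys_plus[OF k(1,4)] by (simp add: cadd add.assoc add_eq_0_nat)
    then show "less x z" unfolding less_def by blast
  qed
  moreover have S: "finite S" "S \<noteq> {}" using t(1) z \<open>c z \<noteq> 0\<close> by (auto simp: S_def)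
  ultimately obtain z0 where z0: "z0 \<in> S" "\<And>z. z \<in> S \<Longrightarrow> z \<noteq> z0 \<Longrightarrow> \<not> less z z0"
    using Finite_Set.bex_min_element[of S less] by blast
  \<comment> \<open>The numerators over the common denominator; they again have constant term
    1.\<close>
  define T where "T z = P z * (\<Prod>q\<in>S - {z}. Q q)" for z
  have up: "unit_poly r (\<Prod>q\<in>A. Q q)" if "A \<subseteq> S" for A
    using finite_subset[OF that S(1)] that by (induction A rule: finite_induct) (auto simp: unit_poly_one unit_poly_mult PQ)
  have T: "unit_poly r (T z)" if "z \<in> S" for z unfolding T_def using that by (intro unit_poly_mult PQ up) auto
  have pprod: "peval g.yh (\<Prod>q\<in>A. Q q) = (\<Prod>q\<in>A. peval g.yh (Q q))" for A
    by (induction A rule: infinite_finite_induct) auto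
  define N where "N = (\<Prod>q\<in>S. peval g.yh (Q q))"
  have zN: "z * N = peval g.yh (T z) * lmono (X v) (\<phi> z)" if z: "z \<in> S" for z
  proof -
    have "N = peval g.yh (Q z) * (\<Prod>q\<in>S - {z}. peval g.yh (Q q))" unfolding N_def by (rule prod.remove[OF S(1) z])
    then have "z * N = peval g.yh (P z) / peval g.yh (Q z) * lmono (X v) (\<phi> z) * (peval g.yh (Q z) * (\<Prod>q\<in>S - {z}. peval g.yh (Q q)))"
      using zeq[OF z] unfolding \<phi>_def by metis
    then show ?thesis using PQ(3)[OF z] by (simp add: T_def pprod)
  qed
  have "(\<Sum>z\<in>S. rconst (c z) * z) = 0" using e t(1) unfolding S_def by (subst (asm) sum.mono_neutral_right[of t "{z \<in> t. c z \<noteq> 0}"]) auto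
  then have "0 = (\<Sum>z\<in>S. rconst (c z) * (z * N))" by (simp add: sum_distrib_right[symmetric] mult.assoc[symmetric])
  also have "\<dots> = lev (X v) (\<Sum>z\<in>S. single (\<phi> z) (c z) * g.hat (T z))"
    using T by (auto simp: zN g.lev_mult' g.lev_hat unit_poly_def intro!: sum.cong)
  finally have "(\<Sum>z\<in>S. single (\<phi> z) (c z) * g.hat (T z)) = 0" by (intro g.inj) (rule sym)
  then have "0 = lookup (\<Sum>z\<in>S. single (\<phi> z) (c z) * g.hat (T z)) (\<phi> z0)" by simp
  also have "\<dots> = (\<Sum>z\<in>S. c z * lookup (g.hat (T z)) (\<phi> z0 - \<phi> z))" by (simp add: lookup_sum lookup_single_mult)
  \<comment> \<open>Other terms do not reach the exponent of \<open>z0\<close>: a proper difference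
    contradicts minimality, and equal exponents would mean equal g-vectors and hence equal
    monomials.\<close>
  also have "\<dots> = (\<Sum>z\<in>S. if z = z0 then c z0 else 0)"
  proof (rule sum.cong[OF refl])
    fix z assume zS: "z \<in> S"
    show "c z * lookup (g.hat (T z)) (\<phi> z0 - \<phi> z) = (if z = z0 then c z0 else 0)"
    proof (cases "z = z0")
      case True
      have "lookup (g.hat (T z0)) (col n r (M v) (emb 0)) = 1"
        using T[OF z0(1)] by (subst g.lookup_hat) (auto simp: unit_poly_def)
      then show ?thesis using True by simp
    next
      case False
      have "\<phi> z0 - \<phi> z \<notin> keys (g.hat (T z))"
      proof
        assume "\<phi> z0 - \<phi> z \<in> keys (g.hat (T z))"
        then obtain m where m: "m \<in> keys (T z)" "\<phi> z0 - \<phi> z = cc m" unfolding cc_def by (rule g.keys_hat)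
        have km: "keys m \<subseteq> {1..r}" using T[OF zS] m(1) by (auto simp: unit_poly_def poly_in_def)
        have p: "\<phi> z0 = \<phi> z + cc m" using m(2) by (simp add: algebra_simps)
        show False
        proof (cases "m = 0")
          case True
          then have "\<phi> z0 = \<phi> z" using p by (simp add: cc_def)
          then show False using \<phi>_inj[OF z0(1) zS] False by simp
        next
          case nz: False
          then show False using z0(2)[OF zS False] p km unfolding less_def by blast
        qed
      qed
      then show ?thesis using False by (simp add: in_keys_iff)
    qed
  qed
  also have "\<dots> = c z0" using S(1) z0(1) by simp
  finally show False using z0(1) by (simp add: S_def)
qed

end

section \<open>Lattice bases and linear independence\<close>

lemma module_frag_cmul: "Modules.module (frag_cmul :: int \<Rightarrow> ('a \<Rightarrow>\<^sub>0 int) \<Rightarrow> _)"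
  by unfold_locales (simp_all add: frag_cmul_distrib frag_cmul_distrib2)

lemma int_basis_rows:
  assumes "unimodular r A" shows "int_basis r ((\<lambda>k. column r (A k)) ` {1..r})"
proof -
  interpret Modules.module "frag_cmul :: int \<Rightarrow> (nat \<Rightarrow>\<^sub>0 int) \<Rightarrow> _" by (rule module_frag_cmul)
  let ?G = "\<lambda>k. column r (A k)"
  obtain D where D: "\<And>p q. p \<in> {1..r} \<Longrightarrow> q \<in> {1..r} \<Longrightarrow> mm r D A p q = (if p = q then 1 else 0)"
    using assms unfolding unimodular_def by blast
  have lookup_sum_G: "lookup (\<Sum>k = 1..r. frag_cmul (c k) (?G k)) j = (\<Sum>k = 1..r. c k * A k j)" if "j \<in> {1..r}" for c j
    using that by (simp add: lookup_sum lookup_column)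
  have kernel: "c k = 0" if "(\<Sum>k = 1..r. frag_cmul (c k) (?G k)) = 0" "k \<in> {1..r}" for c k
    using unimodular_left_kernel[OF assms _ that(2), of c] lookup_sum_G[of _ c] that(1) by simp
  \<comment> \<open>\<open>int_basis\<close> speaks of a set of vectors, so coinciding rows must be
    excluded before relations can be indexed by {1..r}.\<close>
  have inj: "inj_on ?G {1..r}"
  proof (rule inj_onI, rule ccontr)
    fix k l assume kl: "k \<in> {1..r}" "l \<in> {1..r}" "?G k = ?G l" "k \<noteq> l"
    let ?c = "\<lambda>q. if q = k then 1 else if q = l then - 1 else (0::int)"
    have "(\<Sum>q = 1..r. frag_cmul (?c q) (?G q)) = (\<Sum>q\<in>{k, l}. frag_cmul (?c q) (?G q))"
      by (rule sum.mono_neutral_right) (use kl in auto)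
    also have "\<dots> = 0" using kl by simp
    finally show False using kernel[of ?c k] kl by simp
  qed
  have "\<not> dependent (?G ` {1..r})"
  proof
    assume "dependent (?G ` {1..r})"
    then obtain u q where u: "q \<in> ?G ` {1..r}" "u q \<noteq> 0" "(\<Sum>q\<in>?G ` {1..r}. frag_cmul (u q) q) = 0"
      unfolding dependent_finite[OF finite_imageI[OF finite_atLeastAtMost]] by blast
    then have z: "(\<Sum>k = 1..r. frag_cmul (u (?G k)) (?G k)) = 0" unfolding sum.reindex[OF inj] by (simp only: o_def)
    obtain k where "k \<in> {1..r}" "q = ?G k" using u(1) by blast
    then show False using kernel[of "\<lambda>k. u (?G k)", OF z] u(2) by blast
  qed
  moreover have "span (?G ` {1..r}) = int_lattice r"
  proof
    have "?G k \<in> int_lattice r" for k by (auto simp: int_lattice_def in_keys_iff lookup_column split: if_splits)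
    moreover have "subspace (int_lattice r)"
    proof (rule subspaceI)
      fix x y assume "x \<in> int_lattice r" "y \<in> int_lattice r"
      then show "x + y \<in> int_lattice r" using keys_add[of x y] unfolding int_lattice_def by blast
    qed (auto simp: int_lattice_def in_keys_iff subset_iff)
    ultimately show "span (?G ` {1..r}) \<subseteq> int_lattice r" by (intro span_minimal) auto
    show "int_lattice r \<subseteq> span (?G ` {1..r})"
    proof
      fix g assume g: "g \<in> int_lattice r"
      define c where "c k = (\<Sum>j = 1..r. lookup g j * D j k)" for k
      have "g = (\<Sum>k = 1..r. frag_cmul (c k) (?G k))"
      proof (rule poly_mapping_eqI)
        fix j
        show "lookup g j = lookup (\<Sum>k = 1..r. frag_cmul (c k) (?G k)) j"
        proof (cases "j \<in> {1..r}")
          case True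
          have "(\<Sum>k = 1..r. c k * A k j) = (\<Sum>i = 1..r. lookup g i * mm r D A i j)"
            unfolding c_def mm_def sum_distrib_left sum_distrib_right by (subst sum.swap) (simp add: mult.assoc)
          also have "\<dots> = (\<Sum>i = 1..r. if i = j then lookup g j else 0)" by (rule sum.cong[OF refl]) (use D True in simp)
          also have "\<dots> = lookup g j" using True by simp
          finally show ?thesis using lookup_sum_G[OF True] by simp
        next
          case False
          then have "j \<notin> keys g" using g by (auto simp: int_lattice_def)
          then show ?thesis using False by (auto simp: lookup_sum lookup_column in_keys_iff intro!: sum.neutral[symmetric])
        qed
      qed
      then show "g \<in> span (?G ` {1..r})" by (simp only:) (intro span_sum span_scale span_base imageI)
    qed
  qed
  ultimately show ?thesis by (simp add: int_basis_def)
qed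

lemma unimodular_cong:
  assumes A: "\<And>p q. p \<in> {1..r} \<Longrightarrow> q \<in> {1..r} \<Longrightarrow> A p q = A' p q" and u: "unimodular r A"
  shows "unimodular r A'"
proof -
  have "mm r A D p q = mm r A' D p q" "mm r D A p q = mm r D A' p q" if "p \<in> {1..r}" "q \<in> {1..r}" for D p q
    using A that by (auto simp: mm_def intro!: sum.cong)
  then show ?thesis using u unfolding unimodular_def by metis
qed

text \<open>An integer relation is a rational one, so a single hypothesis settles both module
  structures.\<close>

lemma independent_rconst:
  assumes "\<And>t c. finite t \<Longrightarrow> t \<subseteq> S \<Longrightarrow> (\<Sum>z\<in>t. rconst (c z) * z) = 0 \<Longrightarrow> \<forall>z\<in>t. c z = 0"
  shows "\<not> Modules.module.dependent (\<lambda>(c::rat) z. rconst c * z) S"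
    "\<not> Modules.module.dependent (\<lambda>(c::int) z. of_int c * z) S"
proof -
  have q: "Modules.module (\<lambda>(c::rat) z. rconst c * z)" by unfold_locales (simp_all add: algebra_simps)
  have i: "Modules.module (\<lambda>(c::int) z :: ratfun. of_int c * z)" by unfold_locales (simp_all add: algebra_simps)
  show "\<not> Modules.module.dependent (\<lambda>(c::rat) z. rconst c * z) S"
    unfolding module.dependent_explicit[OF q] using assms by blast
  show "\<not> Modules.module.dependent (\<lambda>(c::int) z. of_int c * z) S"
    unfolding module.dependent_explicit[OF i]
  proof
    assume "\<exists>t u. finite t \<and> t \<subseteq> S \<and> (\<Sum>v\<in>t. of_int (u v) * v) = 0 \<and> (\<exists>v\<in>t. u v \<noteq> 0)"
    then obtain t u v where t: "finite t" "t \<subseteq> S" "(\<Sum>v\<in>t. of_int (u v) * v) = 0" "v \<in> t" "u v \<noteq> (0::int)" by blast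
    then have "(\<Sum>v\<in>t. rconst (of_int (u v)) * v) = 0" by (simp add: rconst_of_int)
    then have "\<forall>v\<in>t. rat_of_int (u v) = 0" by (rule assms[OF t(1,2)])
    then show False using t(4,5) by simp
  qed
qed

context cluster_setup
begin

lemma X_mono_at: "k \<in> {1..r} \<Longrightarrow> X w k = mono_at w (\<lambda>j. if j = k then 1 else 0)"
proof -
  assume k: "k \<in> {1..r}"
  have "mono_at w (\<lambda>j. if j = k then 1 else 0) = (\<Prod>j = 1..r. if j = k then X w k else 1)"
    unfolding mono_at_def by (rule prod.cong) auto
  then show ?thesis using k by simp
qed

lemma gsum_single: "k \<in> {1..r} \<Longrightarrow> gsum v w (\<lambda>j. if j = k then 1 else 0) = gv w k v"
proof (rule ext)
  fix j assume k: "k \<in> {1..r}"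
  have "gsum v w (\<lambda>j. if j = k then 1 else 0) j = (\<Sum>q = 1..r. if q = k then gv w k v j else 0)"
    unfolding gsum_def by (rule sum.cong) auto
  then show "gsum v w (\<lambda>j. if j = k then 1 else 0) j = gv w k v j" using k by simp
qed

lemma unimodular_gv:
  assumes v: "set v \<subseteq> {1..r}" and w: "set w \<subseteq> {1..r}" shows "unimodular r (\<lambda>k. gv w k v)"
proof -
  obtain H where H: "expansion v w H" using expansion_exists[OF v w] by blast
  have "H k j = gv w k v j" if "k \<in> {1..r}" "j \<in> {1..r}" for k j using H that rn by (simp add: expansion_def)
  moreover have "unimodular r H" using H by (simp add: expansion_def)
  ultimately show ?thesis by (rule unimodular_cong)
qed

lemma g_vectors_basis:
  assumes v: "set v \<subseteq> {1..r}" and w: "set w \<subseteq> {1..r}" and r: "1 \<le> r"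
  shows "int_basis r (g_vector n r (seed_at n B v) ` cluster n r B w)"
proof -
  have "g_vector n r (seed_at n B v) ` cluster n r B w = (\<lambda>k. column r (gv w k v)) ` {1..r}"
    unfolding cluster_def image_image
    by (rule image_cong[OF refl]) (simp only: X_mono_at g_vector_mono[OF v w r] gsum_single)
  then show ?thesis using int_basis_rows[OF unimodular_gv[OF v w]] by simp
qed

lemma g_vector_inj:
  assumes v: "set v \<subseteq> {1..r}" and r: "1 \<le> r"
  shows "inj_on (g_vector n r (seed_at n B v)) (cluster_monomials n r B)"
proof (rule inj_onI)
  fix z z' assume z: "z \<in> cluster_monomials n r B" "z' \<in> cluster_monomials n r B"
    and e: "g_vector n r (seed_at n B v) z = g_vector n r (seed_at n B v) z'"
  obtain w a where w: "set w \<subseteq> {1..r}" "z = mono_at w a" using z(1) by (rule cluster_monomialE)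
  obtain w' a' where w': "set w' \<subseteq> {1..r}" "z' = mono_at w' a'" using z(2) by (rule cluster_monomialE)
  have "column r (gsum v w a) = column r (gsum v w' a')"
    using e unfolding w(2) w'(2) g_vector_mono[OF v w(1) r] g_vector_mono[OF v w'(1) r] .
  from arg_cong[OF this, of "\<lambda>q. lookup q j" for j] have "gsum v w a j = gsum v w' a' j" if "j \<in> {1..r}" for j
    using that by (metis lookup_column)
  then show "z = z'" unfolding w(2) w'(2) by (intro mono_at_unique[OF v w(1) w'(1)]) blast
qed

lemma g_vector_exists_unique:
  assumes v: "set v \<subseteq> {1..r}" and r: "1 \<le> r" and z: "z \<in> cluster_monomials n r B"
  shows "\<exists>!g. is_g_vector n r (seed_at n B v) z g"
proof -
  obtain w a where w: "set w \<subseteq> {1..r}" "z = mono_at w a" using z by (rule cluster_monomialE)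
  show ?thesis unfolding w(2) using is_g_vector_mono[OF v w(1)] is_g_vector_unique[OF v r] by blast
qed

text \<open>This is \<open>gv_step\<close> in other sign conventions: by antisymmetry the entry in
  row \<open>l\<close> is minus the one in column \<open>l\<close>, and the positive part of -g is
  -min(g,0).\<close>

lemma g_vector_mutation:
  assumes r: "1 \<le> r" and e: "tree_edge r l t t'" and z: "z \<in> cluster_variables n r B"
    and g: "is_g_vector n r (seed_at n B t) z g" "is_g_vector n r (seed_at n B t') z g'" and j: "j \<in> {1..r}"
  shows "lookup g' j = (if j = l then - lookup g l
     else lookup g j + pos_part (M t j l) * lookup g l - M t j l * min (lookup g l) 0)"
proof -
  have nb: "nb l t t'" and t: "set t \<subseteq> {1..r}" "set t' \<subseteq> {1..r}" and l: "l \<in> {1..r}"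
    using e unfolding tree_edge_def nb_def by (auto simp: tree_vertex_def)
  obtain w k where w: "set w \<subseteq> {1..r}" "k \<in> {1..r}" "z = X w k"
    using z by (auto simp: cluster_variables_def cluster_def tree_vertex_def)
  have "g = column r (gv w k t)" "g' = column r (gv w k t')"
    using is_g_vector_unique[OF t(1) r _ g(1)] is_g_vector_unique[OF t(2) r _ g(2)]
      is_g_vector_mono[OF t(1) w(1)] is_g_vector_mono[OF t(2) w(1)]
    unfolding w(3) X_mono_at[OF w(2)] by (metis gsum_single[OF w(2)])+
  moreover have "k \<in> {1..n}" using w(2) rn by auto
  moreover have "M t l j = - M t j l" using good_seed.anti[OF good[OF t(1)] l j] .
  moreover have "pos_part (- gv w k t l) = - min (gv w k t l) 0" by (simp add: pos_part_def)
  ultimately show ?thesis using gv_step[OF w(1) _ nb, of k] j l by (auto simp: lookup_column)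
qed

end

theorem theorem5p5:
  fixes n r :: nat
    and B :: "nat \<Rightarrow> nat \<Rightarrow> int"
    and E :: "('o, 'm::ab_group_add, 'k::alg_closed_field) exact_cat"
    and T :: 'o
  assumes "1 < r" and "r \<le> n"
    and "\<forall>i \<in> {1..r}. \<forall>j \<in> {1..r}. B i j = - B j i"
    and "matrix_rank n r B = r"
    and "frobenius_2cy_realization E T n r B"
  shows
    \<comment> \<open>(a)\<close>
    "\<not> Modules.module.dependent (\<lambda>(c::int) z. of_int c * z) (cluster_monomials n r B)
     \<and> \<not> Modules.module.dependent (\<lambda>(c::rat) z. rconst c * z) (cluster_monomials n r B)
     \<comment> \<open>(b): existence and uniqueness of g-vectors, 1), 2)\<close>
     \<and> (\<forall>t. tree_vertex r t \<longrightarrow>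
          (\<forall>z \<in> cluster_monomials n r B. \<exists>!g. is_g_vector n r (seed_at n B t) z g)
          \<and> inj_on (g_vector n r (seed_at n B t)) (cluster_monomials n r B)
          \<and> (\<forall>t'. tree_vertex r t' \<longrightarrow>
               int_basis r (g_vector n r (seed_at n B t) ` cluster n r B t')))
     \<comment> \<open>(c)\<close>
     \<and> (\<forall>t t' l z g g' b. tree_edge r l t t' \<and> z \<in> cluster_variables n r B
          \<and> is_g_vector n r (seed_at n B t) z g \<and> is_g_vector n r (seed_at n B t') z g'
          \<and> b = fst (seed_at n B t) \<longrightarrow>
          (\<forall>j \<in> {1..r}. Poly_Mapping.lookup g' j =
             (if j = l then - Poly_Mapping.lookup g l
              else Poly_Mapping.lookup g j + pos_part (b j l) * Poly_Mapping.lookup g l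
                - b j l * min (Poly_Mapping.lookup g l) 0)))"
proof -
  obtain d where "hom_dimensions n r B d" using realization_hom_dimensions[OF assms(2,5)] by blast
  \<comment> \<open>The parameters for \<open>cv\<close> and \<open>gv\<close> are instantiated by
    their defining sums, so the defining equations hold by reflexivity.\<close>
  then interpret cluster_setup n r B d "\<lambda>v i w l. - (\<Sum>k = 1..n. ex_matrix n B w k l * d v i w k)"
    "\<lambda>v i w l. \<Sum>k = 1..n. ex_matrix n B w k l * d w k v i"
    by (intro cluster_setup.intro cluster_setup_axioms.intro assms) (assumption | rule reflexive)+
  have r: "1 \<le> r" using assms(1) by simp
  \<comment> \<open>The empty word, that is the initial seed, serves as the reference for the
    exponents.\<close>
  have lin: "\<forall>z\<in>t. c z = 0" if "finite t" "t \<subseteq> cluster_monomials n r B" "(\<Sum>z\<in>t. rconst (c z) * z) = 0" for t c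
    using linear_relation_trivial[of "[]" t c] that by simp
  show ?thesis
    using independent_rconst[of "cluster_monomials n r B", OF lin] g_vector_exists_unique[OF tree_vertex_set r]
      g_vector_inj[OF tree_vertex_set r] g_vectors_basis[OF tree_vertex_set tree_vertex_set r]
      g_vector_mutation[OF r] unfolding ex_matrix_def by blast
qed

end
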